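(* Let $n\ge 2$, $0<p,q\le\infty$ and $s\in\mathbb{R}$. Then the trace operator $$\mathrm{Tr}: f(x)\longmapsto f(\bar x,0),\qquad \bar x=(x_1,\dots,x_{n-1}),$$ is a retraction from $M^{s}_{p,q,\,p\wedge q\wedge 1}(\mathbb{R}^n)$ onto $M^{s}_{p,q}(\mathbb{R}^{n-1})$. That is: $\mathrm{Tr}$ maps $M^{s}_{p,q,\,p\wedge q\wedge 1}(\mathbb{R}^n)$ into $M^{s}_{p,q}(\mathbb{R}^{n-1})$; there is a constant $C>0$ such that $\|\mathrm{Tr} f\|_{M^s_{p,q}(\mathbb{R}^{n-1})}\le C\|f\|_{M^{s}_{p,q,\,p\wedge q\wedge 1}(\mathbb{R}^n)}$ for all $f\in M^{s}_{p,q,\,p\wedge q\wedge 1}(\mathbb{R}^n)$; and there exists a continuous linear operator $\mathrm{Tr}^{-1}: M^{s}_{p,q}(\mathbb{R}^{n-1})\to M^{s}_{p,q,\,p\wedge q\wedge 1}(\mathbb{R}^n)$ such that $\mathrm{Tr}\,\mathrm{Tr}^{-1}$ is the identity operator on $M^{s}_{p,q}(\mathbb{R}^{n-1})$.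
   Context: Notation: $a\wedge b=\min(a,b)$, $\langle x\rangle=(1+|x|^2)^{1/2}$; $\mathscr{F},\mathscr{F}^{-1}$ are the Fourier transform and its inverse. For $x\in\mathbb{R}^n$, $\bar x=(x_1,\dots,x_{n-1})$; for $k\in\mathbb{Z}^n$, $\bar k=(k_1,\dots,k_{n-1})$. Frequency-uniform decomposition: let $\eta:\mathbb{R}\to[0,1]$ be a smooth function with $\eta(t)=1$ for $|t|\le1$ and $\eta(t)=0$ for $|t|\ge2$. In dimension $d$, for $k\in\mathbb{Z}^d$ put $$\psi_k(\xi)=\frac{\prod_{i=1}^d\eta(2(\xi_i-k_i))}{\sum_{m\in\mathbb{Z}^d}\prod_{i=1}^d\eta(2(\xi_i-m_i))},\qquad \Box_k=\mathscr{F}^{-1}\psi_k\mathscr{F}.$$ Modulation space $M^s_{p,q}(\mathbb{R}^d)$: all tempered distributions $f$ with $$\|f\|_{M^s_{p,q}}=\Big(\sum_{k\in\mathbb{Z}^d}\langle k\rangle^{qs}\|\Box_kf\|_{L^p(\mathbb{R}^d)}^q\Big)^{1/q}<\infty .$$ Anisotropic modulation space $M^s_{p,q,r}(\mathbb{R}^n)$ ($0<p,q,r\le\infty$): all tempered distributions $f$ with $$\|f\|_{M^s_{p,q,r}}=\Big(\sum_{k_n\in\mathbb{Z}}\Big(\sum_{\bar k\in\mathbb{Z}^{n-1}}\langle\bar k\rangle^{qs}\|\Box_kf\|^q_{L^p(\mathbb{R}^n)}\Big)^{r/q}\Big)^{1/r}<\infty,\qquad k=(\bar k,k_n).$$ Usual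 modifications (suprema) are made when an index is $\infty$. Trace: each $\Box_kf$ is a smooth function, and for a tempered distribution $f$ the trace $f(\bar x,0)$ is understood as $\sum_{k\in\mathbb{Z}^n}(\Box_kf)(\bar x,0)$, with convergence in $\mathscr{S}'(\mathbb{R}^{n-1})$. *)

theory Defs
  imports "HOL-Analysis.Analysis" "HOL-Probability.Essential_Supremum"
begin

text \<open>
  Everything is set up over an arbitrary Euclidean space \<open>'a\<close>, whose coordinates are those with respect
  to the standard basis \<open>Basis\<close>. The instances used are \<open>\<real>\<^sup>d = real ^ 'm\<close> with \<open>d = CARD('m)\<close>, and
  \<open>\<real>\<^sup>d\<^sup>+\<^sup>1 = (real ^ 'm) \<times> real\<close>, in which a point \<open>x\<close> is the pair of \<open>(x\<^sub>1, \<dots>, x\<^sub>d)\<close> and the last coordinate.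
\<close>

definition jbracket :: "'a::real_normed_vector \<Rightarrow> real" where
  "jbracket x = sqrt (1 + (norm x)\<^sup>2)"

primrec partials :: "'a::real_normed_vector list \<Rightarrow> ('a \<Rightarrow> 'b::real_normed_vector) \<Rightarrow> 'a \<Rightarrow> 'b" where
  "partials [] f = f"
| "partials (b # bs) f = (\<lambda>x. frechet_derivative (partials bs f) (at x) b)"

definition smooth :: "('a::euclidean_space \<Rightarrow> 'b::real_normed_vector) \<Rightarrow> bool" where
  "smooth f \<longleftrightarrow> (\<forall>bs \<in> lists Basis. partials bs f differentiable_on UNIV)"

definition schwartz :: "('a::euclidean_space \<Rightarrow> complex) set" where
  "schwartz = {\<phi>. smooth \<phi> \<and>
     (\<forall>N::nat. \<forall>bs \<in> lists Basis. bounded (range (\<lambda>x. jbracket x ^ N * norm (partials bs \<phi> x))))}"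

definition schwartz_seminorm :: "nat \<Rightarrow> ('a::euclidean_space \<Rightarrow> complex) \<Rightarrow> real" where
  "schwartz_seminorm N \<phi> =
     (SUP (bs, x) \<in> {bs \<in> lists Basis. length bs \<le> N} \<times> UNIV. jbracket x ^ N * norm (partials bs \<phi> x))"

type_synonym 'a functional = "('a \<Rightarrow> complex) \<Rightarrow> complex"

text \<open>
  A tempered distribution is a continuous linear functional on the Schwartz space. As HOL functions
  are total, it is given the value 0 outside the Schwartz space, so that equality of distributions
  is equality of HOL functions; sums and scalar multiples are pointwise.
\<close>

definition on_schwartz :: "'a::euclidean_space functional \<Rightarrow> 'a functional" where
  "on_schwartz u = (\<lambda>\<phi>. if \<phi> \<in> schwartz then u \<phi> else 0)"

definition tempered :: "'a::euclidean_space functional set" where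
  "tempered = {u.
     (\<forall>\<phi>. \<phi> \<notin> schwartz \<longrightarrow> u \<phi> = 0) \<and>
     (\<forall>\<phi> \<in> schwartz. \<forall>\<phi>' \<in> schwartz. u (\<lambda>x. \<phi> x + \<phi>' x) = u \<phi> + u \<phi>') \<and>
     (\<forall>c. \<forall>\<phi> \<in> schwartz. u (\<lambda>x. c * \<phi> x) = c * u \<phi>) \<and>
     (\<exists>C N. \<forall>\<phi> \<in> schwartz. norm (u \<phi>) \<le> C * schwartz_seminorm N \<phi>)}"

definition represents :: "('a::euclidean_space \<Rightarrow> complex) \<Rightarrow> 'a functional \<Rightarrow> bool" where
  "represents g u \<longleftrightarrow>
     (\<forall>\<phi> \<in> schwartz. integrable lborel (\<lambda>x. g x * \<phi> x) \<and> u \<phi> = (\<integral>x. g x * \<phi> x \<partial>lborel))"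

definition fourier :: "('a::euclidean_space \<Rightarrow> complex) \<Rightarrow> 'a \<Rightarrow> complex" where
  "fourier \<phi> \<xi> = of_real ((2 * pi) powr (- real DIM('a) / 2)) *
     (\<integral>x. exp (- (\<i> * of_real (x \<bullet> \<xi>))) * \<phi> x \<partial>lborel)"

definition inv_fourier :: "('a::euclidean_space \<Rightarrow> complex) \<Rightarrow> 'a \<Rightarrow> complex" where
  "inv_fourier \<phi> x = of_real ((2 * pi) powr (- real DIM('a) / 2)) *
     (\<integral>\<xi>. exp (\<i> * of_real (x \<bullet> \<xi>)) * \<phi> \<xi> \<partial>lborel)"

definition dist_fourier :: "'a::euclidean_space functional \<Rightarrow> 'a functional" where
  "dist_fourier u = on_schwartz (\<lambda>\<phi>. u (fourier \<phi>))"

definition dist_inv_fourier :: "'a::euclidean_space functional \<Rightarrow> 'a functional" where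
  "dist_inv_fourier u = on_schwartz (\<lambda>\<phi>. u (inv_fourier \<phi>))"

definition dist_mult :: "('a::euclidean_space \<Rightarrow> real) \<Rightarrow> 'a functional \<Rightarrow> 'a functional" where
  "dist_mult m u = on_schwartz (\<lambda>\<phi>. u (\<lambda>x. of_real (m x) * \<phi> x))"

definition cutoff :: "(real \<Rightarrow> real) \<Rightarrow> bool" where
  "cutoff \<eta> \<longleftrightarrow> smooth \<eta> \<and> (\<forall>t. 0 \<le> \<eta> t \<and> \<eta> t \<le> 1) \<and>
     (\<forall>t. \<bar>t\<bar> \<le> 1 \<longrightarrow> \<eta> t = 1) \<and> (\<forall>t. \<bar>t\<bar> \<ge> 2 \<longrightarrow> \<eta> t = 0)"

text \<open>The lattice \<open>\<int>\<^sup>d\<close>, as a subset of \<open>\<real>\<^sup>d\<close>.\<close>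

definition lattice_pts :: "'a::euclidean_space set" where
  "lattice_pts = {k. \<forall>b \<in> Basis. k \<bullet> b \<in> \<int>}"

text \<open>For each \<open>\<xi>\<close> only finitely many terms of the sum in the denominator are nonzero.\<close>

definition psi :: "(real \<Rightarrow> real) \<Rightarrow> 'a::euclidean_space \<Rightarrow> 'a \<Rightarrow> real" where
  "psi \<eta> k \<xi> = (\<Prod>b\<in>Basis. \<eta> (2 * (\<xi> \<bullet> b - k \<bullet> b))) /
     (\<Sum>\<^sub>\<infinity>m\<in>lattice_pts. \<Prod>b\<in>Basis. \<eta> (2 * (\<xi> \<bullet> b - m \<bullet> b)))"

definition box_dist :: "(real \<Rightarrow> real) \<Rightarrow> 'a::euclidean_space \<Rightarrow> 'a functional \<Rightarrow> 'a functional" where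
  "box_dist \<eta> k f = dist_inv_fourier (dist_mult (psi \<eta> k) (dist_fourier f))"

text \<open>
  \<open>\<box>\<^sub>k f\<close> as a function: the (unique) smooth function that represents the distribution.
\<close>

definition box :: "(real \<Rightarrow> real) \<Rightarrow> 'a::euclidean_space \<Rightarrow> 'a functional \<Rightarrow> 'a \<Rightarrow> complex" where
  "box \<eta> k f = (THE g. smooth g \<and> represents g (box_dist \<eta> k f))"

text \<open>Power of an extended nonnegative number, for exponents \<open>a > 0\<close> only.\<close>

definition epowr :: "ennreal \<Rightarrow> real \<Rightarrow> ennreal" where
  "epowr x a = (if x = \<infinity> then \<infinity> else ennreal (enn2real x powr a))"

definition Lp_norm :: "ennreal \<Rightarrow> ('a::euclidean_space \<Rightarrow> complex) \<Rightarrow> ennreal" where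
  "Lp_norm p g =
     (if p = \<infinity> then esssup lborel (\<lambda>x. ennreal (norm (g x)))
      else epowr (\<integral>\<^sup>+x. epowr (ennreal (norm (g x))) (enn2real p) \<partial>lborel) (1 / enn2real p))"

definition lq_norm :: "ennreal \<Rightarrow> 'i set \<Rightarrow> ('i \<Rightarrow> ennreal) \<Rightarrow> ennreal" where
  "lq_norm q A c =
     (if q = \<infinity> then (SUP k\<in>A. c k)
      else epowr (\<Sum>\<^sub>\<infinity>k\<in>A. epowr (c k) (enn2real q)) (1 / enn2real q))"

definition modulation_norm ::
  "(real \<Rightarrow> real) \<Rightarrow> real \<Rightarrow> ennreal \<Rightarrow> ennreal \<Rightarrow> 'a::euclidean_space functional \<Rightarrow> ennreal" where
  "modulation_norm \<eta> s p q f =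
     lq_norm q lattice_pts (\<lambda>k. ennreal (jbracket k powr s) * Lp_norm p (box \<eta> k f))"

definition modulation_space ::
  "(real \<Rightarrow> real) \<Rightarrow> real \<Rightarrow> ennreal \<Rightarrow> ennreal \<Rightarrow> 'a::euclidean_space functional set" where
  "modulation_space \<eta> s p q = {f \<in> tempered. modulation_norm \<eta> s p q f < \<infinity>}"

definition aniso_norm ::
  "(real \<Rightarrow> real) \<Rightarrow> real \<Rightarrow> ennreal \<Rightarrow> ennreal \<Rightarrow> ennreal \<Rightarrow>
    ('a::euclidean_space \<times> real) functional \<Rightarrow> ennreal" where
  "aniso_norm \<eta> s p q r f =
     lq_norm r \<int> (\<lambda>l. lq_norm q lattice_pts
       (\<lambda>k. ennreal (jbracket k powr s) * Lp_norm p (box \<eta> (k, l) f)))"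

definition aniso_space ::
  "(real \<Rightarrow> real) \<Rightarrow> real \<Rightarrow> ennreal \<Rightarrow> ennreal \<Rightarrow> ennreal \<Rightarrow>
    ('a::euclidean_space \<times> real) functional set" where
  "aniso_space \<eta> s p q r = {f \<in> tempered. aniso_norm \<eta> s p q r f < \<infinity>}"

text \<open>
  The terms of the trace series, as distributions on the hyperplane. Convergence of the series is
  unordered summation over the lattice, in the weak topology of the tempered distributions.
\<close>

definition trace_term ::
  "(real \<Rightarrow> real) \<Rightarrow> ('a::euclidean_space \<times> real) functional \<Rightarrow> 'a \<times> real \<Rightarrow> 'a functional" where
  "trace_term \<eta> f k = on_schwartz (\<lambda>\<phi>. \<integral>x. box \<eta> k f (x, 0) * \<phi> x \<partial>lborel)"

definition has_trace ::
  "(real \<Rightarrow> real) \<Rightarrow> ('a::euclidean_space \<times> real) functional \<Rightarrow> 'a functional \<Rightarrow> bool" where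
  "has_trace \<eta> f g \<longleftrightarrow> g \<in> tempered \<and>
     (\<forall>\<phi> \<in> schwartz. ((\<lambda>k. trace_term \<eta> f k \<phi>) has_sum g \<phi>) lattice_pts)"

definition Tr :: "(real \<Rightarrow> real) \<Rightarrow> ('a::euclidean_space \<times> real) functional \<Rightarrow> 'a functional" where
  "Tr \<eta> f = (THE g. has_trace \<eta> f g)"

definition linear_on_space ::
  "'a functional set \<Rightarrow> ('a functional \<Rightarrow> 'b functional) \<Rightarrow> bool" where
  "linear_on_space X E \<longleftrightarrow>
     (\<forall>f \<in> X. \<forall>g \<in> X. E (\<lambda>\<phi>. f \<phi> + g \<phi>) = (\<lambda>\<phi>. E f \<phi> + E g \<phi>)) \<and>
     (\<forall>c. \<forall>f \<in> X. E (\<lambda>\<phi>. c * f \<phi>) = (\<lambda>\<phi>. c * E f \<phi>))"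

definition continuous_on_space ::
  "'a functional set \<Rightarrow> ('a functional \<Rightarrow> ennreal) \<Rightarrow> ('b functional \<Rightarrow> ennreal) \<Rightarrow>
    ('a functional \<Rightarrow> 'b functional) \<Rightarrow> bool" where
  "continuous_on_space X normX normY E \<longleftrightarrow>
     (\<forall>f \<in> X. \<forall>\<epsilon>>0. \<exists>\<delta>>0. \<forall>g \<in> X.
        normX (\<lambda>\<phi>. g \<phi> - f \<phi>) < \<delta> \<longrightarrow> normY (\<lambda>\<phi>. E g \<phi> - E f \<phi>) < \<epsilon>)"

end

theory Submission
  imports Defs "HOL-Probability.Probability"
begin

text \<open>
  A piece \<open>\<box>\<^sub>l f\<close> reproduces itself under convolution with a rapidly decreasing kernel that is a
  modulation of a fixed one. Hence, for every \<open>p > 0\<close>, its modulus to the power \<open>p\<close> is bounded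
  pointwise by a weighted average of itself, uniformly in \<open>l\<close>, and restricting that average to the
  hyperplane bounds the \<open>L\<^sup>p\<close> norm of the restricted piece by that of the piece. The restriction of
  \<open>\<box>\<^sub>l f\<close> has frequencies close to the first component of \<open>l\<close>, so \<open>\<box>\<^sub>k (Tr f)\<close> is a sum over boundedly
  many neighbours of \<open>k\<close> and over all last frequencies. For \<open>r = p \<and> q \<and> 1\<close> the \<open>r\<close>-th powers of both
  norms are subadditive, which leaves the sum over the last frequencies in \<open>\<ell>\<^sup>r\<close>. Convergence of the trace
  series follows because \<open>\<box>\<^sub>k f\<close> is bounded by its \<open>L\<^sup>p\<close> norm, and testing against a Schwartz function
  gives decay in the first frequencies.

  The right inverse is the tensor product with a fixed Schwartz function of the last variable that
  equals 1 at 0 and whose spectrum is so small that only three last frequencies occur.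
\<close>

subsection \<open>Japanese bracket\<close>

text \<open>\<open>box\<close> is only a description, the smooth function representing a
  distribution, so nothing can be estimated before it has a formula. That formula,
  \<open>box_eq\<close>, pairs the Fourier transform of f with \<open>psi \<eta> k\<close> times the
  plane wave of x. Proving it, and integrating restricted pieces over the hyperplane, means moving a
  tempered distribution past an integral of plane waves;
  \<open>tempered_integral_interchange\<close> does so with a linear map that is the identity in one
  use and the inclusion of the hyperplane in the other. For p < 1 neither Minkowski's nor Young's
  convolution inequality is available, which is why powers of the modulus are estimated pointwise.
  The three bounds on r act separately: r <= 1 makes r-th powers subadditive, while r <= p and r <=
  q make p/r and q/r at least 1, so that Minkowski's inequality holds for the r-th powers. Testing
  gives no decay in the last frequency, so r <= 1 is also what makes the trace series converge
  absolutely. The exponent 2 DIM found throughout is a convenient one at which negative powers of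
  \<open>jbracket\<close> are integrable and summable over the lattice.\<close>

lemma jbracket_ge_1: "1 \<le> jbracket x"
  by (simp add: jbracket_def)

lemma jbracket_pos [simp]: "0 < jbracket x"
  using jbracket_ge_1[of x] by linarith

lemma jbracket_nonneg [simp]: "0 \<le> jbracket x"
  using jbracket_pos[of x] by linarith

lemma jbracket_neq_0 [simp]: "jbracket x \<noteq> 0"
  using jbracket_pos[of x] by linarith

lemma norm_le_jbracket: "norm x \<le> jbracket x"
  unfolding jbracket_def by (rule real_le_rsqrt) simp

lemma inner_le_jbracket: "b \<in> Basis \<Longrightarrow> \<bar>x \<bullet> b\<bar> \<le> jbracket (x::'a::euclidean_space)"
  using Basis_le_norm[of b x] norm_le_jbracket[of x] by linarith

lemma jbracket_le_1_plus_norm: "jbracket x \<le> 1 + norm x"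
  unfolding jbracket_def by (rule real_le_lsqrt) (auto simp: power2_eq_square algebra_simps)

lemma jbracket_minus [simp]: "jbracket (- x) = jbracket x"
  by (simp add: jbracket_def)

lemma jbracket_minus_commute: "jbracket (x - y) = jbracket (y - x)"
  by (simp add: jbracket_def norm_minus_commute)

lemma jbracket_mono: "norm x \<le> norm y \<Longrightarrow> jbracket x \<le> jbracket y"
  by (simp add: jbracket_def power_mono)

text \<open>Peetre's inequality, with a nonoptimal constant.\<close>

lemma jbracket_add: "jbracket (x + y) \<le> 2 * jbracket x * jbracket y"
proof -
  have "jbracket (x + y) \<le> 1 + norm (x + y)" by (rule jbracket_le_1_plus_norm)
  also have "\<dots> \<le> 1 + norm x + norm y" using norm_triangle_ineq[of x y] by linarith
  also have "\<dots> \<le> jbracket x * jbracket y + jbracket x * jbracket y"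
  proof (rule add_mono[of "1 + norm x - norm x" _ "norm x + norm y", simplified, THEN order_trans[rotated]])
    show "1 \<le> jbracket x * jbracket y"
      using mult_mono[OF jbracket_ge_1[of x] jbracket_ge_1[of y]] by simp
    have "norm x + norm y \<le> sqrt ((1 + (norm x)\<^sup>2) * (1 + (norm y)\<^sup>2))"
    proof (rule real_le_rsqrt)
      \<comment> \<open>The right side of the goal minus its left side is exactly this
        square.\<close>
      have "(norm x * norm y - 1)\<^sup>2 \<ge> 0" by simp
      then show "(norm x + norm y)\<^sup>2 \<le> (1 + (norm x)\<^sup>2) * (1 + (norm y)\<^sup>2)"
        by (simp add: power2_eq_square algebra_simps)
    qed
    then show "norm x + norm y \<le> jbracket x * jbracket y"
      by (simp add: jbracket_def real_sqrt_mult)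
  qed simp
  finally show ?thesis by simp
qed

lemma jbracket_le_diff: "jbracket x \<le> 2 * jbracket (x - y) * jbracket y"
  using jbracket_add[of "x - y" y] by simp

lemma jbracket_near: "norm (x - y) \<le> 1 \<Longrightarrow> jbracket x \<le> 4 * jbracket y"
proof -
  assume "norm (x - y) \<le> 1"
  then have "jbracket (x - y) \<le> 2" using jbracket_le_1_plus_norm[of "x - y"] by linarith
  then have "2 * jbracket (x - y) * jbracket y \<le> 4 * jbracket y"
    by (intro mult_right_mono) auto
  then show ?thesis using jbracket_le_diff[of x y] by linarith
qed

lemma jbracket_fst_le: "jbracket (fst z) \<le> jbracket z"
  by (rule jbracket_mono) (metis norm_fst_le prod.collapse)

lemma jbracket_Pair_fst_le: "jbracket x \<le> jbracket (x, y)"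
  using jbracket_fst_le[of "(x, y)"] by simp

lemma jbracket_Pair_0 [simp]: "jbracket (x, 0::real) = jbracket x"
  by (simp add: jbracket_def norm_Pair)

lemma continuous_on_jbracket [continuous_intros]:
  "continuous_on S f \<Longrightarrow> continuous_on S (\<lambda>x. jbracket (f x))"
  unfolding jbracket_def by (intro continuous_intros)

lemma borel_measurable_jbracket [measurable]: "jbracket \<in> borel_measurable borel"
  by (intro borel_measurable_continuous_onI continuous_intros)

lemma jbracket_power_ge_1: "1 \<le> jbracket x ^ N"
  by (rule one_le_power[OF jbracket_ge_1])

lemma jbracket_power_mono: "M \<le> N \<Longrightarrow> jbracket x ^ M \<le> jbracket x ^ N"
  by (rule power_increasing[OF _ jbracket_ge_1])

lemma jbracket_div_mono: "M \<le> N \<Longrightarrow> 0 \<le> B \<Longrightarrow> B / jbracket x ^ N \<le> B / jbracket x ^ M"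
  by (intro divide_left_mono jbracket_power_mono mult_pos_pos zero_less_power jbracket_pos)

lemma jbracket_power_even: "jbracket (x::'a::real_inner) ^ (2 * M) = (1 + x \<bullet> x) ^ M"
proof -
  have "jbracket x ^ 2 = 1 + x \<bullet> x" by (simp add: jbracket_def power2_norm_eq_inner add_nonneg_nonneg)
  then show ?thesis by (simp add: power_mult)
qed

subsection \<open>Partial derivatives with pointwise bounds\<close>

definition pd :: "'a::real_normed_vector \<Rightarrow> ('a \<Rightarrow> 'b::real_normed_vector) \<Rightarrow> 'a \<Rightarrow> 'b" where
  "pd b f = (\<lambda>x. frechet_derivative f (at x) b)"

lemma pd_eqI: "(f has_derivative f') (at x) \<Longrightarrow> pd b f x = f' b"
  unfolding pd_def using frechet_derivative_at by metis

lemma has_derivative_pd: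
  fixes f :: "'a::euclidean_space \<Rightarrow> 'b::real_normed_vector"
  assumes "f differentiable (at x)"
  shows "(f has_derivative (\<lambda>h. \<Sum>b\<in>Basis. (h \<bullet> b) *\<^sub>R pd b f x)) (at x)"
proof -
  have d: "(f has_derivative frechet_derivative f (at x)) (at x)"
    using assms frechet_derivative_works by blast
  then have l: "linear (frechet_derivative f (at x))" by (rule has_derivative_linear)
  have "frechet_derivative f (at x) h = (\<Sum>b\<in>Basis. (h \<bullet> b) *\<^sub>R pd b f x)" for h
  proof -
    have "frechet_derivative f (at x) (\<Sum>b\<in>Basis. (h \<bullet> b) *\<^sub>R b) = (\<Sum>b\<in>Basis. (h \<bullet> b) *\<^sub>R pd b f x)"
      unfolding pd_def by (simp add: linear_sum[OF l] linear_cmul[OF l])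
    then show ?thesis by (simp add: euclidean_representation)
  qed
  then have "frechet_derivative f (at x) = (\<lambda>h. \<Sum>b\<in>Basis. (h \<bullet> b) *\<^sub>R pd b f x)" by (rule ext)
  with d show ?thesis by simp
qed

text \<open>\<open>partials\<close> adds derivatives on the outside. The inductions below peel off
  the derivative nearest to the function, so that the induction hypothesis can be applied to
  \<open>pd b f\<close>.\<close>

lemma partials_snoc: "partials (bs @ [b]) f = partials bs (pd b f)"
  by (induction bs) (auto simp: pd_def)

lemma smooth_unfold: "smooth f \<longleftrightarrow> f differentiable_on UNIV \<and> (\<forall>b\<in>Basis. smooth (pd b f))"
proof
  assume s: "smooth f"
  then have "partials [] f differentiable_on UNIV" unfolding smooth_def by blast
  moreover have "smooth (pd b f)" if "b \<in> Basis" for b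
    unfolding smooth_def partials_snoc[symmetric] using s that
    by (auto simp: smooth_def simp del: partials.simps)
  ultimately show "f differentiable_on UNIV \<and> (\<forall>b\<in>Basis. smooth (pd b f))" by simp
next
  assume a: "f differentiable_on UNIV \<and> (\<forall>b\<in>Basis. smooth (pd b f))"
  show "smooth f"
    unfolding smooth_def
  proof
    fix bs :: "'a list" assume bs: "bs \<in> lists Basis"
    show "partials bs f differentiable_on UNIV"
    proof (cases bs rule: rev_cases)
      case Nil then show ?thesis using a by simp
    next
      case (snoc cs c)
      then show ?thesis using a bs by (auto simp: partials_snoc smooth_def)
    qed
  qed
qed

lemma smooth_differentiable: "smooth f \<Longrightarrow> f differentiable_on UNIV"
  using smooth_unfold by blast

lemma smooth_differentiable_at: "smooth f \<Longrightarrow> f differentiable (at x)"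
  using smooth_differentiable[of f] by (simp add: differentiable_on_def)

lemma smooth_pd: "smooth f \<Longrightarrow> b \<in> Basis \<Longrightarrow> smooth (pd b f)"
  using smooth_unfold by blast

lemma smooth_continuous: "smooth f \<Longrightarrow> continuous_on S f"
  by (meson smooth_differentiable differentiable_imp_continuous_on continuous_on_subset subset_UNIV)

lemma smooth_borel: "smooth f \<Longrightarrow> f \<in> borel_measurable borel"
  by (intro borel_measurable_continuous_onI smooth_continuous)

text \<open>A single weight \<open>W\<close> dominates the function and its partial derivatives up
  to order k. Differentiability is part of the recursion, so bounds of every order imply smoothness,
  and recursing on the innermost derivative makes the product and chain rules plain inductions on
  k.\<close>

primrec dbound :: "nat \<Rightarrow> ('a::euclidean_space \<Rightarrow> real) \<Rightarrow> ('a \<Rightarrow> 'b::real_normed_vector) \<Rightarrow> bool" where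
  "dbound 0 W f \<longleftrightarrow> (\<forall>x. norm (f x) \<le> W x)"
| "dbound (Suc k) W f \<longleftrightarrow>
     (\<forall>x. norm (f x) \<le> W x) \<and> f differentiable_on UNIV \<and> (\<forall>b\<in>Basis. dbound k W (pd b f))"

lemma dbound_norm: "dbound k W f \<Longrightarrow> norm (f x) \<le> W x"
  by (cases k) auto

lemma dbound_nonneg: "dbound k W f \<Longrightarrow> 0 \<le> W x"
  using dbound_norm[of k W f x] norm_ge_zero[of "f x"] by linarith

lemma dbound_Suc_D: "dbound (Suc k) W f \<Longrightarrow> dbound k W f"
proof (induction k arbitrary: f)
  case (Suc k)
  then show ?case by (metis dbound.simps(2))
qed simp

lemma dbound_le: "dbound k W f \<Longrightarrow> j \<le> k \<Longrightarrow> dbound j W f"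
proof (induction k)
  case (Suc k)
  then show ?case using dbound_Suc_D by (cases "j = Suc k") auto
qed simp

lemma dbound_mono: "dbound k W f \<Longrightarrow> (\<And>x. W x \<le> V x) \<Longrightarrow> dbound k V f"
proof (induction k arbitrary: f)
  case 0
  then show ?case by (simp, meson order_trans)
next
  case (Suc k)
  then show ?case by (simp, meson order_trans)
qed

lemma dbound_pd: "dbound (Suc k) W f \<Longrightarrow> b \<in> Basis \<Longrightarrow> dbound k W (pd b f)"
  by simp

lemma dbound_SucI:
  assumes "\<And>x. norm (f x) \<le> W x" "\<And>x. f differentiable (at x)" "\<And>b. b \<in> Basis \<Longrightarrow> dbound k W (pd b f)"
  shows "dbound (Suc k) W f"
  using assms by (auto simp: differentiable_on_def)

text \<open>No estimate is gained here: the norms of the derivatives, added up, always form a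
  weight. Together with the converse it lets the closure properties of smooth functions be read off
  from the corresponding rules for \<open>dbound\<close>.\<close>

lemma smooth_imp_dbound:
  fixes f :: "'a::euclidean_space \<Rightarrow> 'b::real_normed_vector"
  shows "smooth f \<Longrightarrow> \<exists>W. dbound k W f"
proof (induction k arbitrary: f)
  case 0
  then show ?case by (auto intro: exI[of _ "\<lambda>x. norm (f x)"])
next
  case (Suc k)
  then have "\<forall>b\<in>Basis. \<exists>W. dbound k W (pd b f)" using smooth_pd by blast
  then obtain V where V: "\<And>b. b \<in> Basis \<Longrightarrow> dbound k (V b) (pd b f)" by metis
  let ?W = "\<lambda>x. norm (f x) + (\<Sum>b\<in>Basis. V b x)"
  have nn: "0 \<le> V b x" if "b \<in> Basis" for b x using dbound_nonneg[OF V[OF that]] .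
  have "dbound (Suc k) ?W f"
  proof (rule dbound_SucI)
    show "norm (f x) \<le> ?W x" for x using nn by (simp add: sum_nonneg)
    show "f differentiable (at x)" for x using Suc.prems smooth_differentiable_at by blast
    show "dbound k ?W (pd b f)" if "b \<in> Basis" for b
    proof (rule dbound_mono[OF V[OF that]])
      fix x show "V b x \<le> ?W x"
        using member_le_sum[of b Basis "\<lambda>b. V b x"] nn that by (simp add: add_increasing)
    qed
  qed
  then show ?case by blast
qed

lemma dbound_imp_smooth:
  fixes f :: "'a::euclidean_space \<Rightarrow> 'b::real_normed_vector"
  assumes "\<And>k. \<exists>W. dbound k W f"
  shows "smooth f"
proof -
  have "partials bs f differentiable_on UNIV" if "bs \<in> lists Basis" "\<And>k. \<exists>W. dbound k W f" for bs
    using that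
  proof (induction bs arbitrary: f rule: rev_induct)
    case Nil
    then show ?case using dbound.simps(2)[of 0] by (metis partials.simps(1))
  next
    case (snoc b bs)
    then show ?case unfolding partials_snoc
      by (metis append_in_lists_conv dbound_pd listsE)
  qed
  then show ?thesis using assms unfolding smooth_def by blast
qed

text \<open>Links the recursion to the lists of directions in which the Schwartz space and its
  seminorms are phrased.\<close>

lemma dbound_iff_partials:
  fixes f :: "'a::euclidean_space \<Rightarrow> 'b::real_normed_vector"
  assumes "smooth f"
  shows "dbound k W f \<longleftrightarrow> (\<forall>bs\<in>lists Basis. length bs \<le> k \<longrightarrow> (\<forall>x. norm (partials bs f x) \<le> W x))"
  using assms
proof (induction k arbitrary: f)
  case 0 then show ?case by auto
next
  case (Suc k)
  have "dbound (Suc k) W f \<longleftrightarrow> (\<forall>x. norm (f x) \<le> W x) \<and>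
     (\<forall>b\<in>Basis. \<forall>bs\<in>lists Basis. length bs \<le> k \<longrightarrow> (\<forall>x. norm (partials (bs @ [b]) f x) \<le> W x))"
    using Suc.IH[OF smooth_pd[OF Suc.prems]] smooth_differentiable[OF Suc.prems]
    by (simp add: partials_snoc)
  also have "\<dots> \<longleftrightarrow> (\<forall>bs\<in>lists Basis. length bs \<le> Suc k \<longrightarrow> (\<forall>x. norm (partials bs f x) \<le> W x))" (is "?L \<longleftrightarrow> ?R")
  proof
    assume L: ?L
    show ?R
    proof (intro ballI impI)
      fix bs :: "'a list" assume bs: "bs \<in> lists Basis" "length bs \<le> Suc k"
      show "\<forall>x. norm (partials bs f x) \<le> W x"
        using L bs by (cases bs rule: rev_cases) auto
    qed
  next
    assume R: ?R
    show ?L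
    proof (intro conjI ballI impI)
      show "\<forall>x. norm (f x) \<le> W x" using R[rule_format, of "[]"] by auto
      show "\<forall>x. norm (partials (bs @ [b]) f x) \<le> W x"
        if "b \<in> Basis" "bs \<in> lists Basis" "length bs \<le> k" for b bs
        using R[rule_format, of "bs @ [b]"] that by auto
    qed
  qed
  finally show ?case .
qed

section \<open>Calculus rules for derivative bounds\<close>

lemma pd_add: "f differentiable (at x) \<Longrightarrow> g differentiable (at x) \<Longrightarrow>
    pd b (\<lambda>x. f x + g x) x = pd b f x + pd b g x"
  unfolding frechet_derivative_works
  by (drule (1) has_derivative_add, drule pd_eqI[where b=b]) (simp add: pd_def)

lemma pd_linear:
  assumes "bounded_linear L" "f differentiable (at x)"
  shows "pd b (\<lambda>x. L (f x)) x = L (pd b f x)"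
proof -
  have "(f has_derivative frechet_derivative f (at x)) (at x)"
    using assms frechet_derivative_works by blast
  then have "((\<lambda>x. L (f x)) has_derivative (\<lambda>h. L (frechet_derivative f (at x) h))) (at x)"
    by (rule bounded_linear.has_derivative[OF assms(1)])
  then show ?thesis using pd_eqI[of "\<lambda>x. L (f x)" _ x b] by (simp add: pd_def)
qed

lemma differentiable_linear:
  "bounded_linear L \<Longrightarrow> f differentiable (at x) \<Longrightarrow> (\<lambda>x. L (f x)) differentiable (at x)"
  unfolding differentiable_def using bounded_linear.has_derivative by blast

lemma pd_mult:
  fixes f g :: "'a::real_normed_vector \<Rightarrow> 'b::real_normed_algebra"
  assumes "f differentiable (at x)" "g differentiable (at x)"
  shows "pd b (\<lambda>x. f x * g x) x = pd b f x * g x + f x * pd b g x"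
proof -
  have "((\<lambda>x. f x * g x) has_derivative (\<lambda>h. f x * frechet_derivative g (at x) h + frechet_derivative f (at x) h * g x)) (at x)"
    using assms frechet_derivative_works by (intro has_derivative_mult) blast+
  from pd_eqI[OF this, of b] show ?thesis by (simp add: pd_def)
qed

lemma dbound_add:
  fixes f g :: "'a::euclidean_space \<Rightarrow> 'b::real_normed_vector"
  shows "dbound k V f \<Longrightarrow> dbound k W g \<Longrightarrow> dbound k (\<lambda>x. V x + W x) (\<lambda>x. f x + g x)"
proof (induction k arbitrary: f g)
  case 0
  then show ?case by (simp add: norm_add_rule_thm)
next
  case (Suc k)
  have d: "f differentiable (at x)" "g differentiable (at x)" for x
    using Suc.prems by (auto simp: differentiable_on_def)
  show ?case
  proof (rule dbound_SucI)
    show "norm (f x + g x) \<le> V x + W x" for x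
      using dbound_norm[OF Suc.prems(1)] dbound_norm[OF Suc.prems(2)] norm_add_rule_thm by blast
    show "(\<lambda>x. f x + g x) differentiable at x" for x using d by simp
    show "dbound k (\<lambda>x. V x + W x) (pd b (\<lambda>x. f x + g x))" if "b \<in> Basis" for b
    proof -
      have "pd b (\<lambda>x. f x + g x) = (\<lambda>x. pd b f x + pd b g x)" using pd_add d by blast
      then show ?thesis using Suc.IH Suc.prems that by simp
    qed
  qed
qed

lemma dbound_linear:
  fixes f :: "'a::euclidean_space \<Rightarrow> 'b::real_normed_vector" and L :: "'b \<Rightarrow> 'c::real_normed_vector"
  assumes L: "bounded_linear L" "\<And>y. norm (L y) \<le> c * norm y" "0 \<le> c"
  shows "dbound k W f \<Longrightarrow> dbound k (\<lambda>x. c * W x) (\<lambda>x. L (f x))"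
proof (induction k arbitrary: f)
  case 0
  then show ?case using L(2) by (simp, meson L(3) mult_left_mono order_trans)
next
  case (Suc k)
  have d: "f differentiable (at x)" for x
    using Suc.prems by (auto simp: differentiable_on_def)
  show ?case
  proof (rule dbound_SucI)
    show "norm (L (f x)) \<le> c * W x" for x
      using dbound_norm[OF Suc.prems] L by (meson mult_left_mono order_trans)
    show "(\<lambda>x. L (f x)) differentiable at x" for x using d differentiable_linear L(1) by blast
    show "dbound k (\<lambda>x. c * W x) (pd b (\<lambda>x. L (f x)))" if "b \<in> Basis" for b
    proof -
      have "pd b (\<lambda>x. L (f x)) = (\<lambda>x. L (pd b f x))" using pd_linear[OF L(1)] d by blast
      then show ?thesis using Suc.IH Suc.prems that by simp
    qed
  qed
qed

lemma dbound_cmult: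
  fixes f :: "'a::euclidean_space \<Rightarrow> 'b::real_normed_algebra"
  shows "dbound k W f \<Longrightarrow> dbound k (\<lambda>x. norm c * W x) (\<lambda>x. c * f x)"
  by (rule dbound_linear[OF bounded_linear_mult_right]) (auto simp: norm_mult_ineq)

lemma dbound_scaleR:
  fixes f :: "'a::euclidean_space \<Rightarrow> 'b::real_normed_vector"
  shows "dbound k W f \<Longrightarrow> dbound k (\<lambda>x. \<bar>c\<bar> * W x) (\<lambda>x. c *\<^sub>R f x)"
  by (rule dbound_linear[OF bounded_linear_scaleR_right]) auto

lemma dbound_minus:
  fixes f :: "'a::euclidean_space \<Rightarrow> 'b::real_normed_vector"
  shows "dbound k W f \<Longrightarrow> dbound k W (\<lambda>x. - f x)"
  using dbound_scaleR[of k W f "-1"] by simp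

lemma dbound_diff:
  fixes f g :: "'a::euclidean_space \<Rightarrow> 'b::real_normed_vector"
  shows "dbound k V f \<Longrightarrow> dbound k W g \<Longrightarrow> dbound k (\<lambda>x. V x + W x) (\<lambda>x. f x - g x)"
  using dbound_add[OF _ dbound_minus] by fastforce

text \<open>Every differentiation turns one product into two, hence the factor 2^k of the Leibniz
  rule.\<close>

lemma dbound_mult:
  fixes f g :: "'a::euclidean_space \<Rightarrow> 'b::real_normed_algebra"
  shows "dbound k V f \<Longrightarrow> dbound k W g \<Longrightarrow> dbound k (\<lambda>x. 2 ^ k * (V x * W x)) (\<lambda>x. f x * g x)"
proof (induction k arbitrary: f g)
  case 0
  then show ?case
    by (simp, meson dbound_nonneg norm_mult_ineq mult_mono norm_ge_zero order_trans)
next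
  case (Suc k)
  have d: "f differentiable (at x)" "g differentiable (at x)" for x
    using Suc.prems by (auto simp: differentiable_on_def)
  have nn: "0 \<le> V x * W x" for x using dbound_nonneg Suc.prems by (metis mult_nonneg_nonneg)
  show ?case
  proof (rule dbound_SucI)
    fix x
    have "norm (f x * g x) \<le> V x * W x"
      by (rule order_trans[OF norm_mult_ineq])
        (intro mult_mono dbound_norm[OF Suc.prems(1)] dbound_norm[OF Suc.prems(2)] dbound_nonneg[OF Suc.prems(1)] norm_ge_zero)
    also have "\<dots> \<le> 2 ^ Suc k * (V x * W x)" using nn[of x] one_le_power[of "2::real" "Suc k"]
        mult_right_mono[of 1 "2 ^ Suc k" "V x * W x"] by simp
    finally show "norm (f x * g x) \<le> 2 ^ Suc k * (V x * W x)" .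
  next
    show "(\<lambda>x. f x * g x) differentiable at x" for x using d by simp
    show "dbound k (\<lambda>x. 2 ^ Suc k * (V x * W x)) (pd b (\<lambda>x. f x * g x))" if b: "b \<in> Basis" for b
    proof -
      have "pd b (\<lambda>x. f x * g x) = (\<lambda>x. pd b f x * g x + f x * pd b g x)" using pd_mult d by blast
      moreover have "dbound k (\<lambda>x. 2 ^ k * (V x * W x) + 2 ^ k * (V x * W x)) (\<lambda>x. pd b f x * g x + f x * pd b g x)"
        using Suc.prems b by (intro dbound_add Suc.IH) (auto intro: dbound_Suc_D)
      ultimately show ?thesis by (simp add: mult_ac)
    qed
  qed
qed

lemma pd_affine:
  fixes f :: "'b::euclidean_space \<Rightarrow> 'c::real_normed_vector" and A :: "'a::euclidean_space \<Rightarrow> 'b"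
  assumes A: "bounded_linear A" and d: "f differentiable (at (a + A x))"
  shows "pd b (\<lambda>x. f (a + A x)) x = (\<Sum>c\<in>Basis. (A b \<bullet> c) *\<^sub>R pd c f (a + A x))"
    and "(\<lambda>x. f (a + A x)) differentiable (at x)"
proof -
  have "((\<lambda>x. a + A x) has_derivative A) (at x)"
    using bounded_linear_imp_has_derivative[OF A] by (auto intro!: derivative_eq_intros)
  from has_derivative_compose[OF this has_derivative_pd[OF d]]
  have *: "((\<lambda>x. f (a + A x)) has_derivative (\<lambda>h. \<Sum>c\<in>Basis. (A h \<bullet> c) *\<^sub>R pd c f (a + A x))) (at x)" .
  from pd_eqI[OF *] show "pd b (\<lambda>x. f (a + A x)) x = (\<Sum>c\<in>Basis. (A b \<bullet> c) *\<^sub>R pd c f (a + A x))" .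
  from * show "(\<lambda>x. f (a + A x)) differentiable (at x)" unfolding differentiable_def by blast
qed

lemma dbound_sum:
  fixes f :: "'i \<Rightarrow> 'a::euclidean_space \<Rightarrow> 'b::real_normed_vector"
  assumes "finite I" "\<And>i. i \<in> I \<Longrightarrow> dbound k (W i) (f i)"
  shows "dbound k (\<lambda>x. \<Sum>i\<in>I. W i x) (\<lambda>x. \<Sum>i\<in>I. f i x)"
proof -
  have z: "dbound k (\<lambda>x. 0) (\<lambda>x::'a. 0::'b)"
  proof (induction k)
    case (Suc k)
    have "pd b (\<lambda>x::'a. 0::'b) = (\<lambda>x. 0)" for b by (rule ext, rule pd_eqI[where f'="\<lambda>_. 0"]) simp
    then show ?case using Suc by simp
  qed simp
  show ?thesis using assms
    by (induction I rule: finite_induct) (auto simp: z intro!: dbound_add)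
qed

lemma dbound_zero:
  fixes W :: "'a::euclidean_space \<Rightarrow> real"
  assumes "\<And>x. 0 \<le> W x" shows "dbound k W (\<lambda>x. 0::'b::real_normed_vector)"
  by (rule dbound_mono[OF dbound_sum[where I="{}::nat set" and f="\<lambda>_ _. 0::'b" and W="\<lambda>_ _. 0", simplified]]) (use assms in auto)

text \<open>By the chain rule a derivative in direction b is a combination of derivatives in
  directions c with coefficients \<open>A b \<bullet> c\<close>, whose absolute values sum to at
  most \<open>K\<close>. Since \<open>1 \<le> K\<close>, the single factor \<open>K ^ k\<close>
  covers the lower orders as well.\<close>

lemma dbound_affine:
  fixes f :: "'b::euclidean_space \<Rightarrow> 'c::real_normed_vector" and A :: "'a::euclidean_space \<Rightarrow> 'b"
  assumes A: "bounded_linear A" and K: "1 \<le> K" "\<And>b. b \<in> Basis \<Longrightarrow> (\<Sum>c\<in>Basis. \<bar>A b \<bullet> c\<bar>) \<le> K"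
  shows "dbound k W f \<Longrightarrow> dbound k (\<lambda>x. K ^ k * W (a + A x)) (\<lambda>x. f (a + A x))"
proof (induction k arbitrary: f)
  case 0
  then show ?case by simp
next
  case (Suc k)
  have d: "f differentiable (at x)" for x
    using Suc.prems by (auto simp: differentiable_on_def)
  have nn: "0 \<le> W x" for x using dbound_nonneg Suc.prems by metis
  show ?case
  proof (rule dbound_SucI)
    fix x
    have "norm (f (a + A x)) \<le> W (a + A x)" by (rule dbound_norm[OF Suc.prems])
    also have "\<dots> \<le> K ^ Suc k * W (a + A x)"
      using nn[of "a + A x"] K(1) one_le_power[OF K(1), of "Suc k"]
        mult_right_mono[of 1 "K ^ Suc k" "W (a + A x)"] by simp
    finally show "norm (f (a + A x)) \<le> K ^ Suc k * W (a + A x)" .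
  next
    show "(\<lambda>x. f (a + A x)) differentiable at x" for x by (rule pd_affine[OF A d])
    show "dbound k (\<lambda>x. K ^ Suc k * W (a + A x)) (pd b (\<lambda>x. f (a + A x)))" if b: "b \<in> Basis" for b
    proof -
      have e: "pd b (\<lambda>x. f (a + A x)) = (\<lambda>x. \<Sum>c\<in>Basis. (A b \<bullet> c) *\<^sub>R pd c f (a + A x))"
        using pd_affine(1)[OF A d] by blast
      have "dbound k (\<lambda>x. \<Sum>c\<in>Basis. \<bar>A b \<bullet> c\<bar> * (K ^ k * W (a + A x))) (pd b (\<lambda>x. f (a + A x)))"
        unfolding e using Suc.prems b by (intro dbound_sum dbound_scaleR Suc.IH) auto
      then show ?thesis
      proof (rule dbound_mono)
        fix x
        have "(\<Sum>c\<in>Basis. \<bar>A b \<bullet> c\<bar> * (K ^ k * W (a + A x))) = (\<Sum>c\<in>Basis. \<bar>A b \<bullet> c\<bar>) * (K ^ k * W (a + A x))"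
          by (simp add: sum_distrib_right)
        also have "\<dots> \<le> K * (K ^ k * W (a + A x))"
          using K(1) nn by (intro mult_right_mono K(2) b mult_nonneg_nonneg) auto
        finally show "(\<Sum>c\<in>Basis. \<bar>A b \<bullet> c\<bar> * (K ^ k * W (a + A x))) \<le> K ^ Suc k * W (a + A x)" by simp
      qed
    qed
  qed
qed

subsection \<open>Smooth functions\<close>

lemma smooth_const: "smooth (\<lambda>x::'a::euclidean_space. c::'b::real_normed_vector)"
proof (rule dbound_imp_smooth)
  fix k
  have "dbound k (\<lambda>x. norm c) (\<lambda>x::'a. c)"
  proof (cases k)
    case (Suc j)
    have "pd b (\<lambda>x::'a. c) = (\<lambda>x. 0)" for b by (rule ext, rule pd_eqI[where f'="\<lambda>_. 0"]) simp
    then show ?thesis using Suc by (simp add: dbound_zero)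
  qed simp
  then show "\<exists>W. dbound k W (\<lambda>x::'a. c)" by blast
qed

lemma smooth_add: "smooth f \<Longrightarrow> smooth g \<Longrightarrow> smooth (\<lambda>x. f x + g x)"
  by (rule dbound_imp_smooth, drule smooth_imp_dbound, drule smooth_imp_dbound, elim exE, rule exI, erule (1) dbound_add)

lemma smooth_diff: "smooth f \<Longrightarrow> smooth g \<Longrightarrow> smooth (\<lambda>x. f x - g x)"
  by (rule dbound_imp_smooth, drule smooth_imp_dbound, drule smooth_imp_dbound, elim exE, rule exI, erule (1) dbound_diff)

lemma smooth_mult:
  fixes f g :: "'a::euclidean_space \<Rightarrow> 'b::real_normed_algebra"
  shows "smooth f \<Longrightarrow> smooth g \<Longrightarrow> smooth (\<lambda>x. f x * g x)"
  by (rule dbound_imp_smooth, drule smooth_imp_dbound, drule smooth_imp_dbound, elim exE, rule exI, erule (1) dbound_mult)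

lemma smooth_sum:
  "(\<And>i. i \<in> I \<Longrightarrow> smooth (f i)) \<Longrightarrow> smooth (\<lambda>x. \<Sum>i\<in>I. f i x)"
  by (induction I rule: infinite_finite_induct) (auto intro: smooth_add smooth_const)

lemma smooth_prod:
  fixes f :: "'i \<Rightarrow> 'a::euclidean_space \<Rightarrow> 'b::real_normed_field"
  shows "(\<And>i. i \<in> I \<Longrightarrow> smooth (f i)) \<Longrightarrow> smooth (\<lambda>x. \<Prod>i\<in>I. f i x)"
  by (induction I rule: infinite_finite_induct) (auto intro: smooth_mult smooth_const)

lemma smooth_linear: "bounded_linear L \<Longrightarrow> smooth f \<Longrightarrow> smooth (\<lambda>x. L (f x))"
proof (rule dbound_imp_smooth)
  fix k assume L: "bounded_linear L" and "smooth f"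
  then obtain W where W: "dbound k W f" using smooth_imp_dbound by blast
  obtain c where "0 < c" "\<And>y. norm (L y) \<le> norm y * c" using bounded_linear.pos_bounded[OF L] by blast
  then have "dbound k (\<lambda>x. c * W x) (\<lambda>x. L (f x))"
    by (intro dbound_linear[OF L _ _ W]) (auto simp: mult.commute)
  then show "\<exists>W. dbound k W (\<lambda>x. L (f x))" by blast
qed

lemma smooth_of_real: "smooth f \<Longrightarrow> smooth (\<lambda>x. of_real (f x) :: complex)"
  by (rule smooth_linear[OF bounded_linear_of_real])

lemma affine_constant:
  fixes A :: "'a::euclidean_space \<Rightarrow> 'b::euclidean_space"
  assumes "bounded_linear A"
  obtains K where "1 \<le> K" "\<And>b. b \<in> Basis \<Longrightarrow> (\<Sum>c\<in>Basis. \<bar>A b \<bullet> c\<bar>) \<le> K"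
proof
  let ?K = "1 + (\<Sum>b\<in>Basis. \<Sum>c\<in>Basis. \<bar>A b \<bullet> c\<bar>)"
  show "1 \<le> ?K" by (simp add: sum_nonneg)
  show "(\<Sum>c\<in>Basis. \<bar>A b \<bullet> c\<bar>) \<le> ?K" if "b \<in> Basis" for b
    using member_le_sum[OF that, of "\<lambda>b. \<Sum>c\<in>Basis. \<bar>A b \<bullet> c\<bar>"] by (simp add: sum_nonneg)
qed

lemma smooth_affine:
  fixes f :: "'b::euclidean_space \<Rightarrow> 'c::real_normed_vector" and A :: "'a::euclidean_space \<Rightarrow> 'b"
  assumes "bounded_linear A" "smooth f"
  shows "smooth (\<lambda>x. f (a + A x))"
proof (rule dbound_imp_smooth)
  fix k
  obtain W where W: "dbound k W f" using smooth_imp_dbound assms by blast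
  obtain K where "1 \<le> K" "\<And>b. b \<in> Basis \<Longrightarrow> (\<Sum>c\<in>Basis. \<bar>A b \<bullet> c\<bar>) \<le> K"
    using affine_constant[OF assms(1)] by blast
  from dbound_affine[OF assms(1) this W] show "\<exists>W. dbound k W (\<lambda>x. f (a + A x))" by blast
qed

text \<open>The derivative of 1/f is -(1/f) f' (1/f), so a weight of order k for 1/f yields one of
  order k + 1. Only the existence of a weight is carried through the induction.\<close>

lemma smooth_inverse:
  fixes f :: "'a::euclidean_space \<Rightarrow> real"
  assumes s: "smooth f" and nz: "\<And>x. f x \<noteq> 0"
  shows "smooth (\<lambda>x. inverse (f x))"
proof (rule dbound_imp_smooth)
  fix k
  show "\<exists>W. dbound k W (\<lambda>x. inverse (f x))"
  proof (induction k)
    case 0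
    show ?case by (rule exI[of _ "\<lambda>x. norm (inverse (f x))"]) simp
  next
    case (Suc k)
    have pd: "pd b (\<lambda>x. inverse (f x)) = (\<lambda>x. - (inverse (f x) * pd b f x * inverse (f x)))" for b
    proof
      fix x
      have "(f has_derivative frechet_derivative f (at x)) (at x)"
        using smooth_differentiable_at[OF s] frechet_derivative_works by blast
      from Deriv.has_derivative_inverse[OF nz this]
      show "pd b (\<lambda>x. inverse (f x)) x = - (inverse (f x) * pd b f x * inverse (f x))"
        by (subst pd_eqI) (auto simp: pd_def)
    qed
    have dd: "(\<lambda>x. inverse (f x)) differentiable (at x)" for x
      by (intro differentiable_inverse nz smooth_differentiable_at[OF s])
    from Suc obtain W where W: "dbound k W (\<lambda>x. inverse (f x))" by blast
    have "\<exists>V. dbound k V (pd b (\<lambda>x. inverse (f x)))" if b: "b \<in> Basis" for b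
      unfolding pd using smooth_imp_dbound[OF smooth_pd[OF s b], of k] W
      by (elim exE) (rule exI, rule dbound_minus, rule dbound_mult, rule dbound_mult)
    then obtain V where V: "\<And>b. b \<in> Basis \<Longrightarrow> dbound k (V b) (pd b (\<lambda>x. inverse (f x)))" by metis
    let ?W = "\<lambda>x. norm (inverse (f x)) + (\<Sum>b\<in>Basis. V b x)"
    have nn: "0 \<le> V b x" if "b \<in> Basis" for b x using dbound_nonneg[OF V[OF that]] .
    have "dbound (Suc k) ?W (\<lambda>x. inverse (f x))"
    proof (rule dbound_SucI)
      show "norm (inverse (f x)) \<le> ?W x" for x using nn by (simp add: sum_nonneg)
      show "dbound k ?W (pd b (\<lambda>x. inverse (f x)))" if "b \<in> Basis" for b
      proof (rule dbound_mono[OF V[OF that]])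
        fix x show "V b x \<le> ?W x"
          using member_le_sum[of b Basis "\<lambda>b. V b x"] nn that by (simp add: add_increasing)
      qed
    qed (rule dd)
    then show ?case by blast
  qed
qed

lemma pd_vanishes_outside:
  assumes "\<And>x. R < norm x \<Longrightarrow> f x = 0" "R < norm x"
  shows "pd b f x = 0"
proof (rule pd_eqI[where f'="\<lambda>_. 0"])
  have "open {x::'a. R < norm x}" by (intro open_Collect_less continuous_intros)
  then show "(f has_derivative (\<lambda>_. 0)) (at x)"
    by (rule has_derivative_transform_within_open[where f="\<lambda>_. 0" and s="{x. R < norm x}", rotated]) (use assms in auto)
qed

lemma compact_support_dbound:
  fixes f :: "'a::euclidean_space \<Rightarrow> 'b::real_normed_vector"
  shows "smooth f \<Longrightarrow> (\<And>x. R < norm x \<Longrightarrow> f x = 0) \<Longrightarrow>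
    \<exists>B\<ge>0. dbound k (\<lambda>x. if norm x \<le> R then B else 0) f"
proof (induction k arbitrary: f)
  case (0 f)
  have "bounded (f ` cball 0 R)"
    by (intro compact_imp_bounded compact_continuous_image smooth_continuous 0) auto
  then obtain B where "\<And>x. norm x \<le> R \<Longrightarrow> norm (f x) \<le> B" by (fastforce simp: bounded_iff)
  then have "dbound 0 (\<lambda>x. if norm x \<le> R then max B 0 else 0) f" using 0
    by (auto simp: not_le intro: max.coboundedI1)
  then show ?case by (intro exI[of _ "max B 0"]) auto
next
  case (Suc k f)
  have "\<exists>B\<ge>0. dbound k (\<lambda>x. if norm x \<le> R then B else 0) (pd b f)" if "b \<in> Basis" for b
    using Suc.IH[OF smooth_pd[OF Suc.prems(1) that]] pd_vanishes_outside Suc.prems(2) by blast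
  then obtain V where V: "\<And>b. b \<in> Basis \<Longrightarrow> V b \<ge> 0 \<and> dbound k (\<lambda>x. if norm x \<le> R then V b else 0) (pd b f)" by metis
  have "bounded (f ` cball 0 R)"
    by (intro compact_imp_bounded compact_continuous_image smooth_continuous Suc.prems) auto
  then obtain B where B: "\<And>x. norm x \<le> R \<Longrightarrow> norm (f x) \<le> B" by (fastforce simp: bounded_iff)
  let ?B = "max B 0 + (\<Sum>b\<in>Basis. V b)"
  have sV: "0 \<le> (\<Sum>b\<in>Basis. V b)" using V by (simp add: sum_nonneg)
  have "dbound (Suc k) (\<lambda>x. if norm x \<le> R then ?B else 0) f"
  proof (rule dbound_SucI)
    show "norm (f x) \<le> (if norm x \<le> R then ?B else 0)" for x
      using B[of x] Suc.prems(2)[of x] sV by auto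
    show "f differentiable (at x)" for x using smooth_differentiable_at Suc.prems by blast
    show "dbound k (\<lambda>x. if norm x \<le> R then ?B else 0) (pd b f)" if "b \<in> Basis" for b
    proof (rule dbound_mono[of _ "\<lambda>x. if norm x \<le> R then V b else 0"])
      show "dbound k (\<lambda>x. if norm x \<le> R then V b else 0) (pd b f)" using V that by blast
      show "(if norm x \<le> R then V b else 0) \<le> (if norm x \<le> R then ?B else 0)" for x
        using member_le_sum[of b Basis V] V that by auto
    qed
  qed
  then show ?case using sV by (intro exI[of _ ?B]) auto
qed

subsection \<open>Schwartz functions and tempered distributions\<close>

text \<open>The Schwartz bound as a relation between the order k of derivatives, the order N of
  decay and the constant \<open>B\<close>. Unlike a supremum, it passes through estimates without
  boundedness side conditions; \<open>sb_seminorm\<close> and \<open>seminorm_le\<close> connect it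
  with \<open>schwartz_seminorm\<close>.\<close>

definition sb :: "nat \<Rightarrow> nat \<Rightarrow> real \<Rightarrow> ('a::euclidean_space \<Rightarrow> complex) \<Rightarrow> bool" where
  "sb k N B f = dbound k (\<lambda>x. B / jbracket x ^ N) f"

lemma sb_nonneg: "sb k N B f \<Longrightarrow> 0 \<le> B"
  unfolding sb_def using dbound_nonneg[of k "\<lambda>x. B / jbracket x ^ N" f 0] zero_less_power[OF jbracket_pos, of "0::'a" N]
  by (simp add: zero_le_divide_iff not_le[symmetric])

lemma sb_mono: "sb k N B f \<Longrightarrow> j \<le> k \<Longrightarrow> M \<le> N \<Longrightarrow> B \<le> C \<Longrightarrow> sb j M C f"
  unfolding sb_def
  by (rule dbound_mono[OF dbound_le], assumption, assumption, rule order_trans[OF jbracket_div_mono divide_right_mono])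
    (use sb_nonneg[unfolded sb_def] in auto)

lemma sb_norm: "sb k N B f \<Longrightarrow> norm (f x) \<le> B / jbracket x ^ N"
  unfolding sb_def by (rule dbound_norm)

lemma sb_pd: "sb (Suc k) N B f \<Longrightarrow> b \<in> Basis \<Longrightarrow> sb k N B (pd b f)"
  unfolding sb_def by (rule dbound_pd)

lemma sb_add: "sb k N A f \<Longrightarrow> sb k N B g \<Longrightarrow> sb k N (A + B) (\<lambda>x. f x + g x)"
  unfolding sb_def by (drule (1) dbound_add) (simp add: add_divide_distrib)

lemma sb_cmult: "sb k N A f \<Longrightarrow> sb k N (norm c * A) (\<lambda>x. c * f x)"
  unfolding sb_def by (drule dbound_cmult[where c=c]) simp

text \<open>Polynomial growth of order m is paid for by m orders of decay. Coordinates, plane waves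
  and the remainders of plane waves are all handled through this.\<close>

lemma sb_mult_poly:
  assumes "dbound k (\<lambda>x. A * jbracket x ^ m) f" "sb k (N + m) B g"
  shows "sb k N (2 ^ k * A * B) (\<lambda>x. f x * g x)"
  unfolding sb_def
  by (rule dbound_mono[OF dbound_mult[OF assms(1) assms(2)[unfolded sb_def]]])
    (simp add: power_add)

text \<open>For a fixed order there are only finitely many lists of directions, so the separate
  bounds in the definition of \<open>schwartz\<close> can be added up to a common one.\<close>

lemma schwartz_iff: "f \<in> schwartz \<longleftrightarrow> (\<forall>k N. \<exists>B. sb k N B f)"
proof
  assume f: "f \<in> schwartz"
  then have sm: "smooth f" by (simp add: schwartz_def)
  show "\<forall>k N. \<exists>B. sb k N B f"
  proof (intro allI)
    fix k N :: nat
    let ?L = "{bs. set bs \<subseteq> (Basis::'a set) \<and> length bs \<le> k}"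
    have "\<forall>bs\<in>?L. \<exists>C. \<forall>x. jbracket x ^ N * norm (partials bs f x) \<le> C"
      using f by (force simp: schwartz_def bounded_iff lists_eq_set)
    then obtain C where C: "\<And>bs x. bs \<in> ?L \<Longrightarrow> jbracket x ^ N * norm (partials bs f x) \<le> C bs" by metis
    have fin: "finite ?L" by (rule finite_lists_length_le) simp
    have "sb k N (\<Sum>bs\<in>?L. \<bar>C bs\<bar>) f"
      unfolding sb_def dbound_iff_partials[OF sm]
    proof (intro ballI impI allI)
      fix bs x assume bs: "bs \<in> lists (Basis::'a set)" "length bs \<le> k"
      then have m: "bs \<in> ?L" by (auto simp: lists_eq_set)
      have "jbracket x ^ N * norm (partials bs f x) \<le> \<bar>C bs\<bar>" using C[OF m, of x] by linarith
      also have "\<dots> \<le> (\<Sum>bs\<in>?L. \<bar>C bs\<bar>)" by (rule member_le_sum[OF m _ fin]) simp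
      finally show "norm (partials bs f x) \<le> (\<Sum>bs\<in>?L. \<bar>C bs\<bar>) / jbracket x ^ N"
        by (simp add: field_simps)
    qed
    then show "\<exists>B. sb k N B f" by blast
  qed
next
  assume a: "\<forall>k N. \<exists>B. sb k N B f"
  then have sm: "smooth f" unfolding sb_def by (intro dbound_imp_smooth) blast
  have "bounded (range (\<lambda>x. jbracket x ^ N * norm (partials bs f x)))" if "bs \<in> lists Basis" for N bs
  proof -
    obtain B where "sb (length bs) N B f" using a by blast
    then have "norm (partials bs f x) \<le> B / jbracket x ^ N" for x
      using that by (simp add: sb_def dbound_iff_partials[OF sm])
    then show ?thesis by (intro boundedI[of _ B]) (auto simp: field_simps abs_mult)
  qed
  then show "f \<in> schwartz" using sm by (simp add: schwartz_def)
qed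

lemma schwartz_smooth: "f \<in> schwartz \<Longrightarrow> smooth f"
  by (simp add: schwartz_def)

lemma schwartz_borel: "f \<in> schwartz \<Longrightarrow> f \<in> borel_measurable borel"
  using schwartz_smooth smooth_borel by blast

lemma schwartz_sb: "f \<in> schwartz \<Longrightarrow> \<exists>B. sb k N B f"
  by (simp add: schwartz_iff)

lemma sb_seminorm:
  assumes "\<phi> \<in> schwartz" shows "sb N N (schwartz_seminorm N \<phi>) \<phi>"
proof -
  have sm: "smooth \<phi>" by (rule schwartz_smooth[OF assms])
  obtain B where B: "sb N N B \<phi>" using schwartz_sb[OF assms] by blast
  let ?g = "\<lambda>(bs, x). jbracket x ^ N * norm (partials bs \<phi> x)"
  let ?A = "{bs \<in> lists (Basis :: 'a set). length bs \<le> N} \<times> (UNIV :: 'a set)"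
  have bd: "bdd_above (?g ` ?A)"
  proof (rule bdd_aboveI2)
    fix z assume "z \<in> ?A"
    then obtain bs x where z: "z = (bs, x)" "bs \<in> lists (Basis::'a set)" "length bs \<le> N" by blast
    have "norm (partials bs \<phi> x) \<le> B / jbracket x ^ N"
      using B z by (simp add: sb_def dbound_iff_partials[OF sm])
    then show "?g z \<le> B" by (simp add: field_simps z)
  qed
  show ?thesis unfolding sb_def dbound_iff_partials[OF sm]
  proof (intro ballI impI allI)
    fix bs x assume bs: "bs \<in> lists (Basis::'a set)" "length bs \<le> N"
    have "?g (bs, x) \<le> schwartz_seminorm N \<phi>"
      unfolding schwartz_seminorm_def
      by (rule cSUP_upper[where f="?g", OF _ bd]) (use bs in simp)
    then show "norm (partials bs \<phi> x) \<le> schwartz_seminorm N \<phi> / jbracket x ^ N" by (simp add: field_simps)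
  qed
qed

lemma seminorm_le:
  assumes "\<phi> \<in> schwartz" "sb N N B \<phi>" shows "schwartz_seminorm N \<phi> \<le> B"
  unfolding schwartz_seminorm_def
proof (rule cSUP_least)
  show "{bs \<in> lists Basis. length bs \<le> N} \<times> (UNIV :: 'a set) \<noteq> {}" by auto (metis empty_subsetI lists_empty le0 list.size(3) lists.Nil)
  fix z assume "z \<in> {bs \<in> lists (Basis::'a set). length bs \<le> N} \<times> (UNIV :: 'a set)"
  then obtain bs x where z: "z = (bs, x)" "bs \<in> lists (Basis::'a set)" "length bs \<le> N" by blast
  then have "norm (partials bs \<phi> x) \<le> B / jbracket x ^ N"
    using assms(2) by (simp add: sb_def dbound_iff_partials[OF schwartz_smooth[OF assms(1)]])
  then show "(case z of (bs, x) \<Rightarrow> jbracket x ^ N * norm (partials bs \<phi> x)) \<le> B"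
    by (simp add: field_simps z)
qed

lemma temperedI:
  assumes "\<And>\<phi>. \<phi> \<notin> schwartz \<Longrightarrow> u \<phi> = 0"
    "\<And>\<phi> \<phi>'. \<phi> \<in> schwartz \<Longrightarrow> \<phi>' \<in> schwartz \<Longrightarrow> u (\<lambda>x. \<phi> x + \<phi>' x) = u \<phi> + u \<phi>'"
    "\<And>c \<phi>. \<phi> \<in> schwartz \<Longrightarrow> u (\<lambda>x. c * \<phi> x) = c * u \<phi>"
    "\<And>\<phi> B. \<phi> \<in> schwartz \<Longrightarrow> sb k N B \<phi> \<Longrightarrow> norm (u \<phi>) \<le> C * B"
  shows "u \<in> tempered"
proof -
  \<comment> \<open>One index serves both as order and as decay in \<open>schwartz_seminorm\<close>,
    hence the maximum.\<close>
  have "norm (u \<phi>) \<le> C * schwartz_seminorm (max k N) \<phi>" if "\<phi> \<in> schwartz" for \<phi>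
    by (rule assms(4)[OF that sb_mono[OF sb_seminorm[OF that, of "max k N"]]]) auto
  then show ?thesis using assms(1-3) unfolding tempered_def by blast
qed

lemma tempered_add: "u \<in> tempered \<Longrightarrow> \<phi> \<in> schwartz \<Longrightarrow> \<phi>' \<in> schwartz \<Longrightarrow> u (\<lambda>x. \<phi> x + \<phi>' x) = u \<phi> + u \<phi>'"
  by (simp add: tempered_def)

lemma tempered_cmult: "u \<in> tempered \<Longrightarrow> \<phi> \<in> schwartz \<Longrightarrow> u (\<lambda>x. c * \<phi> x) = c * u \<phi>"
  by (simp add: tempered_def)

lemma tempered_outside: "u \<in> tempered \<Longrightarrow> \<phi> \<notin> schwartz \<Longrightarrow> u \<phi> = 0"
  by (simp add: tempered_def)

lemma tempered_bound:
  assumes "u \<in> tempered"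
  obtains C N where "0 \<le> C" "\<And>\<phi> B. \<phi> \<in> schwartz \<Longrightarrow> sb N N B \<phi> \<Longrightarrow> norm (u \<phi>) \<le> C * B"
proof -
  from assms obtain C N where C: "\<And>\<phi>. \<phi> \<in> schwartz \<Longrightarrow> norm (u \<phi>) \<le> C * schwartz_seminorm N \<phi>"
    unfolding tempered_def by blast
  show ?thesis
  proof (rule that[of "\<bar>C\<bar>" N])
    fix \<phi> :: "'a \<Rightarrow> complex" and B assume p: "\<phi> \<in> schwartz" "sb N N B \<phi>"
    have "0 \<le> schwartz_seminorm N \<phi>" by (rule sb_nonneg[OF sb_seminorm[OF p(1)]])
    then have "C * schwartz_seminorm N \<phi> \<le> \<bar>C\<bar> * schwartz_seminorm N \<phi>" by (intro mult_right_mono) auto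
    also have "\<dots> \<le> \<bar>C\<bar> * B" by (intro mult_left_mono seminorm_le p) auto
    finally show "norm (u \<phi>) \<le> \<bar>C\<bar> * B" using C[OF p(1)] by linarith
  qed simp
qed

section \<open>Algebra of Schwartz functions and linearity of distributions\<close>

lemma schwartz_add: "f \<in> schwartz \<Longrightarrow> g \<in> schwartz \<Longrightarrow> (\<lambda>x. f x + g x) \<in> schwartz"
  unfolding schwartz_iff
proof (intro allI)
  fix k N assume "\<forall>k N. \<exists>B. sb k N B f" "\<forall>k N. \<exists>B. sb k N B g"
  then obtain A B where "sb k N A f" "sb k N B g" by blast
  from sb_add[OF this] show "\<exists>B. sb k N B (\<lambda>x. f x + g x)" by blast
qed

lemma schwartz_cmult: "f \<in> schwartz \<Longrightarrow> (\<lambda>x. c * f x) \<in> schwartz"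
  unfolding schwartz_iff
proof (intro allI)
  fix k N assume "\<forall>k N. \<exists>B. sb k N B f"
  then obtain B where "sb k N B f" by blast
  from sb_cmult[OF this] show "\<exists>B. sb k N B (\<lambda>x. c * f x)" by blast
qed

lemma schwartz_zero: "(\<lambda>x. 0) \<in> schwartz"
  unfolding schwartz_iff sb_def by (intro allI exI[of _ 0] dbound_zero) simp

lemma schwartz_sum: "(\<And>i. i \<in> I \<Longrightarrow> f i \<in> schwartz) \<Longrightarrow> (\<lambda>x. \<Sum>i\<in>I. f i x) \<in> schwartz"
  by (induction I rule: infinite_finite_induct) (auto intro: schwartz_add schwartz_zero)

lemma schwartz_diff: "f \<in> schwartz \<Longrightarrow> g \<in> schwartz \<Longrightarrow> (\<lambda>x. f x - g x) \<in> schwartz"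
  using schwartz_add[of f "\<lambda>x. (-1) * g x"] schwartz_cmult[of g "-1"] by simp

lemma tempered_zero: "u \<in> tempered \<Longrightarrow> u (\<lambda>x. 0) = 0"
  using tempered_cmult[of u "\<lambda>x. 0" 0] schwartz_zero by simp

lemma tempered_sum:
  assumes "u \<in> tempered" "\<And>i. i \<in> I \<Longrightarrow> f i \<in> schwartz"
  shows "u (\<lambda>x. \<Sum>i\<in>I. f i x) = (\<Sum>i\<in>I. u (f i))"
  using assms(2)
  by (induction I rule: infinite_finite_induct)
    (auto simp: tempered_zero[OF assms(1)] tempered_add[OF assms(1)] schwartz_sum)

lemma tempered_diff:
  assumes "u \<in> tempered" "f \<in> schwartz" "g \<in> schwartz"
  shows "u (\<lambda>x. f x - g x) = u f - u g"
proof -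
  have "u (\<lambda>x. f x + (-1) * g x) = u f + u (\<lambda>x. (-1) * g x)"
    by (rule tempered_add[OF assms(1,2) schwartz_cmult[OF assms(3)]])
  then show ?thesis unfolding tempered_cmult[OF assms(1,3)] by simp
qed

lemma schwartz_pd: "f \<in> schwartz \<Longrightarrow> b \<in> Basis \<Longrightarrow> pd b f \<in> schwartz"
  unfolding schwartz_iff by (meson sb_pd)

lemma schwartz_mult_poly:
  assumes "\<And>k. \<exists>A m. dbound k (\<lambda>x. A * jbracket x ^ m) f" "g \<in> schwartz"
  shows "(\<lambda>x. f x * g x) \<in> schwartz"
  unfolding schwartz_iff
proof (intro allI)
  fix k N
  obtain A m where 1: "dbound k (\<lambda>x. A * jbracket x ^ m) f" using assms(1) by blast
  obtain B where "sb k (N + m) B g" using schwartz_sb[OF assms(2)] by blast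
  from sb_mult_poly[OF 1 this] show "\<exists>B. sb k N B (\<lambda>x. f x * g x)" by blast
qed

lemma schwartz_mult:
  assumes "f \<in> schwartz" "g \<in> schwartz" shows "(\<lambda>x. f x * g x) \<in> schwartz"
proof (rule schwartz_mult_poly[OF _ assms(2)])
  fix k
  obtain B where "sb k 0 B f" using schwartz_sb[OF assms(1)] by blast
  then have "dbound k (\<lambda>x. B * jbracket x ^ 0) f" by (simp add: sb_def)
  then show "\<exists>A m. dbound k (\<lambda>x. A * jbracket x ^ m) f" by blast
qed

text \<open>On the ball of radius R the bracket is at most 1 + R, so decay of order N costs only the
  factor (1 + R)^N.\<close>

lemma schwartz_compact_support:
  fixes f :: "'a::euclidean_space \<Rightarrow> complex"
  assumes "smooth f" "0 \<le> R" "\<And>x. R < norm x \<Longrightarrow> f x = 0"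
  shows "f \<in> schwartz"
  unfolding schwartz_iff
proof (intro allI)
  fix k N :: nat
  from compact_support_dbound[OF assms(1,3), where k=k] obtain B where
    B: "0 \<le> B" "dbound k (\<lambda>x. if norm x \<le> R then B else 0) f" by blast
  have "sb k N (B * (1 + R) ^ N) f"
    unfolding sb_def
  proof (rule dbound_mono[OF B(2)])
    fix x :: 'a
    have "B * jbracket x ^ N \<le> B * (1 + R) ^ N" if "norm x \<le> R"
      using jbracket_le_1_plus_norm[of x] that B by (intro mult_left_mono power_mono) auto
    moreover have "0 \<le> B * (1 + R) ^ N" using B assms(2) by simp
    ultimately show "(if norm x \<le> R then B else 0) \<le> B * (1 + R) ^ N / jbracket x ^ N"
      by (auto simp: field_simps)
  qed
  then show "\<exists>B. sb k N B f" by blast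
qed

subsection \<open>Taylor estimates\<close>

lemma onorm_sum_pd_le:
  fixes c :: "'a::euclidean_space \<Rightarrow> 'b::real_normed_vector" and B :: real
  assumes "\<And>b. b \<in> Basis \<Longrightarrow> norm (c b) \<le> B"
  shows "onorm (\<lambda>h. \<Sum>b\<in>Basis. (h \<bullet> b) *\<^sub>R c b) \<le> real DIM('a) * B"
proof (rule onorm_le)
  fix h :: 'a
  have "norm (\<Sum>b\<in>Basis. (h \<bullet> b) *\<^sub>R c b) \<le> (\<Sum>b\<in>(Basis::'a set). norm h * B)"
  proof (rule order_trans[OF norm_sum sum_mono])
    fix b :: 'a assume "b \<in> Basis"
    then show "norm ((h \<bullet> b) *\<^sub>R c b) \<le> norm h * B"
      unfolding norm_scaleR by (intro mult_mono assms Basis_le_norm) auto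
  qed
  then show "norm (\<Sum>b\<in>Basis. (h \<bullet> b) *\<^sub>R c b) \<le> real DIM('a) * B * norm h" by (simp add: mult_ac)
qed

lemma dbound_mvt:
  fixes f :: "'a::euclidean_space \<Rightarrow> 'b::real_normed_vector"
  assumes f: "dbound 1 W f" and B: "\<And>y. y \<in> cball x r \<Longrightarrow> W y \<le> B" and h: "norm (y - x) \<le> r"
  shows "norm (f y - f x) \<le> real DIM('a) * B * norm (y - x)"
proof (rule differentiable_bound[of "cball x r"])
  show "(f has_derivative (\<lambda>h. \<Sum>b\<in>Basis. (h \<bullet> b) *\<^sub>R pd b f z)) (at z within cball x r)" for z
    using f by (intro has_derivative_at_withinI[OF has_derivative_pd]) (auto simp: differentiable_on_def)
  show "onorm (\<lambda>h. \<Sum>b\<in>Basis. (h \<bullet> b) *\<^sub>R pd b f z) \<le> real DIM('a) * B" if "z \<in> cball x r" for z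
  proof (rule onorm_sum_pd_le)
    fix b :: 'a assume "b \<in> Basis"
    then have "dbound 0 W (pd b f)" using f unfolding One_nat_def by (rule dbound_pd[rotated])
    then show "norm (pd b f z) \<le> B" using B[OF that] dbound_norm[of 0 W "pd b f" z] by linarith
  qed
  have "0 \<le> r" using h norm_ge_zero[of "y - x"] by linarith
  then show "x \<in> cball x r" by simp
  show "y \<in> cball x r" using h by (simp add: dist_norm norm_minus_commute)
qed simp

text \<open>The mean value estimate is applied to the partial derivatives along the segment; each of
  the two sums over the basis contributes one factor of the dimension.\<close>

lemma dbound_taylor:
  fixes f :: "'a::euclidean_space \<Rightarrow> 'b::real_normed_vector"
  assumes f: "dbound 2 W f" and B: "\<And>y. y \<in> cball x 1 \<Longrightarrow> W y \<le> B" and h: "norm h \<le> 1"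
  shows "norm (f (x + h) - f x - (\<Sum>b\<in>Basis. (h \<bullet> b) *\<^sub>R pd b f x)) \<le> (real DIM('a))\<^sup>2 * B * (norm h)\<^sup>2"
proof -
  let ?D = "\<lambda>z h. \<Sum>b\<in>Basis. (h \<bullet> b) *\<^sub>R pd b f z"
  let ?S = "cball x (norm h)"
  have f': "dbound (Suc 1) W f" using f by (simp add: numeral_2_eq_2)
  have p: "dbound 1 W (pd b f)" if "b \<in> Basis" for b using f' that dbound_pd by blast
  have "norm (f (x + h) - f x - ?D x ((x + h) - x)) \<le> norm ((x + h) - x) * (real DIM('a) * (real DIM('a) * B * norm h))"
  proof (rule differentiable_bound_linearization[of x "x + h" ?S])
    show "x + t *\<^sub>R (x + h - x) \<in> ?S" if "t \<in> {0..1}" for t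
      using that by (auto simp: dist_norm mult_left_le_one_le)
    show "(f has_derivative ?D z) (at z within ?S)" for z
      using f' by (intro has_derivative_at_withinI[OF has_derivative_pd]) (auto simp: differentiable_on_def)
    show "onorm (?D z - ?D x) \<le> real DIM('a) * (real DIM('a) * B * norm h)" if z: "z \<in> ?S" for z
    proof -
      have e: "(?D z - ?D x) = (\<lambda>h. \<Sum>b\<in>Basis. (h \<bullet> b) *\<^sub>R (pd b f z - pd b f x))"
        by (auto simp: scaleR_diff_right sum_subtractf fun_eq_iff)
      have "norm (pd b f z - pd b f x) \<le> real DIM('a) * B * norm h" if b: "b \<in> Basis" for b
      proof -
        have "norm (pd b f z - pd b f x) \<le> real DIM('a) * B * norm (z - x)"
          by (rule dbound_mvt[OF p[OF b], of x "norm h"]) (use z h B in \<open>auto simp: dist_norm norm_minus_commute\<close>)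
        also have "\<dots> \<le> real DIM('a) * B * norm h"
          using z B[of x] dbound_nonneg[OF f, of x] by (intro mult_left_mono) (auto simp: dist_norm norm_minus_commute)
        finally show ?thesis .
      qed
      then show ?thesis unfolding e by (rule onorm_sum_pd_le)
    qed
  qed auto
  then show ?thesis by (simp add: power2_eq_square mult_ac)
qed

text \<open>A quadratic bound on the first-order remainder both proves differentiability and
  identifies the partial derivatives. Differentiation under an integral or under a distribution
  below always goes through such a bound.\<close>

lemma pd_quadratic:
  fixes f :: "'a::euclidean_space \<Rightarrow> 'b::real_normed_vector"
  assumes "\<And>h. norm h \<le> 1 \<Longrightarrow> norm (f (x + h) - f x - (\<Sum>b\<in>Basis. (h \<bullet> b) *\<^sub>R c b)) \<le> C * (norm h)\<^sup>2"
  shows "f differentiable (at x)" "b \<in> Basis \<Longrightarrow> pd b f x = c b"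
proof -
  let ?L = "\<lambda>h. \<Sum>b\<in>Basis. (h \<bullet> b) *\<^sub>R c b"
  have d: "(f has_derivative ?L) (at x)"
  proof (rule has_derivativeI_sandwich[of 1])
    show "bounded_linear ?L"
      by (intro bounded_linear_sum bounded_linear_scaleR_const bounded_linear_inner_left)
    show "norm ((f y - f x) - ?L (y - x)) / norm (y - x) \<le> C * norm (y - x)" if "y \<noteq> x" "dist y x < 1" for y
      using assms[of "y - x"] that by (simp add: dist_norm divide_simps power2_eq_square mult_ac)
    show "((\<lambda>y. C * norm (y - x)) \<longlongrightarrow> 0) (at x)"
      by (auto intro!: tendsto_eq_intros)
  qed auto
  show "f differentiable (at x)" using d unfolding differentiable_def by blast
  show "pd b f x = c b" if "b \<in> Basis"
    using pd_eqI[OF d, of b] that by (simp add: inner_Basis if_distrib[of "\<lambda>t. t *\<^sub>R _"] sum.delta' cong: if_cong)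
qed

subsection \<open>Integration\<close>

lemma lborel_integral_affine:
  fixes f :: "'a::euclidean_space \<Rightarrow> 'b::{banach, second_countable_topology}"
  assumes [measurable]: "f \<in> borel_measurable borel" and c: "c \<noteq> 0"
  shows "(\<integral>x. f x \<partial>lborel) = \<bar>c\<bar> ^ DIM('a) *\<^sub>R (\<integral>x. f (a + c *\<^sub>R x) \<partial>lborel)"
proof -
  have "(\<integral>x. f x \<partial>lborel) = (\<integral>x. f x \<partial>density (distr lborel borel (\<lambda>x. a + c *\<^sub>R x)) (\<lambda>_. ennreal (\<bar>c\<bar> ^ DIM('a))))"
    by (subst lborel_affine[OF c, of a]) auto
  also have "\<dots> = \<bar>c\<bar> ^ DIM('a) *\<^sub>R (\<integral>x. f (a + c *\<^sub>R x) \<partial>lborel)"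
    by (subst integral_density) (auto simp: integral_distr)
  finally show ?thesis .
qed

lemma lborel_integral_reflect:
  fixes f :: "'a::euclidean_space \<Rightarrow> 'b::{banach, second_countable_topology}"
  assumes "f \<in> borel_measurable borel"
  shows "(\<integral>x. f (a - x) \<partial>lborel) = (\<integral>x. f x \<partial>lborel)"
  using lborel_integral_affine[OF assms, of "-1" a] by simp

lemma lborel_integral_shift:
  fixes f :: "'a::euclidean_space \<Rightarrow> 'b::{banach, second_countable_topology}"
  assumes "f \<in> borel_measurable borel"
  shows "(\<integral>x. f (a + x) \<partial>lborel) = (\<integral>x. f x \<partial>lborel)"
  using lborel_integral_affine[OF assms, of 1 a] by simp

lemma lborel_nn_integral_reflect:
  fixes f :: "'a::euclidean_space \<Rightarrow> ennreal"
  assumes [measurable]: "f \<in> borel_measurable borel"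
  shows "(\<integral>\<^sup>+x. f (a - x) \<partial>lborel) = (\<integral>\<^sup>+x. f x \<partial>lborel)"
proof -
  have "(\<integral>\<^sup>+x. f x \<partial>lborel) = (\<integral>\<^sup>+x. f x \<partial>density (distr lborel borel (\<lambda>x. a + (-1) *\<^sub>R x)) (\<lambda>_. ennreal (\<bar>-1\<bar> ^ DIM('a))))"
    by (subst lborel_affine[of "-1" a]) auto
  also have "\<dots> = (\<integral>\<^sup>+x. f (a - x) \<partial>lborel)"
    by (simp add: density_1 nn_integral_distr)
  finally show ?thesis by simp
qed

lemma nn_integral_inverse_1_plus_square_finite:
  "(\<integral>\<^sup>+t. ennreal (inverse (1 + t\<^sup>2)) \<partial>(lborel :: real measure)) < (\<infinity>::ennreal)"
proof -
  have "integrable lborel (\<lambda>t::real. inverse (1 + t\<^sup>2))"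
    using integrable_inverse_1_plus_square by (simp add: set_integrable_def)
  then show ?thesis by (simp add: integrable_iff_bounded)
qed

text \<open>Comparing the radial weight with a product over coordinates reduces integrability to the
  function 1/(1+t^2) of one variable. This is where the exponent \<open>2 * DIM('a)\<close> comes
  from; the lattice sums use the same comparison.\<close>

lemma jbracket_power_ge_prod:
  "(\<Prod>b\<in>Basis. 1 + (x \<bullet> b)\<^sup>2) \<le> jbracket (x::'a::euclidean_space) ^ (2 * DIM('a))"
proof -
  have "(\<Prod>b\<in>(Basis::'a set). 1 + (x \<bullet> b)\<^sup>2) \<le> (\<Prod>b\<in>(Basis::'a set). 1 + x \<bullet> x)"
  proof (rule prod_mono)
    fix b :: 'a assume "b \<in> Basis"
    then have "(x \<bullet> b)\<^sup>2 \<le> (norm x)\<^sup>2" using Basis_le_norm[of b x] by (metis abs_le_square_iff abs_norm_cancel)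
    then show "0 \<le> 1 + (x \<bullet> b)\<^sup>2 \<and> 1 + (x \<bullet> b)\<^sup>2 \<le> 1 + x \<bullet> x" by (simp add: power2_norm_eq_inner)
  qed
  then show ?thesis by (simp add: jbracket_power_even)
qed

lemma integrable_jbracket:
  assumes "2 * DIM('a) \<le> N"
  shows "integrable lborel (\<lambda>x::'a::euclidean_space. B / jbracket x ^ N)"
proof -
  have "(\<integral>\<^sup>+(x::'a). ennreal (1 / jbracket x ^ N) \<partial>lborel) \<le> (\<integral>\<^sup>+(x::'a). (\<Prod>b\<in>Basis. ennreal (inverse (1 + (x \<bullet> b)\<^sup>2))) \<partial>lborel)"
  proof (rule nn_integral_mono)
    fix x :: 'a
    have "1 / jbracket x ^ N \<le> 1 / jbracket x ^ (2 * DIM('a))" by (rule jbracket_div_mono[OF assms]) simp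
    also have "\<dots> \<le> 1 / (\<Prod>b\<in>Basis. 1 + (x \<bullet> b)\<^sup>2)"
      by (intro divide_left_mono jbracket_power_ge_prod mult_pos_pos prod_pos) (auto intro: add_pos_nonneg)
    also have "\<dots> = (\<Prod>b\<in>Basis. inverse (1 + (x \<bullet> b)\<^sup>2))" by (simp add: prod_inversef[symmetric] divide_inverse)
    finally show "ennreal (1 / jbracket x ^ N) \<le> (\<Prod>b\<in>Basis. ennreal (inverse (1 + (x \<bullet> b)\<^sup>2)))"
      by (subst prod_ennreal) (auto intro!: ennreal_leI)
  qed
  also have "\<dots> = (\<Prod>b\<in>(Basis::'a set). (\<integral>\<^sup>+t. ennreal (inverse (1 + t\<^sup>2)) \<partial>lborel))"
    by (rule nn_integral_lborel_prod) auto
  also have "\<dots> < \<infinity>" using nn_integral_inverse_1_plus_square_finite by (simp add: power_less_top_ennreal)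
  finally have "integrable lborel (\<lambda>x::'a. 1 / jbracket x ^ N)"
    by (intro integrableI_bounded) auto
  from integrable_mult_right[OF this, of B] show ?thesis by simp
qed

lemma integrable_by_jbracket:
  fixes f :: "'a::euclidean_space \<Rightarrow> 'b::{banach, second_countable_topology}"
  assumes "f \<in> borel_measurable borel" "\<And>x. norm (f x) \<le> B / jbracket x ^ N" "2 * DIM('a) \<le> N"
  shows "integrable lborel f"
proof (rule Bochner_Integration.integrable_bound[OF integrable_jbracket[OF assms(3), of B]])
  show "AE x in lborel. norm (f x) \<le> norm (B / jbracket x ^ N)" using assms(2) by (intro AE_I2) (smt (verit) real_norm_def)
qed (use assms in auto)

text \<open>The constant by which a pointwise bound of decay order at least
  \<open>2 * DIM('a)\<close> turns into a bound of the integral.\<close>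

definition jint :: "'a::euclidean_space itself \<Rightarrow> real" where
  "jint _ = (\<integral>(x::'a). 1 / jbracket x ^ (2 * DIM('a)) \<partial>lborel)"

lemma jint_nonneg: "0 \<le> jint TYPE('a::euclidean_space)"
  unfolding jint_def by (intro Bochner_Integration.integral_nonneg) simp

lemma integral_le_jint:
  fixes f :: "'a::euclidean_space \<Rightarrow> 'b::{banach, second_countable_topology}"
  assumes "f \<in> borel_measurable borel" "\<And>x. norm (f x) \<le> B / jbracket x ^ N" "2 * DIM('a) \<le> N"
  shows "norm (\<integral>x. f x \<partial>lborel) \<le> B * jint TYPE('a)"
proof -
  have B: "0 \<le> B" using order_trans[OF norm_ge_zero assms(2)[of 0]] zero_less_power[OF jbracket_pos, of "0::'a" N]
    by (simp add: zero_le_divide_iff not_le[symmetric])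
  have "norm (\<integral>x. f x \<partial>lborel) \<le> (\<integral>(x::'a). B * (1 / jbracket x ^ (2 * DIM('a))) \<partial>lborel)"
  proof (rule Bochner_Integration.integral_norm_bound_integral)
    show "integrable lborel f" by (rule integrable_by_jbracket[OF assms])
    show "integrable lborel (\<lambda>x::'a. B * (1 / jbracket x ^ (2 * DIM('a))))" using integrable_jbracket[where 'a='a, of "2 * DIM('a)" B] by simp
    show "norm (f x) \<le> B * (1 / jbracket x ^ (2 * DIM('a)))" for x
      using order_trans[OF assms(2) jbracket_div_mono[OF assms(3) B]] by simp
  qed
  also have "\<dots> = B * jint TYPE('a)" unfolding jint_def by (rule integral_mult_right_zero)
  finally show ?thesis .
qed

lemma nn_integral_jbracket:
  "(\<integral>\<^sup>+(x::'a::euclidean_space). ennreal (1 / jbracket x ^ (2 * DIM('a))) \<partial>lborel) = ennreal (jint TYPE('a))"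
  unfolding jint_def by (rule nn_integral_eq_integral[OF integrable_jbracket]) auto

lemma schwartz_integrable: "f \<in> schwartz \<Longrightarrow> integrable lborel f"
  using schwartz_sb[of f 0 "2 * DIM('a)"] sb_norm
  by (metis integrable_by_jbracket order_refl schwartz_borel)

subsection \<open>Plane waves\<close>

definition wave :: "'a::euclidean_space \<Rightarrow> 'a \<Rightarrow> complex" where
  "wave x \<xi> = exp (\<i> * of_real (x \<bullet> \<xi>))"

lemma norm_wave [simp]: "norm (wave x \<xi>) = 1"
  by (simp add: wave_def norm_exp_i_times)

lemma wave_commute: "wave x \<xi> = wave \<xi> x"
  by (simp add: wave_def inner_commute)

lemma wave_add: "wave (x + y) \<xi> = wave x \<xi> * wave y \<xi>"
  by (simp add: wave_def inner_add_left exp_add[symmetric] algebra_simps)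

lemma wave_add_right: "wave x (\<xi> + h) = wave x \<xi> * wave x h"
  by (metis wave_add wave_commute)

lemma wave_0 [simp]: "wave 0 \<xi> = 1" "wave x 0 = 1"
  by (auto simp: wave_def)

lemma wave_minus_right: "wave x (- \<xi>) = wave (- x) \<xi>"
  by (simp add: wave_def)

lemma continuous_on_wave [continuous_intros]:
  "continuous_on S f \<Longrightarrow> continuous_on S g \<Longrightarrow> continuous_on S (\<lambda>x. wave (f x) (g x))"
  unfolding wave_def by (intro continuous_intros)

lemma borel_measurable_wave [measurable]:
  "f \<in> borel_measurable M \<Longrightarrow> g \<in> borel_measurable M \<Longrightarrow> (\<lambda>x. wave (f x) (g x)) \<in> borel_measurable M"
  unfolding wave_def by measurable

lemma wave_remainder1: "norm (wave x h - 1) \<le> norm x * norm h"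
proof -
  have "norm (wave x h - 1) \<le> \<bar>x \<bullet> h\<bar>" using iexp_approx1[of "x \<bullet> h" 0] by (simp add: wave_def)
  then show ?thesis using Cauchy_Schwarz_ineq2[of x h] by linarith
qed

lemma wave_remainder2: "norm (wave x h - 1 - \<i> * of_real (x \<bullet> h)) \<le> (norm x)\<^sup>2 * (norm h)\<^sup>2"
proof -
  have "norm (wave x h - 1 - \<i> * of_real (x \<bullet> h)) \<le> \<bar>x \<bullet> h\<bar>\<^sup>2 / 2"
    using iexp_approx1[of "x \<bullet> h" 1] by (simp add: wave_def numeral_2_eq_2 algebra_simps)
  also have "\<dots> \<le> \<bar>x \<bullet> h\<bar>\<^sup>2" using zero_le_power2[of "x \<bullet> h"] by simp
  also have "\<dots> \<le> (norm x * norm h)\<^sup>2"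
    by (rule power_mono[OF Cauchy_Schwarz_ineq2]) simp
  finally show ?thesis by (simp add: power_mult_distrib)
qed

lemma sum_inner_Basis_wave:
  "(\<Sum>b\<in>Basis. (h \<bullet> b) *\<^sub>R (c * (\<i> * of_real (x \<bullet> b)))) = c * (\<i> * of_real (x \<bullet> h))"
proof -
  have "(\<Sum>b\<in>Basis. (h \<bullet> b) *\<^sub>R (c * (\<i> * of_real (x \<bullet> b)))) = c * \<i> * of_real (\<Sum>b\<in>Basis. (x \<bullet> b) * (h \<bullet> b))"
    by (simp add: sum_distrib_left scaleR_conv_of_real mult_ac)
  then show ?thesis by (simp only: euclidean_inner[of x h, symmetric]) (simp add: mult_ac)
qed

lemma pd_wave: "b \<in> Basis \<Longrightarrow> pd b (wave x) = (\<lambda>\<xi>. \<i> * of_real (x \<bullet> b) * wave x \<xi>)"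
  and differentiable_wave: "wave x differentiable (at \<xi>)"
proof -
  have *: "norm (wave x (\<xi> + h) - wave x \<xi> - (\<Sum>b\<in>Basis. (h \<bullet> b) *\<^sub>R (wave x \<xi> * (\<i> * of_real (x \<bullet> b))))) \<le> (norm x)\<^sup>2 * (norm h)\<^sup>2" for \<xi> h
  proof -
    have "wave x (\<xi> + h) - wave x \<xi> - (\<Sum>b\<in>Basis. (h \<bullet> b) *\<^sub>R (wave x \<xi> * (\<i> * of_real (x \<bullet> b))))
      = wave x \<xi> * (wave x h - 1 - \<i> * of_real (x \<bullet> h))"
      by (simp only: sum_inner_Basis_wave wave_add_right) (simp add: algebra_simps)
    then show ?thesis using wave_remainder2[of x h] by (simp add: norm_mult)
  qed
  show "wave x differentiable (at \<xi>)" by (rule pd_quadratic(1)[OF *])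
  show "pd b (wave x) = (\<lambda>\<xi>. \<i> * of_real (x \<bullet> b) * wave x \<xi>)" if b: "b \<in> Basis"
    using pd_quadratic(2)[OF * b] by (simp add: fun_eq_iff mult_ac)
qed

text \<open>Each derivative in \<xi> brings down a coordinate of x. The bound is uniform in \<xi>
  and polynomial in x, which gives the polynomial growth of a distribution paired with plane
  waves.\<close>

lemma dbound_wave: "dbound k (\<lambda>\<xi>. jbracket x ^ k) (wave x)"
proof (induction k)
  case (Suc k)
  show ?case
  proof (rule dbound_SucI)
    show "norm (wave x \<xi>) \<le> jbracket x ^ Suc k" for \<xi> using jbracket_power_ge_1[of x "Suc k"] by (simp only: norm_wave)
    show "dbound k (\<lambda>\<xi>. jbracket x ^ Suc k) (pd b (wave x))" if b: "b \<in> Basis" for b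
      unfolding pd_wave[OF b]
    proof (rule dbound_mono[OF dbound_cmult[OF Suc.IH]])
      show "norm (\<i> * of_real (x \<bullet> b)) * jbracket x ^ k \<le> jbracket x ^ Suc k"
        using inner_le_jbracket[OF b, of x] by (simp add: norm_mult mult_right_mono)
    qed
  qed (rule differentiable_wave)
qed simp

lemma dbound_coord:
  assumes "b \<in> Basis"
  shows "dbound k (\<lambda>x. 1 * jbracket x ^ 1) (\<lambda>x. of_real (x \<bullet> b) :: complex)"
proof (cases k)
  case 0
  then show ?thesis using inner_le_jbracket[OF assms] by simp
next
  case (Suc j)
  have d: "((\<lambda>x. of_real (x \<bullet> b) :: complex) has_derivative (\<lambda>h. of_real (h \<bullet> b))) (at x)" for x
    by (auto intro!: derivative_eq_intros)
  have const: "dbound j (\<lambda>x. 1 * jbracket x ^ 1) (\<lambda>x::'a. of_real r :: complex)" if "\<bar>r\<bar> \<le> 1" for r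
  proof (cases j)
    case 0
    then show ?thesis by (auto intro: order_trans[OF that jbracket_ge_1])
  next
    case (Suc i)
    have "pd c (\<lambda>x::'a. of_real r :: complex) = (\<lambda>x. 0)" for c by (rule ext, rule pd_eqI[where f'="\<lambda>_. 0"]) simp
    then show ?thesis using that Suc by (simp add: dbound_zero order_trans[OF that jbracket_ge_1])
  qed
  show ?thesis unfolding Suc
  proof (rule dbound_SucI)
    show "norm (of_real (x \<bullet> b) :: complex) \<le> 1 * jbracket x ^ 1" for x using inner_le_jbracket[OF assms] by simp
    show "(\<lambda>x. of_real (x \<bullet> b) :: complex) differentiable (at x)" for x using d unfolding differentiable_def by blast
    show "dbound j (\<lambda>x. 1 * jbracket x ^ 1) (pd c (\<lambda>x. of_real (x \<bullet> b) :: complex))" if "c \<in> Basis" for c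
    proof -
      have "pd c (\<lambda>x. of_real (x \<bullet> b) :: complex) = (\<lambda>x. of_real (c \<bullet> b))" using pd_eqI[OF d] by blast
      then show ?thesis using const[of "c \<bullet> b"] that assms by (auto simp: inner_Basis)
    qed
  qed
qed

lemma sb_coord: "b \<in> Basis \<Longrightarrow> sb k (Suc N) B \<phi> \<Longrightarrow> sb k N (2 ^ k * B) (\<lambda>x. of_real (x \<bullet> b) * \<phi> x)"
  using sb_mult_poly[OF dbound_coord, of b k N B \<phi>] by simp

lemma schwartz_coord: "b \<in> Basis \<Longrightarrow> \<phi> \<in> schwartz \<Longrightarrow> (\<lambda>x. of_real (x \<bullet> b) * \<phi> x) \<in> schwartz"
  by (rule schwartz_mult_poly) (use dbound_coord in blast)+

lemma sb_wave: "sb k N B \<phi> \<Longrightarrow> sb k N (2 ^ k * jbracket x ^ k * B) (\<lambda>\<xi>. wave x \<xi> * \<phi> \<xi>)"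
  using sb_mult_poly[of k "jbracket x ^ k" 0 "wave x" N B \<phi>] dbound_wave[of k x] by simp

lemma schwartz_wave: "\<phi> \<in> schwartz \<Longrightarrow> (\<lambda>\<xi>. wave x \<xi> * \<phi> \<xi>) \<in> schwartz"
proof (rule schwartz_mult_poly)
  fix k show "\<exists>A m. dbound k (\<lambda>\<xi>. A * jbracket \<xi> ^ m) (wave x)"
    by (rule exI[of _ "jbracket x ^ k"], rule exI[of _ 0]) (simp add: dbound_wave)
qed

text \<open>The second moment of \<tau> controls the quadratic remainder of the plane wave. The map
  \<tau> is general because three cases occur: reflection for the Fourier transform, and the
  identity and an approximation of it in \<open>quantization_dbound\<close>.\<close>

lemma exp_integral_derivative:
  fixes \<tau> :: "'x \<Rightarrow> 'a::euclidean_space"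
  assumes [measurable]: "g \<in> borel_measurable M" "\<tau> \<in> borel_measurable M"
    and g: "integrable M g" and g2: "integrable M (\<lambda>x. norm (g x) * (norm (\<tau> x))\<^sup>2)"
  shows "(\<lambda>\<xi>. \<integral>x. g x * wave (\<tau> x) \<xi> \<partial>M) differentiable (at \<xi>)"
    and "b \<in> Basis \<Longrightarrow> pd b (\<lambda>\<xi>. \<integral>x. g x * wave (\<tau> x) \<xi> \<partial>M) \<xi> = (\<integral>x. (\<i> * of_real (\<tau> x \<bullet> b) * g x) * wave (\<tau> x) \<xi> \<partial>M)"
proof -
  let ?H = "\<lambda>\<xi>. \<integral>x. g x * wave (\<tau> x) \<xi> \<partial>M"
  let ?c = "\<lambda>\<xi> b. \<integral>x. (\<i> * of_real (\<tau> x \<bullet> b) * g x) * wave (\<tau> x) \<xi> \<partial>M"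
  have i1: "integrable M (\<lambda>x. g x * wave (\<tau> x) \<xi>)" for \<xi>
    by (rule Bochner_Integration.integrable_bound[OF g]) (auto simp: norm_mult)
  have i2: "integrable M (\<lambda>x. (\<i> * of_real (\<tau> x \<bullet> b) * g x) * wave (\<tau> x) \<xi>)" if b: "b \<in> Basis" for b \<xi>
  proof (rule Bochner_Integration.integrable_bound[OF Bochner_Integration.integrable_add[OF integrable_norm[OF g] g2]])
    show "AE x in M. norm (\<i> * of_real (\<tau> x \<bullet> b) * g x * wave (\<tau> x) \<xi>) \<le> norm (norm (g x) + norm (g x) * (norm (\<tau> x))\<^sup>2)"
    proof (rule AE_I2)
      fix x
      have "0 \<le> (norm (\<tau> x) - 1)\<^sup>2 + (norm (\<tau> x))\<^sup>2 + 1" by simp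
      then have "norm (\<tau> x) \<le> 1 + (norm (\<tau> x))\<^sup>2" by (simp add: power2_eq_square algebra_simps)
      then have "\<bar>\<tau> x \<bullet> b\<bar> \<le> 1 + (norm (\<tau> x))\<^sup>2" using Basis_le_norm[OF b, of "\<tau> x"] by linarith
      then have "\<bar>\<tau> x \<bullet> b\<bar> * norm (g x) \<le> (1 + (norm (\<tau> x))\<^sup>2) * norm (g x)" by (rule mult_right_mono) simp
      then show "norm (\<i> * of_real (\<tau> x \<bullet> b) * g x * wave (\<tau> x) \<xi>) \<le> norm (norm (g x) + norm (g x) * (norm (\<tau> x))\<^sup>2)"
        by (simp add: norm_mult algebra_simps)
    qed
  qed measurable
  have *: "norm (?H (\<xi> + h) - ?H \<xi> - (\<Sum>b\<in>Basis. (h \<bullet> b) *\<^sub>R ?c \<xi> b)) \<le> (\<integral>x. norm (g x) * (norm (\<tau> x))\<^sup>2 \<partial>M) * (norm h)\<^sup>2" for h \<xi>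
  proof -
    have s: "(\<Sum>b\<in>Basis. (h \<bullet> b) *\<^sub>R ?c \<xi> b) = (\<integral>x. (\<Sum>b\<in>Basis. (h \<bullet> b) *\<^sub>R ((\<i> * of_real (\<tau> x \<bullet> b) * g x) * wave (\<tau> x) \<xi>)) \<partial>M)"
      using i2 by (simp add: Bochner_Integration.integral_sum)
    have e: "(\<Sum>b\<in>Basis. (h \<bullet> b) *\<^sub>R ((\<i> * of_real (\<tau> x \<bullet> b) * g x) * wave (\<tau> x) \<xi>)) = g x * wave (\<tau> x) \<xi> * (\<i> * of_real (\<tau> x \<bullet> h))" for x
      using sum_inner_Basis_wave[of h "g x * wave (\<tau> x) \<xi>" "\<tau> x"] by (simp add: mult_ac)
    have i3: "integrable M (\<lambda>x. g x * wave (\<tau> x) \<xi> * (\<i> * of_real (\<tau> x \<bullet> h)))"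
      unfolding e[symmetric] using i2 by (intro Bochner_Integration.integrable_sum integrable_scaleR_right) auto
    have "?H (\<xi> + h) - ?H \<xi> - (\<Sum>b\<in>Basis. (h \<bullet> b) *\<^sub>R ?c \<xi> b)
        = (\<integral>x. g x * wave (\<tau> x) \<xi> * (wave (\<tau> x) h - 1 - \<i> * of_real (\<tau> x \<bullet> h)) \<partial>M)"
      unfolding s e Bochner_Integration.integral_diff[OF i1 i1, symmetric]
        Bochner_Integration.integral_diff[OF Bochner_Integration.integrable_diff[OF i1 i1] i3, symmetric]
      by (intro Bochner_Integration.integral_cong refl) (simp add: wave_add_right algebra_simps)
    also have "norm \<dots> \<le> (\<integral>x. (norm (g x) * (norm (\<tau> x))\<^sup>2) * (norm h)\<^sup>2 \<partial>M)"
    proof (rule order_trans[OF integral_norm_bound Bochner_Integration.integral_mono[OF integrable_norm]])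
      show "integrable M (\<lambda>x. g x * wave (\<tau> x) \<xi> * (wave (\<tau> x) h - 1 - \<i> * of_real (\<tau> x \<bullet> h)))"
        using Bochner_Integration.integrable_diff[OF Bochner_Integration.integrable_diff[OF i1[of "\<xi> + h"] i1[of \<xi>]] i3]
        by (simp add: wave_add_right algebra_simps)
      show "integrable M (\<lambda>x. (norm (g x) * (norm (\<tau> x))\<^sup>2) * (norm h)\<^sup>2)" using g2 by simp
      show "norm (g x * wave (\<tau> x) \<xi> * (wave (\<tau> x) h - 1 - \<i> * of_real (\<tau> x \<bullet> h))) \<le> (norm (g x) * (norm (\<tau> x))\<^sup>2) * (norm h)\<^sup>2" for x
        using mult_left_mono[OF wave_remainder2[of "\<tau> x" h], of "norm (g x)"] by (simp add: norm_mult mult_ac)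
    qed
    also have "\<dots> = (\<integral>x. norm (g x) * (norm (\<tau> x))\<^sup>2 \<partial>M) * (norm h)\<^sup>2" by simp
    finally show ?thesis .
  qed
  show "?H differentiable (at \<xi>)" by (rule pd_quadratic(1)[OF *])
  show "pd b ?H \<xi> = ?c \<xi> b" if "b \<in> Basis" by (rule pd_quadratic(2)[OF * that])
qed

subsection \<open>The Fourier transform on the Schwartz space\<close>

definition fconst :: "'a::euclidean_space itself \<Rightarrow> real" where
  "fconst _ = (2 * pi) powr (- real DIM('a) / 2)"

lemma fconst_pos [simp]: "0 < fconst TYPE('a::euclidean_space)"
  by (simp add: fconst_def)

lemma fconst_neq_0 [simp]: "fconst TYPE('a::euclidean_space) \<noteq> 0"
  using fconst_pos by (metis less_irrefl)

lemma fourier_eq: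
  "fourier \<phi> \<xi> = of_real (fconst TYPE('a)) * (\<integral>x. \<phi> x * wave (- x) \<xi> \<partial>lborel)" for \<phi> :: "'a::euclidean_space \<Rightarrow> complex"
  by (simp add: fourier_def fconst_def wave_def mult.commute)

lemma inv_fourier_eq:
  "inv_fourier \<phi> x = of_real (fconst TYPE('a)) * (\<integral>\<xi>. \<phi> \<xi> * wave x \<xi> \<partial>lborel)" for \<phi> :: "'a::euclidean_space \<Rightarrow> complex"
  by (simp add: inv_fourier_def fconst_def wave_def mult.commute)

lemma inv_fourier_reflect: "inv_fourier \<phi> x = fourier \<phi> (- x)"
  unfolding inv_fourier_eq fourier_eq by (simp add: wave_minus_right wave_commute[of x])

lemma integrable_wave:
  fixes \<phi> :: "'a::euclidean_space \<Rightarrow> complex"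
  assumes "integrable lborel \<phi>" "g \<in> borel_measurable borel"
  shows "integrable lborel (\<lambda>x. \<phi> x * wave (g x) \<xi>)"
  by (rule Bochner_Integration.integrable_bound[OF assms(1)]) (use assms in \<open>auto simp: norm_mult\<close>)

lemma fourier_add: "\<phi> \<in> schwartz \<Longrightarrow> \<psi> \<in> schwartz \<Longrightarrow> fourier (\<lambda>x. \<phi> x + \<psi> x) = (\<lambda>\<xi>. fourier \<phi> \<xi> + fourier \<psi> \<xi>)"
  unfolding fourier_eq fun_eq_iff
  by (simp add: distrib_right integrable_wave schwartz_integrable ring_distribs)

lemma fourier_cmult: "fourier (\<lambda>x. c * \<phi> x) = (\<lambda>\<xi>. c * fourier \<phi> \<xi>)"
  unfolding fourier_eq fun_eq_iff by (simp add: mult_ac)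

lemma inv_fourier_add: "\<phi> \<in> schwartz \<Longrightarrow> \<psi> \<in> schwartz \<Longrightarrow> inv_fourier (\<lambda>x. \<phi> x + \<psi> x) = (\<lambda>\<xi>. inv_fourier \<phi> \<xi> + inv_fourier \<psi> \<xi>)"
  by (simp add: inv_fourier_reflect fourier_add fun_eq_iff)

lemma inv_fourier_cmult: "inv_fourier (\<lambda>x. c * \<phi> x) = (\<lambda>\<xi>. c * inv_fourier \<phi> \<xi>)"
  by (simp add: inv_fourier_reflect fourier_cmult fun_eq_iff)

lemma fourier_derivative:
  fixes \<phi> :: "'a::euclidean_space \<Rightarrow> complex"
  assumes "\<phi> \<in> schwartz"
  shows "fourier \<phi> differentiable (at \<xi>)"
    and "b \<in> Basis \<Longrightarrow> pd b (fourier \<phi>) = (\<lambda>\<xi>. - \<i> * fourier (\<lambda>x. of_real (x \<bullet> b) * \<phi> x) \<xi>)"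
proof -
  have [measurable]: "\<phi> \<in> borel_measurable borel" by (rule schwartz_borel[OF assms])
  have i: "integrable lborel \<phi>" by (rule schwartz_integrable[OF assms])
  obtain B where B: "sb 0 (2 * DIM('a) + 2) B \<phi>" using schwartz_sb[OF assms] by blast
  have i2: "integrable lborel (\<lambda>x. norm (\<phi> x) * (norm (- x))\<^sup>2)"
  proof (rule integrable_by_jbracket[of _ B "2 * DIM('a)"])
    fix x :: 'a
    have "norm (\<phi> x) * (norm x)\<^sup>2 \<le> (B / jbracket x ^ (2 * DIM('a) + 2)) * (jbracket x)\<^sup>2"
      using sb_norm[OF B, of x] norm_le_jbracket[of x] sb_nonneg[OF B] by (intro mult_mono power_mono) auto
    also have "\<dots> = B / jbracket x ^ (2 * DIM('a))" unfolding power_add by simp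
    finally show "norm (norm (\<phi> x) * (norm (- x))\<^sup>2) \<le> B / jbracket x ^ (2 * DIM('a))" by simp
  qed auto
  have m: "\<phi> \<in> borel_measurable lborel" "(\<lambda>x::'a. - x) \<in> borel_measurable lborel" by auto
  have e: "fourier \<phi> = (\<lambda>\<xi>. of_real (fconst TYPE('a)) * (\<integral>x. \<phi> x * wave (- x) \<xi> \<partial>lborel))"
    unfolding fourier_eq ..
  note D = exp_integral_derivative[OF m i i2]
  show "fourier \<phi> differentiable (at \<xi>)" unfolding e
    by (rule differentiable_linear[OF bounded_linear_mult_right D(1)])
  show "pd b (fourier \<phi>) = (\<lambda>\<xi>. - \<i> * fourier (\<lambda>x. of_real (x \<bullet> b) * \<phi> x) \<xi>)" if b: "b \<in> Basis"
  proof
    fix \<xi>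
    have "pd b (fourier \<phi>) \<xi> = of_real (fconst TYPE('a)) * pd b (\<lambda>\<xi>. \<integral>x. \<phi> x * wave (- x) \<xi> \<partial>lborel) \<xi>"
      unfolding e by (rule pd_linear[OF bounded_linear_mult_right D(1)])
    also have "\<dots> = - \<i> * fourier (\<lambda>x. of_real (x \<bullet> b) * \<phi> x) \<xi>"
      unfolding D(2)[OF b] fourier_eq by (simp add: mult.assoc)
    finally show "pd b (fourier \<phi>) \<xi> = - \<i> * fourier (\<lambda>x. of_real (x \<bullet> b) * \<phi> x) \<xi>" .
  qed
qed

text \<open>By translation invariance the integral of
  \<open>\<psi> (x + t *\<^sub>R b) - \<psi> x\<close> vanishes. Taylor's estimate leaves an error
  of order t^2 after integration; dividing by t and letting t tend to 0 proves the claim.\<close>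

lemma integral_pd_eq_0:
  fixes \<psi> :: "'a::euclidean_space \<Rightarrow> complex"
  assumes "\<psi> \<in> schwartz" and b: "b \<in> Basis"
  shows "(\<integral>x. pd b \<psi> x \<partial>lborel) = 0"
proof -
  let ?n = "2 * DIM('a)"
  have [measurable]: "\<psi> \<in> borel_measurable borel" "pd b \<psi> \<in> borel_measurable borel"
    by (auto intro!: schwartz_borel schwartz_pd assms)
  obtain B where B: "sb 2 ?n B \<psi>" using schwartz_sb[OF assms(1)] by blast
  have B0: "0 \<le> B" by (rule sb_nonneg[OF B])
  \<comment> \<open>Points at distance at most 1 have brackets within a factor of 4, hence 4 to the
    power \<open>?n\<close> from moving the weight to x.\<close>
  let ?C = "(real DIM('a))\<^sup>2 * (B * 4 ^ ?n)"
  have i1: "integrable lborel \<psi>" and i2: "integrable lborel (pd b \<psi>)"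
    by (auto intro!: schwartz_integrable schwartz_pd assms)
  have bd: "norm (t *\<^sub>R (\<integral>x. pd b \<psi> x \<partial>lborel)) \<le> ?C * t\<^sup>2 * jint TYPE('a)" if t: "0 < t" "t \<le> 1" for t
  proof -
    have i3: "integrable lborel (\<lambda>x. \<psi> (x + t *\<^sub>R b))"
    proof (rule integrable_by_jbracket[of _ "B * 4 ^ ?n" "?n"])
      fix x
      have "B / jbracket (x + t *\<^sub>R b) ^ ?n \<le> B / (jbracket x / 4) ^ ?n"
        using jbracket_near[of x "x + t *\<^sub>R b"] t b B0 by (intro divide_left_mono power_mono mult_pos_pos zero_less_power) auto
      then show "norm (\<psi> (x + t *\<^sub>R b)) \<le> B * 4 ^ ?n / jbracket x ^ ?n"
        using sb_norm[OF B, of "x + t *\<^sub>R b"] by (simp add: power_divide)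
    qed auto
    have "norm (\<integral>x. \<psi> (x + t *\<^sub>R b) - \<psi> x - t *\<^sub>R pd b \<psi> x \<partial>lborel) \<le> (?C * t\<^sup>2) * jint TYPE('a)"
    proof (rule integral_le_jint[of _ _ ?n])
      fix x :: 'a
      have s: "(\<Sum>c\<in>Basis. ((t *\<^sub>R b) \<bullet> c) *\<^sub>R pd c \<psi> x) = t *\<^sub>R pd b \<psi> x"
        using b by (simp add: inner_Basis if_distrib[of "\<lambda>t. t *\<^sub>R _"] if_distrib[of "\<lambda>s. t * s"] sum.delta cong: if_cong)
      have "norm (\<psi> (x + t *\<^sub>R b) - \<psi> x - (\<Sum>c\<in>Basis. ((t *\<^sub>R b) \<bullet> c) *\<^sub>R pd c \<psi> x)) \<le>
          (real DIM('a))\<^sup>2 * (B * 4 ^ ?n / jbracket x ^ ?n) * (norm (t *\<^sub>R b))\<^sup>2"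
      proof (rule dbound_taylor[OF B[unfolded sb_def]])
        fix y assume "y \<in> cball x 1"
        then have "jbracket x \<le> 4 * jbracket y" by (intro jbracket_near) (simp add: dist_norm)
        then have "B / jbracket y ^ ?n \<le> B / (jbracket x / 4) ^ ?n"
          using B0 by (intro divide_left_mono power_mono mult_pos_pos zero_less_power) auto
        then show "B / jbracket y ^ ?n \<le> B * 4 ^ ?n / jbracket x ^ ?n" by (simp add: power_divide)
      qed (use t b in simp)
      then show "norm (\<psi> (x + t *\<^sub>R b) - \<psi> x - t *\<^sub>R pd b \<psi> x) \<le> ?C * t\<^sup>2 / jbracket x ^ ?n"
        unfolding s using t b by simp
    qed auto
    moreover have "(\<integral>x. \<psi> (x + t *\<^sub>R b) \<partial>lborel) = (\<integral>x. \<psi> x \<partial>lborel)"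
      using lborel_integral_shift[of \<psi> "t *\<^sub>R b"] by (simp add: add.commute)
    ultimately show ?thesis using i1 i2 i3 by simp
  qed
  have "norm (\<integral>x. pd b \<psi> x \<partial>lborel) \<le> ?C * jint TYPE('a) * t" if t: "0 < t" "t \<le> 1" for t
    using bd[OF t] t by (simp add: power2_eq_square mult_ac)
  moreover have "((\<lambda>t. ?C * jint TYPE('a) * t) \<longlongrightarrow> ?C * jint TYPE('a) * 0) (at_right 0)"
    by (intro tendsto_intros)
  moreover have "eventually (\<lambda>t::real. 0 < t \<and> t \<le> 1) (at_right 0)"
    by (rule eventually_at_rightI[of 0 1]) auto
  ultimately have "norm (\<integral>x. pd b \<psi> x \<partial>lborel) \<le> ?C * jint TYPE('a) * 0"
    by (intro tendsto_lowerbound[of "\<lambda>t. ?C * jint TYPE('a) * t"]) (auto elim: eventually_mono)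
  then show ?thesis by simp
qed

text \<open>Integration by parts: the derivative of \<phi> times the conjugate plane wave has
  integral 0.\<close>

lemma fourier_pd:
  fixes \<phi> :: "'a::euclidean_space \<Rightarrow> complex"
  assumes "\<phi> \<in> schwartz" and b: "b \<in> Basis"
  shows "fourier (pd b \<phi>) \<xi> = \<i> * of_real (\<xi> \<bullet> b) * fourier \<phi> \<xi>"
proof -
  have "(\<lambda>x. wave (- \<xi>) x * \<phi> x) \<in> schwartz" by (rule schwartz_wave[OF assms(1)])
  from integral_pd_eq_0[OF this b] have "(\<integral>x. pd b (\<lambda>x. wave (- \<xi>) x * \<phi> x) x \<partial>lborel) = 0" .
  moreover have e: "wave (- \<xi>) x = wave (- x) \<xi>" for x by (simp add: wave_def inner_commute)
  have "pd b (\<lambda>x. wave (- \<xi>) x * \<phi> x) x = pd b \<phi> x * wave (- x) \<xi> - \<i> * of_real (\<xi> \<bullet> b) * (\<phi> x * wave (- x) \<xi>)" for x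
    using pd_mult[OF differentiable_wave smooth_differentiable_at[OF schwartz_smooth[OF assms(1)]], of b "- \<xi>" x]
    unfolding pd_wave[OF b] by (simp add: e algebra_simps)
  moreover have "integrable lborel (\<lambda>x. pd b \<phi> x * wave (- x) \<xi>)" "integrable lborel (\<lambda>x. \<phi> x * wave (- x) \<xi>)"
    by (auto intro!: integrable_wave[OF schwartz_integrable] schwartz_pd assms)
  ultimately have "(\<integral>x. pd b \<phi> x * wave (- x) \<xi> \<partial>lborel) = \<i> * of_real (\<xi> \<bullet> b) * (\<integral>x. \<phi> x * wave (- x) \<xi> \<partial>lborel)"
    by simp
  then show ?thesis unfolding fourier_eq by simp
qed

lemma jbracket_le_sum: "jbracket (x::'a::euclidean_space) \<le> 1 + (\<Sum>b\<in>Basis. \<bar>x \<bullet> b\<bar>)"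
  using jbracket_le_1_plus_norm[of x] norm_le_l1[of x] by linarith

text \<open>\<open>jbracket \<xi>\<close> is at most 1 plus the sum of the moduli of the
  coordinates, and multiplication by a coordinate is, up to a factor i, the transform of a
  derivative. Each order of decay therefore costs one derivative and a factor 1 + DIM for the number
  of terms.\<close>

lemma fourier_decay:
  fixes \<phi> :: "'a::euclidean_space \<Rightarrow> complex"
  shows "\<phi> \<in> schwartz \<Longrightarrow> sb N (2 * DIM('a)) B \<phi> \<Longrightarrow>
    jbracket \<xi> ^ N * norm (fourier \<phi> \<xi>) \<le> fconst TYPE('a) * jint TYPE('a) * (1 + real DIM('a)) ^ N * B"
proof (induction N arbitrary: \<phi>)
  case 0
  have [measurable]: "\<phi> \<in> borel_measurable borel" by (rule schwartz_borel[OF 0(1)])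
  have "norm (\<integral>x. \<phi> x * wave (- x) \<xi> \<partial>lborel) \<le> B * jint TYPE('a)"
    by (rule integral_le_jint[of _ _ "2 * DIM('a)"]) (use sb_norm[OF 0(2)] in \<open>auto simp: norm_mult\<close>)
  then have "fconst TYPE('a) * norm (\<integral>x. \<phi> x * wave (- x) \<xi> \<partial>lborel) \<le> fconst TYPE('a) * (B * jint TYPE('a))"
    by (intro mult_left_mono) (auto simp: less_imp_le)
  then show ?case unfolding fourier_eq by (simp add: norm_mult mult_ac less_imp_le)
next
  case (Suc N)
  let ?K = "fconst TYPE('a) * jint TYPE('a) * (1 + real DIM('a)) ^ N * B"
  have "jbracket \<xi> ^ Suc N * norm (fourier \<phi> \<xi>) = jbracket \<xi> ^ N * (jbracket \<xi> * norm (fourier \<phi> \<xi>))" by simp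
  also have "\<dots> \<le> jbracket \<xi> ^ N * ((1 + (\<Sum>b\<in>Basis. \<bar>\<xi> \<bullet> b\<bar>)) * norm (fourier \<phi> \<xi>))"
    by (intro mult_left_mono mult_right_mono jbracket_le_sum) auto
  also have "\<dots> = jbracket \<xi> ^ N * norm (fourier \<phi> \<xi>) + (\<Sum>b\<in>Basis. jbracket \<xi> ^ N * norm (fourier (pd b \<phi>) \<xi>))"
    by (simp add: fourier_pd[OF Suc.prems(1)] norm_mult ring_distribs sum_distrib_left sum_distrib_right mult_ac)
  also have "\<dots> \<le> ?K + (\<Sum>b\<in>(Basis::'a set). ?K)"
    using Suc.prems by (intro add_mono sum_mono Suc.IH schwartz_pd sb_pd) (auto elim: sb_mono)
  also have "\<dots> = fconst TYPE('a) * jint TYPE('a) * (1 + real DIM('a)) ^ Suc N * B" by (simp add: algebra_simps)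
  finally show ?case .
qed

text \<open>A derivative of the transform is the transform of a coordinate multiple, so k
  derivatives need k more orders of decay of \<phi>. That \<open>K\<close> does not depend on \<phi>
  is the continuity of the Fourier transform.\<close>

lemma fourier_sb:
  "\<exists>K\<ge>0. \<forall>\<phi>\<in>schwartz. \<forall>B. sb N (2 * DIM('a) + k) B \<phi> \<longrightarrow> sb k N (K * B) (fourier (\<phi>::'a::euclidean_space \<Rightarrow> complex))"
proof (induction k)
  case 0
  show ?case
  proof (intro exI[of _ "fconst TYPE('a) * jint TYPE('a) * (1 + real DIM('a)) ^ N"] conjI ballI allI impI)
    fix \<phi> :: "'a \<Rightarrow> complex" and B assume "\<phi> \<in> schwartz" "sb N (2 * DIM('a) + 0) B \<phi>"
    then show "sb 0 N (fconst TYPE('a) * jint TYPE('a) * (1 + real DIM('a)) ^ N * B) (fourier \<phi>)"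
      using fourier_decay[of \<phi> N B] by (simp add: sb_def field_simps)
  qed (simp add: jint_nonneg less_imp_le)
next
  case (Suc k)
  then obtain K where K: "0 \<le> K" "\<And>\<phi> B. \<phi> \<in> schwartz \<Longrightarrow> sb N (2 * DIM('a) + k) B \<phi> \<Longrightarrow> sb k N (K * B) (fourier (\<phi>::'a \<Rightarrow> complex))" by blast
  show ?case
  proof (intro exI[of _ "2 ^ N * K"] conjI ballI allI impI)
    fix \<phi> :: "'a \<Rightarrow> complex" and B assume p: "\<phi> \<in> schwartz" "sb N (2 * DIM('a) + Suc k) B \<phi>"
    have B0: "0 \<le> B" by (rule sb_nonneg[OF p(2)])
    have one: "K * B \<le> 2 ^ N * K * B" using mult_right_mono[of 1 "2 ^ N" "K * B"] K(1) B0 by simp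
    have s0: "sb k N (2 ^ N * K * B) (fourier \<phi>)"
      by (rule sb_mono[OF K(2)[OF p(1) sb_mono[OF p(2)]]]) (use one in auto)
    show "sb (Suc k) N (2 ^ N * K * B) (fourier \<phi>)"
      unfolding sb_def
    proof (rule dbound_SucI)
      show "norm (fourier \<phi> x) \<le> 2 ^ N * K * B / jbracket x ^ N" for x by (rule sb_norm[OF s0])
      show "fourier \<phi> differentiable at x" for x by (rule fourier_derivative[OF p(1)])
      show "dbound k (\<lambda>x. 2 ^ N * K * B / jbracket x ^ N) (pd b (fourier \<phi>))" if b: "b \<in> Basis" for b
      proof -
        have "sb N (2 * DIM('a) + k) (2 ^ N * B) (\<lambda>x. of_real (x \<bullet> b) * \<phi> x)"
          using sb_coord[OF b] p(2) by simp
        from K(2)[OF schwartz_coord[OF b p(1)] this]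
        have "sb k N (K * (2 ^ N * B)) (fourier (\<lambda>x. of_real (x \<bullet> b) * \<phi> x))" .
        from sb_cmult[OF this, of "- \<i>"] show ?thesis
          unfolding fourier_derivative(2)[OF p(1) b] sb_def by (simp add: mult_ac)
      qed
    qed
  qed (use K in simp)
qed

text \<open>Continuity between Schwartz spaces, expressed through \<open>sb\<close> with constants
  independent of the function. Linearity is not part of it and is a separate assumption of
  \<open>tempered_scont\<close>.\<close>

definition scont :: "(('a::euclidean_space \<Rightarrow> complex) \<Rightarrow> ('b::euclidean_space \<Rightarrow> complex)) \<Rightarrow> bool" where
  "scont T \<longleftrightarrow> (\<forall>\<phi>\<in>schwartz. T \<phi> \<in> schwartz) \<and>
     (\<forall>k N. \<exists>j M C. 0 \<le> C \<and> (\<forall>\<phi>\<in>schwartz. \<forall>B. sb j M B \<phi> \<longrightarrow> sb k N (C * B) (T \<phi>)))"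

lemma scontI:
  assumes "\<And>k N. \<exists>j M C. 0 \<le> C \<and> (\<forall>\<phi>\<in>schwartz. \<forall>B. sb j M B \<phi> \<longrightarrow> sb k N (C * B) (T \<phi>))"
  shows "scont T"
  unfolding scont_def
proof (intro conjI ballI allI)
  fix \<phi> :: "'a \<Rightarrow> complex" assume p: "\<phi> \<in> schwartz"
  show "T \<phi> \<in> schwartz" unfolding schwartz_iff using assms schwartz_sb[OF p] p by meson
qed (use assms in blast)

lemma scont_schwartz: "scont T \<Longrightarrow> \<phi> \<in> schwartz \<Longrightarrow> T \<phi> \<in> schwartz"
  by (simp add: scont_def)

lemma scont_sb:
  assumes "scont T"
  obtains j M C where "0 \<le> C" "\<And>\<phi> B. \<phi> \<in> schwartz \<Longrightarrow> sb j M B \<phi> \<Longrightarrow> sb k N (C * B) (T \<phi>)"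
  using assms unfolding scont_def by meson

lemma scont_comp:
  assumes "scont S" "scont T" shows "scont (\<lambda>\<phi>. S (T \<phi>))"
proof (rule scontI)
  fix k N
  obtain j M C where 1: "0 \<le> C" "\<And>\<phi> B. \<phi> \<in> schwartz \<Longrightarrow> sb j M B \<phi> \<Longrightarrow> sb k N (C * B) (S \<phi>)"
    by (rule scont_sb[OF assms(1), of k N]) blast
  obtain j' M' C' where 2: "0 \<le> C'" "\<And>\<phi> B. \<phi> \<in> schwartz \<Longrightarrow> sb j' M' B \<phi> \<Longrightarrow> sb j M (C' * B) (T \<phi>)"
    by (rule scont_sb[OF assms(2), of j M]) blast
  show "\<exists>j M C. 0 \<le> C \<and> (\<forall>\<phi>\<in>schwartz. \<forall>B. sb j M B \<phi> \<longrightarrow> sb k N (C * B) (S (T \<phi>)))"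
    using 1 2 scont_schwartz[OF assms(2)]
    by (intro exI[of _ j'] exI[of _ M'] exI[of _ "C * C'"]) (auto simp: mult.assoc)
qed

lemma scont_fourier: "scont (fourier :: ('a::euclidean_space \<Rightarrow> complex) \<Rightarrow> _)"
  by (rule scontI) (use fourier_sb in blast)

lemma sb_reflect: "sb k N B f \<Longrightarrow> sb k N B (\<lambda>x. f (- x))"
  unfolding sb_def
  by (drule dbound_affine[where A=uminus and a=0 and K=1, rotated 3])
    (auto simp: bounded_linear_minus[OF bounded_linear_ident] inner_Basis if_distrib[of abs] sum.delta cong: if_cong)

lemma scont_inv_fourier: "scont (inv_fourier :: ('a::euclidean_space \<Rightarrow> complex) \<Rightarrow> _)"
proof -
  have e: "inv_fourier = (\<lambda>\<phi>::'a \<Rightarrow> complex. (\<lambda>f x. f (- x)) (fourier \<phi>))"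
    by (simp add: fun_eq_iff inv_fourier_reflect)
  have "scont (\<lambda>f::'a \<Rightarrow> complex. (\<lambda>x. f (- x)))"
  proof (rule scontI)
    fix k N
    show "\<exists>j M C. 0 \<le> C \<and> (\<forall>\<phi>\<in>schwartz. \<forall>B. sb j M B \<phi> \<longrightarrow> sb k N (C * B) (\<lambda>x. (\<phi>::'a \<Rightarrow> complex) (- x)))"
      by (rule exI[of _ k], rule exI[of _ N], rule exI[of _ 1]) (auto intro: sb_reflect)
  qed
  from scont_comp[OF this scont_fourier] show ?thesis unfolding e .
qed

lemma fourier_schwartz: "\<phi> \<in> schwartz \<Longrightarrow> fourier \<phi> \<in> schwartz"
  by (rule scont_schwartz[OF scont_fourier])

lemma inv_fourier_schwartz: "\<phi> \<in> schwartz \<Longrightarrow> inv_fourier \<phi> \<in> schwartz"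
  by (rule scont_schwartz[OF scont_inv_fourier])

text \<open>Composition with a continuous linear map of Schwartz spaces. This yields both the
  Fourier transform of a distribution and, later, the extension operator.\<close>

lemma tempered_scont:
  assumes u: "u \<in> tempered" and T: "scont T"
    and add: "\<And>\<phi> \<psi>. \<phi> \<in> schwartz \<Longrightarrow> \<psi> \<in> schwartz \<Longrightarrow> T (\<lambda>x. \<phi> x + \<psi> x) = (\<lambda>x. T \<phi> x + T \<psi> x)"
    and cmult: "\<And>c \<phi>. \<phi> \<in> schwartz \<Longrightarrow> T (\<lambda>x. c * \<phi> x) = (\<lambda>x. c * T \<phi> x)"
  shows "on_schwartz (\<lambda>\<phi>. u (T \<phi>)) \<in> tempered"
proof -
  obtain C N where C: "0 \<le> C" "\<And>\<phi> B. \<phi> \<in> schwartz \<Longrightarrow> sb N N B \<phi> \<Longrightarrow> norm (u \<phi>) \<le> C * B"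
    by (rule tempered_bound[OF u]) blast
  obtain j M D where D: "0 \<le> D" "\<And>\<phi> B. \<phi> \<in> schwartz \<Longrightarrow> sb j M B \<phi> \<Longrightarrow> sb N N (D * B) (T \<phi>)"
    by (rule scont_sb[OF T, of N N]) blast
  note TS = scont_schwartz[OF T]
  show ?thesis
  proof (rule temperedI[where k=j and N=M and C="C * D"])
    fix \<phi> \<phi>' :: "'b \<Rightarrow> complex" assume p: "\<phi> \<in> schwartz" "\<phi>' \<in> schwartz"
    show "on_schwartz (\<lambda>\<phi>. u (T \<phi>)) (\<lambda>x. \<phi> x + \<phi>' x) = on_schwartz (\<lambda>\<phi>. u (T \<phi>)) \<phi> + on_schwartz (\<lambda>\<phi>. u (T \<phi>)) \<phi>'"
      using p by (simp add: on_schwartz_def schwartz_add add tempered_add[OF u] TS)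
  next
    fix c and \<phi> :: "'b \<Rightarrow> complex" assume p: "\<phi> \<in> schwartz"
    show "on_schwartz (\<lambda>\<phi>. u (T \<phi>)) (\<lambda>x. c * \<phi> x) = c * on_schwartz (\<lambda>\<phi>. u (T \<phi>)) \<phi>"
      using p by (simp add: on_schwartz_def schwartz_cmult cmult tempered_cmult[OF u] TS)
  next
    fix \<phi> :: "'b \<Rightarrow> complex" and B assume p: "\<phi> \<in> schwartz" "sb j M B \<phi>"
    show "norm (on_schwartz (\<lambda>\<phi>. u (T \<phi>)) \<phi>) \<le> C * D * B"
      using C(2)[OF TS[OF p(1)] D(2)[OF p]] p by (simp add: on_schwartz_def mult_ac)
  qed (simp add: on_schwartz_def)
qed

lemma dist_fourier_tempered: "u \<in> tempered \<Longrightarrow> dist_fourier u \<in> tempered"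
  unfolding dist_fourier_def by (rule tempered_scont[OF _ scont_fourier]) (auto simp: fourier_add fourier_cmult)

subsection \<open>Fourier inversion\<close>

lemma lborel_integral_prod:
  fixes f :: "'a::euclidean_space \<Rightarrow> real \<Rightarrow> complex"
  assumes [measurable]: "\<And>b. b \<in> Basis \<Longrightarrow> integrable lborel (f b)"
  shows "(\<integral>x. (\<Prod>b\<in>Basis. f b (x \<bullet> b)) \<partial>lborel) = (\<Prod>b\<in>Basis. \<integral>t. f b t \<partial>lborel)"
proof -
  interpret product_sigma_finite "\<lambda>b::'a. lborel :: real measure" by standard
  have m [measurable]: "f b \<in> borel_measurable borel" if "b \<in> Basis" for b
    using borel_measurable_integrable[OF assms[OF that]] by simp
  have "(\<integral>x. (\<Prod>b\<in>Basis. f b (x \<bullet> b)) \<partial>lborel) =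
    (\<integral>y. (\<Prod>b\<in>Basis. f b ((\<Sum>c\<in>Basis. y c *\<^sub>R c) \<bullet> b)) \<partial>(\<Pi>\<^sub>M b\<in>(Basis::'a set). lborel))"
    unfolding lborel_def[where 'a='a] lborel_eq_real[symmetric]
    by (subst integral_distr) (auto intro!: borel_measurable_prod measurable_compose[OF _ m])
  also have "\<dots> = (\<integral>y. (\<Prod>b\<in>Basis. f b (y b)) \<partial>(\<Pi>\<^sub>M b\<in>(Basis::'a set). lborel))"
    by (intro Bochner_Integration.integral_cong refl prod.cong)
      (simp add: inner_sum_left inner_Basis if_distrib sum.delta cong: if_cong)
  also have "\<dots> = (\<Prod>b\<in>Basis. \<integral>t. f b t \<partial>lborel)"
    by (rule product_integral_prod) (auto intro: assms)
  finally show ?thesis .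
qed

definition gaussian :: "'a::euclidean_space \<Rightarrow> complex" where
  "gaussian x = of_real (exp (- (x \<bullet> x) / 2))"

text \<open>Read off from the characteristic function of the standard normal distribution.\<close>

lemma gaussian_real_integral:
  "integrable lborel (\<lambda>t::real. of_real (exp (- t\<^sup>2 / 2)) * iexp (s * t))"
  "(\<integral>t. of_real (exp (- t\<^sup>2 / 2)) * iexp (s * t) \<partial>(lborel :: real measure)) = of_real (sqrt (2 * pi) * exp (- s\<^sup>2 / 2))"
proof -
  have e: "of_real (exp (- t\<^sup>2 / 2)) * iexp (s * t) = of_real (sqrt (2 * pi)) * (of_real (std_normal_density t) * iexp (s * t))" for t :: real
    by (simp add: normal_density_def)
  have c: "(\<integral>t. iexp (s * t) \<partial>std_normal_distribution) = of_real (exp (- s\<^sup>2 / 2))"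
    using char_std_normal_distribution[THEN fun_cong, of s] by (simp add: char_def)
  have d: "(\<integral>t. iexp (s * t) \<partial>std_normal_distribution) = (\<integral>t. std_normal_density t *\<^sub>R iexp (s * t) \<partial>lborel)"
    by (rule integral_density) auto
  show "(\<integral>t. of_real (exp (- t\<^sup>2 / 2)) * iexp (s * t) \<partial>(lborel :: real measure)) = of_real (sqrt (2 * pi) * exp (- s\<^sup>2 / 2))"
    unfolding e using c d by (simp add: scaleR_conv_of_real)
  have "integrable lborel (\<lambda>t. std_normal_density t)" by (rule integrable_normal_density) simp
  then have "integrable lborel (\<lambda>t. complex_of_real (std_normal_density t))" by simp
  then have "integrable lborel (\<lambda>t. of_real (std_normal_density t) * iexp (s * t))"
    by (rule Bochner_Integration.integrable_bound) (auto simp: norm_mult)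
  then show "integrable lborel (\<lambda>t::real. of_real (exp (- t\<^sup>2 / 2)) * iexp (s * t))"
    unfolding e by (intro integrable_mult_right)
qed

lemma gaussian_fourier:
  fixes y :: "'a::euclidean_space"
  shows "(\<integral>\<xi>. gaussian \<xi> * wave y \<xi> \<partial>lborel) = of_real ((2 * pi) powr (real DIM('a) / 2)) * gaussian y"
proof -
  have g: "gaussian (x :: 'a) = (\<Prod>b\<in>Basis. of_real (exp (- (x \<bullet> b)\<^sup>2 / 2)))" for x
  proof -
    have "- (x \<bullet> x) / 2 = (\<Sum>b\<in>Basis. - (x \<bullet> b)\<^sup>2 / 2)"
      by (subst euclidean_inner) (simp add: sum_negf sum_divide_distrib power2_eq_square)
    then show ?thesis by (simp add: gaussian_def exp_sum)
  qed
  have w: "wave y x = (\<Prod>b\<in>Basis. iexp ((y \<bullet> b) * (x \<bullet> b)))" for x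
    by (simp add: wave_def euclidean_inner[of y x] exp_sum sum_distrib_left)
  have "(\<integral>\<xi>. gaussian \<xi> * wave y \<xi> \<partial>lborel) =
      (\<integral>\<xi>. (\<Prod>b\<in>Basis. of_real (exp (- (\<xi> \<bullet> b)\<^sup>2 / 2)) * iexp ((y \<bullet> b) * (\<xi> \<bullet> b))) \<partial>lborel)"
    unfolding g w prod.distrib ..
  also have "\<dots> = (\<Prod>b\<in>(Basis::'a set). of_real (sqrt (2 * pi) * exp (- (y \<bullet> b)\<^sup>2 / 2)))"
    by (subst lborel_integral_prod[where f="\<lambda>b t. of_real (exp (- t\<^sup>2 / 2)) * iexp ((y \<bullet> b) * t)"])
      (auto simp only: gaussian_real_integral)
  also have "\<dots> = of_real (sqrt (2 * pi) ^ DIM('a)) * gaussian y"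
    unfolding g by (simp add: prod.distrib)
  also have "sqrt (2 * pi) ^ DIM('a) = (2 * pi) powr (real DIM('a) / 2)"
    by (simp add: powr_half_sqrt[symmetric] powr_powr flip: powr_realpow)
  finally show ?thesis .
qed

text \<open>Apply 1 + u <= exp u to u = |x|^2 / (2 DIM) and raise to the power DIM. Dividing by 2
  DIM keeps the constant term at most 1.\<close>

lemma gaussian_bound:
  "norm (gaussian (x::'a::euclidean_space)) \<le> (2 * real DIM('a)) ^ DIM('a) / jbracket x ^ (2 * DIM('a))"
proof -
  let ?n = "real DIM('a)"
  have n: "0 < ?n" by simp
  have n1: "1 \<le> ?n" using DIM_positive[where 'a='a] by linarith
  have "(1 + x \<bullet> x) / (2 * ?n) \<le> exp ((x \<bullet> x) / (2 * ?n))"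
  proof -
    have "1 / (2 * ?n) \<le> 1" using n1 by (simp only: divide_le_eq_1) linarith
    then have "(1 + x \<bullet> x) / (2 * ?n) \<le> 1 + (x \<bullet> x) / (2 * ?n)" by (simp only: add_divide_distrib)
    then show ?thesis using exp_ge_add_one_self[of "(x \<bullet> x) / (2 * ?n)"] by linarith
  qed
  then have "((1 + x \<bullet> x) / (2 * ?n)) ^ DIM('a) \<le> exp ((x \<bullet> x) / (2 * ?n)) ^ DIM('a)"
    by (rule power_mono) simp
  also have "\<dots> = exp ((x \<bullet> x) / 2)"
    using n by (simp flip: exp_of_nat_mult)
  finally have "(1 + x \<bullet> x) ^ DIM('a) * exp (- (x \<bullet> x) / 2) \<le> (2 * ?n) ^ DIM('a)"
    by (simp add: power_divide field_simps exp_minus)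
  moreover have "0 < (1 + x \<bullet> x) ^ DIM('a)" by (simp add: add_pos_nonneg)
  ultimately show ?thesis
    by (simp add: gaussian_def jbracket_power_even pos_le_divide_eq) (simp add: mult.commute)
qed

lemma continuous_on_gaussian: "continuous_on S gaussian"
  unfolding gaussian_def by (intro continuous_intros) auto

lemma gaussian_borel [measurable]: "gaussian \<in> borel_measurable borel"
  by (intro borel_measurable_continuous_onI continuous_on_gaussian)

lemma gaussian_integrable: "integrable lborel (gaussian :: 'a::euclidean_space \<Rightarrow> complex)"
  by (rule integrable_by_jbracket[OF _ gaussian_bound]) auto

lemma norm_gaussian_le_1: "norm (gaussian x) \<le> 1"
  by (simp add: gaussian_def)

text \<open>Damping by a Gaussian makes Fubini applicable. The damped integrals converge to the
  undamped one by domination; after exchanging the integrals they become averages of \<phi> around x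
  against a Gaussian of width \<epsilon>, which converge to \<phi> x times a normalising
  constant.\<close>

theorem fourier_inversion:
  fixes \<phi> :: "'a::euclidean_space \<Rightarrow> complex"
  assumes "\<phi> \<in> schwartz"
  shows "inv_fourier (fourier \<phi>) x = \<phi> x"
proof -
  let ?D = "DIM('a)"
  let ?P = "(2 * pi) powr (real DIM('a) / 2)"
  define \<epsilon> where "\<epsilon> m = inverse (real (Suc m))" for m
  have e0: "\<epsilon> m > 0" for m by (simp add: \<epsilon>_def)
  have elim: "\<epsilon> \<longlonglongrightarrow> 0" unfolding \<epsilon>_def by (rule LIMSEQ_inverse_real_of_nat)
  have [measurable]: "\<phi> \<in> borel_measurable borel" "fourier \<phi> \<in> borel_measurable borel"
    by (auto intro!: schwartz_borel fourier_schwartz assms)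
  have i\<phi>: "integrable lborel \<phi>" and iF: "integrable lborel (fourier \<phi>)"
    by (auto intro!: schwartz_integrable fourier_schwartz assms)
  have cont: "continuous_on UNIV \<phi>" by (rule smooth_continuous[OF schwartz_smooth[OF assms]])
  have fP: "fconst TYPE('a) * ?P = 1"
    unfolding fconst_def by (simp flip: powr_add)
  define I where "I m = (\<integral>\<xi>. fourier \<phi> \<xi> * wave x \<xi> * gaussian (\<epsilon> m *\<^sub>R \<xi>) \<partial>lborel)" for m
  have "I \<longlonglongrightarrow> (\<integral>\<xi>. fourier \<phi> \<xi> * wave x \<xi> \<partial>lborel)"
    unfolding I_def
  proof (rule integral_dominated_convergence[where w="\<lambda>\<xi>. norm (fourier \<phi> \<xi>)"])
    show "AE \<xi> in lborel. (\<lambda>m. fourier \<phi> \<xi> * wave x \<xi> * gaussian (\<epsilon> m *\<^sub>R \<xi>)) \<longlonglongrightarrow> fourier \<phi> \<xi> * wave x \<xi>"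
    proof (rule AE_I2)
      fix \<xi> :: 'a
      have "(\<lambda>m. gaussian (\<epsilon> m *\<^sub>R \<xi>)) \<longlonglongrightarrow> gaussian (0 *\<^sub>R \<xi>)"
      proof (rule continuous_on_tendsto_compose[OF continuous_on_gaussian[of UNIV]])
        show "(\<lambda>m. \<epsilon> m *\<^sub>R \<xi>) \<longlonglongrightarrow> 0 *\<^sub>R \<xi>" by (intro tendsto_intros elim)
      qed auto
      from tendsto_mult[OF tendsto_const[of "fourier \<phi> \<xi> * wave x \<xi>"] this]
      show "(\<lambda>m. fourier \<phi> \<xi> * wave x \<xi> * gaussian (\<epsilon> m *\<^sub>R \<xi>)) \<longlonglongrightarrow> fourier \<phi> \<xi> * wave x \<xi>"
        by (simp add: gaussian_def)
    qed
    show "AE \<xi> in lborel. norm (fourier \<phi> \<xi> * wave x \<xi> * gaussian (\<epsilon> m *\<^sub>R \<xi>)) \<le> norm (fourier \<phi> \<xi>)" for m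
      by (intro AE_I2) (simp add: norm_mult mult_left_le norm_gaussian_le_1)
  qed (use iF in auto)
  moreover have "I \<longlonglongrightarrow> of_real (fconst TYPE('a) * ?P) * (\<phi> x * (of_real ?P * 1))"
  proof -
    \<comment> \<open>Fubini, the transform of the scaled Gaussian, and the substitution y = x -
      \<epsilon> z. The power of \<epsilon> from the transform cancels the Jacobian.\<close>
    have I1: "I m = of_real (fconst TYPE('a) * ?P) * (\<integral>z. \<phi> (x - \<epsilon> m *\<^sub>R z) * gaussian z \<partial>lborel)" for m
    proof -
      let ?e = "\<epsilon> m"
      let ?f = "\<lambda>(\<xi>, y). (\<phi> y * wave (- y) \<xi>) * (wave x \<xi> * gaussian (?e *\<^sub>R \<xi>))"
      have ig: "integrable lborel (\<lambda>\<xi>::'a. gaussian (?e *\<^sub>R \<xi>))"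
      proof -
        \<comment> \<open>This bound is not uniform in m; it serves integrability for one fixed
          m.\<close>
        have b: "norm (gaussian (?e *\<^sub>R \<xi>)) \<le> (2 * real DIM('a)) ^ DIM('a) / (?e ^ (2 * ?D)) / jbracket \<xi> ^ (2 * DIM('a))" for \<xi> :: 'a
        proof -
          have "?e * jbracket \<xi> \<le> jbracket (?e *\<^sub>R \<xi>)"
          proof -
            have "?e \<le> 1" unfolding \<epsilon>_def by (simp add: field_simps)
            then have "?e\<^sup>2 * (1 + (norm \<xi>)\<^sup>2) \<le> 1 + (norm (?e *\<^sub>R \<xi>))\<^sup>2"
              using e0[of m] by (simp add: power_mult_distrib ring_distribs power_le_one)
            then have "sqrt (?e\<^sup>2 * (1 + (norm \<xi>)\<^sup>2)) \<le> sqrt (1 + (norm (?e *\<^sub>R \<xi>))\<^sup>2)" by (rule real_sqrt_le_mono)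
            then show ?thesis using e0[of m] by (simp add: jbracket_def real_sqrt_mult)
          qed
          then have "(?e * jbracket \<xi>) ^ (2 * ?D) \<le> jbracket (?e *\<^sub>R \<xi>) ^ (2 * ?D)"
            using e0[of m] by (intro power_mono) auto
          then have "(2 * real DIM('a)) ^ DIM('a) / jbracket (?e *\<^sub>R \<xi>) ^ (2 * DIM('a)) \<le> (2 * real DIM('a)) ^ DIM('a) / (?e * jbracket \<xi>) ^ (2 * ?D)"
            using e0[of m] by (intro divide_left_mono mult_pos_pos zero_less_power) auto
          then show ?thesis using gaussian_bound[of "?e *\<^sub>R \<xi>"] by (simp add: power_mult_distrib)
        qed
        show ?thesis by (rule integrable_by_jbracket[OF _ b]) auto
      qed
      have inner: "(\<integral>\<xi>. wave (x - y) \<xi> * gaussian (?e *\<^sub>R \<xi>) \<partial>lborel) = of_real (?P / ?e ^ ?D) * gaussian ((1/?e) *\<^sub>R (x - y))" for y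
      proof -
        have m: "(\<lambda>\<xi>. gaussian \<xi> * wave ((1/?e) *\<^sub>R (x - y)) \<xi>) \<in> borel_measurable borel" by measurable
        have "of_real ?P * gaussian ((1/?e) *\<^sub>R (x - y)) = \<bar>?e\<bar> ^ ?D *\<^sub>R (\<integral>\<xi>. gaussian (0 + ?e *\<^sub>R \<xi>) * wave ((1/?e) *\<^sub>R (x - y)) (0 + ?e *\<^sub>R \<xi>) \<partial>lborel)"
          using e0[of m] by (subst lborel_integral_affine[OF m, symmetric]) (auto simp: gaussian_fourier)
        also have "(\<lambda>\<xi>. gaussian (0 + ?e *\<^sub>R \<xi>) * wave ((1/?e) *\<^sub>R (x - y)) (0 + ?e *\<^sub>R \<xi>)) = (\<lambda>\<xi>. wave (x - y) \<xi> * gaussian (?e *\<^sub>R \<xi>))"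
          using e0[of m] by (simp add: wave_def fun_eq_iff mult.commute)
        finally show ?thesis using e0[of m] by (simp add: scaleR_conv_of_real field_simps)
      qed
      have int: "integrable (lborel \<Otimes>\<^sub>M lborel) ?f"
      proof (rule lborel_pair.Fubini_integrable)
        show "AE \<xi> in lborel. integrable lborel (\<lambda>y. ?f (\<xi>, y))"
          by (intro AE_I2) (auto intro!: integrable_mult_left integrable_wave i\<phi>)
        have "(\<lambda>\<xi>. \<integral>y. norm (?f (\<xi>, y)) \<partial>lborel) = (\<lambda>\<xi>. norm (gaussian (?e *\<^sub>R \<xi>)) * (\<integral>y. norm (\<phi> y) \<partial>lborel))"
          by (simp add: norm_mult fun_eq_iff mult.commute)
        then show "integrable lborel (\<lambda>\<xi>. \<integral>y. norm (?f (\<xi>, y)) \<partial>lborel)" using ig by simp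
      qed measurable
      have in1: "(\<integral>y. ?f (\<xi>, y) \<partial>lborel) = (\<integral>y. \<phi> y * wave (- y) \<xi> \<partial>lborel) * (wave x \<xi> * gaussian (?e *\<^sub>R \<xi>))" for \<xi>
        unfolding prod.case by (rule integral_mult_left_zero)
      have "I m = of_real (fconst TYPE('a)) * (\<integral>\<xi>. (\<integral>y. ?f (\<xi>, y) \<partial>lborel) \<partial>lborel)"
        unfolding I_def fourier_eq in1 by (simp only: mult.assoc integral_mult_right_zero)
      also have "\<dots> = of_real (fconst TYPE('a)) * (\<integral>y. (\<integral>\<xi>. ?f (\<xi>, y) \<partial>lborel) \<partial>lborel)"
        using lborel_pair.Fubini_integral[of "\<lambda>\<xi> y. ?f (\<xi>, y)"] int by simp
      also have "(\<lambda>y. \<integral>\<xi>. ?f (\<xi>, y) \<partial>lborel) = (\<lambda>y. \<phi> y * (of_real (?P / ?e ^ ?D) * gaussian ((1/?e) *\<^sub>R (x - y))))"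
      proof
        fix y
        have "(\<integral>\<xi>. ?f (\<xi>, y) \<partial>lborel) = (\<integral>\<xi>. \<phi> y * (wave (x - y) \<xi> * gaussian (?e *\<^sub>R \<xi>)) \<partial>lborel)"
          using wave_add[of x "- y"] by (intro Bochner_Integration.integral_cong refl) simp
        then show "(\<integral>\<xi>. ?f (\<xi>, y) \<partial>lborel) = \<phi> y * (of_real (?P / ?e ^ ?D) * gaussian ((1/?e) *\<^sub>R (x - y)))"
          by (simp only: integral_mult_right_zero inner)
      qed
      also have "(\<integral>y. \<phi> y * (of_real (?P / ?e ^ ?D) * gaussian ((1/?e) *\<^sub>R (x - y))) \<partial>lborel)
         = \<bar>- ?e\<bar> ^ ?D *\<^sub>R (\<integral>z. \<phi> (x + (- ?e) *\<^sub>R z) * (of_real (?P / ?e ^ ?D) * gaussian ((1/?e) *\<^sub>R (x - (x + (- ?e) *\<^sub>R z)))) \<partial>lborel)"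
        by (rule lborel_integral_affine) (use e0[of m] in auto)
      also have "(\<lambda>z. \<phi> (x + (- ?e) *\<^sub>R z) * (of_real (?P / ?e ^ ?D) * gaussian ((1/?e) *\<^sub>R (x - (x + (- ?e) *\<^sub>R z)))))
         = (\<lambda>z. of_real (?P / ?e ^ ?D) * (\<phi> (x - ?e *\<^sub>R z) * gaussian z))"
        using e0[of m] by (simp add: fun_eq_iff mult_ac)
      finally show ?thesis using e0[of m] by (simp add: scaleR_conv_of_real)
    qed
    obtain B where B: "\<And>y. norm (\<phi> y) \<le> B"
      using schwartz_sb[OF assms, of 0 0] by (auto simp: sb_def)
    have "(\<lambda>m. \<integral>z. \<phi> (x - \<epsilon> m *\<^sub>R z) * gaussian z \<partial>lborel) \<longlonglongrightarrow> (\<integral>(z::'a). \<phi> x * gaussian z \<partial>lborel)"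
    proof (rule integral_dominated_convergence[where w="\<lambda>z::'a. B * norm (gaussian z)"])
      show "AE z in lborel. (\<lambda>m. \<phi> (x - \<epsilon> m *\<^sub>R z) * gaussian z) \<longlonglongrightarrow> \<phi> x * gaussian z"
      proof (rule AE_I2)
        fix z :: 'a
        have "(\<lambda>m. x - \<epsilon> m *\<^sub>R z) \<longlonglongrightarrow> x - 0 *\<^sub>R z" by (intro tendsto_intros elim)
        then have "(\<lambda>m. \<phi> (x - \<epsilon> m *\<^sub>R z)) \<longlonglongrightarrow> \<phi> x"
          by (intro continuous_on_tendsto_compose[OF cont]) auto
        then show "(\<lambda>m. \<phi> (x - \<epsilon> m *\<^sub>R z) * gaussian z) \<longlonglongrightarrow> \<phi> x * gaussian z" by (intro tendsto_intros)
      qed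
      show "AE z in lborel. norm (\<phi> (x - \<epsilon> m *\<^sub>R z) * gaussian z) \<le> B * norm (gaussian z)" for m
        by (intro AE_I2) (simp add: norm_mult mult_right_mono B)
    qed (use gaussian_integrable in auto)
    moreover have "(\<integral>(z::'a). gaussian z \<partial>lborel) = of_real ?P * 1"
      using gaussian_fourier[of "0::'a"] by (simp add: gaussian_def)
    ultimately show ?thesis unfolding I1 by (intro tendsto_intros) simp
  qed
  ultimately have "(\<integral>\<xi>. fourier \<phi> \<xi> * wave x \<xi> \<partial>lborel) = of_real (fconst TYPE('a) * ?P) * (\<phi> x * (of_real ?P * 1))"
    by (rule LIMSEQ_unique)
  then have "inv_fourier (fourier \<phi>) x = of_real (fconst TYPE('a) * ?P) * (of_real (fconst TYPE('a) * ?P) * \<phi> x)"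
    unfolding inv_fourier_eq by simp
  then show ?thesis unfolding fP by simp
qed

lemma fourier_inversion':
  fixes \<phi> :: "'a::euclidean_space \<Rightarrow> complex"
  assumes "\<phi> \<in> schwartz"
  shows "fourier (inv_fourier \<phi>) x = \<phi> x"
proof -
  have [measurable]: "fourier \<phi> \<in> borel_measurable borel" by (intro schwartz_borel fourier_schwartz assms)
  have "fourier (inv_fourier \<phi>) x = of_real (fconst TYPE('a)) * (\<integral>y. fourier \<phi> (0 - y) * wave x (0 - y) \<partial>lborel)"
    unfolding fourier_eq[of "inv_fourier \<phi>"] inv_fourier_reflect wave_commute[of "- _" x] by simp
  also have "\<dots> = of_real (fconst TYPE('a)) * (\<integral>y. fourier \<phi> y * wave x y \<partial>lborel)"
    by (subst lborel_integral_reflect[where f="\<lambda>y. fourier \<phi> y * wave x y"]) auto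
  also have "\<dots> = inv_fourier (fourier \<phi>) x" by (simp add: inv_fourier_eq)
  finally show ?thesis using fourier_inversion[OF assms] by simp
qed

subsection \<open>The integer lattice\<close>

definition lattice_of :: "('a::euclidean_space \<Rightarrow> int) \<Rightarrow> 'a" where
  "lattice_of g = (\<Sum>b\<in>Basis. of_int (g b) *\<^sub>R b)"

lemma lattice_of_inner [simp]: "b \<in> Basis \<Longrightarrow> lattice_of g \<bullet> b = of_int (g b)"
  by (simp add: lattice_of_def inner_sum_left inner_Basis if_distrib sum.delta cong: if_cong)

lemma lattice_of_in [simp]: "lattice_of g \<in> lattice_pts"
  by (simp add: lattice_pts_def)

lemma lattice_of_floor: "k \<in> lattice_pts \<Longrightarrow> lattice_of (\<lambda>b. \<lfloor>k \<bullet> b\<rfloor>) = k"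
  by (rule euclidean_eqI) (auto simp: lattice_pts_def elim: Ints_cases)

lemma lattice_of_restrict: "lattice_of (restrict g Basis) = lattice_of g"
  by (simp add: lattice_of_def)

text \<open>Points of a lattice box correspond to choice functions on the basis, so the sum of a
  product over coordinates is a product of one-dimensional sums. Floors turn the integral
  coordinates into elements of \<open>int\<close>.\<close>

lemma lattice_sum_PiE:
  fixes J :: "'a::euclidean_space \<Rightarrow> int set" and f :: "'a \<Rightarrow> real \<Rightarrow> 'c::comm_semiring_1"
  assumes "\<And>b. b \<in> Basis \<Longrightarrow> finite (J b)"
  shows "(\<Sum>k\<in>{k \<in> lattice_pts. \<forall>b\<in>Basis. \<lfloor>k \<bullet> b\<rfloor> \<in> J b}. \<Prod>b\<in>Basis. f b (k \<bullet> b)) = (\<Prod>b\<in>Basis. \<Sum>j\<in>J b. f b (of_int j))"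
proof -
  have "(\<Sum>k\<in>{k \<in> lattice_pts. \<forall>b\<in>Basis. \<lfloor>k \<bullet> b\<rfloor> \<in> J b}. \<Prod>b\<in>Basis. f b (k \<bullet> b)) = (\<Sum>g\<in>PiE Basis J. \<Prod>b\<in>Basis. f b (of_int (g b)))"
  proof (rule sum.reindex_bij_witness[where i="lattice_of" and j="\<lambda>k. restrict (\<lambda>b. \<lfloor>k \<bullet> b\<rfloor>) Basis"])
    fix k assume "k \<in> {k \<in> lattice_pts. \<forall>b\<in>Basis. \<lfloor>k \<bullet> b\<rfloor> \<in> J b}"
    then show "lattice_of (restrict (\<lambda>b. \<lfloor>k \<bullet> b\<rfloor>) Basis) = k"
      and "restrict (\<lambda>b. \<lfloor>k \<bullet> b\<rfloor>) Basis \<in> PiE Basis J"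
      and "(\<Prod>b\<in>Basis. f b (of_int (restrict (\<lambda>b. \<lfloor>k \<bullet> b\<rfloor>) Basis b))) = (\<Prod>b\<in>Basis. f b (k \<bullet> b))"
      by (auto simp: lattice_of_restrict lattice_of_floor lattice_pts_def elim!: Ints_cases intro!: prod.cong)
  next
    fix g assume "g \<in> PiE Basis J"
    then show "restrict (\<lambda>b. \<lfloor>lattice_of g \<bullet> b\<rfloor>) Basis = g" "lattice_of g \<in> {k \<in> lattice_pts. \<forall>b\<in>Basis. \<lfloor>k \<bullet> b\<rfloor> \<in> J b}"
      by (auto simp: PiE_iff extensional_def restrict_def fun_eq_iff)
  qed
  also have "\<dots> = (\<Prod>b\<in>Basis. \<Sum>j\<in>J b. f b (of_int j))"
    by (rule prod_sum_PiE[symmetric]) (use assms in auto)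
  finally show ?thesis .
qed

lemma finite_lattice_box:
  fixes J :: "'a::euclidean_space \<Rightarrow> int set"
  assumes "\<And>b. b \<in> Basis \<Longrightarrow> finite (J b)"
  shows "finite {k \<in> lattice_pts. \<forall>b\<in>Basis. \<lfloor>k \<bullet> b\<rfloor> \<in> J b}"
proof (rule finite_subset)
  show "finite (lattice_of ` PiE Basis J)" using assms by (intro finite_imageI finite_PiE) auto
  show "{k \<in> lattice_pts. \<forall>b\<in>Basis. \<lfloor>k \<bullet> b\<rfloor> \<in> J b} \<subseteq> lattice_of ` PiE Basis J"
  proof clarify
    fix k assume "k \<in> lattice_pts" "\<forall>b\<in>Basis. \<lfloor>k \<bullet> b\<rfloor> \<in> J b"
    then have "k = lattice_of (restrict (\<lambda>b. \<lfloor>k \<bullet> b\<rfloor>) Basis)" "restrict (\<lambda>b. \<lfloor>k \<bullet> b\<rfloor>) Basis \<in> PiE Basis J"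
      by (auto simp: lattice_of_restrict lattice_of_floor)
    then show "k \<in> lattice_of ` PiE Basis J" by blast
  qed
qed

lemma finite_lattice_near: "finite {k \<in> lattice_pts. \<forall>b\<in>Basis. \<bar>x \<bullet> b - k \<bullet> b\<bar> \<le> R}" for x :: "'a::euclidean_space"
proof (rule finite_subset[OF _ finite_lattice_box[of "\<lambda>b. {\<lfloor>x \<bullet> b - R\<rfloor>..\<lceil>x \<bullet> b + R\<rceil>}"]])
  show "{k \<in> lattice_pts. \<forall>b\<in>Basis. \<bar>x \<bullet> b - k \<bullet> b\<bar> \<le> R} \<subseteq> {k \<in> lattice_pts. \<forall>b\<in>Basis. \<lfloor>k \<bullet> b\<rfloor> \<in> {\<lfloor>x \<bullet> b - R\<rfloor>..\<lceil>x \<bullet> b + R\<rceil>}}"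
  proof safe
    fix k b assume "\<forall>b\<in>Basis. \<bar>x \<bullet> b - k \<bullet> b\<bar> \<le> R" "b \<in> (Basis :: 'a set)"
    then have "\<bar>x \<bullet> b - k \<bullet> b\<bar> \<le> R" by blast
    then have "x \<bullet> b - R \<le> k \<bullet> b" "k \<bullet> b \<le> x \<bullet> b + R" by linarith+
    then show "\<lfloor>k \<bullet> b\<rfloor> \<in> {\<lfloor>x \<bullet> b - R\<rfloor>..\<lceil>x \<bullet> b + R\<rceil>}" by (auto intro: floor_mono) linarith
  qed
qed auto

lemma lattice_add: "k \<in> lattice_pts \<Longrightarrow> m \<in> lattice_pts \<Longrightarrow> k + m \<in> lattice_pts"
  by (simp add: lattice_pts_def inner_add_left)

lemma lattice_diff: "k \<in> lattice_pts \<Longrightarrow> m \<in> lattice_pts \<Longrightarrow> k - m \<in> lattice_pts"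
  by (simp add: lattice_pts_def inner_diff_left)

lemma lattice_0: "0 \<in> lattice_pts"
  by (simp add: lattice_pts_def)

lemma lattice_Pair: "(k, l) \<in> lattice_pts \<longleftrightarrow> k \<in> lattice_pts \<and> (l::real) \<in> \<int>"
  by (auto simp: lattice_pts_def Basis_prod_def)

lemma lattice_prod_eq: "(lattice_pts :: ('a::euclidean_space \<times> real) set) = lattice_pts \<times> \<int>"
  using lattice_Pair by auto

lemma countable_lattice: "countable (lattice_pts :: 'a::euclidean_space set)"
proof -
  have "lattice_pts = lattice_of ` (PiE (Basis :: 'a set) (\<lambda>_. UNIV))"
  proof -
    have "k \<in> lattice_of ` (PiE (Basis :: 'a set) (\<lambda>_. UNIV))" if "k \<in> lattice_pts" for k
      using lattice_of_floor[OF that] lattice_of_restrict[of "\<lambda>b. \<lfloor>k \<bullet> b\<rfloor>"]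
      by (intro image_eqI[of _ _ "restrict (\<lambda>b. \<lfloor>k \<bullet> b\<rfloor>) Basis"]) auto
    then show ?thesis by auto
  qed
  moreover have "countable (lattice_of ` (PiE (Basis :: 'a set) (\<lambda>_. UNIV)))"
    by (intro countable_image countable_PiE) auto
  ultimately show ?thesis by simp
qed

text \<open>The product comparison of brackets reduces the claim to sums of 1/(1+j^2) over integers.
  A finite set of lattice points is enlarged to the box spanned by its coordinates so that the sum
  factors.\<close>

lemma lattice_bounded_sum:
  "\<exists>C. \<forall>F. finite F \<longrightarrow> F \<subseteq> lattice_pts \<longrightarrow> (\<Sum>k\<in>F. 1 / jbracket (k::'a::euclidean_space) ^ (2 * DIM('a))) \<le> C"
proof -
  define w where "w t = inverse (1 + t\<^sup>2)" for t :: real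
  have w0: "0 \<le> w t" for t by (simp add: w_def)
  obtain W where W: "\<And>J. finite J \<Longrightarrow> (\<Sum>j\<in>J. w (of_int j)) \<le> W"
  proof -
    have s: "summable (\<lambda>n. 1 / real (Suc n) ^ 2)" using inverse_power_summable[of 2, where 'a=real] summable_Suc_iff[of "\<lambda>n. inverse (real n ^ 2)"] by (simp add: divide_inverse)
    have le: "(\<Sum>j\<in>J. w (of_int j)) \<le> 2 * (\<Sum>n. 2 / real (Suc n) ^ 2)" if J: "finite J" for J :: "int set"
    proof -
      \<comment> \<open>Nonnegative and negative integers are treated separately, since passing to
        the absolute value is injective on each.\<close>
      have g: "(\<Sum>j\<in>J'. w (of_int j)) \<le> (\<Sum>n. 2 / real (Suc n) ^ 2)" if J': "finite J'" "inj_on (\<lambda>j. nat \<bar>j\<bar>) J'" for J' :: "int set"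
      proof -
        have "(\<Sum>j\<in>J'. w (of_int j)) \<le> (\<Sum>j\<in>J'. 2 / real (Suc (nat \<bar>j\<bar>)) ^ 2)"
        proof (rule sum_mono)
          fix j :: int
          have "0 \<le> (real_of_int \<bar>j\<bar> - 1)\<^sup>2" by simp
          then have "(1 + real_of_int \<bar>j\<bar>)\<^sup>2 \<le> 2 * (1 + (of_int j)\<^sup>2)" by (simp add: power2_eq_square algebra_simps)
          then show "w (of_int j) \<le> 2 / real (Suc (nat \<bar>j\<bar>)) ^ 2"
            by (simp add: w_def field_simps add_pos_nonneg)
        qed
        also have "\<dots> = (\<Sum>n\<in>(\<lambda>j. nat \<bar>j\<bar>) ` J'. 2 / real (Suc n) ^ 2)" using J' by (simp add: sum.reindex)
        also have "\<dots> \<le> (\<Sum>n. 2 / real (Suc n) ^ 2)"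
          by (rule sum_le_suminf) (use J' summable_mult[OF s, of 2] in auto)
        finally show ?thesis .
      qed
      have "J = (J \<inter> {0..}) \<union> (J \<inter> {..<0})" by auto
      then have "(\<Sum>j\<in>J. w (of_int j)) = (\<Sum>j\<in>J \<inter> {0..}. w (of_int j)) + (\<Sum>j\<in>J \<inter> {..<0}. w (of_int j))"
        using J by (subst sum.union_disjoint[symmetric]) auto
      moreover have "(\<Sum>j\<in>J \<inter> {0..}. w (of_int j)) \<le> (\<Sum>n. 2 / real (Suc n) ^ 2)" by (rule g) (use J in \<open>auto simp: inj_on_def\<close>)
      moreover have "(\<Sum>j\<in>J \<inter> {..<0}. w (of_int j)) \<le> (\<Sum>n. 2 / real (Suc n) ^ 2)" by (rule g) (use J in \<open>auto simp: inj_on_def\<close>)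
      ultimately show ?thesis by linarith
    qed
    show ?thesis by (rule that[of "2 * (\<Sum>n. 2 / real (Suc n) ^ 2)"]) (rule le)
  qed
  have "(\<Sum>k\<in>F. 1 / jbracket k ^ (2 * DIM('a))) \<le> W ^ DIM('a)" if F: "finite F" "F \<subseteq> lattice_pts" for F :: "'a set"
  proof -
    let ?J = "\<lambda>b::'a. (\<lambda>k. \<lfloor>k \<bullet> b\<rfloor>) ` F"
    let ?B = "{k \<in> lattice_pts. \<forall>b\<in>Basis. \<lfloor>k \<bullet> b\<rfloor> \<in> ?J b}"
    have "(\<Sum>k\<in>F. 1 / jbracket k ^ (2 * DIM('a))) \<le> (\<Sum>k\<in>F. \<Prod>b\<in>Basis. w (k \<bullet> b))"
    proof (rule sum_mono)
      fix k :: 'a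
      have "1 / jbracket k ^ (2 * DIM('a)) \<le> 1 / (\<Prod>b\<in>Basis. 1 + (k \<bullet> b)\<^sup>2)"
        by (intro divide_left_mono jbracket_power_ge_prod mult_pos_pos prod_pos) (auto intro: add_pos_nonneg)
      also have "\<dots> = (\<Prod>b\<in>Basis. w (k \<bullet> b))" by (simp add: w_def prod_inversef[symmetric] divide_inverse)
      finally show "1 / jbracket k ^ (2 * DIM('a)) \<le> (\<Prod>b\<in>Basis. w (k \<bullet> b))" .
    qed
    also have "\<dots> \<le> (\<Sum>k\<in>?B. \<Prod>b\<in>Basis. w (k \<bullet> b))"
      by (rule sum_mono2) (use F w0 in \<open>auto intro!: finite_lattice_box prod_nonneg\<close>)
    also have "\<dots> = (\<Prod>b\<in>Basis. \<Sum>j\<in>?J b. w (of_int j))" by (rule lattice_sum_PiE) (use F in auto)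
    also have "\<dots> \<le> (\<Prod>b\<in>(Basis::'a set). W)" by (rule prod_mono) (use W F w0 in \<open>auto intro!: sum_nonneg\<close>)
    finally show ?thesis by simp
  qed
  then show ?thesis by blast
qed

lemma lattice_summable: "(\<lambda>k::'a::euclidean_space. 1 / jbracket k ^ (2 * DIM('a))) summable_on lattice_pts"
proof -
  obtain C where "\<And>F. finite F \<Longrightarrow> F \<subseteq> lattice_pts \<Longrightarrow> (\<Sum>k\<in>F. 1 / jbracket (k::'a) ^ (2 * DIM('a))) \<le> C"
    using lattice_bounded_sum by blast
  then show ?thesis by (intro nonneg_bdd_above_summable_on bdd_aboveI2[of _ _ C]) auto
qed

subsection \<open>The partition of unity\<close>

locale decomposition =
  fixes \<eta> :: "real \<Rightarrow> real"
  assumes cutoff: "cutoff \<eta>"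
begin

lemma eta_smooth: "smooth \<eta>" and eta_nonneg: "0 \<le> \<eta> t" and eta_le_1: "\<eta> t \<le> 1"
  and eta_1: "\<bar>t\<bar> \<le> 1 \<Longrightarrow> \<eta> t = 1" and eta_0: "\<bar>t\<bar> \<ge> 2 \<Longrightarrow> \<eta> t = 0"
  using cutoff by (auto simp: cutoff_def)

lemma eta2_1: "\<bar>t\<bar> \<le> 1 / 2 \<Longrightarrow> \<eta> (2 * t) = 1"
  and eta2_0: "1 \<le> \<bar>t\<bar> \<Longrightarrow> \<eta> (2 * t) = 0"
  by (auto intro!: eta_1 eta_0 simp: abs_mult)

text \<open>The term \<open>1 - \<eta> t\<close> vanishes on the support of \<open>\<lambda>t. \<eta> (2 * t)\<close>, where the five summands
  are all the nonzero ones; it keeps the denominator away from 0 everywhere else.\<close>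

definition den :: "real \<Rightarrow> real" where
  "den t = (\<Sum>j\<in>{-2..2::int}. \<eta> (2 * (t - of_int j))) + (1 - \<eta> t)"

text \<open>The one-dimensional factor of the decomposition. With \<open>den\<close> in place of the
  infinite sum its smoothness is immediate; \<open>psi_prod\<close> shows that
  \<open>psi \<eta> k\<close> is a product of its translates.\<close>

definition psi1 :: "real \<Rightarrow> real" where
  "psi1 t = \<eta> (2 * t) * inverse (den t)"

text \<open>If |t| <= 2, the integer nearest to t lies between -2 and 2 and its summand equals 1.
  Otherwise \<eta> t = 0, and the extra term equals 1.\<close>

lemma den_ge_1: "1 \<le> den t"
proof (cases "\<bar>t\<bar> \<le> 2")
  case True
  define j where "j = round t"
  have a: "\<bar>t - of_int j\<bar> \<le> 1 / 2" unfolding j_def by (metis abs_minus_commute of_int_round_abs_le)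
  then have "-3 < real_of_int j" "real_of_int j < 3" using True unfolding abs_le_iff by linarith+
  then have "j \<in> {-2..2}" by auto
  then have "\<eta> (2 * (t - of_int j)) \<le> (\<Sum>j\<in>{-2..2::int}. \<eta> (2 * (t - of_int j)))"
    by (rule member_le_sum) (auto intro: eta_nonneg)
  moreover have "\<eta> (2 * (t - of_int j)) = 1" using a by (rule eta2_1)
  ultimately show ?thesis using eta_le_1[of t] by (simp add: den_def)
next
  case False
  then show ?thesis using eta_0[of t] by (simp add: den_def sum_nonneg eta_nonneg)
qed

lemma smooth_eta_affine: "smooth (\<lambda>t. \<eta> (a + c * t))"
  using smooth_affine[OF bounded_linear_mult_right eta_smooth] .

lemma smooth_psi1: "smooth psi1"
proof -
  have "den t = (\<Sum>j\<in>{-2..2::int}. \<eta> (- 2 * of_int j + 2 * t)) + (1 - \<eta> (0 + 1 * t))" for t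
    unfolding den_def by (simp add: algebra_simps)
  then have "den = (\<lambda>t. (\<Sum>j\<in>{-2..2::int}. \<eta> (- 2 * of_int j + 2 * t)) + (1 - \<eta> (0 + 1 * t)))" by blast
  then have "smooth den" by (simp only:) (intro smooth_add smooth_sum smooth_diff smooth_const smooth_eta_affine)
  moreover have "den t \<noteq> 0" for t using den_ge_1[of t] by linarith
  ultimately have "smooth (\<lambda>t. inverse (den t))" by (rule smooth_inverse)
  moreover have "smooth (\<lambda>t. \<eta> (2 * t))" using smooth_eta_affine[of 0 2] by simp
  ultimately show ?thesis unfolding psi1_def[abs_def] by (intro smooth_mult)
qed

lemma psi1_support: "1 \<le> \<bar>t\<bar> \<Longrightarrow> psi1 t = 0"
  by (simp add: psi1_def eta_0)

lemma psi1_nonneg: "0 \<le> psi1 t"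
  using den_ge_1[of t] by (simp add: psi1_def eta_nonneg)

text \<open>Summands at integers of distance at least 1 from t vanish, so every finite set
  containing the other integers gives the same denominator. For |t| >= 1 both sides have numerator
  0.\<close>

lemma psi1_eq:
  assumes "finite J" "\<And>j. \<bar>t - of_int j\<bar> < 1 \<Longrightarrow> j \<in> J"
  shows "psi1 t = \<eta> (2 * t) / (\<Sum>j\<in>J. \<eta> (2 * (t - of_int j)))"
proof (cases "\<bar>t\<bar> < 1")
  case True
  have nz: "\<bar>t - of_int j\<bar> < 1" if "\<eta> (2 * (t - of_int j)) \<noteq> 0" for j
    using that eta2_0[of "t - of_int j"] by (meson not_less)
  have "(\<Sum>j\<in>J. \<eta> (2 * (t - of_int j))) = (\<Sum>j\<in>J \<union> {-2..2}. \<eta> (2 * (t - of_int j)))"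
    by (rule sum.mono_neutral_left) (use assms nz in auto)
  also have "\<dots> = (\<Sum>j\<in>{-2..2}. \<eta> (2 * (t - of_int j)))"
  proof (rule sum.mono_neutral_right)
    show "\<forall>j\<in>J \<union> {-2..2} - {-2..2}. \<eta> (2 * (t - of_int j)) = 0"
    proof (rule ballI, rule ccontr)
      fix j assume j: "j \<in> J \<union> {-2..2} - {-2..2}" and "\<eta> (2 * (t - of_int j)) \<noteq> 0"
      then have "\<bar>t - of_int j\<bar> < 1" by (intro nz)
      then have "-2 < real_of_int j" "real_of_int j < 2" using True by linarith+
      then show False using j by auto
    qed
  qed (use assms in auto)
  finally show ?thesis using True by (simp add: psi1_def den_def eta_1 divide_inverse)
next
  case False
  then show ?thesis using eta_0[of "2 * t"] by (simp add: psi1_def)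
qed

lemma psi1_shift_eq:
  assumes "finite J" "\<And>j. \<bar>t - of_int j\<bar> < 1 \<Longrightarrow> j \<in> J"
  shows "psi1 (t - of_int i) = \<eta> (2 * (t - of_int i)) / (\<Sum>j\<in>J. \<eta> (2 * (t - of_int j)))"
proof -
  have "psi1 (t - of_int i) = \<eta> (2 * (t - of_int i)) / (\<Sum>j\<in>(\<lambda>j. j - i) ` J. \<eta> (2 * (t - of_int i - of_int j)))"
  proof (rule psi1_eq)
    fix j assume "\<bar>t - of_int i - of_int j\<bar> < 1"
    then have "j + i \<in> J" by (intro assms) (simp add: algebra_simps)
    then show "j \<in> (\<lambda>j. j - i) ` J" by (intro image_eqI[of _ _ "j + i"]) auto
  qed (use assms in auto)
  also have "(\<Sum>j\<in>(\<lambda>j. j - i) ` J. \<eta> (2 * (t - of_int i - of_int j))) = (\<Sum>j\<in>J. \<eta> (2 * (t - of_int j)))"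
    by (subst sum.reindex) (auto simp: inj_on_def)
  finally show ?thesis .
qed

lemma den_sum_pos:
  assumes "finite J" "\<And>j. \<bar>t - of_int j\<bar> < 1 \<Longrightarrow> j \<in> J"
  shows "0 < (\<Sum>j\<in>J. \<eta> (2 * (t - of_int j)))"
proof -
  have a: "\<bar>t - of_int (round t)\<bar> \<le> 1 / 2" by (metis abs_minus_commute of_int_round_abs_le)
  then have "\<eta> (2 * (t - of_int (round t))) \<le> (\<Sum>j\<in>J. \<eta> (2 * (t - of_int j)))"
    by (intro member_le_sum assms) (auto intro: eta_nonneg)
  moreover have "\<eta> (2 * (t - of_int (round t))) = 1" using a by (rule eta2_1)
  ultimately show ?thesis by linarith
qed

lemma psi1_partition:
  assumes "finite J" "\<And>j. \<bar>t - of_int j\<bar> < 1 \<Longrightarrow> j \<in> J"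
  shows "(\<Sum>i\<in>J. psi1 (t - of_int i)) = 1"
proof -
  have "0 < (\<Sum>j\<in>J. \<eta> (2 * (t - of_int j)))" by (rule den_sum_pos) (use assms in auto)
  moreover have "psi1 (t - of_int i) = \<eta> (2 * (t - of_int i)) / (\<Sum>j\<in>J. \<eta> (2 * (t - of_int j)))" for i
    by (rule psi1_shift_eq) (use assms in auto)
  ultimately show ?thesis by (simp only: sum_divide_distrib[symmetric]) simp
qed

definition near :: "real \<Rightarrow> int set" where
  "near t = {j. \<bar>t - of_int j\<bar> < 1}"

lemma finite_near: "finite (near t)"
proof (rule finite_subset)
  show "near t \<subseteq> {\<lfloor>t\<rfloor> - 1..\<lceil>t\<rceil> + 1}" unfolding near_def by auto linarith+
qed simp

text \<open>For fixed \<xi> only the lattice points in a box around it contribute to the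
  denominator. On that box distributivity factors the sum, and with it the quotient, over the
  coordinates.\<close>

lemma psi_prod:
  fixes k :: "'a::euclidean_space"
  assumes k: "k \<in> lattice_pts"
  shows "psi \<eta> k \<xi> = (\<Prod>b\<in>Basis. psi1 ((\<xi> - k) \<bullet> b))"
proof -
  let ?S = "{m \<in> lattice_pts. \<forall>b\<in>Basis. \<lfloor>m \<bullet> b\<rfloor> \<in> near (\<xi> \<bullet> b)}"
  let ?D = "\<lambda>b. \<Sum>j\<in>near (\<xi> \<bullet> b). \<eta> (2 * (\<xi> \<bullet> b - of_int j))"
  have "(\<Sum>\<^sub>\<infinity>m\<in>lattice_pts. \<Prod>b\<in>Basis. \<eta> (2 * (\<xi> \<bullet> b - m \<bullet> b))) = (\<Sum>\<^sub>\<infinity>m\<in>?S. \<Prod>b\<in>Basis. \<eta> (2 * (\<xi> \<bullet> b - m \<bullet> b)))"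
  proof (rule infsum_cong_neutral)
    fix m assume m: "m \<in> lattice_pts - ?S"
    then obtain b where b: "b \<in> Basis" "\<lfloor>m \<bullet> b\<rfloor> \<notin> near (\<xi> \<bullet> b)" by blast
    have "m \<bullet> b = of_int \<lfloor>m \<bullet> b\<rfloor>" using m b by (auto simp: lattice_pts_def elim!: Ints_cases)
    then have "\<bar>\<xi> \<bullet> b - m \<bullet> b\<bar> \<ge> 1" using b unfolding near_def by (metis mem_Collect_eq not_less)
    then have "\<eta> (2 * (\<xi> \<bullet> b - m \<bullet> b)) = 0" by (rule eta2_0)
    then show "(\<Prod>b\<in>Basis. \<eta> (2 * (\<xi> \<bullet> b - m \<bullet> b))) = 0" using b(1) by (auto simp: prod_zero_iff)
  qed auto
  also have "\<dots> = (\<Sum>m\<in>?S. \<Prod>b\<in>Basis. \<eta> (2 * (\<xi> \<bullet> b - m \<bullet> b)))"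
    by (rule infsum_finite[OF finite_lattice_box[OF finite_near]])
  also have "\<dots> = (\<Prod>b\<in>Basis. ?D b)"
    by (rule lattice_sum_PiE[where f="\<lambda>b t. \<eta> (2 * (\<xi> \<bullet> b - t))", OF finite_near])
  finally have "psi \<eta> k \<xi> = (\<Prod>b\<in>Basis. \<eta> (2 * (\<xi> \<bullet> b - k \<bullet> b)) / ?D b)"
    unfolding psi_def by (simp add: prod_dividef)
  also have "\<dots> = (\<Prod>b\<in>Basis. psi1 ((\<xi> - k) \<bullet> b))"
  proof (rule prod.cong[OF refl])
    fix b :: 'a assume "b \<in> Basis"
    then obtain i where i: "k \<bullet> b = of_int i" using k by (auto simp: lattice_pts_def elim: Ints_cases)
    show "\<eta> (2 * (\<xi> \<bullet> b - k \<bullet> b)) / ?D b = psi1 ((\<xi> - k) \<bullet> b)"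
      unfolding inner_diff_left i
      by (rule psi1_shift_eq[symmetric, OF finite_near]) (simp add: near_def)
  qed
  finally show ?thesis .
qed

lemma psi_shift: "k \<in> lattice_pts \<Longrightarrow> psi \<eta> k \<xi> = psi \<eta> 0 (\<xi> - k)"
  by (simp add: psi_prod lattice_0)

lemma psi_real: "l \<in> \<int> \<Longrightarrow> psi \<eta> l t = psi1 (t - l)"
  by (subst psi_prod) (auto simp: lattice_pts_def)

lemma prod_Basis_pair:
  fixes f :: "'a::euclidean_space \<times> real \<Rightarrow> real"
  shows "(\<Prod>b\<in>Basis. f b) = (\<Prod>b\<in>Basis. f (b, 0)) * f (0, 1)"
proof -
  have "(\<Prod>b\<in>Basis. f b) = (\<Prod>b\<in>(\<lambda>u. (u, 0)) ` Basis. f b) * (\<Prod>b\<in>(\<lambda>v. (0, v)) ` Basis. f b)"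
    unfolding Basis_prod_def by (rule prod.union_disjoint) (auto simp: Basis_real_def)
  also have "(\<Prod>b\<in>(\<lambda>u. (u, 0)) ` Basis. f b) = (\<Prod>b\<in>Basis. f (b, 0))" by (subst prod.reindex) (auto simp: inj_on_def)
  also have "(\<Prod>b\<in>(\<lambda>v. (0, v)) ` Basis. f b) = f (0, 1)" by simp
  finally show ?thesis .
qed

text \<open>The tensor structure behind the whole argument: it localises a restricted piece in the
  first frequencies and splits the pieces of an extension.\<close>

lemma psi_Pair:
  assumes "k \<in> lattice_pts" "(l::real) \<in> \<int>"
  shows "psi \<eta> (k, l) (\<xi>, t) = psi \<eta> k \<xi> * psi \<eta> l t"
proof -
  have "(k, l) \<in> lattice_pts" using assms by (simp add: lattice_Pair)
  then have "psi \<eta> (k, l) (\<xi>, t) = (\<Prod>b\<in>Basis. psi1 (((\<xi>, t) - (k, l)) \<bullet> b))" by (rule psi_prod)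
  also have "\<dots> = (\<Prod>b\<in>Basis. psi1 ((\<xi> - k) \<bullet> b)) * psi1 (t - l)" by (subst prod_Basis_pair) simp
  finally show ?thesis using assms by (simp add: psi_prod psi_real)
qed

lemma smooth_coord_prod:
  fixes f :: "real \<Rightarrow> real"
  assumes "smooth f" shows "smooth (\<lambda>\<xi>::'a::euclidean_space. \<Prod>b\<in>Basis. f ((\<xi> - k) \<bullet> b))"
proof (rule smooth_prod)
  fix b :: 'a
  have "smooth (\<lambda>\<xi>. f (- (k \<bullet> b) + \<xi> \<bullet> b))"
    by (rule smooth_affine[OF bounded_linear_inner_left assms])
  then show "smooth (\<lambda>\<xi>. f ((\<xi> - k) \<bullet> b))" by (simp add: inner_diff_left)
qed

lemma psi_smooth: "k \<in> lattice_pts \<Longrightarrow> smooth (psi \<eta> (k::'a::euclidean_space))"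
proof -
  assume k: "k \<in> lattice_pts"
  have "psi \<eta> k = (\<lambda>\<xi>. \<Prod>b\<in>Basis. psi1 ((\<xi> - k) \<bullet> b))" using psi_prod[OF k] by blast
  then show ?thesis using smooth_coord_prod[OF smooth_psi1] by simp
qed

lemma psi_support: "k \<in> lattice_pts \<Longrightarrow> b \<in> Basis \<Longrightarrow> 1 \<le> \<bar>(\<xi> - k) \<bullet> b\<bar> \<Longrightarrow> psi \<eta> k \<xi> = 0"
  by (subst psi_prod) (auto simp: prod_zero_iff intro!: bexI[of _ b] psi1_support)

lemma psi_partition:
  fixes \<xi> :: "'a::euclidean_space"
  assumes F: "finite F" "F \<subseteq> lattice_pts" "\<And>k. k \<in> lattice_pts \<Longrightarrow> (\<And>b. b \<in> Basis \<Longrightarrow> \<bar>\<xi> \<bullet> b - k \<bullet> b\<bar> < 1) \<Longrightarrow> k \<in> F"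
  shows "(\<Sum>k\<in>F. psi \<eta> k \<xi>) = 1"
proof -
  let ?S = "{m \<in> lattice_pts. \<forall>b\<in>Basis. \<lfloor>m \<bullet> b\<rfloor> \<in> near (\<xi> \<bullet> b)}"
  have fl: "\<lfloor>m \<bullet> b\<rfloor> \<in> near (\<xi> \<bullet> b) \<longleftrightarrow> \<bar>\<xi> \<bullet> b - m \<bullet> b\<bar> < 1" if "m \<in> lattice_pts" "b \<in> Basis" for m b :: 'a
    using that by (auto simp: near_def lattice_pts_def elim!: Ints_cases)
  have "(\<Sum>k\<in>F. psi \<eta> k \<xi>) = (\<Sum>k\<in>?S. psi \<eta> k \<xi>)"
  proof (rule sum.mono_neutral_right[OF F(1)])
    show "?S \<subseteq> F" using F(3) fl by auto
    show "\<forall>k\<in>F - ?S. psi \<eta> k \<xi> = 0"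
    proof
      fix k assume k: "k \<in> F - ?S"
      then obtain b where "b \<in> Basis" "1 \<le> \<bar>\<xi> \<bullet> b - k \<bullet> b\<bar>" using F(2) fl by (force simp: not_less)
      then show "psi \<eta> k \<xi> = 0" using k F(2) by (intro psi_support[of _ b]) (auto simp: inner_diff_left)
    qed
  qed
  also have "\<dots> = (\<Sum>k\<in>?S. \<Prod>b\<in>Basis. psi1 (\<xi> \<bullet> b - k \<bullet> b))"
    by (rule sum.cong) (auto simp: psi_prod inner_diff_left)
  also have "\<dots> = (\<Prod>b\<in>Basis. \<Sum>j\<in>near (\<xi> \<bullet> b). psi1 (\<xi> \<bullet> b - of_int j))"
    by (rule lattice_sum_PiE[where f="\<lambda>b t. psi1 (\<xi> \<bullet> b - t)", OF finite_near])
  also have "\<dots> = 1" by (intro prod.neutral ballI psi1_partition finite_near) (simp add: near_def)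
  finally show ?thesis .
qed

text \<open>A wider bump: 1 within coordinate distance 1 of k, thus on the support of
  \<open>psi \<eta> k\<close>, and 0 from coordinate distance 2 on. It can be inserted next to
  \<open>psi \<eta> k\<close> without changing anything, and it supplies the reproducing
  kernel.\<close>

definition chi :: "'a::euclidean_space \<Rightarrow> 'a \<Rightarrow> real" where
  "chi k \<xi> = (\<Prod>b\<in>Basis. \<eta> ((\<xi> - k) \<bullet> b))"

lemma chi_smooth: "smooth (chi k)"
  unfolding chi_def[abs_def] by (rule smooth_coord_prod[OF eta_smooth])

lemma chi_shift: "chi k \<xi> = chi 0 (\<xi> - k)"
  by (simp add: chi_def)

lemma chi_support: "b \<in> Basis \<Longrightarrow> 2 \<le> \<bar>(\<xi> - k) \<bullet> b\<bar> \<Longrightarrow> chi k \<xi> = 0"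
  unfolding chi_def by (auto simp: prod_zero_iff intro!: bexI[of _ b] eta_0)

lemma chi_eq_1: "(\<And>b. b \<in> Basis \<Longrightarrow> \<bar>(\<xi> - k) \<bullet> b\<bar> \<le> 1) \<Longrightarrow> chi k \<xi> = 1"
  unfolding chi_def by (intro prod.neutral ballI eta_1)

lemma psi_mult_chi: "k \<in> lattice_pts \<Longrightarrow> psi \<eta> k \<xi> * chi k \<xi> = psi \<eta> k \<xi>"
proof (cases "\<forall>b\<in>Basis. \<bar>(\<xi> - k) \<bullet> b\<bar> \<le> 1")
  case False
  assume k: "k \<in> lattice_pts"
  from False obtain b where "b \<in> Basis" "1 < \<bar>(\<xi> - k) \<bullet> b\<bar>" by force
  then show ?thesis using psi_support[OF k, of b \<xi>] by simp
qed (simp add: chi_eq_1)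

end

subsection \<open>Band-limited functions\<close>

text \<open>Meant for families that reproduce themselves under differentiation, such as the pairings
  of a distribution with plane waves times m, where m ranges over the Schwartz space.\<close>

lemma smooth_coinduct:
  fixes f :: "'a::euclidean_space \<Rightarrow> 'b::real_normed_vector"
  assumes "P f" "\<And>f x. P f \<Longrightarrow> f differentiable (at x)" "\<And>f b. P f \<Longrightarrow> b \<in> Basis \<Longrightarrow> P (pd b f)"
  shows "smooth f"
proof -
  have "partials bs f differentiable_on UNIV" if "bs \<in> lists Basis" "P f" for bs f
    using that
  proof (induction bs arbitrary: f rule: rev_induct)
    case Nil
    then show ?case using assms(2) by (simp add: differentiable_on_def)
  next
    case (snoc b bs)
    then show ?case unfolding partials_snoc using assms(3) by simp
  qed
  then show ?thesis using assms(1) unfolding smooth_def by blast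
qed

lemma dbound_wave_minus_1:
  assumes h: "norm h \<le> 1"
  shows "dbound k (\<lambda>\<xi>. (2 ^ k * norm h) * jbracket \<xi> ^ 1) (\<lambda>\<xi>. wave h \<xi> - 1)"
proof -
  have jh: "jbracket h \<le> 2" using jbracket_le_1_plus_norm[of h] h by linarith
  have r: "norm (wave h \<xi> - 1) \<le> (2 ^ k * norm h) * jbracket \<xi> ^ 1" for \<xi> k
  proof -
    have "norm (wave h \<xi> - 1) \<le> 1 * norm h * jbracket \<xi>"
      using wave_remainder1[of h \<xi>] mult_left_mono[OF norm_le_jbracket[of \<xi>], of "norm h"] by simp
    also have "\<dots> \<le> (2 ^ k * norm h) * jbracket \<xi>"
      by (intro mult_right_mono) auto
    finally show ?thesis by simp
  qed
  show ?thesis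
  proof (cases k)
    case 0
    then show ?thesis using r[of _ 0] by simp
  next
    case (Suc j)
    show ?thesis unfolding Suc
    proof (rule dbound_SucI)
      show "norm (wave h \<xi> - 1) \<le> 2 ^ Suc j * norm h * jbracket \<xi> ^ 1" for \<xi> by (rule r)
      show "(\<lambda>\<xi>. wave h \<xi> - 1) differentiable (at \<xi>)" for \<xi> by (intro differentiable_diff differentiable_wave differentiable_const)
      fix b :: 'a assume b: "b \<in> Basis"
      have "pd b (\<lambda>\<xi>. wave h \<xi> - 1) = (\<lambda>\<xi>. \<i> * of_real (h \<bullet> b) * wave h \<xi>)"
      proof
        fix \<xi>
        have "pd b (\<lambda>\<xi>. wave h \<xi> + (-1)) \<xi> = pd b (wave h) \<xi> + pd b (\<lambda>_. -1) \<xi>"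
          by (rule pd_add) (auto intro: differentiable_wave)
        moreover have "pd b (\<lambda>_::'a. -1::complex) \<xi> = 0" by (rule pd_eqI[where f'="\<lambda>_. 0"]) simp
        ultimately show "pd b (\<lambda>\<xi>. wave h \<xi> - 1) \<xi> = \<i> * of_real (h \<bullet> b) * wave h \<xi>"
          by (simp add: pd_wave[OF b])
      qed
      moreover have "dbound j (\<lambda>\<xi>. (2 ^ Suc j * norm h) * jbracket \<xi> ^ 1) (\<lambda>\<xi>. \<i> * of_real (h \<bullet> b) * wave h \<xi>)"
      proof (rule dbound_mono[OF dbound_cmult[OF dbound_wave]])
        fix \<xi> :: 'a
        have "\<bar>h \<bullet> b\<bar> * jbracket h ^ j \<le> norm h * 2 ^ j"
          by (intro mult_mono power_mono jh Basis_le_norm b) auto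
        also have "\<dots> \<le> (2 ^ Suc j * norm h) * 1" by simp
        also have "\<dots> \<le> (2 ^ Suc j * norm h) * jbracket \<xi> ^ 1"
          by (intro mult_left_mono jbracket_power_ge_1) auto
        finally show "norm (\<i> * of_real (h \<bullet> b)) * jbracket h ^ j \<le> (2 ^ Suc j * norm h) * jbracket \<xi> ^ 1"
          by (simp add: norm_mult)
      qed
      ultimately show "dbound j (\<lambda>\<xi>. 2 ^ Suc j * norm h * jbracket \<xi> ^ 1) (pd b (\<lambda>\<xi>. wave h \<xi> - 1))" by simp
    qed
  qed
qed

text \<open>Differentiating the second-order remainder in \<xi> gives a coordinate of h times the
  first-order remainder, so all derivatives keep the factor |h|^2. The price is growth of order 2 in
  \<xi>.\<close>

lemma dbound_wave_remainder:
  assumes h: "norm h \<le> 1"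
  shows "dbound k (\<lambda>\<xi>. (2 ^ k * (norm h)\<^sup>2) * jbracket \<xi> ^ 2) (\<lambda>\<xi>. wave h \<xi> - 1 - \<i> * of_real (h \<bullet> \<xi>))"
proof -
  have r: "norm (wave h \<xi> - 1 - \<i> * of_real (h \<bullet> \<xi>)) \<le> (2 ^ k * (norm h)\<^sup>2) * jbracket \<xi> ^ 2" for \<xi> k
  proof -
    have "norm (wave h \<xi> - 1 - \<i> * of_real (h \<bullet> \<xi>)) \<le> 1 * (norm h)\<^sup>2 * jbracket \<xi> ^ 2"
      using wave_remainder2[of h \<xi>] mult_left_mono[OF power_mono[OF norm_le_jbracket[of \<xi>], of 2], of "(norm h)\<^sup>2"] by simp
    also have "\<dots> \<le> (2 ^ k * (norm h)\<^sup>2) * jbracket \<xi> ^ 2"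
      by (intro mult_right_mono) auto
    finally show ?thesis .
  qed
  have d: "((\<lambda>\<xi>. \<i> * of_real (h \<bullet> \<xi>)) has_derivative (\<lambda>y. \<i> * of_real (h \<bullet> y))) (at \<xi>)" for \<xi>
    by (auto intro!: derivative_eq_intros)
  show ?thesis
  proof (cases k)
    case 0
    then show ?thesis using r[of _ 0] by simp
  next
    case (Suc j)
    show ?thesis unfolding Suc
    proof (rule dbound_SucI)
      show "norm (wave h \<xi> - 1 - \<i> * of_real (h \<bullet> \<xi>)) \<le> 2 ^ Suc j * (norm h)\<^sup>2 * jbracket \<xi> ^ 2" for \<xi> by (rule r)
      have dm: "(\<lambda>\<xi>. - (\<i> * of_real (h \<bullet> \<xi>))) differentiable (at \<xi>)" for \<xi>
        using d[of \<xi>] by (intro differentiable_minus) (auto simp: differentiable_def)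
      have dw: "(\<lambda>\<xi>. wave h \<xi> - 1) differentiable (at \<xi>)" for \<xi> by (intro differentiable_diff differentiable_wave differentiable_const)
      show "(\<lambda>\<xi>. wave h \<xi> - 1 - \<i> * of_real (h \<bullet> \<xi>)) differentiable (at \<xi>)" for \<xi>
        using differentiable_add[OF dw[of \<xi>] dm[of \<xi>]] by simp
      fix b :: 'a assume b: "b \<in> Basis"
      have "pd b (\<lambda>\<xi>. wave h \<xi> - 1 - \<i> * of_real (h \<bullet> \<xi>)) = (\<lambda>\<xi>. \<i> * of_real (h \<bullet> b) * (wave h \<xi> - 1))"
      proof
        fix \<xi>
        have "(wave h has_derivative (\<lambda>y. \<Sum>b\<in>Basis. (y \<bullet> b) *\<^sub>R pd b (wave h) \<xi>)) (at \<xi>)"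
          by (rule has_derivative_pd[OF differentiable_wave])
        from has_derivative_diff[OF has_derivative_diff[OF this has_derivative_const[of 1]] d, THEN pd_eqI[where b=b]]
        have "pd b (\<lambda>\<xi>. wave h \<xi> - 1 - \<i> * of_real (h \<bullet> \<xi>)) \<xi> = (\<Sum>c\<in>Basis. (b \<bullet> c) *\<^sub>R pd c (wave h) \<xi>) - \<i> * of_real (h \<bullet> b)" by simp
        also have "(\<Sum>c\<in>Basis. (b \<bullet> c) *\<^sub>R pd c (wave h) \<xi>) = pd b (wave h) \<xi>"
          using b by (simp add: inner_Basis if_distrib[of "\<lambda>t. t *\<^sub>R _"] sum.delta cong: if_cong)
        finally show "pd b (\<lambda>\<xi>. wave h \<xi> - 1 - \<i> * of_real (h \<bullet> \<xi>)) \<xi> = \<i> * of_real (h \<bullet> b) * (wave h \<xi> - 1)"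
          by (simp add: pd_wave[OF b] algebra_simps)
      qed
      moreover have "dbound j (\<lambda>\<xi>. (2 ^ Suc j * (norm h)\<^sup>2) * jbracket \<xi> ^ 2) (\<lambda>\<xi>. \<i> * of_real (h \<bullet> b) * (wave h \<xi> - 1))"
      proof (rule dbound_mono[OF dbound_cmult[OF dbound_wave_minus_1[OF h]]])
        fix \<xi> :: 'a
        have "\<bar>h \<bullet> b\<bar> * ((2 ^ j * norm h) * jbracket \<xi> ^ 1) \<le> norm h * ((2 ^ Suc j * norm h) * jbracket \<xi> ^ 2)"
          by (intro mult_mono Basis_le_norm b jbracket_power_mono) auto
        then show "norm (\<i> * of_real (h \<bullet> b)) * (2 ^ j * norm h * jbracket \<xi> ^ 1) \<le> (2 ^ Suc j * (norm h)\<^sup>2) * jbracket \<xi> ^ 2"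
          by (simp add: norm_mult power2_eq_square mult_ac)
      qed
      ultimately show "dbound j (\<lambda>\<xi>. 2 ^ Suc j * (norm h)\<^sup>2 * jbracket \<xi> ^ 2) (pd b (\<lambda>\<xi>. wave h \<xi> - 1 - \<i> * of_real (h \<bullet> \<xi>)))" by simp
    qed
  qed
qed

lemma tempered_wave_growth:
  assumes v: "v \<in> tempered" and m: "m \<in> schwartz"
  obtains C N where "0 \<le> C" "\<And>x. norm (v (\<lambda>\<xi>. wave x \<xi> * m \<xi>)) \<le> C * jbracket x ^ N"
proof -
  obtain C N where C: "0 \<le> C" "\<And>\<phi> B. \<phi> \<in> schwartz \<Longrightarrow> sb N N B \<phi> \<Longrightarrow> norm (v \<phi>) \<le> C * B"
    by (rule tempered_bound[OF v]) blast
  obtain B where B: "sb N N B m" using schwartz_sb[OF m] by blast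
  show ?thesis
  proof (rule that[of "C * (2 ^ N * B)" N])
    show "0 \<le> C * (2 ^ N * B)" using C(1) sb_nonneg[OF B] by simp
    show "norm (v (\<lambda>\<xi>. wave x \<xi> * m \<xi>)) \<le> C * (2 ^ N * B) * jbracket x ^ N" for x
      using C(2)[OF schwartz_wave[OF m] sb_wave[OF B], of x] by (simp add: mult_ac)
  qed
qed

text \<open>The second-order remainder of the plane wave times m is of size |h|^2 in every Schwartz
  seminorm, and v is bounded by one of them. The derivative multiplies m by i times a
  coordinate.\<close>

lemma tempered_wave_derivative:
  assumes v: "v \<in> tempered" and m: "m \<in> schwartz"
  shows "(\<lambda>x. v (\<lambda>\<xi>. wave x \<xi> * m \<xi>)) differentiable (at x)"
    and "b \<in> Basis \<Longrightarrow> pd b (\<lambda>x. v (\<lambda>\<xi>. wave x \<xi> * m \<xi>)) x = v (\<lambda>\<xi>. wave x \<xi> * (\<i> * (of_real (\<xi> \<bullet> b) * m \<xi>)))"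
proof -
  let ?U = "\<lambda>x. v (\<lambda>\<xi>. wave x \<xi> * m \<xi>)"
  let ?c = "\<lambda>b. v (\<lambda>\<xi>. wave x \<xi> * (\<i> * (of_real (\<xi> \<bullet> b) * m \<xi>)))"
  obtain C N where C: "0 \<le> C" "\<And>\<phi> B. \<phi> \<in> schwartz \<Longrightarrow> sb N N B \<phi> \<Longrightarrow> norm (v \<phi>) \<le> C * B"
    by (rule tempered_bound[OF v]) blast
  \<comment> \<open>Two extra orders of decay compensate for the growth of the remainder in
    \<xi>.\<close>
  obtain B where B: "sb N (N + 2) B (\<lambda>\<xi>. wave x \<xi> * m \<xi>)" using schwartz_sb[OF schwartz_wave[OF m]] by blast
  have S: "(\<lambda>\<xi>. wave y \<xi> * m \<xi>) \<in> schwartz" for y by (rule schwartz_wave[OF m])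
  have Sb: "(\<lambda>\<xi>. wave x \<xi> * (\<i> * (of_real (\<xi> \<bullet> b) * m \<xi>))) \<in> schwartz" if "b \<in> Basis" for b
    by (intro schwartz_wave schwartz_cmult schwartz_coord that m)
  have *: "norm (?U (x + h) - ?U x - (\<Sum>b\<in>Basis. (h \<bullet> b) *\<^sub>R ?c b)) \<le> (C * (2 ^ N * 2 ^ N * B)) * (norm h)\<^sup>2" if h: "norm h \<le> 1" for h
  proof -
    let ?r = "\<lambda>\<xi>. (wave h \<xi> - 1 - \<i> * of_real (h \<bullet> \<xi>)) * (wave x \<xi> * m \<xi>)"
    have rS: "?r \<in> schwartz"
    proof (rule schwartz_mult_poly[OF _ S])
      fix k show "\<exists>A n. dbound k (\<lambda>\<xi>. A * jbracket \<xi> ^ n) (\<lambda>\<xi>. wave h \<xi> - 1 - \<i> * of_real (h \<bullet> \<xi>))"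
        using dbound_wave_remainder[OF h] by blast
    qed
    have "(\<Sum>b\<in>Basis. (h \<bullet> b) *\<^sub>R ?c b) = (\<Sum>b\<in>Basis. v (\<lambda>\<xi>. of_real (h \<bullet> b) * (wave x \<xi> * (\<i> * (of_real (\<xi> \<bullet> b) * m \<xi>)))))"
      by (intro sum.cong refl) (simp add: tempered_cmult[OF v Sb] scaleR_conv_of_real)
    also have "\<dots> = v (\<lambda>\<xi>. \<Sum>b\<in>Basis. of_real (h \<bullet> b) * (wave x \<xi> * (\<i> * (of_real (\<xi> \<bullet> b) * m \<xi>))))"
      by (rule tempered_sum[symmetric, OF v]) (intro schwartz_cmult Sb)
    also have "(\<lambda>\<xi>. \<Sum>b\<in>Basis. of_real (h \<bullet> b) * (wave x \<xi> * (\<i> * (of_real (\<xi> \<bullet> b) * m \<xi>)))) = (\<lambda>\<xi>. \<i> * of_real (h \<bullet> \<xi>) * (wave x \<xi> * m \<xi>))"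
    proof
      fix \<xi>
      have "complex_of_real (h \<bullet> \<xi>) = (\<Sum>b\<in>Basis. of_real (h \<bullet> b) * of_real (\<xi> \<bullet> b))"
        by (subst euclidean_inner) simp
      then show "(\<Sum>b\<in>Basis. of_real (h \<bullet> b) * (wave x \<xi> * (\<i> * (of_real (\<xi> \<bullet> b) * m \<xi>)))) = \<i> * of_real (h \<bullet> \<xi>) * (wave x \<xi> * m \<xi>)"
        by (simp add: sum_distrib_right sum_distrib_left mult_ac)
    qed
    finally have e: "(\<Sum>b\<in>Basis. (h \<bullet> b) *\<^sub>R ?c b) = v (\<lambda>\<xi>. \<i> * of_real (h \<bullet> \<xi>) * (wave x \<xi> * m \<xi>))" .
    have S3: "(\<lambda>\<xi>. \<i> * of_real (h \<bullet> \<xi>) * (wave x \<xi> * m \<xi>)) \<in> schwartz"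
    proof -
      have "(\<lambda>\<xi>. (wave (x + h) \<xi> * m \<xi> - wave x \<xi> * m \<xi>) - ?r \<xi>) \<in> schwartz"
        by (intro schwartz_diff S rS)
      then show ?thesis by (simp add: wave_add algebra_simps)
    qed
    have "?U (x + h) - ?U x - (\<Sum>b\<in>Basis. (h \<bullet> b) *\<^sub>R ?c b) = v ?r"
      unfolding e tempered_diff[OF v S S, symmetric] tempered_diff[OF v schwartz_diff[OF S S] S3, symmetric]
      by (rule arg_cong[where f=v]) (simp add: fun_eq_iff wave_add algebra_simps)
    moreover have "norm (v ?r) \<le> C * (2 ^ N * (2 ^ N * (norm h)\<^sup>2) * B)"
      by (rule C(2)[OF rS sb_mult_poly[OF dbound_wave_remainder[OF h] B]])
    ultimately show ?thesis by (simp only: mult_ac)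
  qed
  show "?U differentiable (at x)" by (rule pd_quadratic(1)[OF *])
  show "pd b ?U x = ?c b" if "b \<in> Basis" by (rule pd_quadratic(2)[OF * that])
qed

lemma tempered_wave_smooth:
  assumes v: "v \<in> tempered" and m: "m \<in> schwartz"
  shows "smooth (\<lambda>x. v (\<lambda>\<xi>. wave x \<xi> * m \<xi>))"
proof (rule smooth_coinduct[where P="\<lambda>f. \<exists>m\<in>schwartz. f = (\<lambda>x. v (\<lambda>\<xi>. wave x \<xi> * m \<xi>))"])
  show "\<exists>m'\<in>schwartz. (\<lambda>x. v (\<lambda>\<xi>. wave x \<xi> * m \<xi>)) = (\<lambda>x. v (\<lambda>\<xi>. wave x \<xi> * m' \<xi>))" using m by blast
  show "f differentiable (at x)" if "\<exists>m\<in>schwartz. f = (\<lambda>x. v (\<lambda>\<xi>. wave x \<xi> * m \<xi>))" for f x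
    using that tempered_wave_derivative(1)[OF v] by blast
  show "\<exists>m\<in>schwartz. pd b f = (\<lambda>x. v (\<lambda>\<xi>. wave x \<xi> * m \<xi>))" if f: "\<exists>m\<in>schwartz. f = (\<lambda>x. v (\<lambda>\<xi>. wave x \<xi> * m \<xi>))" and b: "b \<in> Basis" for f b
  proof -
    from f obtain m where m: "m \<in> schwartz" "f = (\<lambda>x. v (\<lambda>\<xi>. wave x \<xi> * m \<xi>))" by blast
    have "(\<lambda>\<xi>. \<i> * (of_real (\<xi> \<bullet> b) * m \<xi>)) \<in> schwartz" by (intro schwartz_cmult schwartz_coord b m)
    moreover have "pd b f = (\<lambda>x. v (\<lambda>\<xi>. wave x \<xi> * (\<i> * (of_real (\<xi> \<bullet> b) * m \<xi>))))"
      unfolding m(2) by (rule ext) (rule tempered_wave_derivative(2)[OF v m(1) b])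
    ultimately show ?thesis by (intro bexI[of _ "\<lambda>\<xi>. \<i> * (of_real (\<xi> \<bullet> b) * m \<xi>)"])
  qed
qed

subsection \<open>Interchanging a tempered distribution with an integral\<close>

text \<open>Grouping by the finitely many values of \<open>F\<close> writes the integral as a finite
  linear combination, to which the linearity of a distribution applies.\<close>

lemma integral_simple_function:
  fixes w :: "'x \<Rightarrow> complex" and G :: "'y \<Rightarrow> complex"
  assumes F: "simple_function M F" and w: "integrable M w"
  shows "(\<Sum>y\<in>F ` space M. (\<integral>x. indicator (F -` {y} \<inter> space M) x * w x \<partial>M) * G y) = (\<integral>x. w x * G (F x) \<partial>M)"
proof -
  have fin: "finite (F ` space M)" and s: "F -` {y} \<inter> space M \<in> sets M" for y
    using simple_functionD[OF F] by auto
  have i: "integrable M (\<lambda>x. indicator (F -` {y} \<inter> space M) x * w x)" for y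
    by (rule Bochner_Integration.integrable_cong[THEN iffD1, OF refl _ integrable_mult_indicator[OF s[of y] w]]) (simp add: indicator_def)
  have "(\<Sum>y\<in>F ` space M. (\<integral>x. indicator (F -` {y} \<inter> space M) x * w x \<partial>M) * G y)
     = (\<integral>x. (\<Sum>y\<in>F ` space M. indicator (F -` {y} \<inter> space M) x * w x * G y) \<partial>M)"
    by (subst Bochner_Integration.integral_sum) (auto intro!: integrable_mult_left i)
  also have "\<dots> = (\<integral>x. w x * G (F x) \<partial>M)"
  proof (rule Bochner_Integration.integral_cong[OF refl])
    fix x assume x: "x \<in> space M"
    have "(\<Sum>y\<in>F ` space M. indicator (F -` {y} \<inter> space M) x * w x * G y) = (\<Sum>y\<in>F ` space M. if F x = y then w x * G y else 0)"
      using x by (intro sum.cong) (auto simp: indicator_def)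
    also have "\<dots> = w x * G (F x)" using fin x by (simp add: sum.delta)
    finally show "(\<Sum>y\<in>F ` space M. indicator (F -` {y} \<inter> space M) x * w x * G y) = w x * G (F x)" .
  qed
  finally show ?thesis .
qed

text \<open>Even powers of the bracket are polynomials. One more square amounts to repeated
  multiplication by coordinates, under which the Schwartz space is closed.\<close>

lemma jbracket_even_Suc:
  "of_real (jbracket x ^ (2 * Suc p)) * (\<phi> x :: complex) = of_real (jbracket x ^ (2 * p)) * \<phi> x +
    (\<Sum>b\<in>Basis. of_real (x \<bullet> b) * (of_real (x \<bullet> b) * (of_real (jbracket x ^ (2 * p)) * \<phi> x)))"
proof -
  have "complex_of_real (jbracket x ^ (2 * Suc p)) = of_real ((1 + x \<bullet> x) * jbracket x ^ (2 * p))"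
    by (simp only: jbracket_power_even power_Suc)
  also have "\<dots> = (1 + of_real (x \<bullet> x)) * of_real (jbracket x ^ (2 * p))" by simp
  also have "complex_of_real (x \<bullet> x) = (\<Sum>b\<in>Basis. of_real (x \<bullet> b) * of_real (x \<bullet> b))"
    by (subst euclidean_inner) simp
  finally show ?thesis by (simp add: ring_distribs sum_distrib_left sum_distrib_right mult_ac)
qed

lemma schwartz_jbracket: "\<phi> \<in> schwartz \<Longrightarrow> (\<lambda>x. of_real (jbracket x ^ (2 * p)) * \<phi> x) \<in> schwartz"
proof (induction p)
  case (Suc p)
  show ?case unfolding jbracket_even_Suc
    by (intro schwartz_add schwartz_sum schwartz_coord Suc)
qed simp

text \<open>For a simple function \<open>F\<close> the second term of the integrand is a finite combination of plane waves.
  The weight \<open>w\<close> makes the error integral finite, and it tends to 0 along simple functions converging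
  to the identity.\<close>

lemma quantization_dbound:
  fixes \<theta> :: "'c::euclidean_space \<Rightarrow> complex"
  defines "w \<equiv> \<lambda>x::'c. of_real (1 / jbracket x ^ (2 * DIM('c) + 2)) :: complex"
  shows "\<theta> \<in> schwartz \<Longrightarrow> \<exists>C\<ge>0. \<forall>F. F \<in> borel_measurable borel \<longrightarrow> (\<forall>x. norm (F x) \<le> 2 * norm x) \<longrightarrow>
    dbound k (\<lambda>\<xi>. (C * (\<integral>x. norm (w x) * norm (x - F x) \<partial>lborel)) * jbracket \<xi> ^ 1)
      (\<lambda>\<xi>. \<integral>x. w x * (\<theta> x * wave x \<xi> - \<theta> (F x) * wave (F x) \<xi>) \<partial>lborel)"
proof (induction k arbitrary: \<theta>)
  have w [measurable]: "w \<in> borel_measurable borel" unfolding w_def by measurable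
  have nw: "norm (w x) = 1 / jbracket x ^ (2 * DIM('c) + 2)" for x unfolding w_def norm_of_real by simp
  have zero: "\<exists>C\<ge>0. \<forall>F. F \<in> borel_measurable borel \<longrightarrow> (\<forall>x. norm (F x) \<le> 2 * norm x) \<longrightarrow> (\<forall>\<xi>.
    norm (\<integral>x. w x * (\<theta> x * wave x \<xi> - \<theta> (F x) * wave (F x) \<xi>) \<partial>lborel) \<le> (C * (\<integral>x. norm (w x) * norm (x - F x) \<partial>lborel)) * jbracket \<xi> ^ 1)"
    if th: "\<theta> \<in> schwartz" for \<theta> :: "'c \<Rightarrow> complex"
  proof -
    obtain B where B: "sb 1 0 B \<theta>" using schwartz_sb[OF th] by blast
    have B0: "0 \<le> B" by (rule sb_nonneg[OF B])
    have [measurable]: "\<theta> \<in> borel_measurable borel" by (rule schwartz_borel[OF th])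
    show ?thesis
    proof (intro exI[of _ "real DIM('c) * B + B"] conjI allI impI)
      show "0 \<le> real DIM('c) * B + B" using B0 by simp
      fix F :: "'c \<Rightarrow> 'c" and \<xi> assume F [measurable]: "F \<in> borel_measurable borel" and F2: "\<forall>x. norm (F x) \<le> 2 * norm x"
      have d: "norm (\<theta> x * wave x \<xi> - \<theta> y * wave y \<xi>) \<le> ((real DIM('c) * B + B) * jbracket \<xi>) * norm (x - y)" for x y
      proof -
        \<comment> \<open>Separates the variation of the amplitude \<theta> from the variation of
          the phase.\<close>
        have e: "\<theta> x * wave x \<xi> - \<theta> y * wave y \<xi> = (\<theta> x - \<theta> y) * wave x \<xi> + \<theta> y * (wave (x - y) \<xi> - 1) * wave y \<xi>"
          using wave_add[of "x - y" y \<xi>] by (simp add: algebra_simps)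
        have "norm (\<theta> x - \<theta> y) \<le> real DIM('c) * B * norm (x - y)"
          using dbound_mvt[OF B[unfolded sb_def], of y "norm (x - y)" B x] by simp
        moreover have "norm (\<theta> y * (wave (x - y) \<xi> - 1)) \<le> B * (norm (x - y) * norm \<xi>)"
          using sb_norm[OF B, of y] wave_remainder1[of "x - y" \<xi>] B0 unfolding norm_mult by (intro mult_mono) auto
        ultimately have "norm (\<theta> x * wave x \<xi> - \<theta> y * wave y \<xi>) \<le> real DIM('c) * B * norm (x - y) + B * (norm (x - y) * norm \<xi>)"
          unfolding e by (intro order_trans[OF norm_triangle_ineq] add_mono) (auto simp: norm_mult)
        also have "\<dots> \<le> real DIM('c) * B * norm (x - y) * jbracket \<xi> + B * (norm (x - y) * jbracket \<xi>)"
          using B0 norm_le_jbracket[of \<xi>] mult_left_mono[OF jbracket_ge_1[of \<xi>], of "real DIM('c) * B * norm (x - y)"]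
          by (intro add_mono mult_left_mono) auto
        finally show ?thesis by (simp add: algebra_simps)
      qed
      have i2: "integrable lborel (\<lambda>x. norm (w x) * norm (x - F x))"
      proof (rule integrable_by_jbracket[of _ 3 "2 * DIM('c)"])
        fix x
        have "norm (x - F x) \<le> 3 * norm x" using F2[rule_format, of x] norm_triangle_ineq4[of x "F x"] by linarith
        also have "\<dots> \<le> 3 * jbracket x ^ 2" using norm_le_jbracket[of x] jbracket_power_mono[of 1 2 x] by simp
        finally have "norm (w x) * norm (x - F x) \<le> 1 / jbracket x ^ (2 * DIM('c) + 2) * (3 * jbracket x ^ 2)"
          unfolding nw by (intro mult_left_mono) auto
        then show "norm (norm (w x) * norm (x - F x)) \<le> 3 / jbracket x ^ (2 * DIM('c))" unfolding power_add by simp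
      qed auto
      have "norm (\<integral>x. w x * (\<theta> x * wave x \<xi> - \<theta> (F x) * wave (F x) \<xi>) \<partial>lborel) \<le>
          (\<integral>x. ((real DIM('c) * B + B) * jbracket \<xi>) * (norm (w x) * norm (x - F x)) \<partial>lborel)"
      proof (rule Bochner_Integration.integral_norm_bound_integral)
        show bd: "norm (w x * (\<theta> x * wave x \<xi> - \<theta> (F x) * wave (F x) \<xi>)) \<le> ((real DIM('c) * B + B) * jbracket \<xi>) * (norm (w x) * norm (x - F x))" for x
          using mult_left_mono[OF d[of x "F x"], of "norm (w x)"] by (simp add: norm_mult mult_ac)
        show i3: "integrable lborel (\<lambda>x. ((real DIM('c) * B + B) * jbracket \<xi>) * (norm (w x) * norm (x - F x)))"
          using i2 by (rule integrable_mult_right)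
        show "integrable lborel (\<lambda>x. w x * (\<theta> x * wave x \<xi> - \<theta> (F x) * wave (F x) \<xi>))"
          by (rule Bochner_Integration.integrable_bound[OF i3]) (use bd in \<open>auto intro!: AE_I2 order_trans[OF bd]\<close>)
      qed
      also have "\<dots> = ((real DIM('c) * B + B) * jbracket \<xi>) * (\<integral>x. norm (w x) * norm (x - F x) \<partial>lborel)"
        by (rule integral_mult_right_zero)
      finally show "norm (\<integral>x. w x * (\<theta> x * wave x \<xi> - \<theta> (F x) * wave (F x) \<xi>) \<partial>lborel) \<le> ((real DIM('c) * B + B) * (\<integral>x. norm (w x) * norm (x - F x) \<partial>lborel)) * jbracket \<xi> ^ 1"
        by (simp add: mult_ac)
    qed
  qed
  {
    case (0 \<theta>)
    from zero[OF this] show ?case by simp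
  next
    case (Suc k \<theta>)
    have [measurable]: "\<theta> \<in> borel_measurable borel" by (rule schwartz_borel[OF Suc(2)])
    \<comment> \<open>Differentiation in \<xi> replaces the amplitude by i times a coordinate times
      the amplitude, so the induction runs over all Schwartz \<theta>.\<close>
    let ?\<theta> = "\<lambda>b x. \<i> * (of_real (x \<bullet> b) * \<theta> x)"
    have thb: "?\<theta> b \<in> schwartz" if "b \<in> Basis" for b by (intro schwartz_cmult schwartz_coord that Suc(2))
    define Q where "Q b C \<longleftrightarrow> 0 \<le> C \<and> (\<forall>F. F \<in> borel_measurable borel \<longrightarrow> (\<forall>x. norm (F x) \<le> 2 * norm x) \<longrightarrow>
      dbound k (\<lambda>\<xi>. (C * (\<integral>x. norm (w x) * norm (x - F x) \<partial>lborel)) * jbracket \<xi> ^ 1)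
        (\<lambda>\<xi>. \<integral>x. w x * (?\<theta> b x * wave x \<xi> - ?\<theta> b (F x) * wave (F x) \<xi>) \<partial>lborel))" for b C
    have "\<forall>b\<in>Basis. \<exists>C. Q b C"
      unfolding Q_def using Suc(1)[OF thb] by blast
    from bchoice[OF this] obtain C where Cq: "\<And>b. b \<in> Basis \<Longrightarrow> Q b (C b)" by blast
    have C: "0 \<le> C b" "F \<in> borel_measurable borel \<Longrightarrow> (\<forall>x. norm (F x) \<le> 2 * norm x) \<Longrightarrow>
      dbound k (\<lambda>\<xi>. (C b * (\<integral>x. norm (w x) * norm (x - F x) \<partial>lborel)) * jbracket \<xi> ^ 1)
        (\<lambda>\<xi>. \<integral>x. w x * (?\<theta> b x * wave x \<xi> - ?\<theta> b (F x) * wave (F x) \<xi>) \<partial>lborel)" if "b \<in> Basis" for b F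
      using Cq[OF that] unfolding Q_def by blast+
    obtain C0 where C0: "0 \<le> C0" "\<And>F \<xi>. F \<in> borel_measurable borel \<Longrightarrow> (\<forall>x. norm (F x) \<le> 2 * norm x) \<Longrightarrow>
        norm (\<integral>x. w x * (\<theta> x * wave x \<xi> - \<theta> (F x) * wave (F x) \<xi>) \<partial>lborel) \<le> (C0 * (\<integral>x. norm (w x) * norm (x - F x) \<partial>lborel)) * jbracket \<xi> ^ 1"
      using zero[OF Suc(2)] by blast
    let ?C = "C0 + (\<Sum>b\<in>Basis. C b)"
    have sC: "0 \<le> (\<Sum>b\<in>Basis. C b)" using C(1) by (simp add: sum_nonneg)
    show ?case
    proof (intro exI[of _ ?C] conjI allI impI)
      show "0 \<le> ?C" using C0(1) sC by simp
      fix F :: "'c \<Rightarrow> 'c" assume F [measurable]: "F \<in> borel_measurable borel" and F2: "\<forall>x. norm (F x) \<le> 2 * norm x"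
      let ?\<epsilon> = "\<integral>x. norm (w x) * norm (x - F x) \<partial>lborel"
      have e0: "0 \<le> ?\<epsilon>" by simp
      let ?H = "\<lambda>\<theta> \<xi>. \<integral>x. w x * (\<theta> x * wave x \<xi> - \<theta> (F x) * wave (F x) \<xi>) \<partial>lborel"
      let ?G = "\<lambda>\<theta> \<tau> \<xi>. \<integral>x. w x * \<theta> (\<tau> x) * wave (\<tau> x) \<xi> \<partial>lborel"
      \<comment> \<open>Decay of order 2 bounds both \<theta> and |y|^2 \<theta>, the two quantities
        that \<open>exp_integral_derivative\<close> asks for.\<close>
      obtain B where B: "sb 0 2 B \<theta>" using schwartz_sb[OF Suc(2)] by blast
      have B0: "0 \<le> B" by (rule sb_nonneg[OF B])
      have iG: "integrable lborel (\<lambda>x. w x * \<theta> (\<tau> x))" and iG2: "integrable lborel (\<lambda>x. norm (w x * \<theta> (\<tau> x)) * (norm (\<tau> x))\<^sup>2)"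
        if [measurable]: "\<tau> \<in> borel_measurable borel" for \<tau> :: "'c \<Rightarrow> 'c"
      proof -
        have t1: "norm (\<theta> y) \<le> B" "norm (\<theta> y) * (norm y)\<^sup>2 \<le> B" for y
        proof -
          have a: "norm (\<theta> y) * jbracket y ^ 2 \<le> B" using sb_norm[OF B, of y] by (simp add: field_simps)
          show "norm (\<theta> y) \<le> B" using order_trans[OF mult_left_mono[OF jbracket_power_ge_1[of y 2], of "norm (\<theta> y)"] a] by simp
          show "norm (\<theta> y) * (norm y)\<^sup>2 \<le> B"
            by (rule order_trans[OF mult_left_mono[OF power_mono[OF norm_le_jbracket]] a]) auto
        qed
        show "integrable lborel (\<lambda>x. w x * \<theta> (\<tau> x))"
        proof (rule integrable_by_jbracket[of _ B "2 * DIM('c) + 2"])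
          show "norm (w x * \<theta> (\<tau> x)) \<le> B / jbracket x ^ (2 * DIM('c) + 2)" for x
            unfolding norm_mult nw using t1(1)[of "\<tau> x"] by (simp add: divide_right_mono)
        qed auto
        show "integrable lborel (\<lambda>x. norm (w x * \<theta> (\<tau> x)) * (norm (\<tau> x))\<^sup>2)"
        proof (rule integrable_by_jbracket[of _ B "2 * DIM('c) + 2"])
          show "norm (norm (w x * \<theta> (\<tau> x)) * (norm (\<tau> x))\<^sup>2) \<le> B / jbracket x ^ (2 * DIM('c) + 2)" for x
            unfolding norm_mult nw using t1(2)[of "\<tau> x"] by (simp add: divide_right_mono)
        qed auto
      qed
      have HG: "?H \<theta> = (\<lambda>\<xi>. ?G \<theta> (\<lambda>x. x) \<xi> - ?G \<theta> F \<xi>)"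
      proof
        fix \<xi>
        have "integrable lborel (\<lambda>x. w x * \<theta> x * wave x \<xi>)" "integrable lborel (\<lambda>x. w x * \<theta> (F x) * wave (F x) \<xi>)"
          using iG[of "\<lambda>x. x"] iG[of F] by (auto intro!: integrable_wave)
        then show "?H \<theta> \<xi> = ?G \<theta> (\<lambda>x. x) \<xi> - ?G \<theta> F \<xi>"
          by (simp add: right_diff_distrib mult.assoc)
      qed
      have mG: "(\<lambda>x. w x * \<theta> (\<tau> x)) \<in> borel_measurable lborel" "\<tau> \<in> borel_measurable lborel"
        if [measurable]: "\<tau> \<in> borel_measurable borel" for \<tau> :: "'c \<Rightarrow> 'c" by auto
      have mid: "(\<lambda>x::'c. x) \<in> borel_measurable borel" by simp
      note DG = exp_integral_derivative[OF mG iG iG2]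
      have dH: "?H \<theta> differentiable (at \<xi>)" for \<xi>
        unfolding HG by (intro differentiable_diff DG(1) mid F)
      have pH: "pd b (?H \<theta>) = ?H (?\<theta> b)" if b: "b \<in> Basis" for b
      proof
        fix \<xi>
        have "pd b (?H \<theta>) \<xi> = pd b (?G \<theta> (\<lambda>x. x)) \<xi> - pd b (?G \<theta> F) \<xi>"
        proof -
          have "(?H \<theta> has_derivative (\<lambda>h. (\<Sum>b\<in>Basis. (h \<bullet> b) *\<^sub>R pd b (?G \<theta> (\<lambda>x. x)) \<xi>) - (\<Sum>b\<in>Basis. (h \<bullet> b) *\<^sub>R pd b (?G \<theta> F) \<xi>))) (at \<xi>)"
            unfolding HG by (intro has_derivative_diff has_derivative_pd DG(1) mid F)
          from pd_eqI[OF this, of b] show ?thesis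
            using b by (simp add: inner_Basis if_distrib[of "\<lambda>t. t *\<^sub>R _"] sum.delta cong: if_cong)
        qed
        also have "\<dots> = (\<integral>x. (\<i> * of_real (x \<bullet> b) * (w x * \<theta> x)) * wave x \<xi> \<partial>lborel) - (\<integral>x. (\<i> * of_real (F x \<bullet> b) * (w x * \<theta> (F x))) * wave (F x) \<xi> \<partial>lborel)"
          unfolding DG(2)[OF mid mid mid mid b] DG(2)[OF F F F F b] ..
        also have "\<dots> = ?H (?\<theta> b) \<xi>"
        proof -
          have bd: "\<bar>y \<bullet> b\<bar> * norm (\<theta> y) \<le> B" for y
          proof -
            have "\<bar>y \<bullet> b\<bar> \<le> jbracket y ^ 2" using inner_le_jbracket[OF b, of y] jbracket_power_mono[of 1 2 y] by simp
            then have "\<bar>y \<bullet> b\<bar> * norm (\<theta> y) \<le> jbracket y ^ 2 * norm (\<theta> y)" by (rule mult_right_mono) simp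
            also have "\<dots> \<le> B" using sb_norm[OF B, of y] by (simp add: field_simps)
            finally show ?thesis .
          qed
          have "integrable lborel (\<lambda>x. (\<i> * of_real (\<tau> x \<bullet> b) * (w x * \<theta> (\<tau> x))) * wave (\<tau> x) \<xi>)"
            if [measurable]: "\<tau> \<in> borel_measurable borel" for \<tau> :: "'c \<Rightarrow> 'c"
          proof (rule integrable_by_jbracket[of _ B "2 * DIM('c) + 2"])
            show "norm ((\<i> * of_real (\<tau> x \<bullet> b) * (w x * \<theta> (\<tau> x))) * wave (\<tau> x) \<xi>) \<le> B / jbracket x ^ (2 * DIM('c) + 2)" for x
              unfolding norm_mult nw using bd[of "\<tau> x"] by (simp add: divide_right_mono)
          qed auto
          from Bochner_Integration.integral_diff[OF this[OF mid] this[OF F]]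
          show ?thesis by (simp add: algebra_simps)
        qed
        finally show "pd b (?H \<theta>) \<xi> = ?H (?\<theta> b) \<xi>" .
      qed
      show "dbound (Suc k) (\<lambda>\<xi>. ?C * ?\<epsilon> * jbracket \<xi> ^ 1) (?H \<theta>)"
      proof (rule dbound_SucI)
        show "norm (?H \<theta> \<xi>) \<le> ?C * ?\<epsilon> * jbracket \<xi> ^ 1" for \<xi>
          by (rule order_trans[OF C0(2)[OF F F2]]) (use e0 sC in \<open>auto intro!: mult_right_mono\<close>)
        show "?H \<theta> differentiable (at \<xi>)" for \<xi> by (rule dH)
        show "dbound k (\<lambda>\<xi>. ?C * ?\<epsilon> * jbracket \<xi> ^ 1) (pd b (?H \<theta>))" if b: "b \<in> Basis" for b
          unfolding pH[OF b]
        proof (rule dbound_mono[OF C(2)[OF b F F2]])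
          fix \<xi> :: 'c
          have "C b \<le> (\<Sum>b\<in>Basis. C b)" using member_le_sum[OF b, of C] C(1) by simp
          then show "C b * ?\<epsilon> * jbracket \<xi> ^ 1 \<le> ?C * ?\<epsilon> * jbracket \<xi> ^ 1"
            using C0(1) e0 by (intro mult_right_mono) auto
        qed
      qed
    qed
  }
qed

text \<open>Along simple functions \<open>F i\<close> tending to the identity, the superposition of
  plane waves becomes a finite sum \<open>S i\<close>, to which linearity applies. The scalar
  integrals converge by domination, and \<open>S i\<close> converges in the seminorm that bounds v
  by \<open>quantization_dbound\<close>. The map \<open>A\<close> selects the plane waves that occur
  and \<open>A'\<close> is its adjoint, so plane waves indexed by a subspace are covered.\<close>

theorem tempered_integral_interchange:
  fixes A :: "'c::euclidean_space \<Rightarrow> 'a::euclidean_space" and A' :: "'a \<Rightarrow> 'c"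
  assumes v: "v \<in> tempered" and m: "m \<in> schwartz" and \<phi>: "\<phi> \<in> schwartz"
    and A: "bounded_linear A" "\<And>x. norm (A x) \<le> norm x" and A': "bounded_linear A'"
    and adj: "\<And>x \<xi>. A x \<bullet> \<xi> = x \<bullet> A' \<xi>"
  shows "integrable lborel (\<lambda>x. \<phi> x * v (\<lambda>\<xi>. wave (A x) \<xi> * m \<xi>))"
    and "v (\<lambda>\<xi>. inv_fourier \<phi> (A' \<xi>) * m \<xi>) = of_real (fconst TYPE('c)) * (\<integral>x. \<phi> x * v (\<lambda>\<xi>. wave (A x) \<xi> * m \<xi>) \<partial>lborel)"
    and "(\<lambda>\<xi>. inv_fourier \<phi> (A' \<xi>) * m \<xi>) \<in> schwartz"
proof -
  let ?p = "2 * DIM('c) + 2"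
  \<comment> \<open>The factorisation \<phi> = w \<theta> isolates an integrable weight with finite
    first moment for the quantisation, while \<theta> stays Schwartz and absorbs the polynomial
    growth of \<open>U\<close>.\<close>
  define w :: "'c \<Rightarrow> complex" where "w x = of_real (1 / jbracket x ^ ?p)" for x
  define \<theta> :: "'c \<Rightarrow> complex" where "\<theta> x = of_real (jbracket x ^ ?p) * \<phi> x" for x
  define U where "U x = v (\<lambda>\<xi>. wave (A x) \<xi> * m \<xi>)" for x
  have th: "\<theta> \<in> schwartz" using schwartz_jbracket[OF \<phi>, of "DIM('c) + 1"] by (simp add: \<theta>_def[abs_def])
  have wth: "w x * \<theta> x = \<phi> x" for x by (simp add: w_def \<theta>_def)
  have wW: "wave (A x) \<xi> = wave x (A' \<xi>)" for x \<xi> by (simp add: wave_def adj)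
  have smU: "smooth U"
    using smooth_affine[OF A(1) tempered_wave_smooth[OF v m], of 0] by (simp add: U_def[abs_def])
  have contU: "continuous_on UNIV U" by (rule smooth_continuous[OF smU])
  have [measurable]: "U \<in> borel_measurable borel" "\<theta> \<in> borel_measurable borel" "\<phi> \<in> borel_measurable borel" "w \<in> borel_measurable borel"
    using smooth_borel[OF smU] schwartz_borel[OF th] schwartz_borel[OF \<phi>] by (auto simp: w_def[abs_def])
  obtain C N where CN: "0 \<le> C" "\<And>x. norm (v (\<lambda>\<xi>. wave x \<xi> * m \<xi>)) \<le> C * jbracket x ^ N"
    by (rule tempered_wave_growth[OF v m]) blast
  have Ub: "norm (U x) \<le> C * jbracket x ^ N" for x
  proof -
    have "norm (U x) \<le> C * jbracket (A x) ^ N" unfolding U_def by (rule CN(2))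
    also have "\<dots> \<le> C * jbracket x ^ N"
      using A(2)[of x] CN(1) by (intro mult_left_mono power_mono jbracket_mono) auto
    finally show ?thesis .
  qed
  obtain B where B: "sb 0 N B \<theta>" using schwartz_sb[OF th] by blast
  have B0: "0 \<le> B" by (rule sb_nonneg[OF B])
  have thU: "norm (\<theta> x * U x) \<le> B * C" for x
  proof -
    have "norm (\<theta> x * U x) \<le> (B / jbracket x ^ N) * (C * jbracket x ^ N)"
      unfolding norm_mult using sb_norm[OF B, of x] Ub[of x] B0 by (intro mult_mono) auto
    then show ?thesis by simp
  qed
  have iw: "integrable lborel w"
  proof (rule integrable_by_jbracket[of _ 1 ?p])
    show "norm (w x) \<le> 1 / jbracket x ^ ?p" for x unfolding w_def norm_of_real by simp
  qed auto
  have iwn: "integrable lborel (\<lambda>x. norm (w x) * (B * C))" using iw by simp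
  show iU: "integrable lborel (\<lambda>x. \<phi> x * v (\<lambda>\<xi>. wave (A x) \<xi> * m \<xi>))"
    unfolding U_def[symmetric] wth[symmetric]
    by (rule Bochner_Integration.integrable_bound[OF iwn])
      (use thU B0 CN(1) in \<open>auto simp: mult.assoc norm_mult intro!: mult_left_mono\<close>)
  \<comment> \<open>The approximating functions stay within twice the distance to 0, which is the
    domination that \<open>quantization_dbound\<close> assumes.\<close>
  have "\<exists>F. (\<forall>i. simple_function lborel (F i)) \<and> (\<forall>x\<in>space lborel. (\<lambda>i. F i x) \<longlonglongrightarrow> x) \<and>
      (\<forall>i. \<forall>x\<in>space lborel. dist (F i x) (0::'c) \<le> 2 * dist x 0)"
    by (rule borel_measurable_implies_sequence_metric) simp
  then obtain F where F: "\<And>i. simple_function lborel (F i)" "\<And>x. (\<lambda>i. F i x) \<longlonglongrightarrow> (x::'c)"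
      "\<And>i x. norm (F i x) \<le> 2 * norm x" by auto
  have Fm [measurable]: "F i \<in> borel_measurable borel" for i
    using borel_measurable_simple_function[OF F(1)[of i]] by simp
  define \<epsilon> where "\<epsilon> i = (\<integral>x. norm (w x) * norm (x - F i x) \<partial>lborel)" for i
  have eps: "\<epsilon> \<longlonglongrightarrow> (\<integral>(x::'c). 0 \<partial>lborel)"
    unfolding \<epsilon>_def
  proof (rule integral_dominated_convergence[where w="\<lambda>x. norm (w x) * (3 * norm x)"])
    show "integrable lborel (\<lambda>x. norm (w x) * (3 * norm x))"
    proof (rule integrable_by_jbracket[of _ 3 "2 * DIM('c)"])
      fix x :: 'c
      have "norm x \<le> jbracket x ^ 2" using norm_le_jbracket[of x] jbracket_power_mono[of 1 2 x] by simp
      then have "norm (w x) * (3 * norm x) \<le> norm (w x) * (3 * jbracket x ^ 2)" by (intro mult_left_mono) auto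
      also have "\<dots> = 3 / jbracket x ^ (2 * DIM('c))" unfolding w_def norm_of_real power_add by simp
      finally show "norm (norm (w x) * (3 * norm x)) \<le> 3 / jbracket x ^ (2 * DIM('c))" by simp
    qed auto
    show "AE x in lborel. (\<lambda>i. norm (w x) * norm (x - F i x)) \<longlonglongrightarrow> 0"
    proof (rule AE_I2)
      fix x
      have "(\<lambda>i. norm (w x) * norm (x - F i x)) \<longlonglongrightarrow> norm (w x) * norm (x - x)" by (intro tendsto_intros F(2))
      then show "(\<lambda>i. norm (w x) * norm (x - F i x)) \<longlonglongrightarrow> 0" by simp
    qed
    show "AE x in lborel. norm (norm (w x) * norm (x - F i x)) \<le> norm (w x) * (3 * norm x)" for i
    proof (rule AE_I2)
      fix x
      have "norm (x - F i x) \<le> 3 * norm x" using F(3)[of i x] norm_triangle_ineq4[of x "F i x"] by linarith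
      then show "norm (norm (w x) * norm (x - F i x)) \<le> norm (w x) * (3 * norm x)" by (simp add: mult_left_mono)
    qed
  qed auto
  define c where "c i y = (\<integral>x. indicator (F i -` {y} \<inter> space lborel) x * w x \<partial>lborel)" for i y
  define S where "S i \<xi> = (\<Sum>y\<in>F i ` space lborel. (c i y * \<theta> y) * (wave (A y) \<xi> * m \<xi>))" for i \<xi>
  define J where "J \<xi> = (\<integral>x. \<phi> x * wave x \<xi> \<partial>lborel)" for \<xi>
  have Jinv: "inv_fourier \<phi> \<xi> = of_real (fconst TYPE('c)) * J \<xi>" for \<xi>
    unfolding inv_fourier_eq J_def by (simp add: wave_commute)
  have waveS: "(\<lambda>\<xi>. wave y \<xi> * m \<xi>) \<in> schwartz" for y by (rule schwartz_wave[OF m])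
  have S_schw: "S i \<in> schwartz" for i
    unfolding S_def[abs_def] by (intro schwartz_sum schwartz_cmult waveS)
  obtain K where K: "1 \<le> K" "\<And>b. b \<in> Basis \<Longrightarrow> (\<Sum>c\<in>Basis. \<bar>A' b \<bullet> c\<bar>) \<le> K"
    using affine_constant[OF A'] by blast
  have invS: "inv_fourier \<phi> \<in> schwartz" by (rule inv_fourier_schwartz[OF \<phi>])
  have "(\<lambda>\<xi>. inv_fourier \<phi> (0 + A' \<xi>) * m \<xi>) \<in> schwartz"
  proof (rule schwartz_mult_poly[OF _ m])
    fix k
    obtain D where "sb k 0 D (inv_fourier \<phi>)" using schwartz_sb[OF invS] by blast
    then have "dbound k (\<lambda>x. D) (inv_fourier \<phi>)" by (simp add: sb_def)
    from dbound_affine[OF A' K this, of 0]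
    have "dbound k (\<lambda>x. (K ^ k * D) * jbracket x ^ 0) (\<lambda>\<xi>. inv_fourier \<phi> (0 + A' \<xi>))" by simp
    then show "\<exists>E n. dbound k (\<lambda>x. E * jbracket x ^ n) (\<lambda>\<xi>. inv_fourier \<phi> (0 + A' \<xi>))" by blast
  qed
  then show JS: "(\<lambda>\<xi>. inv_fourier \<phi> (A' \<xi>) * m \<xi>) \<in> schwartz" by simp
  have JmS: "(\<lambda>\<xi>. J (A' \<xi>) * m \<xi>) \<in> schwartz"
    using schwartz_cmult[OF JS, of "1 / of_real (fconst TYPE('c))"] unfolding Jinv by simp
  have vS: "v (S i) = (\<integral>x. w x * (\<theta> (F i x) * U (F i x)) \<partial>lborel)" for i
  proof -
    have "v (S i) = (\<Sum>y\<in>F i ` space lborel. v (\<lambda>\<xi>. (c i y * \<theta> y) * (wave (A y) \<xi> * m \<xi>)))"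
      unfolding S_def[abs_def] by (intro tempered_sum[OF v] schwartz_cmult waveS)
    also have "\<dots> = (\<Sum>y\<in>F i ` space lborel. c i y * (\<theta> y * U y))"
      unfolding tempered_cmult[OF v waveS] U_def by (simp only: mult.assoc)
    also have "\<dots> = (\<integral>x. w x * (\<theta> (F i x) * U (F i x)) \<partial>lborel)"
      unfolding c_def by (rule integral_simple_function[OF F(1) iw, where G="\<lambda>y. \<theta> y * U y"])
    finally show ?thesis .
  qed
  have lim1: "(\<lambda>i. v (S i)) \<longlonglongrightarrow> (\<integral>x. w x * (\<theta> x * U x) \<partial>lborel)"
    unfolding vS
  proof (rule integral_dominated_convergence[where w="\<lambda>x. norm (w x) * (B * C)"])
    show "AE x in lborel. (\<lambda>i. w x * (\<theta> (F i x) * U (F i x))) \<longlonglongrightarrow> w x * (\<theta> x * U x)"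
      by (intro AE_I2 tendsto_intros continuous_on_tendsto_compose[OF contU F(2)]
        continuous_on_tendsto_compose[OF smooth_continuous[OF schwartz_smooth[OF th], of UNIV] F(2)]) auto
    show "AE x in lborel. norm (w x * (\<theta> (F i x) * U (F i x))) \<le> norm (w x) * (B * C)" for i
      using thU by (intro AE_I2) (simp add: norm_mult mult_left_mono)
  qed (use iwn in auto)
  obtain Cv Nv where V: "0 \<le> Cv" "\<And>\<phi> B. \<phi> \<in> schwartz \<Longrightarrow> sb Nv Nv B \<phi> \<Longrightarrow> norm (v \<phi>) \<le> Cv * B"
    by (rule tempered_bound[OF v]) blast
  obtain Q where Q: "0 \<le> Q" "\<And>F. F \<in> borel_measurable borel \<Longrightarrow> (\<forall>x. norm (F x) \<le> 2 * norm x) \<Longrightarrow>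
    dbound Nv (\<lambda>\<xi>. (Q * (\<integral>x. norm (w x) * norm (x - F x) \<partial>lborel)) * jbracket \<xi> ^ 1)
      (\<lambda>\<xi>. \<integral>x. w x * (\<theta> x * wave x \<xi> - \<theta> (F x) * wave (F x) \<xi>) \<partial>lborel)"
    using quantization_dbound[OF th, of Nv] unfolding w_def by blast
  obtain R where R: "0 < R" "\<And>\<xi>. norm (A' \<xi>) \<le> norm \<xi> * R" using bounded_linear.pos_bounded[OF A'] by blast
  have jA: "jbracket (A' \<xi>) \<le> (1 + R) * jbracket \<xi> ^ 1" for \<xi>
  proof -
    have "norm \<xi> * R \<le> jbracket \<xi> * R" using norm_le_jbracket[of \<xi>] R(1) by simp
    then show ?thesis
      using jbracket_le_1_plus_norm[of "A' \<xi>"] R(2)[of \<xi>] jbracket_ge_1[of \<xi>] by (simp add: algebra_simps)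
  qed
  \<comment> \<open>One additional order of decay of m absorbs the linear growth in \<xi> of the
    quantisation error.\<close>
  obtain Bm where Bm: "sb Nv (Nv + 1) Bm m" using schwartz_sb[OF m] by blast
  have diff: "norm (v (\<lambda>\<xi>. J (A' \<xi>) * m \<xi>) - v (S i)) \<le> (Cv * (2 ^ Nv * (K ^ Nv * Q * (1 + R)) * Bm)) * \<epsilon> i" for i
  proof -
    let ?H = "\<lambda>\<xi>. \<integral>x. w x * (\<theta> x * wave x \<xi> - \<theta> (F i x) * wave (F i x) \<xi>) \<partial>lborel"
    have e0: "0 \<le> \<epsilon> i" unfolding \<epsilon>_def by simp
    have "J (A' \<xi>) * m \<xi> - S i \<xi> = ?H (0 + A' \<xi>) * m \<xi>" for \<xi>
    proof -
      obtain B' where B': "\<And>x. norm (\<theta> x) \<le> B'" using schwartz_sb[OF th, of 0 0] by (auto simp: sb_def)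
      have "integrable lborel (\<lambda>x. w x * (\<theta> (F i x) * wave (F i x) (A' \<xi>)))"
      proof (rule Bochner_Integration.integrable_bound)
        show "integrable lborel (\<lambda>x. norm (w x) * B')" using iw by simp
        show "AE x in lborel. norm (w x * (\<theta> (F i x) * wave (F i x) (A' \<xi>))) \<le> norm (norm (w x) * B')"
        proof (rule AE_I2)
          fix x
          have "norm (\<theta> (F i x)) \<le> \<bar>B'\<bar>" using B'[of "F i x"] by linarith
          then show "norm (w x * (\<theta> (F i x) * wave (F i x) (A' \<xi>))) \<le> norm (norm (w x) * B')"
            by (simp add: norm_mult abs_mult mult_left_mono)
        qed
      qed auto
      moreover have "integrable lborel (\<lambda>x. w x * (\<theta> x * wave x (A' \<xi>)))"
        using integrable_wave[OF schwartz_integrable[OF \<phi>], of "\<lambda>x. x" "A' \<xi>"]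
        by (simp add: mult.assoc[symmetric] wth)
      moreover have "J (A' \<xi>) = (\<integral>x. w x * (\<theta> x * wave x (A' \<xi>)) \<partial>lborel)"
        unfolding J_def wth[symmetric] by (simp add: mult.assoc)
      moreover have "S i \<xi> = (\<integral>x. w x * (\<theta> (F i x) * wave (F i x) (A' \<xi>)) \<partial>lborel) * m \<xi>"
        unfolding S_def integral_simple_function[OF F(1) iw, where G="\<lambda>y. \<theta> y * wave y (A' \<xi>)", symmetric] c_def
        by (simp add: sum_distrib_right wW mult.assoc)
      ultimately show ?thesis by (simp add: right_diff_distrib left_diff_distrib)
    qed
    then have e: "(\<lambda>\<xi>. J (A' \<xi>) * m \<xi> - S i \<xi>) = (\<lambda>\<xi>. ?H (0 + A' \<xi>) * m \<xi>)" by blast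
    have "dbound Nv (\<lambda>\<xi>. K ^ Nv * ((Q * \<epsilon> i) * jbracket (0 + A' \<xi>) ^ 1)) (\<lambda>\<xi>. ?H (0 + A' \<xi>))"
      unfolding \<epsilon>_def using F(3) by (intro dbound_affine[OF A' K] Q Fm) auto
    then have "dbound Nv (\<lambda>\<xi>. (K ^ Nv * Q * (1 + R) * \<epsilon> i) * jbracket \<xi> ^ 1) (\<lambda>\<xi>. ?H (0 + A' \<xi>))"
    proof (rule dbound_mono)
      fix \<xi>
      have "(K ^ Nv * Q * \<epsilon> i) * jbracket (A' \<xi>) \<le> (K ^ Nv * Q * \<epsilon> i) * ((1 + R) * jbracket \<xi> ^ 1)"
        using K(1) Q(1) e0 by (intro mult_left_mono jA) auto
      then show "K ^ Nv * ((Q * \<epsilon> i) * jbracket (0 + A' \<xi>) ^ 1) \<le> (K ^ Nv * Q * (1 + R) * \<epsilon> i) * jbracket \<xi> ^ 1"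
        by (simp add: mult_ac)
    qed
    from sb_mult_poly[OF this Bm]
    have "sb Nv Nv (2 ^ Nv * (K ^ Nv * Q * (1 + R) * \<epsilon> i) * Bm) (\<lambda>\<xi>. J (A' \<xi>) * m \<xi> - S i \<xi>)" unfolding e .
    from V(2)[OF schwartz_diff[OF JmS S_schw] this] show ?thesis
      unfolding tempered_diff[OF v JmS S_schw] by (simp only: mult_ac)
  qed
  have "(\<lambda>i. v (\<lambda>\<xi>. J (A' \<xi>) * m \<xi>) - v (S i)) \<longlonglongrightarrow> 0"
  proof (rule Lim_null_comparison)
    show "eventually (\<lambda>i. norm (v (\<lambda>\<xi>. J (A' \<xi>) * m \<xi>) - v (S i)) \<le> (Cv * (2 ^ Nv * (K ^ Nv * Q * (1 + R)) * Bm)) * \<epsilon> i) sequentially"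
      using diff by simp
    show "(\<lambda>i. (Cv * (2 ^ Nv * (K ^ Nv * Q * (1 + R)) * Bm)) * \<epsilon> i) \<longlonglongrightarrow> 0"
      using tendsto_mult[OF tendsto_const eps] by simp
  qed
  from tendsto_diff[OF tendsto_const[of "v (\<lambda>\<xi>. J (A' \<xi>) * m \<xi>)"] this]
  have "(\<lambda>i. v (S i)) \<longlonglongrightarrow> v (\<lambda>\<xi>. J (A' \<xi>) * m \<xi>)" by simp
  then have "v (\<lambda>\<xi>. J (A' \<xi>) * m \<xi>) = (\<integral>x. w x * (\<theta> x * U x) \<partial>lborel)"
    using lim1 by (rule LIMSEQ_unique)
  then have "v (\<lambda>\<xi>. J (A' \<xi>) * m \<xi>) = (\<integral>x. \<phi> x * v (\<lambda>\<xi>. wave (A x) \<xi> * m \<xi>) \<partial>lborel)"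
    by (simp add: wth U_def flip: mult.assoc)
  moreover have "v (\<lambda>\<xi>. inv_fourier \<phi> (A' \<xi>) * m \<xi>) = of_real (fconst TYPE('c)) * v (\<lambda>\<xi>. J (A' \<xi>) * m \<xi>)"
    using tempered_cmult[OF v JmS, of "of_real (fconst TYPE('c))"] unfolding Jinv by (simp add: mult.assoc)
  ultimately show "v (\<lambda>\<xi>. inv_fourier \<phi> (A' \<xi>) * m \<xi>) = of_real (fconst TYPE('c)) * (\<integral>x. \<phi> x * v (\<lambda>\<xi>. wave (A x) \<xi> * m \<xi>) \<partial>lborel)"
    by simp
qed

subsection \<open>The frequency-localized pieces\<close>

lemma norm_gt_imp_coord:
  fixes x k :: "'a::euclidean_space"
  assumes "norm k + real DIM('a) * r < norm x"
  obtains b where "b \<in> Basis" "r \<le> \<bar>(x - k) \<bullet> b\<bar>"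
proof (rule ccontr)
  assume n: "\<not> thesis"
  have "\<not> r \<le> \<bar>(x - k) \<bullet> b\<bar>" if b: "b \<in> Basis" for b
    using n b \<open>\<And>b. b \<in> Basis \<Longrightarrow> r \<le> \<bar>(x - k) \<bullet> b\<bar> \<Longrightarrow> thesis\<close> by blast
  then have "\<bar>(x - k) \<bullet> b\<bar> \<le> r" if "b \<in> Basis" for b using that by fastforce
  then have "(\<Sum>b\<in>Basis. \<bar>(x - k) \<bullet> b\<bar>) \<le> real DIM('a) * r"
    using sum_mono[of Basis "\<lambda>b. \<bar>(x - k) \<bullet> b\<bar>" "\<lambda>_. r"] by simp
  then show False using assms norm_le_l1[of "x - k"] norm_triangle_ineq2[of x k] by linarith
qed

context decomposition
begin

text \<open>If the difference d is nonzero at \<open>x0\<close>, a nonnegative bump concentrated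
  where d stays within half of |d x0| of its value at \<open>x0\<close> is forced to have integral
  0. The bump is continuous and equals 1 at \<open>x0\<close>, a contradiction.\<close>

lemma represents_unique:
  fixes g g' :: "'a::euclidean_space \<Rightarrow> complex"
  assumes g: "smooth g" "represents g u" and g': "smooth g'" "represents g' u"
  shows "g = g'"
proof (rule ccontr)
  assume "g \<noteq> g'"
  then obtain x0 where x0: "g x0 \<noteq> g' x0" by blast
  define d where "d x = g x - g' x" for x
  have cd: "continuous_on UNIV d" unfolding d_def by (intro continuous_intros smooth_continuous g g')
  have d0: "0 < norm (d x0) / 2" using x0 by (simp add: d_def)
  obtain \<delta> where \<delta>: "0 < \<delta>" "\<And>x. dist x x0 < \<delta> \<Longrightarrow> dist (d x) (d x0) < norm (d x0) / 2"
    using cd d0 unfolding continuous_on_iff by (metis UNIV_I)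
  \<comment> \<open>The bump lives where all coordinates of x - x0 are below 2/R in modulus; there
    |x - x0| is at most DIM times 2/R, which is \<delta>/2.\<close>
  define R where "R = 4 * real DIM('a) / \<delta>"
  have R: "0 < R" using \<delta>(1) by (simp add: R_def)
  define \<phi> :: "'a \<Rightarrow> real" where "\<phi> x = (\<Prod>b\<in>Basis. \<eta> (0 + R * ((x - x0) \<bullet> b)))" for x
  have sm: "smooth \<phi>" unfolding \<phi>_def[abs_def] by (rule smooth_coord_prod) (rule smooth_eta_affine)
  have nn: "0 \<le> \<phi> x" for x unfolding \<phi>_def by (intro prod_nonneg ballI eta_nonneg)
  have far: "\<phi> x = 0" if x: "\<delta> \<le> dist x x0" for x
  proof -
    have "real DIM('a) * (2 / R) = \<delta> / 2" using \<delta>(1) by (simp add: R_def)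
    then have "norm (0::'a) + real DIM('a) * (2 / R) < norm (x - x0)" using x \<delta>(1) by (simp add: dist_norm)
    then obtain b where b: "b \<in> Basis" "2 / R \<le> \<bar>(x - x0 - 0) \<bullet> b\<bar>" by (rule norm_gt_imp_coord)
    have "2 \<le> \<bar>0 + R * ((x - x0) \<bullet> b)\<bar>" using b(2) R by (simp add: abs_mult field_simps)
    then have "\<eta> (0 + R * ((x - x0) \<bullet> b)) = 0" by (rule eta_0)
    then show ?thesis unfolding \<phi>_def using b(1) by (auto simp: prod_zero_iff)
  qed
  have S: "(\<lambda>x. complex_of_real (\<phi> x)) \<in> schwartz"
  proof (rule schwartz_compact_support[of _ "norm x0 + \<delta>"])
    fix x :: 'a assume "norm x0 + \<delta> < norm x"
    then have "\<delta> \<le> dist x x0" using norm_triangle_ineq2[of x x0] by (simp add: dist_norm)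
    then show "complex_of_real (\<phi> x) = 0" using far by simp
  qed (use \<delta>(1) smooth_of_real[OF sm] in auto)
  have i\<phi>: "integrable lborel (\<lambda>x. complex_of_real (\<phi> x))" by (rule schwartz_integrable[OF S])
  from integrable_Re[OF this] have ir: "integrable lborel \<phi>" by simp
  have "integrable lborel (\<lambda>x. g x * \<phi> x)" "integrable lborel (\<lambda>x. g' x * \<phi> x)"
      "(\<integral>x. g x * \<phi> x \<partial>lborel) = (\<integral>x. g' x * \<phi> x \<partial>lborel)"
    using g(2) g'(2) S unfolding represents_def by auto
  then have d: "integrable lborel (\<lambda>x. d x * \<phi> x)" "(\<integral>x. d x * \<phi> x \<partial>lborel) = 0"
    unfolding d_def by (auto simp: left_diff_distrib)
  have "d x0 * of_real (\<integral>x. \<phi> x \<partial>lborel) = - (\<integral>x. (d x - d x0) * \<phi> x \<partial>lborel)"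
    using d i\<phi> by (simp add: left_diff_distrib)
  then have "norm (d x0) * (\<integral>x. \<phi> x \<partial>lborel) = norm (\<integral>x. (d x - d x0) * \<phi> x \<partial>lborel)"
    using nn by (metis norm_mult norm_minus_cancel norm_of_real abs_of_nonneg Bochner_Integration.integral_nonneg)
  also have "\<dots> \<le> (\<integral>x. (norm (d x0) / 2) * \<phi> x \<partial>lborel)"
  proof (rule Bochner_Integration.integral_norm_bound_integral)
    show "integrable lborel (\<lambda>x. (d x - d x0) * \<phi> x)" using d i\<phi> by (simp add: left_diff_distrib)
    show "integrable lborel (\<lambda>x. norm (d x0) / 2 * \<phi> x)" using ir by simp
    show "norm ((d x - d x0) * \<phi> x) \<le> norm (d x0) / 2 * \<phi> x" for x
    proof (cases "dist x x0 < \<delta>")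
      case True
      then have "norm (d x - d x0) \<le> norm (d x0) / 2" using \<delta>(2)[OF True] by (simp add: dist_norm)
      from mult_right_mono[OF this nn[of x]] show ?thesis using nn[of x] by (simp add: norm_mult)
    qed (use far in auto)
  qed
  also have "\<dots> = norm (d x0) / 2 * (\<integral>x. \<phi> x \<partial>lborel)" by simp
  finally have "norm (d x0) / 2 * (\<integral>x. \<phi> x \<partial>lborel) \<le> 0" by (simp add: mult.commute)
  then have "(\<integral>x. \<phi> x \<partial>lborel) \<le> 0" using d0 by (simp add: mult_le_0_iff)
  moreover have "0 \<le> (\<integral>x. \<phi> x \<partial>lborel)" by (intro Bochner_Integration.integral_nonneg nn)
  ultimately have "(\<integral>x. \<phi> x \<partial>lborel) = 0" by (rule antisym)
  then have "AE x in lborel. \<phi> x = 0" using integral_nonneg_eq_0_iff_AE[OF ir] nn by simp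
  then have "{x \<in> space lborel. \<not> \<phi> x = 0} \<in> null_sets lborel"
    by (subst (asm) AE_iff_null) (use borel_measurable_integrable[OF ir] in measurable)
  then have "negligible {x. \<phi> x \<noteq> 0}" by (simp add: negligible_iff_null_sets null_sets_completionI)
  moreover have "open {x. \<phi> x \<noteq> 0}"
    by (intro open_Collect_neq smooth_continuous sm continuous_on_const)
  moreover have "\<phi> x0 = 1" unfolding \<phi>_def by (intro prod.neutral) (simp add: eta_1)
  ultimately show False using open_not_negligible[of "{x. \<phi> x \<noteq> 0}"] by force
qed

lemma psi_schwartz: "k \<in> lattice_pts \<Longrightarrow> (\<lambda>\<xi>. of_real (psi \<eta> (k::'a::euclidean_space) \<xi>)) \<in> schwartz"
proof (rule schwartz_compact_support[of _ "norm k + real DIM('a) * 1"])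
  assume k: "k \<in> lattice_pts"
  show "smooth (\<lambda>\<xi>. complex_of_real (psi \<eta> k \<xi>))" by (intro smooth_of_real psi_smooth k)
  fix x :: 'a assume "norm k + real DIM('a) * 1 < norm x"
  then obtain b where "b \<in> Basis" "1 \<le> \<bar>(x - k) \<bullet> b\<bar>" by (rule norm_gt_imp_coord)
  then show "complex_of_real (psi \<eta> k x) = 0" using psi_support[OF k] by simp
qed auto

lemma chi_schwartz: "(\<lambda>\<xi>. of_real (chi (k::'a::euclidean_space) \<xi>)) \<in> schwartz"
proof (rule schwartz_compact_support[of _ "norm k + real DIM('a) * 2"])
  show "smooth (\<lambda>\<xi>. complex_of_real (chi k \<xi>))" by (intro smooth_of_real chi_smooth)
  fix x :: 'a assume "norm k + real DIM('a) * 2 < norm x"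
  then obtain b where "b \<in> Basis" "2 \<le> \<bar>(x - k) \<bullet> b\<bar>" by (rule norm_gt_imp_coord)
  then show "complex_of_real (chi k x) = 0" using chi_support by simp
qed auto

end

text \<open>Up to a constant this is the inverse transform of m at x - y, the convolution kernel of
  the multiplier m. Writing it as a Fourier transform in y makes it a test function whose inverse
  transform is explicit.\<close>

definition kern :: "('a::euclidean_space \<Rightarrow> complex) \<Rightarrow> 'a \<Rightarrow> 'a \<Rightarrow> complex" where
  "kern m x = fourier (\<lambda>\<xi>. of_real (fconst TYPE('a)) * (wave x \<xi> * m \<xi>))"

lemma kern_schwartz: "m \<in> schwartz \<Longrightarrow> kern m x \<in> schwartz"
  unfolding kern_def by (intro fourier_schwartz schwartz_cmult schwartz_wave)

lemma inv_fourier_kern: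
  "m \<in> schwartz \<Longrightarrow> inv_fourier (kern m x) \<xi> = of_real (fconst TYPE('a)) * (wave x \<xi> * m (\<xi>::'a::euclidean_space))"
  unfolding kern_def by (rule fourier_inversion) (intro schwartz_cmult schwartz_wave)

text \<open>Translating the multiplier by k multiplies the kernel by a phase, so one decay bound
  serves every k.\<close>

lemma kern_bound:
  assumes "m \<in> schwartz"
  shows "\<exists>K\<ge>0. \<forall>k x y. norm (kern (\<lambda>\<xi>. m (\<xi> - k)) x y) \<le> K / jbracket (x - y :: 'a::euclidean_space) ^ N"
proof -
  obtain B where B: "sb 0 N B (inv_fourier m)" using schwartz_sb[OF inv_fourier_schwartz[OF assms]] by blast
  have [measurable]: "m \<in> borel_measurable borel" by (rule schwartz_borel[OF assms])
  have e: "norm (kern (\<lambda>\<xi>. m (\<xi> - k)) x y) = fconst TYPE('a) * norm (inv_fourier m (x - y))" for k x y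
  proof -
    have "kern (\<lambda>\<xi>. m (\<xi> - k)) x y = of_real (fconst TYPE('a)) * (of_real (fconst TYPE('a)) * (\<integral>\<xi>. m (\<xi> - k) * wave (x - y) \<xi> \<partial>lborel))"
      unfolding kern_def fourier_cmult fourier_eq
      using wave_add[of x "- y"] by (simp add: wave_commute[of "- _" y] wave_minus_right mult_ac)
    also have "(\<integral>\<xi>. m (\<xi> - k) * wave (x - y) \<xi> \<partial>lborel) = (\<integral>\<xi>. m (k + \<xi> - k) * wave (x - y) (k + \<xi>) \<partial>lborel)"
      by (rule lborel_integral_shift[symmetric]) measurable
    also have "\<dots> = wave (x - y) k * (\<integral>\<xi>. m \<xi> * wave (x - y) \<xi> \<partial>lborel)"
      by (simp add: wave_add_right mult_ac flip: integral_mult_right_zero)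
    finally show ?thesis unfolding inv_fourier_eq by (simp add: norm_mult less_imp_le)
  qed
  show ?thesis
  proof (intro exI[of _ "fconst TYPE('a) * B"] conjI allI)
    show "0 \<le> fconst TYPE('a) * B" using sb_nonneg[OF B] by (simp add: less_imp_le)
    show "norm (kern (\<lambda>\<xi>. m (\<xi> - k)) x y) \<le> fconst TYPE('a) * B / jbracket (x - y) ^ N" for k x y
      unfolding e using mult_left_mono[OF sb_norm[OF B, of "x - y"], of "fconst TYPE('a)"] by (simp add: less_imp_le)
  qed
qed

context decomposition
begin

section \<open>Formulas for the pieces and for their restrictions\<close>

abbreviation psic :: "'a::euclidean_space \<Rightarrow> 'a \<Rightarrow> complex" where
  "psic k \<equiv> \<lambda>\<xi>. of_real (psi \<eta> k \<xi>)"

abbreviation chic :: "'a::euclidean_space \<Rightarrow> 'a \<Rightarrow> complex" where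
  "chic k \<equiv> \<lambda>\<xi>. of_real (chi k \<xi>)"

lemma box_dist_eq:
  assumes "k \<in> lattice_pts" "\<phi> \<in> schwartz"
  shows "box_dist \<eta> k f \<phi> = dist_fourier f (\<lambda>\<xi>. inv_fourier \<phi> \<xi> * psic k \<xi>)"
  using assms inv_fourier_schwartz[OF assms(2)]
  by (simp add: box_dist_def dist_inv_fourier_def dist_mult_def on_schwartz_def mult.commute)

text \<open>The proposed function is smooth by \<open>tempered_wave_smooth\<close>, and it
  represents the distribution by the interchange theorem with both maps the identity. Uniqueness of
  smooth representatives then evaluates the description in \<open>box\<close>.\<close>

lemma box_eq:
  assumes f: "f \<in> tempered" and k: "k \<in> lattice_pts"
  shows "box \<eta> k f = (\<lambda>x::'a::euclidean_space. of_real (fconst TYPE('a)) * dist_fourier f (\<lambda>\<xi>. wave x \<xi> * psic k \<xi>))" (is "_ = ?g")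
    and "represents (box \<eta> k f) (box_dist \<eta> k f)"
    and "smooth (box \<eta> k f)"
proof -
  have v: "dist_fourier f \<in> tempered" by (rule dist_fourier_tempered[OF f])
  have sm: "smooth ?g" by (intro smooth_mult smooth_const tempered_wave_smooth v psi_schwartz k)
  have re: "represents ?g (box_dist \<eta> k f)"
    unfolding represents_def
  proof (intro ballI conjI)
    fix \<phi> :: "'a \<Rightarrow> complex" assume p: "\<phi> \<in> schwartz"
    note I = tempered_integral_interchange[where A="\<lambda>x. x" and A'="\<lambda>x. x", OF v psi_schwartz[OF k] p bounded_linear_ident order_refl bounded_linear_ident refl]
    show "integrable lborel (\<lambda>x. ?g x * \<phi> x)" using integrable_mult_right[OF I(1), of "of_real (fconst TYPE('a))"] by (simp add: mult_ac)
    show "box_dist \<eta> k f \<phi> = (\<integral>x. ?g x * \<phi> x \<partial>lborel)"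
      unfolding box_dist_eq[OF k p] I(2) by (simp add: mult_ac flip: integral_mult_right_zero)
  qed
  have "box \<eta> k f = ?g"
    unfolding box_def by (rule the_equality) (use sm re represents_unique in auto)
  then show "box \<eta> k f = ?g" "represents (box \<eta> k f) (box_dist \<eta> k f)" "smooth (box \<eta> k f)"
    using sm re by auto
qed

text \<open>As a value of f on a Schwartz function, a piece at a fixed point is within reach of the
  weak convergence of the trace series.\<close>

lemma box_eq_kern:
  assumes f: "f \<in> tempered" and k: "k \<in> lattice_pts"
  shows "box \<eta> k f x = f (kern (psic k) x)"
proof -
  have S: "(\<lambda>\<xi>. wave x \<xi> * psic k \<xi>) \<in> schwartz" by (intro schwartz_wave psi_schwartz k)
  show ?thesis unfolding box_eq(1)[OF f k] kern_def fourier_cmult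
    using S by (simp add: dist_fourier_def on_schwartz_def tempered_cmult[OF f fourier_schwartz[OF S]])
qed

lemma box_growth:
  assumes f: "f \<in> tempered" and k: "k \<in> lattice_pts"
  obtains C N where "0 \<le> C" "\<And>x. norm (box \<eta> k f (x::'a::euclidean_space)) \<le> C * jbracket x ^ N"
proof -
  obtain C N where C: "0 \<le> C" "\<And>x. norm (dist_fourier f (\<lambda>\<xi>. wave x \<xi> * psic k \<xi>)) \<le> C * jbracket x ^ N"
    by (rule tempered_wave_growth[OF dist_fourier_tempered[OF f] psi_schwartz[OF k]]) blast
  show ?thesis
  proof (rule that[of "fconst TYPE('a) * C" N])
    show "norm (box \<eta> k f x) \<le> fconst TYPE('a) * C * jbracket x ^ N" for x
      unfolding box_eq[OF f k] using mult_left_mono[OF C(2)[of x], of "fconst TYPE('a)"] by (simp add: norm_mult less_imp_le mult_ac)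
  qed (use C in \<open>simp add: less_imp_le\<close>)
qed

lemma box_integral:
  assumes f: "f \<in> tempered" and k: "k \<in> lattice_pts" and p: "\<phi> \<in> schwartz"
  shows "integrable lborel (\<lambda>x. box \<eta> k f x * \<phi> x)"
    and "(\<integral>x. box \<eta> k f x * \<phi> x \<partial>lborel) = dist_fourier f (\<lambda>\<xi>. inv_fourier \<phi> \<xi> * psic k \<xi>)"
  using box_eq(2)[OF f k] p box_dist_eq[OF k p] unfolding represents_def by auto

text \<open>Testing against the kernel of \<open>chi k\<close> multiplies the spectrum by
  \<open>chi k\<close>, which is 1 on the support of \<open>psi \<eta> k\<close>.\<close>

lemma box_reproducing:
  assumes f: "f \<in> tempered" and k: "k \<in> lattice_pts"
  shows "integrable lborel (\<lambda>y. box \<eta> k f y * kern (chic k) x y)"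
    and "box \<eta> k f x = (\<integral>y. box \<eta> k f y * kern (chic k) x y \<partial>lborel)"
proof -
  have c: "kern (chic k) x \<in> schwartz" by (rule kern_schwartz[OF chi_schwartz])
  show "integrable lborel (\<lambda>y. box \<eta> k f y * kern (chic k) x y)" by (rule box_integral(1)[OF f k c])
  have S: "(\<lambda>\<xi>. wave x \<xi> * psic k \<xi>) \<in> schwartz" by (intro schwartz_wave psi_schwartz k)
  have "(\<integral>y. box \<eta> k f y * kern (chic k) x y \<partial>lborel) = dist_fourier f (\<lambda>\<xi>. of_real (fconst TYPE('a)) * (wave x \<xi> * psic k \<xi>))"
    unfolding box_integral(2)[OF f k c] inv_fourier_kern[OF chi_schwartz]
  proof (intro arg_cong[where f="dist_fourier f"] ext)
    fix \<xi>
    have "psic k \<xi> * chic k \<xi> = psic k \<xi>" using psi_mult_chi[OF k, of \<xi>] by (metis of_real_mult)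
    then show "of_real (fconst TYPE('a)) * (wave x \<xi> * chic k \<xi>) * psic k \<xi> = of_real (fconst TYPE('a)) * (wave x \<xi> * psic k \<xi>)"
      by (metis mult.assoc mult.commute)
  qed
  also have "\<dots> = box \<eta> k f x"
    unfolding box_eq(1)[OF f k] by (rule tempered_cmult[OF dist_fourier_tempered[OF f] S])
  finally show "box \<eta> k f x = (\<integral>y. box \<eta> k f y * kern (chic k) x y \<partial>lborel)" by simp
qed

text \<open>The interchange theorem for the inclusion of the hyperplane, whose adjoint is
  \<open>fst\<close>. The quotient of constants appears because the piece is normalised on the
  product space and the inverse transform of \<phi> on the hyperplane.\<close>

lemma trace_integral:
  fixes f :: "('a::euclidean_space \<times> real) functional"
  assumes f: "f \<in> tempered" and l: "l \<in> lattice_pts" and p: "\<phi> \<in> schwartz"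
  shows "integrable lborel (\<lambda>x. box \<eta> l f (x, 0) * \<phi> x)"
    and "(\<integral>x. box \<eta> l f (x, 0) * \<phi> x \<partial>lborel) =
      of_real (fconst TYPE('a \<times> real) / fconst TYPE('a)) * dist_fourier f (\<lambda>\<xi>. inv_fourier \<phi> (fst \<xi>) * psic l \<xi>)"
proof -
  have A: "bounded_linear (\<lambda>x::'a. (x, 0::real))" by (intro bounded_linear_Pair bounded_linear_ident bounded_linear_zero)
  have v: "dist_fourier f \<in> tempered" by (rule dist_fourier_tempered[OF f])
  note I = tempered_integral_interchange[where A="\<lambda>x. (x, 0::real)" and A'=fst, OF v psi_schwartz[OF l] p A _ bounded_linear_fst]
  have n: "norm (x, 0::real) \<le> norm x" for x :: 'a by (simp add: norm_Pair)
  have a: "(x, 0::real) \<bullet> \<xi> = x \<bullet> fst \<xi>" for x :: 'a and \<xi> by (simp add: inner_prod_def)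
  show "integrable lborel (\<lambda>x. box \<eta> l f (x, 0) * \<phi> x)"
    unfolding box_eq(1)[OF f l] using integrable_mult_right[OF I(1)[OF n a], of "of_real (fconst TYPE('a \<times> real))"] by (simp add: mult_ac)
  show "(\<integral>x. box \<eta> l f (x, 0) * \<phi> x \<partial>lborel) =
      of_real (fconst TYPE('a \<times> real) / fconst TYPE('a)) * dist_fourier f (\<lambda>\<xi>. inv_fourier \<phi> (fst \<xi>) * psic l \<xi>)"
    unfolding box_eq(1)[OF f l] I(2)[OF n a] by (simp add: mult_ac flip: integral_mult_right_zero)
qed

lemma psi_fst_support:
  fixes l :: "'a::euclidean_space \<times> real"
  assumes "l \<in> lattice_pts" "psi \<eta> l \<xi> \<noteq> 0"
  shows "psi \<eta> (fst l) (fst \<xi>) \<noteq> 0"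
  using assms psi_Pair[of "fst l" "snd l :: real" "fst \<xi>" "snd \<xi>"] lattice_Pair[of "fst l" "snd l"] by auto

lemma chi_eq_1_if_psi: "k \<in> lattice_pts \<Longrightarrow> psi \<eta> k \<xi> \<noteq> 0 \<Longrightarrow> chi k \<xi> = 1"
  using psi_mult_chi[of k \<xi>] by auto

text \<open>On the support of \<open>psi \<eta> l\<close> the first frequency lies where
  \<open>chi (fst l)\<close> is 1, so the test function may be cut off there on the Fourier side.
  This is the source of the decay in \<open>fst l\<close>.\<close>

lemma trace_localize:
  fixes f :: "('a::euclidean_space \<times> real) functional"
  assumes f: "f \<in> tempered" and l: "l \<in> lattice_pts" and p: "\<phi> \<in> schwartz"
  shows "(\<integral>x. box \<eta> l f (x, 0) * \<phi> x \<partial>lborel) =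
    (\<integral>x. box \<eta> l f (x, 0) * fourier (\<lambda>\<xi>. chic (fst l) \<xi> * inv_fourier \<phi> \<xi>) x \<partial>lborel)"
    and "fourier (\<lambda>\<xi>. chic (fst l) \<xi> * inv_fourier \<phi> \<xi>) \<in> schwartz"
proof -
  have S: "(\<lambda>\<xi>. chic (fst l) \<xi> * inv_fourier \<phi> \<xi>) \<in> schwartz"
    by (intro schwartz_mult chi_schwartz inv_fourier_schwartz p)
  then show S2: "fourier (\<lambda>\<xi>. chic (fst l) \<xi> * inv_fourier \<phi> \<xi>) \<in> schwartz" by (rule fourier_schwartz)
  have "inv_fourier \<phi> (fst \<xi>) * psic l \<xi> = inv_fourier (fourier (\<lambda>\<xi>. chic (fst l) \<xi> * inv_fourier \<phi> \<xi>)) (fst \<xi>) * psic l \<xi>" for \<xi>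
    unfolding fourier_inversion[OF S]
    using chi_eq_1_if_psi[of "fst l" "fst \<xi>"] psi_fst_support[OF l, of \<xi>] l lattice_Pair[of "fst l" "snd l"]
    by (cases "psi \<eta> l \<xi> = 0") auto
  then show "(\<integral>x. box \<eta> l f (x, 0) * \<phi> x \<partial>lborel) =
    (\<integral>x. box \<eta> l f (x, 0) * fourier (\<lambda>\<xi>. chic (fst l) \<xi> * inv_fourier \<phi> \<xi>) x \<partial>lborel)"
    unfolding trace_integral(2)[OF f l p] trace_integral(2)[OF f l S2] by presburger
qed

text \<open>The two cutoffs in the first frequency have supports of coordinate radius 1 around
  \<open>fst l\<close> and k, so at distance 2 in some coordinate their product vanishes.\<close>

lemma trace_vanish:
  fixes f :: "('a::euclidean_space \<times> real) functional"
  assumes f: "f \<in> tempered" and l: "l \<in> lattice_pts" and k: "k \<in> lattice_pts"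
    and far: "b \<in> Basis" "2 \<le> \<bar>(fst l - k) \<bullet> b\<bar>"
  shows "(\<integral>x. box \<eta> l f (x, 0) * kern (psic k) y x \<partial>lborel) = 0"
proof -
  have l1: "fst l \<in> lattice_pts" using l lattice_Pair[of "fst l" "snd l"] by simp
  have "psi \<eta> k (fst \<xi>) = 0 \<or> psi \<eta> l \<xi> = 0" for \<xi>
  proof (rule ccontr)
    assume a: "\<not> ?thesis"
    then have "psi \<eta> (fst l) (fst \<xi>) \<noteq> 0" using psi_fst_support[OF l] by blast
    then have "\<bar>(fst \<xi> - fst l) \<bullet> b\<bar> < 1" "\<bar>(fst \<xi> - k) \<bullet> b\<bar> < 1"
      using a psi_support[OF l1 far(1), of "fst \<xi>"] psi_support[OF k far(1), of "fst \<xi>"] by linarith+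
    then show False using far(2) unfolding inner_diff_left by linarith
  qed
  then have "(\<lambda>\<xi>. inv_fourier (kern (psic k) y) (fst \<xi>) * psic l \<xi>) = (\<lambda>\<xi>. 0)"
    unfolding inv_fourier_kern[OF psi_schwartz[OF k]] by (auto simp: fun_eq_iff)
  then show ?thesis unfolding trace_integral(2)[OF f l kern_schwartz[OF psi_schwartz[OF k]]]
    using tempered_zero[OF dist_fourier_tempered[OF f]] by simp
qed

end

subsection \<open>Powers of extended nonnegative reals\<close>

lemma epowr_ennreal: "0 \<le> r \<Longrightarrow> epowr (ennreal r) a = ennreal (r powr a)"
  by (simp add: epowr_def)

lemma epowr_top [simp]: "epowr top a = top"
  by (simp add: epowr_def)

lemma epowr_0 [simp]: "epowr 0 a = 0"
  using epowr_ennreal[of 0 a] by simp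

lemma epowr_1 [simp]: "epowr x 1 = x"
  by (cases x) (auto simp: epowr_ennreal)

lemma epowr_mono: "x \<le> y \<Longrightarrow> 0 \<le> a \<Longrightarrow> epowr x a \<le> epowr y a"
  by (cases x; cases y) (auto simp: epowr_ennreal top_unique intro!: ennreal_leI powr_mono2)

lemma epowr_eq_0: "epowr x a = 0 \<longleftrightarrow> x = 0"
  by (cases x) (auto simp: epowr_ennreal ennreal_eq_0_iff)

lemma epowr_eq_top: "epowr x a = top \<longleftrightarrow> x = top"
  by (cases x) (auto simp: epowr_ennreal)

lemma epowr_mult: "epowr (x * y) a = epowr x a * epowr y a"
proof (cases x)
  case x: (real r)
  show ?thesis
  proof (cases y)
    case (real s)
    then show ?thesis using x by (simp add: epowr_ennreal powr_mult flip: ennreal_mult)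
  next
    case top
    then show ?thesis using x by (cases "r = 0") (auto simp: epowr_ennreal ennreal_mult_top)
  qed
next
  case x: top
  show ?thesis
  proof (cases y)
    case (real s)
    then show ?thesis using x by (cases "s = 0") (auto simp: epowr_ennreal ennreal_top_mult)
  qed (use x in simp)
qed

lemma epowr_epowr: "epowr (epowr x a) b = epowr x (a * b)"
  by (cases x) (auto simp: epowr_ennreal powr_powr)

lemma epowr_inverse: "0 < a \<Longrightarrow> epowr (epowr x a) (1 / a) = x" "0 < a \<Longrightarrow> epowr (epowr x (1 / a)) a = x"
  by (simp_all add: epowr_epowr)

lemma epowr_add: "epowr x (a + b) = epowr x a * epowr x b"
  by (cases x) (auto simp: epowr_ennreal powr_add ennreal_mult')

lemma borel_measurable_epowr [measurable]:
  assumes [measurable]: "f \<in> borel_measurable M"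
  shows "(\<lambda>x. epowr (f x) a) \<in> borel_measurable M"
  unfolding epowr_def by measurable

text \<open>If y > \<epsilon>, write y = y^(1-t) y^t and use that y^(1-t) decreases in y. The free
  \<epsilon> is chosen later to balance the two terms, in place of Hoelder's inequality.\<close>

lemma epowr_young:
  assumes t: "1 \<le> t" and e: "0 < \<epsilon>"
  shows "y \<le> ennreal (\<epsilon> powr (1 - t)) * epowr y t + ennreal \<epsilon>"
proof (cases y)
  case (real r)
  show ?thesis
  proof (cases "r \<le> \<epsilon>")
    case True
    then show ?thesis using real by (intro add_increasing) (auto intro: ennreal_leI)
  next
    case False
    have "r = r powr (1 - t) * r powr t" using False e by (simp flip: powr_add)
    also have "\<dots> \<le> \<epsilon> powr (1 - t) * r powr t"
      using False e t by (intro mult_right_mono powr_mono2') auto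
    finally have "y \<le> ennreal (\<epsilon> powr (1 - t)) * epowr y t"
      using real by (simp add: epowr_ennreal flip: ennreal_mult)
    then show ?thesis by (intro add_increasing2) auto
  qed
next
  case top
  have "0 < \<epsilon> powr (1 - t)" using e by simp
  then have "ennreal (\<epsilon> powr (1 - t)) * top = top" by (simp add: ennreal_mult_top)
  then show ?thesis using top by simp
qed

section \<open>Sums as integrals and Lebesgue quasi-norms\<close>

lemma infsum_eq_nn_integral_count_space:
  fixes f :: "'i \<Rightarrow> ennreal"
  assumes A: "countable A"
  shows "infsum f A = (\<integral>\<^sup>+i. f i \<partial>count_space A)"
proof (cases "finite A")
  case True
  then show ?thesis by (simp add: nn_integral_count_space_finite)
next
  case False
  have b: "bij_betw (from_nat_into A) UNIV A" by (rule bij_betw_from_nat_into[OF A False])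
  have "infsum f A = infsum (f \<circ> from_nat_into A) UNIV"
    using infsum_reindex[of "from_nat_into A" UNIV f] b by (simp add: bij_betw_def)
  also have "\<dots> = (\<Sum>n. f (from_nat_into A n))"
  proof -
    have "(f \<circ> from_nat_into A) summable_on UNIV" by (rule nonneg_summable_on_complete) simp
    from has_sum_imp_sums[OF has_sum_infsum[OF this]] show ?thesis by (simp add: sums_iff comp_def)
  qed
  also have "\<dots> = (\<integral>\<^sup>+i. f i \<partial>count_space A)"
    by (simp add: nn_integral_bij_count_space[OF b, symmetric] nn_integral_count_space_nat)
  finally show ?thesis .
qed

text \<open>Covers the Lp norms, with Lebesgue measure, and the lq norms, with counting measure, so
  that homogeneity and Minkowski's inequality are proved once for both.\<close>

definition nlp :: "'x measure \<Rightarrow> real \<Rightarrow> ('x \<Rightarrow> ennreal) \<Rightarrow> ennreal" where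
  "nlp M t f = epowr (\<integral>\<^sup>+x. epowr (f x) t \<partial>M) (1 / t)"

lemma nlp_mono: "0 < t \<Longrightarrow> (\<And>x. x \<in> space M \<Longrightarrow> f x \<le> g x) \<Longrightarrow> nlp M t f \<le> nlp M t g"
  unfolding nlp_def by (intro epowr_mono nn_integral_mono) auto

lemma nlp_cmult:
  assumes "0 < t" "f \<in> borel_measurable M"
  shows "nlp M t (\<lambda>x. c * f x) = c * nlp M t f"
  unfolding nlp_def using assms
  by (simp add: epowr_mult nn_integral_cmult epowr_inverse)

text \<open>The device for exponents below 1: after passing to r-th powers with r <= t the exponent
  t / r is at least 1, and Minkowski's inequality applies.\<close>

lemma nlp_epowr: "0 < r \<Longrightarrow> 0 < t \<Longrightarrow> epowr (nlp M t f) r = nlp M (t / r) (\<lambda>x. epowr (f x) r)"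
  by (simp add: nlp_def epowr_epowr)

lemma Lp_norm_eq: "p \<noteq> \<infinity> \<Longrightarrow> Lp_norm p g = nlp lborel (enn2real p) (\<lambda>x. ennreal (norm (g x)))"
  by (simp add: Lp_norm_def nlp_def)

lemma lq_norm_eq: "q \<noteq> \<infinity> \<Longrightarrow> countable A \<Longrightarrow> lq_norm q A c = nlp (count_space A) (enn2real q) c"
  by (simp add: lq_norm_def nlp_def infsum_eq_nn_integral_count_space)

lemma nn_integral_count_space_eq_0:
  "(\<integral>\<^sup>+i. f i \<partial>count_space I) = 0 \<Longrightarrow> i \<in> I \<Longrightarrow> f i = (0::ennreal)"
  using nn_integral_ge_point[of i I f] by simp

text \<open>With s the sum of the r-th powers, every summand satisfies x = (x^r)^(1/r - 1) x^r <=
  s^(1/r - 1) x^r; summing gives at most s^(1/r).\<close>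

lemma epowr_subadditive:
  assumes r: "0 < r" "r \<le> 1"
  shows "epowr (\<integral>\<^sup>+i. x i \<partial>count_space I) r \<le> (\<integral>\<^sup>+i. epowr (x i) r \<partial>count_space I)"
proof (cases "(\<integral>\<^sup>+i. epowr (x i) r \<partial>count_space I)")
  case (real s)
  show ?thesis
  proof (cases "s = 0")
    case True
    then have "x i = 0" if "i \<in> I" for i
      using nn_integral_count_space_eq_0[where f="\<lambda>i. epowr (x i) r" and I=I and i=i] real that by (simp add: epowr_eq_0)
    then have "(\<integral>\<^sup>+i. x i \<partial>count_space I) = (\<integral>\<^sup>+i. 0 \<partial>count_space I)" by (intro nn_integral_cong) simp
    then show ?thesis by simp
  next
    case False
    then have s: "0 < s" using real by simp
    have "x i \<le> ennreal (s powr (1 / r - 1)) * epowr (x i) r" if i: "i \<in> I" for i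
    proof -
      have le: "epowr (x i) r \<le> ennreal s" using nn_integral_ge_point[of i I "\<lambda>i. epowr (x i) r"] i real by simp
      have "x i = epowr (epowr (x i) r) (1 / r)" using r by (simp add: epowr_inverse)
      also have "\<dots> = epowr (epowr (x i) r) (1 / r - 1) * epowr (x i) r"
        using epowr_add[of "epowr (x i) r" "1 / r - 1" 1] by simp
      also have "\<dots> \<le> epowr (ennreal s) (1 / r - 1) * epowr (x i) r"
        using r by (intro mult_right_mono epowr_mono le) auto
      finally show ?thesis using s by (simp add: epowr_ennreal)
    qed
    then have "(\<integral>\<^sup>+i. x i \<partial>count_space I) \<le> (\<integral>\<^sup>+i. ennreal (s powr (1 / r - 1)) * epowr (x i) r \<partial>count_space I)"
      by (intro nn_integral_mono) simp
    also have "\<dots> = ennreal (s powr (1 / r - 1)) * ennreal s"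
      by (subst nn_integral_cmult) (auto simp: real)
    also have "\<dots> = epowr (ennreal s) (1 / r)"
      using s by (simp add: epowr_ennreal powr_diff flip: ennreal_mult)
    finally have "epowr (\<integral>\<^sup>+i. x i \<partial>count_space I) r \<le> epowr (epowr (ennreal s) (1 / r)) r"
      using r by (intro epowr_mono) auto
    then show ?thesis using r real by (simp add: epowr_inverse)
  qed
qed simp

text \<open>Minkowski's inequality with a constant 2, which Young's inequality gives for infinitely many
  summands at once.\<close>

lemma quasi_Minkowski:
  fixes f :: "'i \<Rightarrow> 'x \<Rightarrow> ennreal"
  assumes I: "countable I" and [measurable]: "\<And>i. i \<in> I \<Longrightarrow> f i \<in> borel_measurable M" and t: "1 \<le> t"
  shows "nlp M t (\<lambda>x. \<integral>\<^sup>+i. f i x \<partial>count_space I) \<le> 2 * (\<integral>\<^sup>+i. nlp M t (f i) \<partial>count_space I)"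
proof (cases "\<integral>\<^sup>+i. nlp M t (f i) \<partial>count_space I")
  case top
  then show ?thesis by (simp add: ennreal_mult_top)
next
  case (real n)
  have t0: "0 < t" using t by simp
  define N where "N i = enn2real (nlp M t (f i))" for i
  have N: "nlp M t (f i) = ennreal (N i)" "0 \<le> N i" if "i \<in> I" for i
    unfolding N_def using nn_integral_ge_point[of i I "\<lambda>i. nlp M t (f i)"] that real
    by (auto simp: top_unique ennreal_enn2real_if)
  have Nint: "(\<integral>\<^sup>+x. epowr (f i x) t \<partial>M) = ennreal (N i powr t)" if "i \<in> I" for i
    using N[OF that] t0 unfolding nlp_def by (metis epowr_ennreal epowr_inverse(2))
  have sumN: "(\<integral>\<^sup>+i. ennreal (N i) \<partial>count_space I) = ennreal n"
    unfolding real(2)[symmetric] by (intro nn_integral_cong) (simp add: N)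
  \<comment> \<open>Summands of norm 0 are settled separately, because the weight they receive below
    is 0 and gives no control of them.\<close>
  have "AE x in M. N i = 0 \<longrightarrow> f i x = 0" if i: "i \<in> I" for i
  proof (cases "N i = 0")
    case True
    then have "(\<integral>\<^sup>+x. epowr (f i x) t \<partial>M) = 0" using Nint[OF i] by simp
    then have "AE x in M. epowr (f i x) t = 0" using i by (subst (asm) nn_integral_0_iff_AE) auto
    then show ?thesis by (simp add: epowr_eq_0)
  qed simp
  then have ae: "AE x in M. \<forall>i\<in>I. N i = 0 \<longrightarrow> f i x = 0" using I by (simp add: AE_ball_countable)
  show ?thesis
  proof (cases "n = 0")
    case True
    then have "N i = 0" if "i \<in> I" for i
      using nn_integral_count_space_eq_0[where f="\<lambda>i. ennreal (N i)" and I=I and i=i] sumN that N(2)[OF that] by simp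
    then have "AE x in M. epowr (\<integral>\<^sup>+i. f i x \<partial>count_space I) t = 0"
      using ae by (auto elim!: eventually_mono simp: epowr_eq_0 nn_integral_0_iff_AE AE_count_space)
    then have "(\<integral>\<^sup>+x. epowr (\<integral>\<^sup>+i. f i x \<partial>count_space I) t \<partial>M) = (\<integral>\<^sup>+x. 0 \<partial>M)"
      by (intro nn_integral_cong_AE)
    then show ?thesis by (simp add: nlp_def)
  next
    case False
    then have n: "0 < n" using real by simp
    \<comment> \<open>The weights arise from Young's inequality with parameter \<epsilon> N i / n.
      The additive terms then sum to \<epsilon>, since the \<open>N i\<close> sum to n.\<close>
    define c where "c i = (N i / n) powr (1 - t)" for i
    define S where "S x = (\<integral>\<^sup>+i. ennreal (c i) * epowr (f i x) t \<partial>count_space I)" for x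
    have pt: "epowr (\<integral>\<^sup>+i. f i x \<partial>count_space I) t \<le> ennreal (2 powr t) * S x"
      if x: "\<forall>i\<in>I. N i = 0 \<longrightarrow> f i x = 0" for x
    proof (cases "S x")
      case top
      then show ?thesis by (simp add: ennreal_mult_top)
    next
      case (real s)
      show ?thesis
      proof (cases "s = 0")
        case True
        have "f i x = 0" if i: "i \<in> I" for i
        proof (cases "N i = 0")
          case False
          then have "0 < c i" using N(2)[OF i] n by (simp add: c_def)
          moreover have "ennreal (c i) * epowr (f i x) t = 0"
            using nn_integral_count_space_eq_0[where f="\<lambda>i. ennreal (c i) * epowr (f i x) t" and I=I and i=i] i True real by (simp add: S_def)
          ultimately show ?thesis by (simp add: epowr_eq_0)
        qed (use x i in blast)
        then have "(\<integral>\<^sup>+i. f i x \<partial>count_space I) = (\<integral>\<^sup>+i. 0 \<partial>count_space I)" by (intro nn_integral_cong) simp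
        then show ?thesis by simp
      next
        case False
        then have s: "0 < s" using real by simp
        \<comment> \<open>This choice makes the two terms equal; each contributes \<epsilon>, which
          is the source of the constant 2.\<close>
        define \<epsilon> where "\<epsilon> = s powr (1 / t)"
        have e: "0 < \<epsilon>" using s by (simp add: \<epsilon>_def)
        have es: "\<epsilon> powr (1 - t) * s = \<epsilon>"
        proof -
          have "s = \<epsilon> powr t" unfolding \<epsilon>_def using s t0 by (simp add: powr_powr)
          then show ?thesis using e by (simp flip: powr_add)
        qed
        have "f i x \<le> ennreal (\<epsilon> powr (1 - t)) * (ennreal (c i) * epowr (f i x) t) + ennreal (\<epsilon> / n) * ennreal (N i)" if i: "i \<in> I" for i
        proof (cases "N i = 0")
          case False
          then have Np: "0 < N i / n" using N(2)[OF i] n by simp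
          have "f i x \<le> ennreal ((\<epsilon> * (N i / n)) powr (1 - t)) * epowr (f i x) t + ennreal (\<epsilon> * (N i / n))"
            by (rule epowr_young[OF t mult_pos_pos[OF e Np]])
          also have "(\<epsilon> * (N i / n)) powr (1 - t) = \<epsilon> powr (1 - t) * c i"
            unfolding c_def using e Np by (intro powr_mult)
          also have "ennreal (\<epsilon> * (N i / n)) = ennreal (\<epsilon> / n) * ennreal (N i)"
            using e n N(2)[OF i] by (simp flip: ennreal_mult)
          finally show ?thesis by (simp add: ennreal_mult' c_def mult.assoc)
        qed (use x i in simp)
        then have "(\<integral>\<^sup>+i. f i x \<partial>count_space I) \<le> (\<integral>\<^sup>+i. ennreal (\<epsilon> powr (1 - t)) * (ennreal (c i) * epowr (f i x) t) + ennreal (\<epsilon> / n) * ennreal (N i) \<partial>count_space I)"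
          by (intro nn_integral_mono) simp
        also have "\<dots> = ennreal (\<epsilon> powr (1 - t)) * S x + ennreal (\<epsilon> / n) * ennreal n"
          unfolding S_def sumN[symmetric] by (simp add: nn_integral_add nn_integral_cmult)
        also have "\<dots> = ennreal (2 * \<epsilon>)"
          using real e n s es by (simp flip: ennreal_mult ennreal_plus)
        finally have "epowr (\<integral>\<^sup>+i. f i x \<partial>count_space I) t \<le> epowr (ennreal (2 * \<epsilon>)) t"
          using t0 by (intro epowr_mono) auto
        also have "\<dots> = ennreal (2 powr t) * S x"
          using e s t0 real by (simp add: epowr_ennreal powr_mult \<epsilon>_def powr_powr flip: ennreal_mult)
        finally show ?thesis .
      qed
    qed
    have "(\<integral>\<^sup>+x. epowr (\<integral>\<^sup>+i. f i x \<partial>count_space I) t \<partial>M) \<le> (\<integral>\<^sup>+x. ennreal (2 powr t) * S x \<partial>M)"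
      by (rule nn_integral_mono_AE) (use ae pt in \<open>auto elim!: eventually_mono\<close>)
    also have "\<dots> = (\<integral>\<^sup>+x. \<integral>\<^sup>+i. ennreal (2 powr t) * (ennreal (c i) * epowr (f i x) t) \<partial>count_space I \<partial>M)"
      unfolding S_def by (simp add: nn_integral_cmult)
    also have "\<dots> = (\<integral>\<^sup>+i. \<integral>\<^sup>+x. ennreal (2 powr t) * (ennreal (c i) * epowr (f i x) t) \<partial>M \<partial>count_space I)"
      by (rule nn_integral_count_space_nn_integral[OF I]) auto
    also have "\<dots> = (\<integral>\<^sup>+i. ennreal (2 powr t * n powr (t - 1)) * ennreal (N i) \<partial>count_space I)"
    proof (rule nn_integral_cong)
      fix i assume "i \<in> space (count_space I)"
      then have i: "i \<in> I" by simp
      have "(\<integral>\<^sup>+x. ennreal (2 powr t) * (ennreal (c i) * epowr (f i x) t) \<partial>M) = ennreal (2 powr t) * (ennreal (c i) * ennreal (N i powr t))"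
        using i by (simp add: nn_integral_cmult Nint)
      also have "\<dots> = ennreal (2 powr t * (c i * N i powr t))" by (simp add: c_def flip: ennreal_mult)
      also have "c i * N i powr t = n powr (t - 1) * N i"
      proof (cases "N i = 0")
        case False
        then have "c i * N i powr t = (N i powr (1 - t) * N i powr t) / n powr (1 - t)"
          using N(2)[OF i] n by (simp add: c_def powr_divide)
        also have "\<dots> = n powr (t - 1) * N i" using False N(2)[OF i] n powr_minus_divide[of n "1 - t"]
          by (simp flip: powr_add)
        finally show ?thesis .
      qed (use t0 in simp)
      finally show "(\<integral>\<^sup>+x. ennreal (2 powr t) * (ennreal (c i) * epowr (f i x) t) \<partial>M) = ennreal (2 powr t * n powr (t - 1)) * ennreal (N i)"
        using N(2)[OF i] by (simp add: mult.assoc flip: ennreal_mult)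
    qed
    also have "\<dots> = ennreal (2 powr t * n powr (t - 1)) * ennreal n"
      by (simp add: nn_integral_cmult sumN)
    also have "\<dots> = ennreal ((2 * n) powr t)"
      using n by (simp add: powr_mult powr_diff flip: ennreal_mult)
    also have "\<dots> = epowr (ennreal (2 * n)) t" using n by (simp add: epowr_ennreal)
    finally have "nlp M t (\<lambda>x. \<integral>\<^sup>+i. f i x \<partial>count_space I) \<le> epowr (epowr (ennreal (2 * n)) t) (1 / t)"
      unfolding nlp_def using t0 by (intro epowr_mono) auto
    also have "\<dots> = 2 * ennreal n" using t0 n by (simp add: epowr_inverse ennreal_mult)
    finally show ?thesis unfolding real(2) .
  qed
qed

subsection \<open>Pointwise estimates for band-limited functions\<close>

lemma nn_integral_jbracket_shift:
  fixes x :: "'a::euclidean_space"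
  shows "(\<integral>\<^sup>+z. ennreal (1 / jbracket (x - z) ^ (2 * DIM('a))) \<partial>lborel) = ennreal (jint TYPE('a))"
  using lborel_nn_integral_reflect[of "\<lambda>z. ennreal (1 / jbracket z ^ (2 * DIM('a)))" x] nn_integral_jbracket[where 'a='a] by simp

text \<open>For \<open>p < 1\<close> split \<open>|g| = |g|\<^sup>p |g|\<^sup>1\<^sup>-\<^sup>p\<close> and bound the second factor by the supremum \<open>M\<close> of
  \<open>y \<mapsto> |g y| / jbracket (x - y) ^ b\<close>. The representation then yields \<open>M \<le> K 2\<^sup>b M\<^sup>1\<^sup>-\<^sup>p I\<close>, and since the growth
  bound makes \<open>M\<close> finite, it can be cancelled.\<close>

lemma band_limited_le_1:
  fixes g :: "'a::euclidean_space \<Rightarrow> complex"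
  assumes [measurable]: "g \<in> borel_measurable borel" and growth: "\<And>y. norm (g y) \<le> C0 * jbracket y ^ b"
    and K: "0 \<le> K" and rep: "\<And>y. ennreal (norm (g y)) \<le> (\<integral>\<^sup>+z. ennreal (norm (g z) * (K / jbracket (y - z) ^ b)) \<partial>lborel)"
    and p: "0 < p" "p \<le> 1"
  shows "epowr (ennreal (norm (g x))) p \<le> ennreal (K * 2 ^ b) *
    (\<integral>\<^sup>+z. epowr (ennreal (norm (g z))) p * ennreal (jbracket (x - z) powr (- (real b * p))) \<partial>lborel)"
proof -
  let ?q = "\<lambda>y. norm (g y) / jbracket (x - y) ^ b"
  let ?I = "\<integral>\<^sup>+z. epowr (ennreal (norm (g z))) p * ennreal (jbracket (x - z) powr (- (real b * p))) \<partial>lborel"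
  define M where "M = (SUP y. ?q y)"
  have C0: "0 \<le> C0" using order_trans[OF norm_ge_zero growth[of 0]] zero_less_power[OF jbracket_pos, of "0::'a" b]
    by (simp add: zero_le_mult_iff not_le[symmetric])
  have bd: "bdd_above (range ?q)"
  proof (rule bdd_aboveI2)
    fix y
    \<comment> \<open>The assumed growth order of g equals the order of the weight, so the quotient
      is bounded and \<open>M\<close> is a genuine supremum.\<close>
    have "jbracket y ^ b \<le> (2 * jbracket x * jbracket (x - y)) ^ b"
      using jbracket_le_diff[of y x] by (intro power_mono) (auto simp: jbracket_minus_commute[of y x] mult_ac)
    then have "C0 * jbracket y ^ b \<le> C0 * ((2 * jbracket x) ^ b * jbracket (x - y) ^ b)"
      using C0 by (intro mult_left_mono) (auto simp: power_mult_distrib)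
    then show "?q y \<le> C0 * (2 * jbracket x) ^ b" using growth[of y] by (simp add: field_simps)
  qed
  have qM: "?q y \<le> M" for y unfolding M_def by (rule cSUP_upper[OF _ bd]) simp
  have gM: "norm (g y) \<le> M * jbracket (x - y) ^ b" for y using qM[of y] by (simp add: field_simps)
  have gx: "norm (g x) \<le> M" using qM[of x] by (simp add: jbracket_def)
  have M0: "0 \<le> M" using order_trans[OF norm_ge_zero gx] .
  show ?thesis
  proof (cases "M = 0")
    case True
    then show ?thesis using gx by simp
  next
    case False
    then have Mp: "0 < M" using M0 by simp
    have le: "ennreal (?q y) \<le> ennreal (K * 2 ^ b * M powr (1 - p)) * ?I" for y
    proof -
      have "ennreal (?q y) = ennreal (1 / jbracket (x - y) ^ b) * ennreal (norm (g y))"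
        by (simp flip: ennreal_mult)
      also have "\<dots> \<le> ennreal (1 / jbracket (x - y) ^ b) * (\<integral>\<^sup>+z. ennreal (norm (g z) * (K / jbracket (y - z) ^ b)) \<partial>lborel)"
        by (intro mult_left_mono rep) auto
      also have "\<dots> = (\<integral>\<^sup>+z. ennreal (1 / jbracket (x - y) ^ b) * ennreal (norm (g z) * (K / jbracket (y - z) ^ b)) \<partial>lborel)"
        by (simp add: nn_integral_cmult)
      also have "\<dots> \<le> (\<integral>\<^sup>+z. ennreal (K * 2 ^ b * M powr (1 - p)) * (epowr (ennreal (norm (g z))) p * ennreal (jbracket (x - z) powr (- (real b * p)))) \<partial>lborel)"
      proof (rule nn_integral_mono)
        fix z
        \<comment> \<open>Peetre's inequality compares the weight centred at x with the product of
          the kernel weight at y and the normalisation of \<open>?q y\<close>.\<close>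
        have jb: "jbracket (x - z) ^ b \<le> 2 ^ b * (jbracket (x - y) ^ b * jbracket (y - z) ^ b)"
          using power_mono[OF jbracket_add[of "x - y" "y - z"], of b] by (simp add: power_mult_distrib mult.assoc)
        have jp: "jbracket (x - z) ^ b = jbracket (x - z) powr (real b)" by (simp add: powr_realpow)
        have "norm (g z) = norm (g z) powr p * norm (g z) powr (1 - p)"
          by (cases "g z = 0") (simp_all flip: powr_add)
        also have "\<dots> \<le> norm (g z) powr p * (M * jbracket (x - z) ^ b) powr (1 - p)"
          using p gM by (intro mult_left_mono powr_mono2) auto
        also have "\<dots> = norm (g z) powr p * M powr (1 - p) * jbracket (x - z) powr (- (real b * p)) * jbracket (x - z) ^ b"
          using Mp unfolding jp by (simp add: powr_mult powr_powr algebra_simps flip: powr_add)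
        also have "\<dots> \<le> norm (g z) powr p * M powr (1 - p) * jbracket (x - z) powr (- (real b * p)) * (2 ^ b * (jbracket (x - y) ^ b * jbracket (y - z) ^ b))"
          by (intro mult_left_mono jb) auto
        finally have "norm (g z) * (K / (jbracket (x - y) ^ b * jbracket (y - z) ^ b)) \<le>
            norm (g z) powr p * M powr (1 - p) * jbracket (x - z) powr (- (real b * p)) * (2 ^ b * (jbracket (x - y) ^ b * jbracket (y - z) ^ b)) * (K / (jbracket (x - y) ^ b * jbracket (y - z) ^ b))"
          using K by (intro mult_right_mono) auto
        also have "\<dots> = K * 2 ^ b * M powr (1 - p) * (norm (g z) powr p * jbracket (x - z) powr (- (real b * p)))"
          by simp
        finally show "ennreal (1 / jbracket (x - y) ^ b) * ennreal (norm (g z) * (K / jbracket (y - z) ^ b)) \<le> ennreal (K * 2 ^ b * M powr (1 - p)) * (epowr (ennreal (norm (g z))) p * ennreal (jbracket (x - z) powr (- (real b * p))))"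
          using K by (simp add: epowr_ennreal mult.assoc flip: ennreal_mult)
      qed
      also have "\<dots> = ennreal (K * 2 ^ b * M powr (1 - p)) * ?I" by (simp add: nn_integral_cmult)
      finally show ?thesis .
    qed
    show ?thesis
    proof (cases ?I)
      case (real i)
      have "?q y \<le> K * 2 ^ b * M powr (1 - p) * i" for y
      proof -
        have "ennreal (?q y) \<le> ennreal (K * 2 ^ b * M powr (1 - p) * i)"
          using le[of y] K real by (simp flip: ennreal_mult)
        moreover have "0 \<le> K * 2 ^ b * M powr (1 - p) * i" using K real by simp
        ultimately show ?thesis by (simp only: ennreal_le_iff)
      qed
      then have "M \<le> K * 2 ^ b * M powr (1 - p) * i" unfolding M_def by (intro cSUP_least) auto
      \<comment> \<open>Division by \<open>M powr (1 - p)\<close>, legitimate because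
        \<open>M\<close> is finite and positive, leaves M^p on the left.\<close>
      then have "M powr (p - 1) * M \<le> M powr (p - 1) * (K * 2 ^ b * M powr (1 - p) * i)" by (intro mult_left_mono) auto
      also have "\<dots> = (M powr (p - 1) * M powr (1 - p)) * (K * 2 ^ b * i)" by simp
      also have "M powr (p - 1) * M powr (1 - p) = 1" using Mp by (simp flip: powr_add)
      also have "M powr (p - 1) * M = M powr p" using Mp by (simp add: powr_diff)
      finally have "norm (g x) powr p \<le> K * 2 ^ b * i"
        using powr_mono2[of p "norm (g x)" M] gx p by simp
      then show ?thesis using real K by (simp add: epowr_ennreal ennreal_leI flip: ennreal_mult)
    next
      case top
      \<comment> \<open>If the integral is infinite, only K = 0 could spoil the bound, and then g
        would vanish by the representation.\<close>
      have "K \<noteq> 0"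
      proof
        assume "K = 0"
        then have "norm (g y) = 0" for y using rep[of y] by simp
        then have "M = 0" unfolding M_def by simp
        then show False using False by simp
      qed
      then have "ennreal (K * 2 ^ b) * top = top" using K by (simp add: ennreal_mult_top)
      then show ?thesis unfolding top by simp
    qed
  qed
qed

text \<open>Young's inequality with a free \<epsilon> replaces Jensen's inequality. Its additive
  term integrates against the kernel weight to at most \<epsilon> times \<open>jint\<close>, and
  \<epsilon> = I^(1/p), with I the weighted integral, balances the two terms.\<close>

lemma band_limited_ge_1:
  fixes g :: "'a::euclidean_space \<Rightarrow> complex"
  assumes [measurable]: "g \<in> borel_measurable borel" and A: "2 * DIM('a) \<le> A"
    and K: "0 \<le> K" and rep: "ennreal (norm (g x)) \<le> (\<integral>\<^sup>+z. ennreal (norm (g z) * (K / jbracket (x - z) ^ A)) \<partial>lborel)"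
    and p: "1 \<le> p"
  shows "epowr (ennreal (norm (g x))) p \<le> ennreal ((K * (1 + jint TYPE('a))) powr p) *
    (\<integral>\<^sup>+z. epowr (ennreal (norm (g z))) p * ennreal (1 / jbracket (x - z) ^ A) \<partial>lborel)"
proof -
  let ?J = "jint TYPE('a)"
  let ?I = "\<integral>\<^sup>+z. epowr (ennreal (norm (g z))) p * ennreal (1 / jbracket (x - z) ^ A) \<partial>lborel"
  have p0: "0 < p" using p by simp
  have le: "ennreal (norm (g x)) \<le> ennreal K * (ennreal (\<epsilon> powr (1 - p)) * ?I + ennreal (\<epsilon> * ?J))" if e: "0 < \<epsilon>" for \<epsilon>
  proof -
    have "(\<integral>\<^sup>+z. ennreal (norm (g z) * (K / jbracket (x - z) ^ A)) \<partial>lborel) \<le>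
      (\<integral>\<^sup>+z. ennreal K * (ennreal (\<epsilon> powr (1 - p)) * (epowr (ennreal (norm (g z))) p * ennreal (1 / jbracket (x - z) ^ A)) + ennreal \<epsilon> * ennreal (1 / jbracket (x - z) ^ (2 * DIM('a)))) \<partial>lborel)"
    proof (rule nn_integral_mono)
      fix z
      have "ennreal (norm (g z) * (K / jbracket (x - z) ^ A)) = ennreal K * (ennreal (norm (g z)) * ennreal (1 / jbracket (x - z) ^ A))"
        using K by (simp flip: ennreal_mult)
      also have "\<dots> \<le> ennreal K * ((ennreal (\<epsilon> powr (1 - p)) * epowr (ennreal (norm (g z))) p + ennreal \<epsilon>) * ennreal (1 / jbracket (x - z) ^ A))"
        by (intro mult_left_mono mult_right_mono epowr_young p e) auto
      also have "\<dots> \<le> ennreal K * (ennreal (\<epsilon> powr (1 - p)) * (epowr (ennreal (norm (g z))) p * ennreal (1 / jbracket (x - z) ^ A)) + ennreal \<epsilon> * ennreal (1 / jbracket (x - z) ^ (2 * DIM('a))))"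
        unfolding distrib_right mult.assoc
        by (intro mult_left_mono add_mono ennreal_leI jbracket_div_mono A) auto
      finally show "ennreal (norm (g z) * (K / jbracket (x - z) ^ A)) \<le> \<dots>" .
    qed
    also have "\<dots> = ennreal K * (ennreal (\<epsilon> powr (1 - p)) * ?I + ennreal \<epsilon> * ennreal ?J)"
      by (simp add: nn_integral_cmult nn_integral_add nn_integral_jbracket_shift)
    finally show ?thesis using rep e jint_nonneg[where 'a='a] by (simp add: ennreal_mult)
  qed
  show ?thesis
  proof (cases ?I)
    case (real i)
    show ?thesis
    proof (cases "i = 0")
      case True
      \<comment> \<open>The choice of \<epsilon> below would be 0 here. Instead g vanishes almost
        everywhere, and the representation gives g x = 0.\<close>
      then have "?I = 0" using real by simp
      then have "AE z in lborel. epowr (ennreal (norm (g z))) p * ennreal (1 / jbracket (x - z) ^ A) = 0"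
        by (subst (asm) nn_integral_0_iff_AE) auto
      then have "AE z in lborel. ennreal (norm (g z) * (K / jbracket (x - z) ^ A)) = 0"
        by (auto elim!: eventually_mono simp: epowr_eq_0)
      then have "(\<integral>\<^sup>+z. ennreal (norm (g z) * (K / jbracket (x - z) ^ A)) \<partial>lborel) = (\<integral>\<^sup>+(z::'a). 0 \<partial>lborel)"
        by (intro nn_integral_cong_AE)
      then show ?thesis using rep by simp
    next
      case False
      then have i: "0 < i" using real by simp
      define \<epsilon> where "\<epsilon> = i powr (1 / p)"
      have e: "0 < \<epsilon>" using i by (simp add: \<epsilon>_def)
      have es: "\<epsilon> powr (1 - p) * i = \<epsilon>"
      proof -
        have "i = \<epsilon> powr p" unfolding \<epsilon>_def using i p0 by (simp add: powr_powr)
        then show ?thesis using e by (simp flip: powr_add)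
      qed
      have "ennreal (norm (g x)) \<le> ennreal K * (ennreal (\<epsilon> powr (1 - p)) * ennreal i + ennreal (\<epsilon> * ?J))"
        using le[OF e] unfolding real(2) .
      also have "\<dots> = ennreal (K * (1 + ?J) * \<epsilon>)"
        using K e i jint_nonneg[where 'a='a] es by (simp add: algebra_simps flip: ennreal_mult ennreal_plus)
      finally have "epowr (ennreal (norm (g x))) p \<le> epowr (ennreal (K * (1 + ?J) * \<epsilon>)) p"
        using p0 by (intro epowr_mono) auto
      also have "\<dots> = ennreal ((K * (1 + ?J)) powr p * i)"
        using K e i p0 jint_nonneg[where 'a='a] by (simp add: epowr_ennreal powr_mult \<epsilon>_def powr_powr)
      also have "\<dots> = ennreal ((K * (1 + ?J)) powr p) * ?I" using i by (simp add: real(2) ennreal_mult)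
      finally show ?thesis .
    qed
  next
    case top
    show ?thesis
    proof (cases "K = 0")
      case True
      then show ?thesis using rep by simp
    next
      case False
      then have "0 < K * (1 + ?J)" using K jint_nonneg[where 'a='a] by (simp add: add_pos_nonneg)
      then have "K * (1 + ?J) \<noteq> 0" by (rule less_imp_neq[symmetric])
      then have "ennreal ((K * (1 + ?J)) powr p) * top = top" by (simp add: ennreal_mult_top)
      then show ?thesis unfolding top by simp
    qed
  qed
qed

lemma band_limited_pointwise:
  fixes K :: "nat \<Rightarrow> real"
  assumes K: "\<And>A. 0 \<le> K A" and p: "0 < p" and a: "2 * DIM('a::euclidean_space) \<le> a"
  shows "\<exists>C\<ge>0. \<forall>g::'a \<Rightarrow> complex. g \<in> borel_measurable borel \<longrightarrow> (\<exists>C0 N. \<forall>y. norm (g y) \<le> C0 * jbracket y ^ N) \<longrightarrow>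
    (\<forall>A y. ennreal (norm (g y)) \<le> (\<integral>\<^sup>+z. ennreal (norm (g z) * (K A / jbracket (y - z) ^ A)) \<partial>lborel)) \<longrightarrow>
    (\<integral>\<^sup>+z. epowr (ennreal (norm (g z))) p \<partial>lborel) < \<infinity> \<longrightarrow>
    (\<forall>x. epowr (ennreal (norm (g x))) p \<le> ennreal C * (\<integral>\<^sup>+z. epowr (ennreal (norm (g z))) p * ennreal (1 / jbracket (x - z) ^ a) \<partial>lborel))"
proof (cases "1 \<le> p")
  case True
  show ?thesis
    by (rule exI[of _ "(K a * (1 + jint TYPE('a))) powr p"])
      (auto intro!: band_limited_ge_1[OF _ a K _ True])
next
  case False
  then have p1: "p \<le> 1" by simp
  \<comment> \<open>Chosen so that b p >= a, which makes the weight left by the estimate for p <= 1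
    at most the required one.\<close>
  define b where "b = nat \<lceil>real a / p\<rceil>"
  have "real a / p \<le> real b" unfolding b_def by linarith
  then have b: "real a \<le> real b * p" using p by (simp add: field_simps)
  show ?thesis
  proof (intro exI[of _ "K b * 2 ^ b"] conjI allI impI)
    show "0 \<le> K b * 2 ^ b" using K by simp
    fix g :: "'a \<Rightarrow> complex" and x
    assume m [measurable]: "g \<in> borel_measurable borel" and gr: "\<exists>C0 N. \<forall>y. norm (g y) \<le> C0 * jbracket y ^ N"
      and rep: "\<forall>A y. ennreal (norm (g y)) \<le> (\<integral>\<^sup>+z. ennreal (norm (g z) * (K A / jbracket (y - z) ^ A)) \<partial>lborel)"
      and fin: "(\<integral>\<^sup>+z. epowr (ennreal (norm (g z))) p \<partial>lborel) < \<infinity>"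
    from gr obtain C0 N where N: "\<And>y. norm (g y) \<le> C0 * jbracket y ^ N" by blast
    obtain i where i: "0 \<le> i" "(\<integral>\<^sup>+z. epowr (ennreal (norm (g z))) p \<partial>lborel) = ennreal i"
      using fin by (cases "\<integral>\<^sup>+z. epowr (ennreal (norm (g z))) p \<partial>lborel") auto
    \<comment> \<open>The growth exponent \<open>N\<close> depends on \<open>g\<close>, hence so would the constant. A first pass with \<open>N\<close> only
      shows that \<open>g\<close> is bounded, and a second pass with \<open>b\<close> gives a constant independent of \<open>g\<close>.\<close>
    have bdd: "norm (g y) powr p \<le> K N * 2 ^ N * i" for y
    proof -
      have "epowr (ennreal (norm (g y))) p \<le> ennreal (K N * 2 ^ N) *
          (\<integral>\<^sup>+z. epowr (ennreal (norm (g z))) p * ennreal (jbracket (y - z) powr (- (real N * p))) \<partial>lborel)"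
        by (rule band_limited_le_1[OF m N K _ p p1]) (use rep in blast)
      also have "\<dots> \<le> ennreal (K N * 2 ^ N) * (\<integral>\<^sup>+z. epowr (ennreal (norm (g z))) p * 1 \<partial>lborel)"
      proof (intro mult_left_mono nn_integral_mono)
        fix z
        have "jbracket (y - z) powr (- (real N * p)) \<le> jbracket (y - z) powr 0"
          using p by (intro powr_mono jbracket_ge_1) auto
        then show "ennreal (jbracket (y - z) powr (- (real N * p))) \<le> 1" by (simp add: ennreal_le_1)
      qed auto
      finally have "ennreal (norm (g y) powr p) \<le> ennreal (K N * 2 ^ N * i)" using i K by (simp add: epowr_ennreal flip: ennreal_mult)
      moreover have "0 \<le> K N * 2 ^ N * i" using i K by simp
      ultimately show ?thesis by (simp add: ennreal_le_iff)
    qed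
    have bdd': "norm (g y) \<le> (K N * 2 ^ N * i) powr (1 / p) * jbracket y ^ b" for y
    proof -
      have "norm (g y) = (norm (g y) powr p) powr (1 / p)" using p by (simp add: powr_powr)
      also have "\<dots> \<le> (K N * 2 ^ N * i) powr (1 / p) * 1"
        using p bdd[of y] by (simp add: powr_mono2)
      also have "\<dots> \<le> (K N * 2 ^ N * i) powr (1 / p) * jbracket y ^ b"
        by (intro mult_left_mono jbracket_power_ge_1) auto
      finally show ?thesis .
    qed
    have "epowr (ennreal (norm (g x))) p \<le> ennreal (K b * 2 ^ b) *
        (\<integral>\<^sup>+z. epowr (ennreal (norm (g z))) p * ennreal (jbracket (x - z) powr (- (real b * p))) \<partial>lborel)"
      by (rule band_limited_le_1[OF m bdd' K _ p p1]) (use rep in blast)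
    also have "\<dots> \<le> ennreal (K b * 2 ^ b) * (\<integral>\<^sup>+z. epowr (ennreal (norm (g z))) p * ennreal (1 / jbracket (x - z) ^ a) \<partial>lborel)"
    proof (intro mult_left_mono nn_integral_mono ennreal_leI)
      fix z
      have "jbracket (x - z) powr (- (real b * p)) \<le> jbracket (x - z) powr (- real a)"
        using b by (intro powr_mono jbracket_ge_1) auto
      also have "\<dots> = 1 / jbracket (x - z) ^ a" by (simp add: powr_minus_divide powr_realpow)
      finally show "jbracket (x - z) powr (- (real b * p)) \<le> 1 / jbracket (x - z) ^ a" .
    qed auto
    finally show "epowr (ennreal (norm (g x))) p \<le> ennreal (K b * 2 ^ b) * (\<integral>\<^sup>+z. epowr (ennreal (norm (g z))) p * ennreal (1 / jbracket (x - z) ^ a) \<partial>lborel)" .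
  qed
qed

subsection \<open>Norms of the pieces\<close>

lemma open_null_set_empty:
  fixes U :: "'a::euclidean_space set"
  assumes "open U" "U \<in> null_sets lborel" shows "U = {}"
  using open_not_negligible[OF assms(1)] assms(2) by (auto simp: negligible_iff_null_sets null_sets_completionI)

text \<open>The set where |g| exceeds its essential supremum is open and null, hence empty. Thus for
  p = \<infinity> the norm of a piece bounds it at every point, also on the hyperplane.\<close>

lemma le_esssup_continuous:
  fixes g :: "'a::euclidean_space \<Rightarrow> complex"
  assumes "continuous_on UNIV g"
  shows "ennreal (norm (g x)) \<le> esssup lborel (\<lambda>x. ennreal (norm (g x)))"
proof -
  let ?S = "esssup lborel (\<lambda>x. ennreal (norm (g x)))"
  let ?U = "{x. ?S < ennreal (norm (g x))}"
  have "open ?U" by (intro open_Collect_less continuous_intros continuous_on_ennreal assms)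
  moreover have "?U \<in> null_sets lborel"
  proof -
    have "AE x in lborel. \<not> ?S < ennreal (norm (g x))"
      using esssup_AE[where M=lborel and f="\<lambda>x. ennreal (norm (g x))"] by (auto elim!: eventually_mono)
    moreover have "?U \<in> sets borel" using \<open>open ?U\<close> by simp
    ultimately show ?thesis by (subst (asm) AE_iff_null) auto
  qed
  ultimately have "?U = {}" by (rule open_null_set_empty)
  then show ?thesis by (auto simp: not_less)
qed

lemma Lp_norm_le_sup:
  assumes "g \<in> borel_measurable borel" "\<And>x. ennreal (norm (g x)) \<le> c"
  shows "Lp_norm \<infinity> g \<le> c"
  unfolding Lp_norm_def using assms by (auto intro!: esssup_I)

lemma enn2real_pos: "0 < p \<Longrightarrow> p \<noteq> \<infinity> \<Longrightarrow> 0 < enn2real p"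
  by (simp add: enn2real_positive_iff top.not_eq_extremum)

lemma le_lq_norm:
  assumes "0 < q" "k \<in> A" "countable A"
  shows "c k \<le> lq_norm q A c"
proof (cases "q = \<infinity>")
  case True
  then show ?thesis using assms by (auto simp: lq_norm_def intro: SUP_upper)
next
  case False
  then have q: "0 < enn2real q" using assms(1) by (simp add: enn2real_positive_iff top.not_eq_extremum)
  have "epowr (c k) (enn2real q) \<le> (\<integral>\<^sup>+k. epowr (c k) (enn2real q) \<partial>count_space A)"
    using nn_integral_ge_point[of k A "\<lambda>k. epowr (c k) (enn2real q)"] assms(2) by simp
  from epowr_mono[OF this, of "1 / enn2real q"] show ?thesis
    using q False assms(3) by (simp add: lq_norm_eq nlp_def epowr_inverse)
qed

lemma nn_integral_count_space_Times:
  assumes "countable A" "countable B"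
  shows "(\<integral>\<^sup>+z. f z \<partial>count_space (A \<times> B)) = (\<integral>\<^sup>+x. \<integral>\<^sup>+y. f (x, y) \<partial>count_space B \<partial>count_space A)"
proof -
  interpret sigma_finite_measure "count_space B" by (rule sigma_finite_measure_count_space_countable[OF assms(2)])
  show ?thesis
    using nn_integral_fst[of f "count_space A"] assms by (simp add: pair_measure_countable)
qed

lemma summable_from_nn_integral:
  fixes t :: "'i \<Rightarrow> complex"
  assumes "(\<integral>\<^sup>+i. ennreal (norm (t i)) \<partial>count_space I) \<le> ennreal c" "0 \<le> c"
  shows "(\<lambda>i. norm (t i)) summable_on I" "norm (infsum t I) \<le> c"
proof -
  have le: "(\<Sum>i\<in>F. norm (t i)) \<le> c" if F: "finite F" "F \<subseteq> I" for F
  proof -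
    have "ennreal (\<Sum>i\<in>F. norm (t i)) = (\<integral>\<^sup>+i. ennreal (norm (t i)) \<partial>count_space F)"
      using F by (simp add: nn_integral_count_space_finite)
    also have "\<dots> = (\<integral>\<^sup>+i. ennreal (norm (t i)) * indicator F i \<partial>count_space UNIV)"
      by (rule nn_integral_count_space_indicator) simp
    also have "\<dots> \<le> (\<integral>\<^sup>+i. ennreal (norm (t i)) * indicator I i \<partial>count_space UNIV)"
      by (intro nn_integral_mono mult_left_mono) (use F in \<open>auto simp: indicator_def\<close>)
    also have "\<dots> = (\<integral>\<^sup>+i. ennreal (norm (t i)) \<partial>count_space I)"
      by (rule nn_integral_count_space_indicator[symmetric]) simp
    also have "\<dots> \<le> ennreal c" by (rule assms)
    finally show ?thesis using assms(2) by (simp add: ennreal_le_iff)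
  qed
  show s: "(\<lambda>i. norm (t i)) summable_on I"
    by (rule nonneg_bdd_above_summable_on) (auto intro!: bdd_aboveI2[of _ _ c] le)
  have "norm (infsum t I) \<le> infsum (\<lambda>i. norm (t i)) I" by (rule norm_infsum_bound[OF s])
  also have "\<dots> \<le> c" by (rule infsum_le_finite_sums[OF s]) (rule le)
  finally show "norm (infsum t I) \<le> c" .
qed

lemma ennreal_norm_infsum_le:
  fixes t :: "'i \<Rightarrow> complex"
  shows "ennreal (norm (infsum t I)) \<le> (\<integral>\<^sup>+i. ennreal (norm (t i)) \<partial>count_space I)"
proof (cases "\<integral>\<^sup>+i. ennreal (norm (t i)) \<partial>count_space I")
  case (real c)
  then show ?thesis using summable_from_nn_integral(2)[where t=t and I=I and c=c] by simp
qed simp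

text \<open>Peetre's inequality for all real exponents; for negative s the roles of x and y are
  exchanged.\<close>

lemma jbracket_powr_le:
  fixes x :: "'a::real_normed_vector"
  shows "jbracket x powr s \<le> (2 * jbracket (x - y)) powr \<bar>s\<bar> * jbracket y powr s"
proof (cases "0 \<le> s")
  case True
  have "jbracket x powr s \<le> (2 * jbracket (x - y) * jbracket y) powr s"
    using True by (intro powr_mono2 jbracket_le_diff) auto
  then show ?thesis using True by (simp add: powr_mult)
next
  case False
  have "jbracket y powr (- s) \<le> (2 * jbracket (x - y) * jbracket x) powr (- s)"
    using False jbracket_le_diff[of y x] by (intro powr_mono2) (auto simp: jbracket_minus_commute[of y x])
  then have "jbracket y powr (- s) \<le> (2 * jbracket (x - y)) powr (- s) * jbracket x powr (- s)"
    by (simp add: powr_mult)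
  then have "jbracket x powr s * jbracket y powr (- s) * jbracket y powr s \<le> jbracket x powr s * ((2 * jbracket (x - y)) powr (- s) * jbracket x powr (- s)) * jbracket y powr s"
    by (intro mult_right_mono mult_left_mono) auto
  moreover have "jbracket x powr s * jbracket y powr (- s) * jbracket y powr s = jbracket x powr s"
    by (simp add: mult.assoc flip: powr_add)
  moreover have "jbracket x powr s * ((2 * jbracket (x - y)) powr (- s) * jbracket x powr (- s)) * jbracket y powr s =
      (2 * jbracket (x - y)) powr (- s) * jbracket y powr s * (jbracket x powr s * jbracket x powr (- s))" by simp
  moreover have "jbracket x powr s * jbracket x powr (- s) = 1" by (simp flip: powr_add)
  ultimately show ?thesis using False by simp
qed

context decomposition
begin

section \<open>Pointwise bounds and frequency decay of the pieces\<close>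

lemma box_borel: "f \<in> tempered \<Longrightarrow> k \<in> lattice_pts \<Longrightarrow> box \<eta> k f \<in> borel_measurable borel"
  by (rule smooth_borel[OF box_eq(3)])

lemma chic_shift: "chic k = (\<lambda>\<xi>. chic 0 (\<xi> - k))"
  by (simp add: chi_shift[of k])

lemma psic_shift: "k \<in> lattice_pts \<Longrightarrow> psic k = (\<lambda>\<xi>. psic 0 (\<xi> - k))"
  by (simp add: psi_shift[of k])

text \<open>\<open>K\<close> depends on the order \<open>A\<close> only, not on f or k, because the
  kernels of the bumps \<open>chi k\<close> agree up to a phase.\<close>

lemma box_reproducing_bound:
  "\<exists>K. \<forall>A. 0 \<le> K A \<and> (\<forall>f\<in>tempered. \<forall>k\<in>lattice_pts. \<forall>y. ennreal (norm (box \<eta> k f (y::'a::euclidean_space))) \<le>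
    (\<integral>\<^sup>+z. ennreal (norm (box \<eta> k f z) * (K A / jbracket (y - z) ^ A)) \<partial>lborel))"
proof -
  have "\<forall>A. \<exists>K\<ge>0. \<forall>k x y. norm (kern (chic k) x y) \<le> K / jbracket (x - y :: 'a) ^ A"
    unfolding chic_shift by (intro allI kern_bound chi_schwartz)
  then obtain K where K: "\<And>A. 0 \<le> K A" "\<And>A k x y. norm (kern (chic k) x y) \<le> K A / jbracket (x - y :: 'a) ^ A"
    by metis
  have "ennreal (norm (box \<eta> k f y)) \<le> (\<integral>\<^sup>+z. ennreal (norm (box \<eta> k f z) * (K A / jbracket (y - z) ^ A)) \<partial>lborel)"
    if "f \<in> tempered" "k \<in> lattice_pts" for A f k and y :: 'a
  proof -
    have "ennreal (norm (box \<eta> k f y)) \<le> (\<integral>\<^sup>+z. ennreal (norm (box \<eta> k f z * kern (chic k) y z)) \<partial>lborel)"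
      by (subst box_reproducing(2)[OF that]) (rule integral_norm_bound_ennreal[OF box_reproducing(1)[OF that]])
    also have "\<dots> \<le> (\<integral>\<^sup>+z. ennreal (norm (box \<eta> k f z) * (K A / jbracket (y - z) ^ A)) \<partial>lborel)"
      unfolding norm_mult by (intro nn_integral_mono ennreal_leI mult_left_mono K) auto
    finally show ?thesis .
  qed
  then show ?thesis by (intro exI[of _ K] allI conjI ballI K(1))
qed

lemma box_pointwise:
  assumes p: "0 < p" and a: "2 * DIM('a::euclidean_space) \<le> a"
  shows "\<exists>C\<ge>0. \<forall>f\<in>tempered. \<forall>k\<in>lattice_pts. (\<integral>\<^sup>+z. epowr (ennreal (norm (box \<eta> k f z))) p \<partial>lborel) < \<infinity> \<longrightarrow>
    (\<forall>x::'a. epowr (ennreal (norm (box \<eta> k f x))) p \<le> ennreal C * (\<integral>\<^sup>+z. epowr (ennreal (norm (box \<eta> k f z))) p * ennreal (1 / jbracket (x - z) ^ a) \<partial>lborel))"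
proof -
  obtain K where K: "\<And>A. 0 \<le> K A" "\<And>A f k y. f \<in> tempered \<Longrightarrow> k \<in> lattice_pts \<Longrightarrow> ennreal (norm (box \<eta> k f (y::'a))) \<le>
    (\<integral>\<^sup>+z. ennreal (norm (box \<eta> k f z) * (K A / jbracket (y - z) ^ A)) \<partial>lborel)"
    using box_reproducing_bound[where 'a='a] by blast
  obtain C where C: "0 \<le> C" "\<And>g. g \<in> borel_measurable borel \<Longrightarrow> (\<exists>C0 N. \<forall>y. norm (g y) \<le> C0 * jbracket (y::'a) ^ N) \<Longrightarrow>
    (\<forall>A y. ennreal (norm (g y)) \<le> (\<integral>\<^sup>+z. ennreal (norm (g z) * (K A / jbracket (y - z) ^ A)) \<partial>lborel)) \<Longrightarrow>
    (\<integral>\<^sup>+z. epowr (ennreal (norm (g z :: complex))) p \<partial>lborel) < \<infinity> \<Longrightarrow>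
    (\<forall>x. epowr (ennreal (norm (g x))) p \<le> ennreal C * (\<integral>\<^sup>+z. epowr (ennreal (norm (g z))) p * ennreal (1 / jbracket (x - z) ^ a) \<partial>lborel))"
    using band_limited_pointwise[where K=K, OF K(1) p a] by blast
  show ?thesis
  proof (intro exI[of _ C] conjI ballI impI C(1))
    fix f :: "'a functional" and k assume f: "f \<in> tempered" and k: "k \<in> lattice_pts"
      and fin: "(\<integral>\<^sup>+z. epowr (ennreal (norm (box \<eta> k f z))) p \<partial>lborel) < \<infinity>"
    have gr: "\<exists>C0 N. \<forall>y. norm (box \<eta> k f y) \<le> C0 * jbracket y ^ N" using box_growth[OF f k] by metis
    show "\<forall>x. epowr (ennreal (norm (box \<eta> k f x))) p \<le> ennreal C * (\<integral>\<^sup>+z. epowr (ennreal (norm (box \<eta> k f z))) p * ennreal (1 / jbracket (x - z) ^ a) \<partial>lborel)"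
      by (rule C(2)[OF box_borel[OF f k] gr _ fin]) (intro allI K(2) f k)
  qed
qed

text \<open>A Nikolskii-type inequality: in the pointwise estimate the weight is at most 1. The
  constant is kept at least 1, so that the case of an infinite norm remains trivial.\<close>

lemma box_sup:
  assumes p: "0 < p"
  shows "\<exists>C\<ge>1. \<forall>f\<in>tempered. \<forall>k\<in>lattice_pts. \<forall>x::'a::euclidean_space. ennreal (norm (box \<eta> k f x)) \<le> ennreal C * Lp_norm p (box \<eta> k f)"
proof (cases "p = \<infinity>")
  case True
  show ?thesis
    unfolding True Lp_norm_def
    by (rule exI[of _ 1]) (auto intro!: le_esssup_continuous smooth_continuous box_eq(3))
next
  case False
  let ?p = "enn2real p"
  have p0: "0 < ?p" by (rule enn2real_pos[OF p False])
  obtain C where C: "0 \<le> C" "\<And>f k x. f \<in> tempered \<Longrightarrow> k \<in> lattice_pts \<Longrightarrow> (\<integral>\<^sup>+z. epowr (ennreal (norm (box \<eta> k f z))) ?p \<partial>lborel) < \<infinity> \<Longrightarrow>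
    epowr (ennreal (norm (box \<eta> k f (x::'a)))) ?p \<le> ennreal C * (\<integral>\<^sup>+z. epowr (ennreal (norm (box \<eta> k f z))) ?p * ennreal (1 / jbracket (x - z) ^ (2 * DIM('a))) \<partial>lborel)"
    using box_pointwise[OF p0 order_refl, where 'a='a] by blast
  define D where "D = max 1 (C powr (1 / ?p))"
  have "ennreal (norm (box \<eta> k f x)) \<le> ennreal D * Lp_norm p (box \<eta> k f)" if f: "f \<in> tempered" and k: "k \<in> lattice_pts" for f k and x :: 'a
  proof (cases "(\<integral>\<^sup>+z. epowr (ennreal (norm (box \<eta> k f z))) ?p \<partial>lborel) < \<infinity>")
    case True
    have "epowr (ennreal (norm (box \<eta> k f x))) ?p \<le> ennreal C * (\<integral>\<^sup>+z. epowr (ennreal (norm (box \<eta> k f z))) ?p * 1 \<partial>lborel)"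
      by (rule order_trans[OF C(2)[OF f k True]])
        (intro mult_left_mono nn_integral_mono; simp add: ennreal_le_1 jbracket_power_ge_1)
    then have "epowr (epowr (ennreal (norm (box \<eta> k f x))) ?p) (1 / ?p) \<le> epowr (ennreal C * (\<integral>\<^sup>+z. epowr (ennreal (norm (box \<eta> k f z))) ?p * 1 \<partial>lborel)) (1 / ?p)"
      using p0 by (intro epowr_mono) auto
    then have "ennreal (norm (box \<eta> k f x)) \<le> ennreal (C powr (1 / ?p)) * Lp_norm p (box \<eta> k f)"
      unfolding Lp_norm_eq[OF False] nlp_def by (simp only: epowr_inverse(1)[OF p0] epowr_mult epowr_ennreal[OF C(1)] mult_1_right)
    also have "\<dots> \<le> ennreal D * Lp_norm p (box \<eta> k f)"
      unfolding D_def by (intro mult_right_mono ennreal_leI) auto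
    finally show ?thesis .
  next
    case inf: False
    then have "Lp_norm p (box \<eta> k f) = top"
      using inf unfolding Lp_norm_eq[OF False] nlp_def by (simp add: epowr_eq_top less_top[symmetric])
    moreover have "0 < D" unfolding D_def by simp
    ultimately show ?thesis by (simp add: ennreal_mult_top)
  qed
  then show ?thesis by (intro exI[of _ D]) (auto simp: D_def)
qed

text \<open>Where the cutoff at m is nonzero, \<xi> is within R of m and \<open>jbracket m\<close>
  is at most 2 (1 + R) times \<open>jbracket \<xi>\<close>. Hence L surplus orders of decay of the
  inverse transform can be traded for L powers of \<open>jbracket m\<close>.\<close>

lemma freq_decay:
  fixes \<mu> :: "'a::euclidean_space \<Rightarrow> 'a \<Rightarrow> complex"
  assumes sm: "smooth (\<mu> 0)" and sh: "\<And>m \<xi>. m \<in> lattice_pts \<Longrightarrow> \<mu> m \<xi> = \<mu> 0 (\<xi> - m)" and R: "0 \<le> R" "\<And>\<xi>. R < norm \<xi> \<Longrightarrow> \<mu> 0 \<xi> = 0"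
  shows "\<exists>j M C. 0 \<le> C \<and> (\<forall>m\<in>lattice_pts. \<forall>\<phi>\<in>schwartz. \<forall>B. sb j M B \<phi> \<longrightarrow> sb k N (C * B / jbracket m ^ L) (\<lambda>\<xi>. \<mu> m \<xi> * inv_fourier \<phi> \<xi>))"
proof -
  obtain j M C where C: "0 \<le> C" "\<And>\<phi> B. \<phi> \<in> schwartz \<Longrightarrow> sb j M B \<phi> \<Longrightarrow> sb k (N + L) (C * B) (inv_fourier (\<phi> :: 'a \<Rightarrow> complex))"
    by (rule scont_sb[OF scont_inv_fourier, of k "N + L"]) blast
  obtain Q where Q: "0 \<le> Q" "dbound k (\<lambda>x. if norm x \<le> R then Q else 0) (\<mu> 0)"
  proof -
    have "\<exists>Q\<ge>0. dbound k (\<lambda>x. if norm x \<le> R then Q else 0) (\<mu> 0)"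
      by (rule compact_support_dbound[OF sm]) (rule R(2))
    then show thesis using that by blast
  qed
  show ?thesis
  proof (rule exI[of _ j], rule exI[of _ M], rule exI[of _ "2 ^ k * Q * C * (2 * (1 + R)) ^ L"], intro conjI ballI allI impI)
    show "0 \<le> 2 ^ k * Q * C * (2 * (1 + R)) ^ L" using C Q R by simp
    fix m :: 'a and \<phi> :: "'a \<Rightarrow> complex" and B assume m: "m \<in> lattice_pts" and p: "\<phi> \<in> schwartz" "sb j M B \<phi>"
    have B0: "0 \<le> B" by (rule sb_nonneg[OF p(2)])
    have sh': "\<mu> m = (\<lambda>\<xi>. \<mu> 0 (- m + \<xi>))" using sh[OF m] by auto
    have "dbound k (\<lambda>\<xi>. 1 ^ k * (if norm (- m + \<xi>) \<le> R then Q else 0)) (\<lambda>\<xi>. \<mu> 0 (- m + \<xi>))"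
      by (rule dbound_affine[OF bounded_linear_ident _ _ Q(2)]) (auto simp: inner_Basis if_distrib[of abs] sum.delta cong: if_cong)
    then have "dbound k (\<lambda>\<xi>. if norm (- m + \<xi>) \<le> R then Q else 0) (\<mu> m)" unfolding sh' by simp
    from dbound_mult[OF this C(2)[OF p, unfolded sb_def]]
    have d: "dbound k (\<lambda>\<xi>. 2 ^ k * ((if norm (- m + \<xi>) \<le> R then Q else 0) * (C * B / jbracket \<xi> ^ (N + L)))) (\<lambda>\<xi>. \<mu> m \<xi> * inv_fourier \<phi> \<xi>)" .
    show "sb k N (2 ^ k * Q * C * (2 * (1 + R)) ^ L * B / jbracket m ^ L) (\<lambda>\<xi>. \<mu> m \<xi> * inv_fourier \<phi> \<xi>)"
      unfolding sb_def
    proof (rule dbound_mono[OF d])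
      fix \<xi>
      show "2 ^ k * ((if norm (- m + \<xi>) \<le> R then Q else 0) * (C * B / jbracket \<xi> ^ (N + L))) \<le> 2 ^ k * Q * C * (2 * (1 + R)) ^ L * B / jbracket m ^ L / jbracket \<xi> ^ N"
      proof (cases "norm (- m + \<xi>) \<le> R")
        case True
        have "jbracket (m - \<xi>) \<le> 1 + R" using jbracket_le_1_plus_norm[of "m - \<xi>"] True by (simp add: norm_minus_commute)
        then have "2 * jbracket (m - \<xi>) * jbracket \<xi> \<le> 2 * (1 + R) * jbracket \<xi>"
          by (intro mult_right_mono) auto
        then have "jbracket m \<le> 2 * (1 + R) * jbracket \<xi>" using jbracket_le_diff[of m \<xi>] by linarith
        then have "jbracket m ^ L \<le> (2 * (1 + R)) ^ L * jbracket \<xi> ^ L"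
          using power_mono[of "jbracket m" "2 * (1 + R) * jbracket \<xi>" L] by (simp add: power_mult_distrib)
        then have "(2 ^ k * Q * C * B / (jbracket \<xi> ^ (N + L) * jbracket m ^ L)) * jbracket m ^ L \<le> (2 ^ k * Q * C * B / (jbracket \<xi> ^ (N + L) * jbracket m ^ L)) * ((2 * (1 + R)) ^ L * jbracket \<xi> ^ L)"
          using Q C B0 by (intro mult_left_mono) auto
        then show ?thesis using True by (simp add: power_add mult_ac)
      next
        case False
        then show ?thesis using Q C B0 R by auto
      qed
    qed
  qed
qed

lemma coord_prod_support:
  assumes "real DIM('a) * r < norm (\<xi> :: 'a::euclidean_space)"
  obtains b where "b \<in> Basis" "r \<le> \<bar>(\<xi> - 0) \<bullet> b\<bar>"
  using norm_gt_imp_coord[of "0::'a" r \<xi>] assms by auto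

lemma chi_decay:
  "\<exists>j M C. 0 \<le> C \<and> (\<forall>m\<in>lattice_pts. \<forall>\<phi>\<in>schwartz. \<forall>B. sb j M B \<phi> \<longrightarrow>
    sb k N (C * B / jbracket m ^ L) (\<lambda>\<xi>. chic (m::'a::euclidean_space) \<xi> * inv_fourier \<phi> \<xi>))"
proof (rule freq_decay[where R="real DIM('a) * 2"])
  show "smooth (chic (0::'a))" by (intro smooth_of_real chi_smooth)
  show "chic m \<xi> = chic 0 (\<xi> - m)" for m \<xi> :: 'a by (simp add: chi_shift[of m])
  show "chic 0 \<xi> = 0" if "real DIM('a) * 2 < norm \<xi>" for \<xi> :: 'a
    using coord_prod_support[OF that] chi_support by (metis of_real_0)
qed simp

lemma psi_decay:
  "\<exists>j M C. 0 \<le> C \<and> (\<forall>m\<in>lattice_pts. \<forall>\<phi>\<in>schwartz. \<forall>B. sb j M B \<phi> \<longrightarrow>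
    sb k N (C * B / jbracket m ^ L) (\<lambda>\<xi>. psic (m::'a::euclidean_space) \<xi> * inv_fourier \<phi> \<xi>))"
proof (rule freq_decay[where R="real DIM('a) * 1"])
  show "smooth (psic (0::'a))" by (intro smooth_of_real psi_smooth lattice_0)
  show "psic m \<xi> = psic 0 (\<xi> - m)" if "m \<in> lattice_pts" for m \<xi> :: 'a using psi_shift[OF that] by simp
  show "psic 0 \<xi> = 0" if "real DIM('a) * 1 < norm \<xi>" for \<xi> :: 'a
    using coord_prod_support[OF that] psi_support[OF lattice_0] by (metis of_real_0)
qed simp

text \<open>After localisation the test function itself is of size \<open>jbracket (fst l)\<close>
  to the power -L, and the piece enters only through its supremum on the hyperplane. There is no
  gain in the last frequency; summability there must come from the norm of f.\<close>

lemma trace_term_decay: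
  "\<exists>j M C. 0 \<le> C \<and> (\<forall>f\<in>tempered. \<forall>l\<in>lattice_pts. \<forall>\<phi>\<in>schwartz. \<forall>B S. sb j M B \<phi> \<longrightarrow> (\<forall>x. norm (box \<eta> l f (x, 0 :: real)) \<le> S) \<longrightarrow>
    norm (\<integral>x. box \<eta> l f (x, 0) * \<phi> x \<partial>lborel) \<le> C * B * S / jbracket (fst l :: 'a::euclidean_space) ^ L)"
proof -
  obtain j1 M1 C1 where C1: "0 \<le> C1" "\<And>\<phi> B. \<phi> \<in> schwartz \<Longrightarrow> sb j1 M1 B \<phi> \<Longrightarrow> sb 0 (2 * DIM('a)) (C1 * B) (fourier (\<phi> :: 'a \<Rightarrow> complex))"
    by (rule scont_sb[OF scont_fourier, of 0 "2 * DIM('a)"]) blast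
  obtain j M C where C: "0 \<le> C" "\<And>m \<phi> B. m \<in> lattice_pts \<Longrightarrow> \<phi> \<in> schwartz \<Longrightarrow> sb j M B \<phi> \<Longrightarrow>
      sb j1 M1 (C * B / jbracket m ^ L) (\<lambda>\<xi>. chic (m::'a) \<xi> * inv_fourier \<phi> \<xi>)"
    using chi_decay[of j1 M1 L, where 'a='a] by blast
  show ?thesis
  proof (rule exI[of _ j], rule exI[of _ M], rule exI[of _ "C1 * C * jint TYPE('a)"], intro conjI ballI allI impI)
    show "0 \<le> C1 * C * jint TYPE('a)" using C1(1) C(1) jint_nonneg[where 'a='a] by simp
    fix f :: "('a \<times> real) functional" and l and \<phi> :: "'a \<Rightarrow> complex" and B S
    assume f: "f \<in> tempered" and l: "l \<in> lattice_pts" and p: "\<phi> \<in> schwartz" "sb j M B \<phi>" and S: "\<forall>x. norm (box \<eta> l f (x, 0)) \<le> S"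
    let ?\<phi> = "fourier (\<lambda>\<xi>. chic (fst l) \<xi> * inv_fourier \<phi> \<xi>)"
    have l1: "fst l \<in> lattice_pts" using l lattice_Pair[of "fst l" "snd l"] by simp
    have S0: "0 \<le> S" using S order_trans[OF norm_ge_zero] by blast
    have cS: "(\<lambda>\<xi>. chic (fst l) \<xi> * inv_fourier \<phi> \<xi>) \<in> schwartz"
      by (intro schwartz_mult chi_schwartz inv_fourier_schwartz p)
    have s: "sb 0 (2 * DIM('a)) (C1 * (C * B / jbracket (fst l) ^ L)) ?\<phi>"
      by (rule C1(2)[OF cS C(2)[OF l1 p]])
    have [measurable]: "?\<phi> \<in> borel_measurable borel" by (rule schwartz_borel[OF trace_localize(2)[OF f l p(1)]])
    have [measurable]: "(\<lambda>x. box \<eta> l f (x, 0)) \<in> borel_measurable borel"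
      by (rule measurable_compose[OF _ box_borel[OF f l]]) measurable
    have "norm (\<integral>x. box \<eta> l f (x, 0) * ?\<phi> x \<partial>lborel) \<le> (S * (C1 * (C * B / jbracket (fst l) ^ L))) * jint TYPE('a)"
    proof (rule integral_le_jint[of _ _ "2 * DIM('a)"])
      fix x
      have "norm (box \<eta> l f (x, 0) * ?\<phi> x) \<le> S * ((C1 * (C * B / jbracket (fst l) ^ L)) / jbracket x ^ (2 * DIM('a)))"
        unfolding norm_mult using S S0 sb_norm[OF s, of x] by (intro mult_mono) auto
      then show "norm (box \<eta> l f (x, 0) * ?\<phi> x) \<le> S * (C1 * (C * B / jbracket (fst l) ^ L)) / jbracket x ^ (2 * DIM('a))" by simp
    qed auto
    then show "norm (\<integral>x. box \<eta> l f (x, 0) * \<phi> x \<partial>lborel) \<le> C1 * C * jint TYPE('a) * B * S / jbracket (fst l) ^ L"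
      unfolding trace_localize(1)[OF f l p(1)] by (simp add: mult_ac)
  qed
qed

end

subsection \<open>The trace\<close>

lemma countable_Ints_real: "countable (\<int> :: real set)"
  unfolding Ints_def by (rule countable_image) simp

lemma inverse_power_le:
  fixes u v w :: real
  assumes "u \<le> 2 * v * w" "0 < u" "0 < w"
  shows "1 / w ^ a \<le> 2 ^ a * v ^ a * (1 / u ^ a)"
  using power_mono[OF assms(1), of a] assms(2,3) by (simp add: power_mult_distrib field_simps)

lemma ennreal_mult_swap: "0 \<le> u \<Longrightarrow> (ennreal u * E) * ennreal w = E * ennreal (u * w)"
  by (simp add: ennreal_mult' mult_ac)

lemma lattice_nn_integral_finite:
  "(\<integral>\<^sup>+k. ennreal (1 / jbracket (k::'a::euclidean_space) ^ (2 * DIM('a))) \<partial>count_space lattice_pts) < \<infinity>"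
proof -
  obtain C where C: "\<And>F. finite F \<Longrightarrow> F \<subseteq> lattice_pts \<Longrightarrow> (\<Sum>k\<in>F. 1 / jbracket (k::'a) ^ (2 * DIM('a))) \<le> C"
    using lattice_bounded_sum by blast
  have "(\<integral>\<^sup>+k. ennreal (1 / jbracket (k::'a) ^ (2 * DIM('a))) \<partial>count_space lattice_pts) = infsum (\<lambda>k. ennreal (1 / jbracket (k::'a) ^ (2 * DIM('a)))) lattice_pts"
    by (rule infsum_eq_nn_integral_count_space[symmetric, OF countable_lattice])
  also have "\<dots> \<le> ennreal C"
  proof (subst nonneg_infsum_complete)
    show "(SUP F\<in>{F. finite F \<and> F \<subseteq> lattice_pts}. \<Sum>k\<in>F. ennreal (1 / jbracket (k::'a) ^ (2 * DIM('a)))) \<le> ennreal C"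
      by (rule SUP_least) (auto simp: sum_ennreal intro!: ennreal_leI C)
  qed simp
  finally show ?thesis by (simp add: order_le_less_trans)
qed

lemma min_exponent:
  fixes p q :: ennreal
  assumes "0 < p" "0 < q"
  defines "r \<equiv> enn2real (min p (min q 1))"
  shows "min p (min q 1) \<noteq> \<infinity>" "0 < r" "r \<le> 1" "p \<noteq> \<infinity> \<Longrightarrow> r \<le> enn2real p" "q \<noteq> \<infinity> \<Longrightarrow> r \<le> enn2real q"
proof -
  have le: "min p (min q 1) \<le> 1" by (simp add: min.coboundedI2)
  have "min p (min q 1) < \<infinity>" by (rule order_le_less_trans[OF le]) simp
  then show fin: "min p (min q 1) \<noteq> \<infinity>" by (rule less_imp_neq)
  have "0 < min p (min q 1)" using assms by simp
  then show "0 < r" unfolding r_def using fin by (simp add: enn2real_positive_iff top.not_eq_extremum)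
  show "r \<le> 1" unfolding r_def using enn2real_mono[OF le] by simp
  show "r \<le> enn2real p" if "p \<noteq> \<infinity>" unfolding r_def using that by (intro enn2real_mono) (auto simp: top.not_eq_extremum)
  show "r \<le> enn2real q" if "q \<noteq> \<infinity>" unfolding r_def using that by (intro enn2real_mono) (auto simp: top.not_eq_extremum min.coboundedI2)
qed

context decomposition
begin

section \<open>Existence of the trace\<close>

lemma has_trace_unique: "has_trace \<eta> f g \<Longrightarrow> has_trace \<eta> f g' \<Longrightarrow> g = g'"
proof
  fix \<phi> assume "has_trace \<eta> f g" "has_trace \<eta> f g'"
  then show "g \<phi> = g' \<phi>"
    by (cases "\<phi> \<in> schwartz") (auto simp: has_trace_def tempered_outside intro: has_sum_unique)
qed

lemma Tr_eqI: "has_trace \<eta> f g \<Longrightarrow> Tr \<eta> f = g"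
  unfolding Tr_def by (rule the_equality) (auto intro: has_trace_unique)

lemma aniso_norm_eq:
  assumes "0 < p" "0 < q"
  shows "aniso_norm \<eta> s p q (min p (min q 1)) f = nlp (count_space \<int>) (enn2real (min p (min q 1)))
    (\<lambda>j. lq_norm q lattice_pts (\<lambda>k. ennreal (jbracket k powr s) * Lp_norm p (box \<eta> (k, j) f)))"
  unfolding aniso_norm_def by (rule lq_norm_eq[OF min_exponent(1)[OF assms] countable_Ints_real])

text \<open>Since r <= 1, the l^r norm dominates the l^1 norm. This is where absolute convergence
  over the last frequencies comes from.\<close>

lemma aniso_sum_le:
  assumes "0 < p" "0 < q"
  shows "(\<integral>\<^sup>+j. lq_norm q lattice_pts (\<lambda>k. ennreal (jbracket k powr s) * Lp_norm p (box \<eta> (k, j) f)) \<partial>count_space \<int>)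
    \<le> aniso_norm \<eta> s p q (min p (min q 1)) f"
proof -
  let ?r = "enn2real (min p (min q 1))"
  have r: "0 < ?r" "?r \<le> 1" using min_exponent[OF assms] by auto
  show ?thesis
    using epowr_mono[OF epowr_subadditive[OF r], of "1 / ?r"] r
    unfolding aniso_norm_eq[OF assms] nlp_def by (simp add: epowr_inverse)
qed

text \<open>The terms are bounded by a summable weight in the first frequencies times
  \<open>A i\<close>, so the double sum factors into two finite ones. The same bound is linear in
  the constant of the test function, which makes the sum a tempered distribution.\<close>

lemma trace_exists:
  fixes f :: "('a::euclidean_space \<times> real) functional"
  assumes p: "0 < p" and q: "0 < q" and f: "f \<in> aniso_space \<eta> s p q (min p (min q 1))"
  shows "\<exists>g. has_trace \<eta> f g"
proof -
  let ?n = "2 * DIM('a)"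
  have ft: "f \<in> tempered" and fin: "aniso_norm \<eta> s p q (min p (min q 1)) f < \<infinity>" using f by (auto simp: aniso_space_def)
  define A where "A j = lq_norm q lattice_pts (\<lambda>k. ennreal (jbracket k powr s) * Lp_norm p (box \<eta> (k, j) f))" for j
  define sumA where "sumA = (\<integral>\<^sup>+j. A j \<partial>count_space \<int>)"
  have sA: "sumA < \<infinity>" unfolding sumA_def A_def using aniso_sum_le[OF p q] fin by (rule order_le_less_trans)
  define \<Lambda> where "\<Lambda> = (\<integral>\<^sup>+k. ennreal (1 / jbracket (k::'a) ^ ?n) \<partial>count_space lattice_pts)"
  have L: "\<Lambda> < \<infinity>" unfolding \<Lambda>_def by (rule lattice_nn_integral_finite)
  \<comment> \<open>Besides the order needed for summation over the first lattice, |s| further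
    orders absorb the weight \<open>jbracket k powr (- s)\<close>.\<close>
  define N where "N = ?n + nat \<lceil>\<bar>s\<bar>\<rceil>"
  have Ns: "real ?n \<le> real N + s" unfolding N_def by linarith
  obtain Cs where Cs: "1 \<le> Cs" "\<And>f k x. f \<in> tempered \<Longrightarrow> k \<in> lattice_pts \<Longrightarrow> ennreal (norm (box \<eta> k f (x::'a \<times> real))) \<le> ennreal Cs * Lp_norm p (box \<eta> k f)"
    using box_sup[OF p, where 'a="'a \<times> real"] by blast
  obtain j M C where C: "0 \<le> C" "\<forall>f\<in>tempered. \<forall>l\<in>lattice_pts. \<forall>\<phi>\<in>schwartz. \<forall>B S. sb j M B \<phi> \<longrightarrow> (\<forall>x. norm (box \<eta> l f (x, 0 :: real)) \<le> S) \<longrightarrow>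
    norm (\<integral>x. box \<eta> l f (x, 0) * \<phi> x \<partial>lborel) \<le> C * B * S / jbracket (fst l :: 'a) ^ N"
    using trace_term_decay[of N, where 'a='a] by blast
  define t where "t \<phi> l = (\<integral>x. box \<eta> l f (x, 0) * \<phi> x \<partial>lborel)" for \<phi> l
  have Apt: "ennreal (jbracket k powr s) * Lp_norm p (box \<eta> (k, i) f) \<le> A i" if "k \<in> lattice_pts" for k i
    unfolding A_def by (rule le_lq_norm[OF q that countable_lattice])
  have Afin: "A i < \<infinity>" if "i \<in> \<int>" for i
    using nn_integral_ge_point[of i "\<int>" A] that sA unfolding sumA_def by (rule_tac order_le_less_trans)
  have tb: "ennreal (norm (t \<phi> (k, i))) \<le> ennreal (C * B * Cs) * (ennreal (1 / jbracket k ^ ?n) * A i)"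
    if k: "k \<in> lattice_pts" and i: "i \<in> \<int>" and ph: "\<phi> \<in> schwartz" "sb j M B \<phi>" for k i \<phi> B
  proof -
    have B0: "0 \<le> B" by (rule sb_nonneg[OF ph(2)])
    have l: "(k, i) \<in> lattice_pts" using k i by (simp add: lattice_Pair)
    have "Lp_norm p (box \<eta> (k, i) f) = ennreal (jbracket k powr (- s)) * (ennreal (jbracket k powr s) * Lp_norm p (box \<eta> (k, i) f))"
      by (simp add: mult.assoc[symmetric] flip: ennreal_mult powr_add)
    also have "\<dots> \<le> ennreal (jbracket k powr (- s)) * A i" by (intro mult_left_mono Apt k) auto
    finally have le: "Lp_norm p (box \<eta> (k, i) f) \<le> ennreal (jbracket k powr (- s)) * A i" .
    also have "\<dots> < \<infinity>" using Afin[OF i] by (simp add: ennreal_mult_less_top)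
    \<comment> \<open>A real value is extracted because \<open>trace_term_decay\<close> speaks of a
      real supremum.\<close>
    finally obtain \<alpha> where al: "0 \<le> \<alpha>" "Lp_norm p (box \<eta> (k, i) f) = ennreal \<alpha>" by (cases "Lp_norm p (box \<eta> (k, i) f)") auto
    have "norm (box \<eta> (k, i) f (x, 0)) \<le> Cs * \<alpha>" for x
      using Cs(2)[OF ft l, of "(x, 0)"] al Cs(1) by (simp add: ennreal_le_iff flip: ennreal_mult)
    then have "norm (t \<phi> (k, i)) \<le> C * B * (Cs * \<alpha>) / jbracket (fst (k, i)) ^ N"
      unfolding t_def by (rule C(2)[rule_format, OF ft l ph])
    then have "ennreal (norm (t \<phi> (k, i))) \<le> ennreal (C * B * Cs / jbracket k ^ N * \<alpha>)" by (simp add: ennreal_leI mult_ac)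
    also have "\<dots> = ennreal (C * B * Cs / jbracket k ^ N) * Lp_norm p (box \<eta> (k, i) f)"
      unfolding al(2) using al(1) by (rule ennreal_mult'')
    also have "\<dots> \<le> ennreal (C * B * Cs / jbracket k ^ N) * (ennreal (jbracket k powr (- s)) * A i)"
      by (intro mult_left_mono le) auto
    also have "\<dots> = ennreal (C * B * Cs * (jbracket k powr (- s) / jbracket k ^ N)) * A i"
      using C(1) B0 Cs(1) by (simp add: mult.assoc[symmetric] flip: ennreal_mult)
    also have "\<dots> \<le> ennreal (C * B * Cs * (1 / jbracket k ^ ?n)) * A i"
    proof (intro mult_right_mono ennreal_leI mult_left_mono)
      have "jbracket k powr (- s) / jbracket k ^ N = jbracket k powr (- s - real N)" by (simp add: powr_diff powr_realpow)
      also have "\<dots> \<le> jbracket k powr (- real ?n)" using Ns by (intro powr_mono jbracket_ge_1) auto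
      also have "\<dots> = 1 / jbracket k ^ ?n" unfolding powr_minus_divide using powr_realpow[OF jbracket_pos[of k], of ?n] by simp
      finally show "jbracket k powr (- s) / jbracket k ^ N \<le> 1 / jbracket k ^ ?n" .
    qed (use C(1) B0 Cs(1) in auto)
    also have "\<dots> = ennreal (C * B * Cs) * (ennreal (1 / jbracket k ^ ?n) * A i)"
      using C(1) B0 Cs(1) by (simp add: mult.assoc[symmetric] flip: ennreal_mult)
    finally show ?thesis .
  qed
  have "\<Lambda> * sumA < \<infinity>" using L sA by (simp add: ennreal_mult_less_top)
  then obtain \<Theta> where Th: "0 \<le> \<Theta>" "\<Lambda> * sumA = ennreal \<Theta>" by (cases "\<Lambda> * sumA") auto
  have tot: "(\<integral>\<^sup>+l. ennreal (norm (t \<phi> l)) \<partial>count_space lattice_pts) \<le> ennreal (C * Cs * \<Theta> * B)"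
    if ph: "\<phi> \<in> schwartz" "sb j M B \<phi>" for \<phi> B
  proof -
    have B0: "0 \<le> B" by (rule sb_nonneg[OF ph(2)])
    have "(\<integral>\<^sup>+l. ennreal (norm (t \<phi> l)) \<partial>count_space lattice_pts) = (\<integral>\<^sup>+k. \<integral>\<^sup>+i. ennreal (norm (t \<phi> (k, i))) \<partial>count_space \<int> \<partial>count_space lattice_pts)"
      unfolding lattice_prod_eq by (rule nn_integral_count_space_Times[OF countable_lattice countable_Ints_real])
    also have "\<dots> \<le> (\<integral>\<^sup>+k. \<integral>\<^sup>+i. ennreal (C * B * Cs) * (ennreal (1 / jbracket (k::'a) ^ ?n) * A i) \<partial>count_space \<int> \<partial>count_space lattice_pts)"
      using tb[OF _ _ ph] by (intro nn_integral_mono) auto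
    also have "\<dots> = ennreal (C * B * Cs) * (\<Lambda> * sumA)"
      unfolding \<Lambda>_def sumA_def by (simp add: nn_integral_cmult nn_integral_multc)
    also have "\<dots> = ennreal (C * Cs * \<Theta> * B)" unfolding Th(2) using C(1) B0 Cs(1) Th(1) by (simp add: mult_ac flip: ennreal_mult)
    finally show ?thesis .
  qed
  have CC: "0 \<le> C * Cs * \<Theta>" using C(1) Cs(1) Th(1) by simp
  have summ: "t \<phi> summable_on lattice_pts" if ph: "\<phi> \<in> schwartz" for \<phi>
  proof -
    obtain B where B: "sb j M B \<phi>" using schwartz_sb[OF ph] by blast
    have "0 \<le> C * Cs * \<Theta> * B" using CC sb_nonneg[OF B] by simp
    from summable_from_nn_integral(1)[OF tot[OF ph B] this] show ?thesis by (rule abs_summable_summable)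
  qed
  define g where "g = on_schwartz (\<lambda>\<phi>. infsum (t \<phi>) lattice_pts)"
  have gt: "g \<in> tempered"
  proof (rule temperedI[where k=j and N=M and C="C * Cs * \<Theta>"])
    fix \<phi> \<phi>' :: "'a \<Rightarrow> complex" assume ph: "\<phi> \<in> schwartz" "\<phi>' \<in> schwartz"
    have "t (\<lambda>x. \<phi> x + \<phi>' x) l = t \<phi> l + t \<phi>' l" if "l \<in> lattice_pts" for l
      unfolding t_def using trace_integral(1)[OF ft that] ph by (simp add: ring_distribs)
    then have "infsum (t (\<lambda>x. \<phi> x + \<phi>' x)) lattice_pts = infsum (\<lambda>l. t \<phi> l + t \<phi>' l) lattice_pts" by (intro infsum_cong)
    also have "\<dots> = infsum (t \<phi>) lattice_pts + infsum (t \<phi>') lattice_pts" by (rule infsum_add[OF summ[OF ph(1)] summ[OF ph(2)]])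
    finally show "g (\<lambda>x. \<phi> x + \<phi>' x) = g \<phi> + g \<phi>'" using ph by (simp add: g_def on_schwartz_def schwartz_add)
  next
    fix c and \<phi> :: "'a \<Rightarrow> complex" assume ph: "\<phi> \<in> schwartz"
    have "t (\<lambda>x. c * \<phi> x) = (\<lambda>l. c * t \<phi> l)"
      unfolding t_def fun_eq_iff by (simp add: mult.left_commute)
    then show "g (\<lambda>x. c * \<phi> x) = c * g \<phi>" using ph by (simp add: g_def on_schwartz_def schwartz_cmult infsum_cmult_right')
  next
    fix \<phi> :: "'a \<Rightarrow> complex" and B assume ph: "\<phi> \<in> schwartz" "sb j M B \<phi>"
    have "0 \<le> C * Cs * \<Theta> * B" using CC sb_nonneg[OF ph(2)] by simp
    from summable_from_nn_integral(2)[OF tot[OF ph] this] show "norm (g \<phi>) \<le> C * Cs * \<Theta> * B"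
      using ph by (simp add: g_def on_schwartz_def)
  qed (simp add: g_def on_schwartz_def)
  have "has_trace \<eta> f g"
    unfolding has_trace_def
  proof (intro conjI ballI gt)
    fix \<phi> :: "'a \<Rightarrow> complex" assume ph: "\<phi> \<in> schwartz"
    have "(\<lambda>l. trace_term \<eta> f l \<phi>) = t \<phi>" using ph by (simp add: trace_term_def on_schwartz_def t_def fun_eq_iff)
    then show "((\<lambda>l. trace_term \<eta> f l \<phi>) has_sum g \<phi>) lattice_pts"
      using has_sum_infsum[OF summ[OF ph]] ph by (simp add: g_def on_schwartz_def)
  qed
  then show ?thesis by blast
qed

section \<open>Boundedness of the trace\<close>

definition shifts :: "'a::euclidean_space set" where
  "shifts = {d \<in> lattice_pts. \<forall>b\<in>Basis. \<bar>0 \<bullet> b - d \<bullet> b\<bar> \<le> 2}"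

lemma finite_shifts: "finite (shifts :: 'a::euclidean_space set)"
  unfolding shifts_def by (rule finite_lattice_near)

text \<open>Evaluating the weakly convergent trace series on the kernel of
  \<open>psi \<eta> k\<close> gives \<open>box \<eta> k g x\<close>. By \<open>trace_vanish\<close>
  only first frequencies that differ from k by an element of the finite set \<open>shifts\<close>
  contribute.\<close>

lemma box_trace_le:
  fixes f :: "('a::euclidean_space \<times> real) functional"
  assumes f: "f \<in> tempered" and g: "has_trace \<eta> f g" and k: "k \<in> lattice_pts"
  shows "ennreal (norm (box \<eta> k g x)) \<le>
    (\<integral>\<^sup>+(d, j). ennreal (norm (\<integral>y. box \<eta> (k + d, j) f (y, 0) * kern (psic k) x y \<partial>lborel)) \<partial>count_space (shifts \<times> \<int>))"
proof -
  let ?h = "\<lambda>l. ennreal (norm (\<integral>y. box \<eta> l f (y, 0) * kern (psic k) x y \<partial>lborel))"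
  have gt: "g \<in> tempered" using g by (simp add: has_trace_def)
  have kS: "kern (psic k) x \<in> schwartz" by (rule kern_schwartz[OF psi_schwartz[OF k]])
  have "box \<eta> k g x = g (kern (psic k) x)" by (rule box_eq_kern[OF gt k])
  also have "\<dots> = infsum (\<lambda>l. trace_term \<eta> f l (kern (psic k) x)) lattice_pts"
    using g kS by (intro infsumI[symmetric]) (auto simp: has_trace_def)
  also have "ennreal (norm \<dots>) \<le> (\<integral>\<^sup>+l. ennreal (norm (trace_term \<eta> f l (kern (psic k) x))) \<partial>count_space lattice_pts)"
    by (rule ennreal_norm_infsum_le)
  also have "\<dots> = (\<integral>\<^sup>+l. ?h l \<partial>count_space lattice_pts)"
    using kS by (simp add: trace_term_def on_schwartz_def)
  also have "\<dots> = (\<integral>\<^sup>+l. ?h l \<partial>count_space ((\<lambda>(d, j). (k + d, j)) ` (shifts \<times> \<int>)))"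
  proof (rule nn_integral_count_space_eq)
    fix l :: "'a \<times> real" assume l: "l \<in> lattice_pts - (\<lambda>(d, j). (k + d, j)) ` (shifts \<times> \<int>)"
    have fl: "fst l \<in> lattice_pts" "snd l \<in> \<int>" using l lattice_Pair[of "fst l" "snd l"] by auto
    have "l = (k + (fst l - k), snd l)" by simp
    then have "fst l - k \<notin> shifts" using l fl by (metis (no_types, lifting) DiffD2 SigmaI case_prod_conv image_eqI)
    then obtain b where "b \<in> Basis" "2 < \<bar>(fst l - k) \<bullet> b\<bar>"
      using lattice_diff[OF fl(1) k] unfolding shifts_def by auto
    then show "?h l = 0" using trace_vanish[OF f _ k, of l b x] l by simp
  next
    fix l :: "'a \<times> real" assume "l \<in> (\<lambda>(d, j). (k + d, j)) ` (shifts \<times> \<int>) - lattice_pts"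
    then show "?h l = 0" using k by (auto simp: lattice_Pair shifts_def lattice_add)
  qed
  also have "\<dots> = (\<integral>\<^sup>+z. ?h ((\<lambda>(d, j). (k + d, j)) z) \<partial>count_space (shifts \<times> \<int>))"
    by (rule nn_integral_bij_count_space[symmetric]) (auto simp: bij_betw_def inj_on_def)
  finally show ?thesis by (simp add: case_prod_unfold)
qed

text \<open>The pointwise estimate at (y, 0) is moved to (x, 0) at the cost of a power of
  \<open>jbracket (x - y)\<close>, which the decay of the kernel absorbs. What remains is a weighted
  average over the whole space with centre (x, 0).\<close>

lemma trace_piece:
  assumes p: "0 < p"
  shows "\<exists>C\<ge>0. \<forall>f\<in>tempered. \<forall>l\<in>lattice_pts. \<forall>k\<in>lattice_pts. \<forall>x::'a::euclidean_space.
    (\<integral>\<^sup>+z. epowr (ennreal (norm (box \<eta> l f z))) p \<partial>lborel) < \<infinity> \<longrightarrow>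
    ennreal (norm (\<integral>y. box \<eta> l f (y, 0 :: real) * kern (psic k) x y \<partial>lborel)) \<le>
    ennreal C * epowr (\<integral>\<^sup>+z. epowr (ennreal (norm (box \<eta> l f z))) p * ennreal (1 / jbracket ((x, 0) - z) ^ (2 * DIM('a \<times> real))) \<partial>lborel) (1 / p)"
proof -
  let ?a = "2 * DIM('a \<times> real)"
  obtain C where C: "0 \<le> C" "\<And>f l x. f \<in> tempered \<Longrightarrow> l \<in> lattice_pts \<Longrightarrow> (\<integral>\<^sup>+z. epowr (ennreal (norm (box \<eta> l f z))) p \<partial>lborel) < \<infinity> \<Longrightarrow>
    epowr (ennreal (norm (box \<eta> l f (x :: 'a \<times> real)))) p \<le> ennreal C * (\<integral>\<^sup>+z. epowr (ennreal (norm (box \<eta> l f z))) p * ennreal (1 / jbracket (x - z) ^ ?a) \<partial>lborel)"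
    using box_pointwise[OF p order_refl, where 'a="'a \<times> real"] by blast
  \<comment> \<open>Taking p-th roots turns the power \<open>?a\<close> of the bracket into
    \<open>?a / p\<close>; \<open>N\<close> then adds the order that keeps the remaining kernel
    integrable.\<close>
  define m where "m = nat \<lceil>real ?a / p\<rceil>"
  have m: "real ?a / p \<le> real m" unfolding m_def by linarith
  define N where "N = m + 2 * DIM('a)"
  obtain K where K: "0 \<le> K" "\<And>k x y. norm (kern (\<lambda>\<xi>. psic 0 (\<xi> - k)) x y) \<le> K / jbracket (x - y :: 'a) ^ N"
    using kern_bound[OF psi_schwartz[OF lattice_0], where 'a='a and N=N] by blast
  let ?C = "(C * 2 ^ ?a) powr (1 / p) * (K * jint TYPE('a))"
  have "ennreal (norm (\<integral>y. box \<eta> l f (y, 0) * kern (psic k) x y \<partial>lborel)) \<le>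
    ennreal ?C * epowr (\<integral>\<^sup>+z. epowr (ennreal (norm (box \<eta> l f z))) p * ennreal (1 / jbracket ((x, 0) - z) ^ ?a) \<partial>lborel) (1 / p)"
    if f: "f \<in> tempered" and l: "l \<in> lattice_pts" and k: "k \<in> lattice_pts" and fin: "(\<integral>\<^sup>+z. epowr (ennreal (norm (box \<eta> l f z))) p \<partial>lborel) < \<infinity>"
    for f :: "('a \<times> real) functional" and l and k and x :: 'a
  proof -
    let ?P = "\<integral>\<^sup>+z. epowr (ennreal (norm (box \<eta> l f z))) p * ennreal (1 / jbracket ((x, 0) - z) ^ ?a) \<partial>lborel"
    have [measurable]: "box \<eta> l f \<in> borel_measurable borel" by (rule box_borel[OF f l])
    have kS: "kern (psic k) x \<in> schwartz" by (rule kern_schwartz[OF psi_schwartz[OF k]])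
    have pt: "ennreal (norm (box \<eta> l f (y, 0))) \<le> ennreal ((C * 2 ^ ?a) powr (1 / p) * jbracket (x - y) ^ m) * epowr ?P (1 / p)" for y
    proof -
      have "epowr (ennreal (norm (box \<eta> l f (y, 0)))) p \<le> ennreal C * (\<integral>\<^sup>+z. epowr (ennreal (norm (box \<eta> l f z))) p * ennreal (1 / jbracket ((y, 0) - z) ^ ?a) \<partial>lborel)"
        by (rule C(2)[OF f l fin])
      also have "\<dots> \<le> ennreal C * (\<integral>\<^sup>+z. ennreal (2 ^ ?a * jbracket (x - y) ^ ?a) * (epowr (ennreal (norm (box \<eta> l f z))) p * ennreal (1 / jbracket ((x, 0) - z) ^ ?a)) \<partial>lborel)"
      proof (intro mult_left_mono nn_integral_mono)
        fix z :: "'a \<times> real"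
        have "jbracket ((x, 0) - z) \<le> 2 * jbracket (x - y) * jbracket ((y, 0) - z)"
        proof -
          have e: "(x, 0) - z = ((x, 0) - (y, 0)) + ((y, 0) - z)" by (simp only: add_diff_eq diff_add_cancel)
          show ?thesis unfolding e using jbracket_add[of "(x, 0) - (y, 0)" "(y, 0) - z"] by simp
        qed
        then have "1 / jbracket ((y, 0) - z) ^ ?a \<le> 2 ^ ?a * jbracket (x - y) ^ ?a * (1 / jbracket ((x, 0) - z) ^ ?a)"
          by (rule inverse_power_le) auto
        then have "ennreal (1 / jbracket ((y, 0) - z) ^ ?a) \<le> ennreal (2 ^ ?a * jbracket (x - y) ^ ?a) * ennreal (1 / jbracket ((x, 0) - z) ^ ?a)"
          by (simp add: ennreal_leI flip: ennreal_mult)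
        then have "epowr (ennreal (norm (box \<eta> l f z))) p * ennreal (1 / jbracket ((y, 0) - z) ^ ?a) \<le> epowr (ennreal (norm (box \<eta> l f z))) p * (ennreal (2 ^ ?a * jbracket (x - y) ^ ?a) * ennreal (1 / jbracket ((x, 0) - z) ^ ?a))"
          by (rule mult_left_mono) simp
        then show "epowr (ennreal (norm (box \<eta> l f z))) p * ennreal (1 / jbracket ((y, 0) - z) ^ ?a) \<le> ennreal (2 ^ ?a * jbracket (x - y) ^ ?a) * (epowr (ennreal (norm (box \<eta> l f z))) p * ennreal (1 / jbracket ((x, 0) - z) ^ ?a))"
          by (simp add: mult_ac)
      qed simp
      also have "\<dots> = ennreal (C * 2 ^ ?a * jbracket (x - y) ^ ?a) * ?P"
        using C(1) by (subst nn_integral_cmult) (auto simp: mult.assoc[symmetric] simp flip: ennreal_mult)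
      finally have "epowr (epowr (ennreal (norm (box \<eta> l f (y, 0)))) p) (1 / p) \<le> epowr (ennreal (C * 2 ^ ?a * jbracket (x - y) ^ ?a) * ?P) (1 / p)"
        using p by (intro epowr_mono) auto
      then have "ennreal (norm (box \<eta> l f (y, 0))) \<le> ennreal ((C * 2 ^ ?a * jbracket (x - y) ^ ?a) powr (1 / p)) * epowr ?P (1 / p)"
        using C(1) by (simp only: epowr_inverse(1)[OF p] epowr_mult) (simp add: epowr_ennreal)
      also have "\<dots> \<le> ennreal ((C * 2 ^ ?a) powr (1 / p) * jbracket (x - y) ^ m) * epowr ?P (1 / p)"
      proof (intro mult_right_mono ennreal_leI)
        have "(jbracket (x - y) ^ ?a) powr (1 / p) = jbracket (x - y) powr (real ?a / p)"
          by (subst powr_realpow[symmetric]) (simp_all add: powr_powr)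
        also have "\<dots> \<le> jbracket (x - y) powr real m" using m by (intro powr_mono jbracket_ge_1)
        also have "\<dots> = jbracket (x - y) ^ m" by (simp add: powr_realpow)
        finally have "(C * 2 ^ ?a) powr (1 / p) * (jbracket (x - y) ^ ?a) powr (1 / p) \<le> (C * 2 ^ ?a) powr (1 / p) * jbracket (x - y) ^ m"
          by (rule mult_left_mono) simp
        then show "(C * 2 ^ ?a * jbracket (x - y) ^ ?a) powr (1 / p) \<le> (C * 2 ^ ?a) powr (1 / p) * jbracket (x - y) ^ m"
          using C(1) by (simp only: powr_mult mult_nonneg_nonneg zero_le_power jbracket_nonneg zero_le_numeral)
      qed simp
      finally show ?thesis .
    qed
    have "ennreal (norm (\<integral>y. box \<eta> l f (y, 0) * kern (psic k) x y \<partial>lborel)) \<le> (\<integral>\<^sup>+y. ennreal (norm (box \<eta> l f (y, 0) * kern (psic k) x y)) \<partial>lborel)"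
      by (rule integral_norm_bound_ennreal[OF trace_integral(1)[OF f l kS]])
    also have "\<dots> \<le> (\<integral>\<^sup>+y. (ennreal ((C * 2 ^ ?a) powr (1 / p) * K) * epowr ?P (1 / p)) * ennreal (1 / jbracket (x - y) ^ (2 * DIM('a))) \<partial>lborel)"
    proof (rule nn_integral_mono)
      fix y
      have kb: "norm (kern (psic k) x y) \<le> K / jbracket (x - y) ^ N" unfolding psic_shift[OF k] by (rule K(2))
      have "ennreal (norm (box \<eta> l f (y, 0) * kern (psic k) x y)) = ennreal (norm (box \<eta> l f (y, 0))) * ennreal (norm (kern (psic k) x y))"
        by (simp add: norm_mult ennreal_mult)
      also have "\<dots> \<le> (ennreal ((C * 2 ^ ?a) powr (1 / p) * jbracket (x - y) ^ m) * epowr ?P (1 / p)) * ennreal (K / jbracket (x - y) ^ N)"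
        by (intro mult_mono pt ennreal_leI kb) auto
      also have "\<dots> = epowr ?P (1 / p) * ennreal (((C * 2 ^ ?a) powr (1 / p) * jbracket (x - y) ^ m) * (K / jbracket (x - y) ^ N))"
        by (rule ennreal_mult_swap) simp
      also have "((C * 2 ^ ?a) powr (1 / p) * jbracket (x - y) ^ m) * (K / jbracket (x - y) ^ N) = ((C * 2 ^ ?a) powr (1 / p) * K) * (1 / jbracket (x - y) ^ (2 * DIM('a)))"
        unfolding N_def power_add by simp
      finally show "ennreal (norm (box \<eta> l f (y, 0) * kern (psic k) x y)) \<le> (ennreal ((C * 2 ^ ?a) powr (1 / p) * K) * epowr ?P (1 / p)) * ennreal (1 / jbracket (x - y) ^ (2 * DIM('a)))"
        by (subst ennreal_mult_swap) (use K(1) in simp_all)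
    qed
    also have "\<dots> = (ennreal ((C * 2 ^ ?a) powr (1 / p) * K) * epowr ?P (1 / p)) * ennreal (jint TYPE('a))"
      by (subst nn_integral_cmult) (auto simp: nn_integral_jbracket_shift)
    also have "\<dots> = epowr ?P (1 / p) * ennreal ((C * 2 ^ ?a) powr (1 / p) * K * jint TYPE('a))"
      by (rule ennreal_mult_swap) (use K(1) in simp)
    also have "\<dots> = ennreal ?C * epowr ?P (1 / p)" by (simp only: mult_ac)
    finally show ?thesis .
  qed
  then show ?thesis using K(1) jint_nonneg[where 'a='a] by (intro exI[of _ ?C]) auto
qed

text \<open>By Tonelli the integral over x is taken first. The bracket on the product space
  dominates that of the first component, so this inner integral of the weight is at most
  \<open>jint\<close>, independently of z. In this way a slice is controlled by the whole
  space.\<close>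

lemma slice_weight_integral:
  fixes G :: "'a::euclidean_space \<times> real \<Rightarrow> ennreal"
  assumes [measurable]: "G \<in> borel_measurable borel"
  shows "(\<integral>\<^sup>+x. \<integral>\<^sup>+z. G z * ennreal (1 / jbracket ((x, 0) - z) ^ (2 * DIM('a \<times> real))) \<partial>lborel \<partial>lborel) \<le> ennreal (jint TYPE('a)) * (\<integral>\<^sup>+z. G z \<partial>lborel)"
    and "(\<lambda>x. \<integral>\<^sup>+z. G z * ennreal (1 / jbracket ((x, 0) - z) ^ (2 * DIM('a \<times> real))) \<partial>lborel) \<in> borel_measurable borel"
proof -
  let ?a = "2 * DIM('a \<times> real)"
  let ?F = "\<lambda>(x::'a, z). G z * ennreal (1 / jbracket ((x, 0) - z) ^ ?a)"
  have m: "?F \<in> borel_measurable (lborel \<Otimes>\<^sub>M lborel)" by measurable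
  have "(\<integral>\<^sup>+x. \<integral>\<^sup>+z. G z * ennreal (1 / jbracket ((x, 0) - z) ^ ?a) \<partial>lborel \<partial>lborel) = (\<integral>\<^sup>+z. \<integral>\<^sup>+x. G z * ennreal (1 / jbracket ((x, 0) - z) ^ ?a) \<partial>lborel \<partial>lborel)"
    using lborel_pair.Fubini'[OF m] by simp
  also have "\<dots> \<le> (\<integral>\<^sup>+z. \<integral>\<^sup>+x. G z * ennreal (1 / jbracket (fst z - x) ^ (2 * DIM('a))) \<partial>lborel \<partial>lborel)"
  proof (intro nn_integral_mono mult_left_mono ennreal_leI)
    fix z :: "'a \<times> real" and x :: 'a
    have "1 / jbracket ((x, 0) - z) ^ ?a \<le> 1 / jbracket ((x, 0) - z) ^ (2 * DIM('a))" by (rule jbracket_div_mono) auto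
    also have "\<dots> \<le> 1 / jbracket (x - fst z) ^ (2 * DIM('a))"
      using jbracket_fst_le[of "(x, 0) - z"] by (intro divide_left_mono power_mono mult_pos_pos zero_less_power) auto
    finally show "1 / jbracket ((x, 0) - z) ^ ?a \<le> 1 / jbracket (fst z - x) ^ (2 * DIM('a))"
      by (simp add: jbracket_minus_commute)
  qed auto
  also have "\<dots> = (\<integral>\<^sup>+z. G z * ennreal (jint TYPE('a)) \<partial>lborel)"
    by (intro nn_integral_cong) (simp add: nn_integral_cmult nn_integral_jbracket_shift)
  also have "\<dots> = ennreal (jint TYPE('a)) * (\<integral>\<^sup>+z. G z \<partial>lborel)"
    by (simp add: nn_integral_multc mult.commute)
  finally show "(\<integral>\<^sup>+x. \<integral>\<^sup>+z. G z * ennreal (1 / jbracket ((x, 0) - z) ^ ?a) \<partial>lborel \<partial>lborel) \<le> ennreal (jint TYPE('a)) * (\<integral>\<^sup>+z. G z \<partial>lborel)" .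
  have "(\<lambda>x::'a. \<integral>\<^sup>+z. ?F (x, z) \<partial>lborel) \<in> borel_measurable lborel"
    by (rule lborel.borel_measurable_nn_integral_fst) (rule m)
  then show "(\<lambda>x. \<integral>\<^sup>+z. G z * ennreal (1 / jbracket ((x, 0) - z) ^ ?a) \<partial>lborel) \<in> borel_measurable borel" by simp
qed

text \<open>For finite p, subadditivity moves the power r inside the sum and Minkowski's inequality
  with exponent p/r then moves the norm inside. For p = \<infinity> the supremum of each piece and
  subadditivity are enough.\<close>

lemma trace_Lp:
  assumes p: "0 < p" and r: "0 < r" "r \<le> 1" "p \<noteq> \<infinity> \<Longrightarrow> r \<le> enn2real p"
  shows "\<exists>C\<ge>0. \<forall>f\<in>tempered. \<forall>g. \<forall>k\<in>lattice_pts. has_trace \<eta> f g \<longrightarrow> (\<forall>l\<in>lattice_pts. Lp_norm p (box \<eta> l f) < \<infinity>) \<longrightarrow>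
    epowr (Lp_norm p (box \<eta> k g)) r \<le> ennreal C * (\<integral>\<^sup>+(d, j). epowr (Lp_norm p (box \<eta> (k + d :: 'a::euclidean_space, j) f)) r \<partial>count_space (shifts \<times> \<int>))"
proof (cases "p = \<infinity>")
  case True
  obtain K where K: "0 \<le> K" "\<And>k x y. norm (kern (\<lambda>\<xi>. psic 0 (\<xi> - k)) x y) \<le> K / jbracket (x - y :: 'a) ^ (2 * DIM('a))"
    using kern_bound[OF psi_schwartz[OF lattice_0], where 'a='a and N="2 * DIM('a)"] by blast
  let ?C = "K * jint TYPE('a)"
  have C0: "0 \<le> ?C" using K jint_nonneg[where 'a='a] by simp
  have "epowr (Lp_norm p (box \<eta> k g)) r \<le> ennreal (?C powr r) * (\<integral>\<^sup>+(d, j). epowr (Lp_norm p (box \<eta> (k + d, j) f)) r \<partial>count_space (shifts \<times> \<int>))"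
    if f: "f \<in> tempered" and k: "k \<in> lattice_pts" and g: "has_trace \<eta> f g" for f :: "('a \<times> real) functional" and g k
  proof -
    have gt: "g \<in> tempered" using g by (simp add: has_trace_def)
    have piece: "ennreal (norm (\<integral>y. box \<eta> l f (y, 0) * kern (psic k) x y \<partial>lborel)) \<le> ennreal ?C * Lp_norm p (box \<eta> l f)"
      if l: "l \<in> lattice_pts" for l x
    proof -
      have kS: "kern (psic k) x \<in> schwartz" by (rule kern_schwartz[OF psi_schwartz[OF k]])
      have le: "ennreal (norm (box \<eta> l f z)) \<le> Lp_norm p (box \<eta> l f)" for z
        unfolding True Lp_norm_def using le_esssup_continuous[OF smooth_continuous[OF box_eq(3)[OF f l]]] by simp
      have "ennreal (norm (\<integral>y. box \<eta> l f (y, 0) * kern (psic k) x y \<partial>lborel)) \<le> (\<integral>\<^sup>+y. ennreal (norm (box \<eta> l f (y, 0) * kern (psic k) x y)) \<partial>lborel)"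
        by (rule integral_norm_bound_ennreal[OF trace_integral(1)[OF f l kS]])
      also have "\<dots> \<le> (\<integral>\<^sup>+y. (Lp_norm p (box \<eta> l f) * ennreal K) * ennreal (1 / jbracket (x - y) ^ (2 * DIM('a))) \<partial>lborel)"
      proof (rule nn_integral_mono)
        fix y
        have kb: "norm (kern (psic k) x y) \<le> K * (1 / jbracket (x - y) ^ (2 * DIM('a)))"
          using K(2)[of k x y] unfolding psic_shift[OF k] by simp
        have "ennreal (norm (box \<eta> l f (y, 0) * kern (psic k) x y)) = ennreal (norm (box \<eta> l f (y, 0))) * ennreal (norm (kern (psic k) x y))"
          by (simp add: norm_mult ennreal_mult)
        also have "\<dots> \<le> Lp_norm p (box \<eta> l f) * ennreal (K * (1 / jbracket (x - y) ^ (2 * DIM('a))))"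
          by (intro mult_mono le ennreal_leI kb) auto
        finally show "ennreal (norm (box \<eta> l f (y, 0) * kern (psic k) x y)) \<le> (Lp_norm p (box \<eta> l f) * ennreal K) * ennreal (1 / jbracket (x - y) ^ (2 * DIM('a)))"
          unfolding ennreal_mult'[OF K(1)] mult.assoc .
      qed
      also have "\<dots> = (Lp_norm p (box \<eta> l f) * ennreal K) * ennreal (jint TYPE('a))"
        by (subst nn_integral_cmult) (auto simp: nn_integral_jbracket_shift)
      also have "\<dots> = ennreal ?C * Lp_norm p (box \<eta> l f)" using K(1) jint_nonneg[where 'a='a] by (simp add: ennreal_mult mult_ac)
      finally show ?thesis .
    qed
    have "Lp_norm p (box \<eta> k g) \<le> ennreal ?C * (\<integral>\<^sup>+(d, j). Lp_norm p (box \<eta> (k + d, j) f) \<partial>count_space (shifts \<times> \<int>))"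
      unfolding True
    proof (rule Lp_norm_le_sup[OF box_borel[OF gt k]])
      fix x
      have "ennreal (norm (box \<eta> k g x)) \<le> (\<integral>\<^sup>+(d, j). ennreal (norm (\<integral>y. box \<eta> (k + d, j) f (y, 0) * kern (psic k) x y \<partial>lborel)) \<partial>count_space (shifts \<times> \<int>))"
        by (rule box_trace_le[OF f g k])
      also have "\<dots> \<le> (\<integral>\<^sup>+(d, j). ennreal ?C * Lp_norm \<infinity> (box \<eta> (k + d, j) f) \<partial>count_space (shifts \<times> \<int>))"
        by (intro nn_integral_mono) (use piece[unfolded True] k in \<open>auto simp: shifts_def lattice_Pair lattice_add\<close>)
      also have "\<dots> = ennreal ?C * (\<integral>\<^sup>+(d, j). Lp_norm \<infinity> (box \<eta> (k + d, j) f) \<partial>count_space (shifts \<times> \<int>))"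
        unfolding case_prod_unfold by (rule nn_integral_cmult) simp
      finally show "ennreal (norm (box \<eta> k g x)) \<le> \<dots>" .
    qed
    then have "epowr (Lp_norm p (box \<eta> k g)) r \<le> epowr (ennreal ?C * (\<integral>\<^sup>+(d, j). Lp_norm p (box \<eta> (k + d, j) f) \<partial>count_space (shifts \<times> \<int>))) r"
      using r by (intro epowr_mono) auto
    also have "\<dots> \<le> ennreal (?C powr r) * (\<integral>\<^sup>+(d, j). epowr (Lp_norm p (box \<eta> (k + d, j) f)) r \<partial>count_space (shifts \<times> \<int>))"
      unfolding epowr_mult epowr_ennreal[OF C0] case_prod_unfold
      by (intro mult_left_mono epowr_subadditive r) auto
    finally show ?thesis .
  qed
  then show ?thesis by (intro exI[of _ "?C powr r"]) auto
next
  case False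
  let ?p = "enn2real p"
  have p0: "0 < ?p" by (rule enn2real_pos[OF p False])
  have t1: "1 \<le> ?p / r" using r False by simp
  have tp: "0 < ?p / r" using p0 r by simp
  let ?a = "2 * DIM('a \<times> real)"
  define P where "P f l x = (\<integral>\<^sup>+z. epowr (ennreal (norm (box \<eta> l f z))) ?p * ennreal (1 / jbracket ((x, 0) - z) ^ ?a) \<partial>lborel)"
    for f :: "('a \<times> real) functional" and l and x :: 'a
  obtain C where C: "0 \<le> C" "\<And>f l k x. f \<in> tempered \<Longrightarrow> l \<in> lattice_pts \<Longrightarrow> k \<in> lattice_pts \<Longrightarrow>
    (\<integral>\<^sup>+z. epowr (ennreal (norm (box \<eta> l f z))) ?p \<partial>lborel) < \<infinity> \<Longrightarrow>
    ennreal (norm (\<integral>y. box \<eta> l f (y, 0) * kern (psic k) (x::'a) y \<partial>lborel)) \<le> ennreal C * epowr (P f l x) (1 / ?p)"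
    using trace_piece[OF p0, where 'a='a] unfolding P_def by blast
  let ?J = "jint TYPE('a)"
  let ?C = "C powr r * 2 * ?J powr (r / ?p)"
  have "epowr (Lp_norm p (box \<eta> k g)) r \<le> ennreal ?C * (\<integral>\<^sup>+(d, j). epowr (Lp_norm p (box \<eta> (k + d, j) f)) r \<partial>count_space (shifts \<times> \<int>))"
    if f: "f \<in> tempered" and k: "k \<in> lattice_pts" and g: "has_trace \<eta> f g" and fin: "\<forall>l\<in>lattice_pts. Lp_norm p (box \<eta> l f) < \<infinity>"
    for f :: "('a \<times> real) functional" and g k
  proof -
    have gt: "g \<in> tempered" using g by (simp add: has_trace_def)
    have sh: "(k + d, j) \<in> lattice_pts" if "d \<in> shifts" "j \<in> \<int>" for d and j :: real
      unfolding lattice_Pair using that k by (simp add: shifts_def lattice_add)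
    have fin': "(\<integral>\<^sup>+z. epowr (ennreal (norm (box \<eta> l f z))) ?p \<partial>lborel) < \<infinity>" if l: "l \<in> lattice_pts" for l
      using fin[rule_format, OF l] unfolding Lp_norm_eq[OF False] nlp_def by (auto simp: epowr_eq_top simp flip: less_top)
    have Pm [measurable]: "P f l \<in> borel_measurable borel" if l: "l \<in> lattice_pts" for l
    proof -
      have [measurable]: "box \<eta> l f \<in> borel_measurable borel" by (rule box_borel[OF f l])
      show ?thesis unfolding P_def[abs_def] by (rule slice_weight_integral(2)) measurable
    qed
    have PJ: "(\<integral>\<^sup>+x. P f l x \<partial>lborel) \<le> ennreal ?J * epowr (Lp_norm p (box \<eta> l f)) ?p" if l: "l \<in> lattice_pts" for l
    proof -
      have [measurable]: "box \<eta> l f \<in> borel_measurable borel" by (rule box_borel[OF f l])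
      have "(\<integral>\<^sup>+x. P f l x \<partial>lborel) \<le> ennreal ?J * (\<integral>\<^sup>+z. epowr (ennreal (norm (box \<eta> l f z))) ?p \<partial>lborel)"
        unfolding P_def by (rule slice_weight_integral(1)) measurable
      then show ?thesis unfolding Lp_norm_eq[OF False] nlp_def epowr_inverse(2)[OF p0] .
    qed
    have pw: "epowr (ennreal (norm (box \<eta> k g x))) r \<le> ennreal (C powr r) * (\<integral>\<^sup>+z. epowr (P f (k + fst z, snd z) x) (r / ?p) \<partial>count_space (shifts \<times> \<int>))" for x
    proof -
      have "ennreal (norm (box \<eta> k g x)) \<le> (\<integral>\<^sup>+(d, j). ennreal (norm (\<integral>y. box \<eta> (k + d, j) f (y, 0) * kern (psic k) x y \<partial>lborel)) \<partial>count_space (shifts \<times> \<int>))"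
        by (rule box_trace_le[OF f g k])
      also have "\<dots> \<le> (\<integral>\<^sup>+z. ennreal C * epowr (P f (k + fst z, snd z) x) (1 / ?p) \<partial>count_space (shifts \<times> \<int>))"
        by (intro nn_integral_mono) (auto intro!: C(2) f k sh fin')
      also have "\<dots> = ennreal C * (\<integral>\<^sup>+z. epowr (P f (k + fst z, snd z) x) (1 / ?p) \<partial>count_space (shifts \<times> \<int>))"
        by (rule nn_integral_cmult) simp
      finally have "epowr (ennreal (norm (box \<eta> k g x))) r \<le> epowr (ennreal C * (\<integral>\<^sup>+z. epowr (P f (k + fst z, snd z) x) (1 / ?p) \<partial>count_space (shifts \<times> \<int>))) r"
        using r by (intro epowr_mono) auto
      also have "\<dots> \<le> ennreal (C powr r) * (\<integral>\<^sup>+z. epowr (epowr (P f (k + fst z, snd z) x) (1 / ?p)) r \<partial>count_space (shifts \<times> \<int>))"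
        unfolding epowr_mult epowr_ennreal[OF C(1)] by (intro mult_left_mono epowr_subadditive r) auto
      finally show ?thesis unfolding epowr_epowr by simp
    qed
    have "epowr (Lp_norm p (box \<eta> k g)) r = nlp lborel (?p / r) (\<lambda>x. epowr (ennreal (norm (box \<eta> k g x))) r)"
      unfolding Lp_norm_eq[OF False] by (rule nlp_epowr[OF r(1) p0])
    also have "\<dots> \<le> nlp lborel (?p / r) (\<lambda>x. ennreal (C powr r) * (\<integral>\<^sup>+z. epowr (P f (k + fst z, snd z) x) (r / ?p) \<partial>count_space (shifts \<times> \<int>)))"
      by (intro nlp_mono tp pw)
    also have "\<dots> = ennreal (C powr r) * nlp lborel (?p / r) (\<lambda>x. \<integral>\<^sup>+z. epowr (P f (k + fst z, snd z) x) (r / ?p) \<partial>count_space (shifts \<times> \<int>))"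
    proof (rule nlp_cmult[OF tp])
      \<comment> \<open>Measurability in x of the countable sum follows from joint measurability
        with respect to the counting measure.\<close>
      interpret S: sigma_finite_measure "count_space (shifts \<times> \<int> :: ('a \<times> real) set)"
        by (intro sigma_finite_measure_count_space_countable countable_SIGMA countable_finite finite_shifts countable_Ints_real)
      have "(\<lambda>(x, z). epowr (P f (k + fst z, snd z) x) (r / ?p)) \<in> borel_measurable (lborel \<Otimes>\<^sub>M count_space (shifts \<times> \<int>))"
      proof (subst measurable_pair_swap_iff, rule measurable_pair_measure_countable1)
        show "countable (shifts \<times> \<int> :: ('a \<times> real) set)"
          by (intro countable_SIGMA countable_finite finite_shifts countable_Ints_real)
        fix z assume "z \<in> (shifts \<times> \<int> :: ('a \<times> real) set)"
        then have [measurable]: "P f (k + fst z, snd z) \<in> borel_measurable borel" by (intro Pm sh) auto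
        show "(\<lambda>x. case (z, x) of (x, y) \<Rightarrow> case (y, x) of (x, z) \<Rightarrow> epowr (P f (k + fst z, snd z) x) (r / ?p)) \<in> borel_measurable lborel" by simp
      qed
      from S.borel_measurable_nn_integral[OF this]
      show "(\<lambda>x. \<integral>\<^sup>+z. epowr (P f (k + fst z, snd z) x) (r / ?p) \<partial>count_space (shifts \<times> \<int>)) \<in> borel_measurable lborel" by simp
    qed
    also have "\<dots> \<le> ennreal (C powr r) * (2 * (\<integral>\<^sup>+z. nlp lborel (?p / r) (\<lambda>x. epowr (P f (k + fst z, snd z) x) (r / ?p)) \<partial>count_space (shifts \<times> \<int>)))"
    proof (intro mult_left_mono quasi_Minkowski t1)
      show "countable (shifts \<times> \<int> :: ('a \<times> real) set)"
        by (intro countable_SIGMA countable_finite finite_shifts countable_Ints_real)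
      fix z assume "z \<in> (shifts \<times> \<int> :: ('a \<times> real) set)"
      then have [measurable]: "P f (k + fst z, snd z) \<in> borel_measurable borel" by (intro Pm sh) auto
      show "(\<lambda>x. epowr (P f (k + fst z, snd z) x) (r / ?p)) \<in> borel_measurable lborel" by simp
    qed simp
    also have "\<dots> \<le> ennreal (C powr r) * (2 * (\<integral>\<^sup>+z. ennreal (?J powr (r / ?p)) * epowr (Lp_norm p (box \<eta> (k + fst z, snd z) f)) r \<partial>count_space (shifts \<times> \<int>)))"
    proof (intro mult_left_mono nn_integral_mono)
      fix z assume "z \<in> space (count_space (shifts \<times> \<int> :: ('a \<times> real) set))"
      then have l: "(k + fst z, snd z) \<in> lattice_pts" by (intro sh) auto
      have "nlp lborel (?p / r) (\<lambda>x. epowr (P f (k + fst z, snd z) x) (r / ?p)) = epowr (\<integral>\<^sup>+x. P f (k + fst z, snd z) x \<partial>lborel) (r / ?p)"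
        using p0 r by (simp add: nlp_def epowr_epowr)
      also have "\<dots> \<le> epowr (ennreal ?J * epowr (Lp_norm p (box \<eta> (k + fst z, snd z) f)) ?p) (r / ?p)"
        using p0 r by (intro epowr_mono PJ l) auto
      also have "\<dots> = ennreal (?J powr (r / ?p)) * epowr (Lp_norm p (box \<eta> (k + fst z, snd z) f)) r"
        using p0 by (simp add: epowr_mult epowr_ennreal[OF jint_nonneg] epowr_epowr)
      finally show "nlp lborel (?p / r) (\<lambda>x. epowr (P f (k + fst z, snd z) x) (r / ?p)) \<le> \<dots>" .
    qed auto
    also have "\<dots> = ennreal ?C * (\<integral>\<^sup>+z. epowr (Lp_norm p (box \<eta> (k + fst z, snd z) f)) r \<partial>count_space (shifts \<times> \<int>))"
      by (subst nn_integral_cmult) (auto simp: ennreal_mult mult.assoc)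
    finally show ?thesis by (simp add: case_prod_unfold)
  qed
  then show ?thesis using jint_nonneg[where 'a='a] by (intro exI[of _ ?C]) auto
qed

text \<open>Elements of \<open>shifts\<close> have norm at most 2 DIM, so Peetre's inequality makes
  the weights at k and k + d comparable.\<close>

lemma shift_weight:
  "\<exists>C\<ge>0. \<forall>k::'a::euclidean_space. \<forall>d\<in>shifts. jbracket k powr s \<le> C * jbracket (k + d) powr s"
proof (intro exI[of _ "(2 * (1 + real DIM('a) * 2)) powr \<bar>s\<bar>"] conjI allI ballI)
  fix k d :: 'a assume d: "d \<in> shifts"
  have "norm d \<le> (\<Sum>b\<in>(Basis::'a set). 2)"
    by (rule order_trans[OF norm_le_l1]) (intro sum_mono, use d in \<open>auto simp: shifts_def\<close>)
  then have "jbracket d \<le> 1 + real DIM('a) * 2" using jbracket_le_1_plus_norm[of d] by simp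
  then have "(2 * jbracket (k - (k + d))) powr \<bar>s\<bar> \<le> (2 * (1 + real DIM('a) * 2)) powr \<bar>s\<bar>"
    by (intro powr_mono2) auto
  then have "(2 * jbracket (k - (k + d))) powr \<bar>s\<bar> * jbracket (k + d) powr s \<le> (2 * (1 + real DIM('a) * 2)) powr \<bar>s\<bar> * jbracket (k + d) powr s"
    by (rule mult_right_mono) simp
  then show "jbracket k powr s \<le> (2 * (1 + real DIM('a) * 2)) powr \<bar>s\<bar> * jbracket (k + d) powr s"
    using jbracket_powr_le[of k s "k + d"] by linarith
qed simp

text \<open>A shift by d permutes the lattice, so each of the n shifts contributes the same lq norm
  \<open>A j\<close>. For finite q, Minkowski's inequality with exponent q/r pulls the sum over
  shifts and last frequencies out of the lq norm, leaving the sum of the r-th powers of the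
  \<open>A j\<close>.\<close>

lemma trace_bound:
  assumes p: "0 < p" and q: "0 < q"
  shows "\<exists>C>0. \<forall>f\<in>aniso_space \<eta> s p q (min p (min q 1)). \<forall>g. has_trace \<eta> f g \<longrightarrow>
    modulation_norm \<eta> s p q (g :: 'a::euclidean_space functional) \<le> ennreal C * aniso_norm \<eta> s p q (min p (min q 1)) f"
proof -
  define r where "r = enn2real (min p (min q 1))"
  have r: "0 < r" "r \<le> 1" "p \<noteq> \<infinity> \<Longrightarrow> r \<le> enn2real p" "q \<noteq> \<infinity> \<Longrightarrow> r \<le> enn2real q"
    unfolding r_def using min_exponent[OF p q] by auto
  obtain C1 where C1: "0 \<le> C1" "\<And>f g k. f \<in> tempered \<Longrightarrow> k \<in> lattice_pts \<Longrightarrow> has_trace \<eta> f g \<Longrightarrow> (\<forall>l\<in>lattice_pts. Lp_norm p (box \<eta> l f) < \<infinity>) \<Longrightarrow>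
    epowr (Lp_norm p (box \<eta> k g)) r \<le> ennreal C1 * (\<integral>\<^sup>+(d, j). epowr (Lp_norm p (box \<eta> (k + d :: 'a, j) f)) r \<partial>count_space (shifts \<times> \<int>))"
    using trace_Lp[OF p r(1-3), where 'a='a] by blast
  obtain C2 where C2: "0 \<le> C2" "\<And>(k::'a) d. d \<in> shifts \<Longrightarrow> jbracket k powr s \<le> C2 * jbracket (k + d) powr s"
    using shift_weight[where 'a='a] by blast
  define n where "n = real (card (shifts :: 'a set))"
  define C3 where "C3 = C1 * C2 powr r"
  \<comment> \<open>The summand 1 makes the constant positive.\<close>
  define C where "C = (2 * C3 * n) powr (1 / r) + 1"
  have n0: "0 \<le> n" unfolding n_def by simp
  have C30: "0 \<le> C3" unfolding C3_def using C1 by simp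
  have cD: "countable (shifts \<times> \<int> :: ('a \<times> real) set)"
    by (intro countable_SIGMA countable_finite finite_shifts countable_Ints_real)
  have main: "modulation_norm \<eta> s p q g \<le> ennreal C * aniso_norm \<eta> s p q (min p (min q 1)) f"
    if f: "f \<in> aniso_space \<eta> s p q (min p (min q 1))" and g: "has_trace \<eta> f g" for f and g :: "'a functional"
  proof -
    have ft: "f \<in> tempered" and fin: "aniso_norm \<eta> s p q (min p (min q 1)) f < \<infinity>" using f by (auto simp: aniso_space_def)
    define b where "b j k = ennreal (jbracket k powr s) * Lp_norm p (box \<eta> (k, j) f)" for j k
    define A where "A j = lq_norm q lattice_pts (b j)" for j
    define c where "c k = ennreal (jbracket k powr s) * Lp_norm p (box \<eta> k g)" for k
    define X where "X = (\<integral>\<^sup>+j. epowr (A j) r \<partial>count_space \<int>)"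
    have an: "aniso_norm \<eta> s p q (min p (min q 1)) f = epowr X (1 / r)"
      unfolding aniso_norm_eq[OF p q] nlp_def X_def A_def b_def r_def ..
    have bA: "b j k \<le> A j" if "k \<in> lattice_pts" for j k
      unfolding A_def by (rule le_lq_norm[OF q that countable_lattice])
    have Lfin: "\<forall>l\<in>lattice_pts. Lp_norm p (box \<eta> l f) < \<infinity>"
    proof
      fix l :: "'a \<times> real" assume l: "l \<in> lattice_pts"
      have fl: "fst l \<in> lattice_pts" "snd l \<in> \<int>" using l lattice_Pair[of "fst l" "snd l"] by auto
      have "b (snd l) (fst l) \<le> A (snd l)" by (rule bA[OF fl(1)])
      also have "\<dots> \<le> (\<integral>\<^sup>+j. A j \<partial>count_space \<int>)" using nn_integral_ge_point[of "snd l" "\<int>" A] fl(2) by simp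
      also have "\<dots> < \<infinity>" unfolding A_def b_def using aniso_sum_le[OF p q] fin by (rule order_le_less_trans)
      finally have lt: "ennreal (jbracket (fst l) powr s) * Lp_norm p (box \<eta> l f) < \<infinity>" by (simp add: b_def)
      have "0 < jbracket (fst l) powr s" by simp
      then show "Lp_norm p (box \<eta> l f) < \<infinity>" using lt by (auto simp: ennreal_mult_less_top)
    qed
    have ck: "epowr (c k) r \<le> ennreal C3 * (\<integral>\<^sup>+z. epowr (b (snd z) (k + fst z)) r \<partial>count_space (shifts \<times> \<int>))"
      if k: "k \<in> lattice_pts" for k
    proof -
      have "epowr (c k) r = ennreal ((jbracket k powr s) powr r) * epowr (Lp_norm p (box \<eta> k g)) r"
        unfolding c_def epowr_mult by (simp add: epowr_ennreal)
      also have "\<dots> \<le> ennreal ((jbracket k powr s) powr r) * (ennreal C1 * (\<integral>\<^sup>+(d, j). epowr (Lp_norm p (box \<eta> (k + d, j) f)) r \<partial>count_space (shifts \<times> \<int>)))"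
        by (intro mult_left_mono C1(2)[OF ft k g Lfin]) simp
      also have "\<dots> = ennreal C1 * (\<integral>\<^sup>+z. ennreal ((jbracket k powr s) powr r) * epowr (Lp_norm p (box \<eta> (k + fst z, snd z) f)) r \<partial>count_space (shifts \<times> \<int>))"
        by (subst nn_integral_cmult) (auto simp: case_prod_unfold mult_ac)
      also have "\<dots> \<le> ennreal C1 * (\<integral>\<^sup>+z. ennreal (C2 powr r) * epowr (b (snd z) (k + fst z)) r \<partial>count_space (shifts \<times> \<int>))"
      proof (intro mult_left_mono nn_integral_mono)
        fix z assume "z \<in> space (count_space (shifts \<times> \<int> :: ('a \<times> real) set))"
        then have "jbracket k powr s \<le> C2 * jbracket (k + fst z) powr s" by (intro C2(2)) auto
        then have "(jbracket k powr s) powr r \<le> (C2 * jbracket (k + fst z) powr s) powr r" using r by (intro powr_mono2) auto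
        also have "\<dots> = C2 powr r * (jbracket (k + fst z) powr s) powr r" using C2(1) by (simp add: powr_mult)
        finally have "ennreal ((jbracket k powr s) powr r) \<le> ennreal (C2 powr r) * ennreal ((jbracket (k + fst z) powr s) powr r)"
          by (simp add: ennreal_leI flip: ennreal_mult)
        then have "ennreal ((jbracket k powr s) powr r) * epowr (Lp_norm p (box \<eta> (k + fst z, snd z) f)) r \<le>
          (ennreal (C2 powr r) * ennreal ((jbracket (k + fst z) powr s) powr r)) * epowr (Lp_norm p (box \<eta> (k + fst z, snd z) f)) r"
          by (rule mult_right_mono) simp
        then show "ennreal ((jbracket k powr s) powr r) * epowr (Lp_norm p (box \<eta> (k + fst z, snd z) f)) r \<le> ennreal (C2 powr r) * epowr (b (snd z) (k + fst z)) r"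
          unfolding b_def epowr_mult by (simp add: epowr_ennreal mult.assoc)
      qed simp
      also have "\<dots> = ennreal C3 * (\<integral>\<^sup>+z. epowr (b (snd z) (k + fst z)) r \<partial>count_space (shifts \<times> \<int>))"
        unfolding C3_def using C1(1) by (subst nn_integral_cmult) (auto simp: ennreal_mult mult.assoc)
      finally show ?thesis .
    qed
    have cnt: "(\<integral>\<^sup>+z. epowr (A (snd z)) r \<partial>count_space (shifts \<times> \<int> :: ('a \<times> real) set)) = ennreal n * X"
      by (subst nn_integral_count_space_Times[OF countable_finite[OF finite_shifts] countable_Ints_real])
        (simp add: X_def n_def emeasure_count_space_finite finite_shifts ennreal_of_nat_eq_real_of_nat mult.commute)
    have lq: "epowr (lq_norm q lattice_pts c) r \<le> ennreal (2 * C3 * n) * X"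
    proof (cases "q = \<infinity>")
      case True
      \<comment> \<open>For q = \<infinity> every \<open>b j k\<close> is at most
        \<open>A j\<close>, so the supremum is bounded term by term.\<close>
      have "c k \<le> epowr (ennreal (2 * C3 * n) * X) (1 / r)" if k: "k \<in> lattice_pts" for k
      proof -
        have "epowr (c k) r \<le> ennreal C3 * (\<integral>\<^sup>+z. epowr (A (snd z)) r \<partial>count_space (shifts \<times> \<int> :: ('a \<times> real) set))"
          by (rule order_trans[OF ck[OF k]])
            (intro mult_left_mono nn_integral_mono epowr_mono bA, use k r in \<open>auto simp: shifts_def lattice_add\<close>)
        also have "\<dots> \<le> ennreal (2 * C3 * n) * X"
          unfolding cnt mult.assoc[symmetric] using C30 n0
          by (intro mult_right_mono) (auto simp: mult_right_mono intro!: ennreal_leI simp flip: ennreal_mult)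
        finally have "epowr (epowr (c k) r) (1 / r) \<le> epowr (ennreal (2 * C3 * n) * X) (1 / r)" using r by (intro epowr_mono) auto
        then show ?thesis using r by (simp add: epowr_inverse)
      qed
      then have "lq_norm q lattice_pts c \<le> epowr (ennreal (2 * C3 * n) * X) (1 / r)"
        unfolding lq_norm_def using True by (auto intro: SUP_least)
      then have "epowr (lq_norm q lattice_pts c) r \<le> epowr (epowr (ennreal (2 * C3 * n) * X) (1 / r)) r" using r by (intro epowr_mono) auto
      then show ?thesis using r by (simp add: epowr_inverse)
    next
      case False
      let ?q = "enn2real q"
      have q0: "0 < ?q" by (rule enn2real_pos[OF q False])
      have t1: "1 \<le> ?q / r" using r False by simp
      have tp: "0 < ?q / r" using q0 r by simp
      have "epowr (lq_norm q lattice_pts c) r = nlp (count_space lattice_pts) (?q / r) (\<lambda>k. epowr (c k) r)"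
        unfolding lq_norm_eq[OF False countable_lattice] by (rule nlp_epowr[OF r(1) q0])
      also have "\<dots> \<le> nlp (count_space lattice_pts) (?q / r) (\<lambda>k. ennreal C3 * (\<integral>\<^sup>+z. epowr (b (snd z) (k + fst z)) r \<partial>count_space (shifts \<times> \<int>)))"
        by (intro nlp_mono tp ck) simp
      also have "\<dots> = ennreal C3 * nlp (count_space lattice_pts) (?q / r) (\<lambda>k. \<integral>\<^sup>+z. epowr (b (snd z) (k + fst z)) r \<partial>count_space (shifts \<times> \<int>))"
        by (rule nlp_cmult[OF tp]) simp
      also have "\<dots> \<le> ennreal C3 * (2 * (\<integral>\<^sup>+z. nlp (count_space lattice_pts) (?q / r) (\<lambda>k. epowr (b (snd z) (k + fst z)) r) \<partial>count_space (shifts \<times> \<int>)))"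
        by (intro mult_left_mono quasi_Minkowski cD t1) auto
      also have "(\<integral>\<^sup>+z. nlp (count_space lattice_pts) (?q / r) (\<lambda>k. epowr (b (snd z) (k + fst z)) r) \<partial>count_space (shifts \<times> \<int>)) = (\<integral>\<^sup>+z. epowr (A (snd z)) r \<partial>count_space (shifts \<times> \<int> :: ('a \<times> real) set))"
      proof (rule nn_integral_cong)
        fix z assume "z \<in> space (count_space (shifts \<times> \<int> :: ('a \<times> real) set))"
        then have d: "fst z \<in> lattice_pts" by (auto simp: shifts_def)
        have bij: "bij_betw (\<lambda>k. k + fst z) lattice_pts lattice_pts"
          by (rule bij_betw_byWitness[where f'="\<lambda>k. k - fst z"]) (auto simp: d lattice_add lattice_diff)
        have "nlp (count_space lattice_pts) (?q / r) (\<lambda>k. epowr (b (snd z) (k + fst z)) r) = epowr (nlp (count_space lattice_pts) ?q (\<lambda>k. b (snd z) (k + fst z))) r"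
          by (rule nlp_epowr[OF r(1) q0, symmetric])
        also have "nlp (count_space lattice_pts) ?q (\<lambda>k. b (snd z) (k + fst z)) = nlp (count_space lattice_pts) ?q (b (snd z))"
          unfolding nlp_def using nn_integral_bij_count_space[OF bij, of "\<lambda>k. epowr (b (snd z) k) ?q"] by simp
        also have "\<dots> = A (snd z)" unfolding A_def by (rule lq_norm_eq[OF False countable_lattice, symmetric])
        finally show "nlp (count_space lattice_pts) (?q / r) (\<lambda>k. epowr (b (snd z) (k + fst z)) r) = epowr (A (snd z)) r" .
      qed
      also have "ennreal C3 * (2 * (\<integral>\<^sup>+z. epowr (A (snd z)) r \<partial>count_space (shifts \<times> \<int> :: ('a \<times> real) set))) = ennreal (2 * C3 * n) * X"
        unfolding cnt using C30 n0 by (simp add: ennreal_mult mult_ac)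
      finally show ?thesis .
    qed
    have "lq_norm q lattice_pts c \<le> epowr (ennreal (2 * C3 * n) * X) (1 / r)"
      using epowr_mono[OF lq, of "1 / r"] r by (simp add: epowr_inverse)
    also have "\<dots> = ennreal ((2 * C3 * n) powr (1 / r)) * epowr X (1 / r)"
      using C30 n0 by (simp add: epowr_mult epowr_ennreal)
    also have "\<dots> \<le> ennreal C * epowr X (1 / r)" unfolding C_def by (intro mult_right_mono ennreal_leI) auto
    finally show ?thesis unfolding modulation_norm_def an c_def[abs_def] .
  qed
  have "0 < C" unfolding C_def by (simp add: add_nonneg_pos)
  then show ?thesis using main by blast
qed

end

subsection \<open>The partition of unity as a decomposition of distributions\<close>

lemma frechet_derivative_local:
  assumes "open U" "x \<in> U" "\<And>y. y \<in> U \<Longrightarrow> f y = g y"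
  shows "frechet_derivative f (at x) = frechet_derivative g (at x)"
proof -
  have "(f has_derivative D) (at x) \<longleftrightarrow> (g has_derivative D) (at x)" for D
    using has_derivative_transform_within_open[of f D x UNIV U g] has_derivative_transform_within_open[of g D x UNIV U f] assms by auto
  then show ?thesis by (simp add: frechet_derivative_def)
qed

text \<open>Lets a function be differentiated at a point through a formula valid only nearby, as
  happens with a locally finite sum.\<close>

lemma partials_local:
  assumes "open U" "\<And>y. y \<in> U \<Longrightarrow> f y = g y"
  shows "x \<in> U \<Longrightarrow> partials bs f x = partials bs g x"
proof (induction bs arbitrary: x)
  case (Cons b bs)
  then show ?case using frechet_derivative_local[OF assms(1), of x "partials bs f" "partials bs g"] by simp
qed (use assms in simp)

lemma smooth_schwartz_sum: "(\<And>i. i \<in> I \<Longrightarrow> f i \<in> schwartz) \<Longrightarrow> smooth (\<lambda>x. \<Sum>i\<in>I. f i x)"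
  by (rule schwartz_smooth[OF schwartz_sum])

context decomposition
begin

text \<open>The seminorms of the localised functions \<open>u k\<close> are bounded by a constant
  times the summable weights \<open>w k\<close>. Near any point, \<theta> minus a partial sum is a
  finite sum of other \<open>u k\<close>, so its seminorm is at most a constant times the tail of
  the sum of w, and the distribution is continuous in that seminorm.\<close>

lemma box_sum:
  fixes g :: "'a::euclidean_space functional"
  assumes g: "g \<in> tempered" and ph: "\<phi> \<in> schwartz"
  shows "((\<lambda>k. \<integral>x. box \<eta> k g x * \<phi> x \<partial>lborel) has_sum g \<phi>) lattice_pts"
proof -
  let ?n = "2 * DIM('a)"
  define \<theta> where "\<theta> = inv_fourier \<phi>"
  define v where "v = dist_fourier g"
  define u where "u k = (\<lambda>\<xi>. psic k \<xi> * \<theta> \<xi>)" for k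
  define w where "w k = 1 / jbracket (k::'a) ^ ?n" for k
  have chiS: "\<theta> \<in> schwartz" unfolding \<theta>_def by (rule inv_fourier_schwartz[OF ph])
  have v: "v \<in> tempered" unfolding v_def by (rule dist_fourier_tempered[OF g])
  have uS: "u k \<in> schwartz" if "k \<in> lattice_pts" for k
    unfolding u_def by (intro schwartz_mult psi_schwartz that chiS)
  have "fourier \<theta> = \<phi>" unfolding \<theta>_def using fourier_inversion'[OF ph] by blast
  then have vchi: "v \<theta> = g \<phi>" unfolding v_def dist_fourier_def on_schwartz_def using chiS by simp
  have vu: "(\<integral>x. box \<eta> k g x * \<phi> x \<partial>lborel) = v (u k)" if "k \<in> lattice_pts" for k
    unfolding box_integral(2)[OF g that ph] v_def u_def \<theta>_def by (simp add: mult.commute)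
  obtain C N where C: "0 \<le> C" "\<And>\<phi> B. \<phi> \<in> schwartz \<Longrightarrow> sb N N B \<phi> \<Longrightarrow> norm (v \<phi>) \<le> C * B"
    by (rule tempered_bound[OF v]) blast
  have "\<exists>j M D. 0 \<le> D \<and> (\<forall>m\<in>lattice_pts. \<forall>\<phi>\<in>schwartz. \<forall>B. sb j M B \<phi> \<longrightarrow>
    sb N N (D * B / jbracket m ^ ?n) (\<lambda>\<xi>. psic (m::'a) \<xi> * inv_fourier \<phi> \<xi>))" by (rule psi_decay)
  then obtain j M D' where D': "0 \<le> D'" "\<forall>m\<in>lattice_pts. \<forall>\<phi>\<in>schwartz. \<forall>B. sb j M B \<phi> \<longrightarrow>
    sb N N (D' * B / jbracket m ^ ?n) (\<lambda>\<xi>. psic (m::'a) \<xi> * inv_fourier \<phi> \<xi>)" by blast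
  obtain B where B: "sb j M B \<phi>" using schwartz_sb[OF ph] by blast
  define D where "D = D' * B"
  have D0: "0 \<le> D" unfolding D_def using D'(1) sb_nonneg[OF B] by simp
  have ub: "sb N N (D * w k) (u k)" if "k \<in> lattice_pts" for k
    using D'(2)[rule_format, OF that ph B] by (simp add: u_def \<theta>_def D_def w_def)
  have ws: "w summable_on lattice_pts" unfolding w_def by (rule lattice_summable)
  have w0: "0 \<le> w k" for k by (simp add: w_def)
  have tail: "sb N N (D * (infsum w lattice_pts - sum w F)) (\<lambda>\<xi>. \<theta> \<xi> - (\<Sum>k\<in>F. u k \<xi>))"
    if F: "finite F" "F \<subseteq> lattice_pts" for F
  proof -
    have sm: "smooth (\<lambda>\<xi>. \<theta> \<xi> - (\<Sum>k\<in>F. u k \<xi>))"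
      using F uS by (intro smooth_diff schwartz_smooth chiS smooth_schwartz_sum) auto
    show ?thesis
      unfolding sb_def dbound_iff_partials[OF sm]
    proof (intro ballI impI allI)
      fix bs and x :: 'a assume bs: "bs \<in> lists (Basis::'a set)" "length bs \<le> N"
      \<comment> \<open>Every cutoff that is nonzero somewhere on the unit ball around x has its
        centre in this set: 1 for the ball plus 1 for the support.\<close>
      let ?E = "{k \<in> lattice_pts. \<forall>b\<in>Basis. \<bar>x \<bullet> b - k \<bullet> b\<bar> \<le> 2}"
      let ?G = "F \<union> ?E"
      have fG: "finite ?G" using F(1) finite_lattice_near by blast
      have Gl: "?G \<subseteq> lattice_pts" using F(2) by auto
      have loc: "\<theta> \<xi> - (\<Sum>k\<in>F. u k \<xi>) = (\<Sum>k\<in>?G - F. u k \<xi>)" if \<xi>: "\<xi> \<in> ball x 1" for \<xi>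
      proof -
        have "(\<Sum>k\<in>?G. psi \<eta> k \<xi>) = 1"
        proof (rule psi_partition[OF fG Gl])
          fix k assume k: "k \<in> lattice_pts" "\<And>b. b \<in> Basis \<Longrightarrow> \<bar>\<xi> \<bullet> b - k \<bullet> b\<bar> < 1"
          have "\<bar>x \<bullet> b - k \<bullet> b\<bar> \<le> 2" if b: "b \<in> Basis" for b
          proof -
            have "\<bar>(x - \<xi>) \<bullet> b\<bar> \<le> 1" using Basis_le_norm[OF b, of "x - \<xi>"] \<xi> by (simp add: dist_norm)
            then show ?thesis using k(2)[OF b] unfolding inner_diff_left by linarith
          qed
          then show "k \<in> ?G" using k(1) by auto
        qed
        then have "(\<Sum>k\<in>?G. u k \<xi>) = \<theta> \<xi>"
          unfolding u_def by (simp flip: sum_distrib_right of_real_sum)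
        moreover have "(\<Sum>k\<in>?G. u k \<xi>) = (\<Sum>k\<in>?G - F. u k \<xi>) + (\<Sum>k\<in>F. u k \<xi>)"
          using fG by (intro sum.subset_diff) auto
        ultimately show ?thesis unfolding diff_eq_eq by (rule trans[OF sym])
      qed
      have "partials bs (\<lambda>\<xi>. \<theta> \<xi> - (\<Sum>k\<in>F. u k \<xi>)) x = partials bs (\<lambda>\<xi>. \<Sum>k\<in>?G - F. u k \<xi>) x"
        by (rule partials_local[of "ball x 1"]) (use loc in auto)
      also have "norm \<dots> \<le> (\<Sum>k\<in>?G - F. D * w k / jbracket x ^ N)"
      proof -
        have "dbound N (\<lambda>x. \<Sum>k\<in>?G - F. D * w k / jbracket x ^ N) (\<lambda>\<xi>. \<Sum>k\<in>?G - F. u k \<xi>)"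
          using fG Gl by (intro dbound_sum ub[unfolded sb_def]) auto
        moreover have "smooth (\<lambda>\<xi>. \<Sum>k\<in>?G - F. u k \<xi>)" using Gl by (intro smooth_schwartz_sum uS) auto
        ultimately show ?thesis using bs by (simp add: dbound_iff_partials)
      qed
      also have "\<dots> = D * sum w (?G - F) / jbracket x ^ N"
        by (simp add: sum_distrib_left sum_divide_distrib)
      also have "\<dots> \<le> D * (infsum w lattice_pts - sum w F) / jbracket x ^ N"
      proof (intro divide_right_mono mult_left_mono D0)
        have "sum w ?G \<le> infsum w lattice_pts" by (rule finite_sum_le_infsum[OF ws fG Gl]) (rule w0)
        moreover have "sum w ?G = sum w (?G - F) + sum w F" using fG by (intro sum.subset_diff) auto
        ultimately show "sum w (?G - F) \<le> infsum w lattice_pts - sum w F" by linarith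
      qed simp
      finally show "norm (partials bs (\<lambda>\<xi>. \<theta> \<xi> - (\<Sum>k\<in>F. u k \<xi>)) x) \<le> D * (infsum w lattice_pts - sum w F) / jbracket x ^ N" .
    qed
  qed
  have est: "norm (sum (\<lambda>k. v (u k)) F - v \<theta>) \<le> C * (D * (infsum w lattice_pts - sum w F))"
    if F: "finite F" "F \<subseteq> lattice_pts" for F
  proof -
    have S: "(\<lambda>\<xi>. \<Sum>k\<in>F. u k \<xi>) \<in> schwartz" using F uS by (intro schwartz_sum) auto
    have "v (\<lambda>\<xi>. \<Sum>k\<in>F. u k \<xi>) = sum (\<lambda>k. v (u k)) F" using F uS by (intro tempered_sum[OF v]) auto
    then have "v \<theta> - sum (\<lambda>k. v (u k)) F = v (\<lambda>\<xi>. \<theta> \<xi> - (\<Sum>k\<in>F. u k \<xi>))"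
      by (simp add: tempered_diff[OF v chiS S])
    then show ?thesis using C(2)[OF schwartz_diff[OF chiS S] tail[OF F]] by (simp add: norm_minus_commute)
  qed
  have "((\<lambda>k. v (u k)) has_sum v \<theta>) lattice_pts"
    unfolding has_sum_def
  proof (rule LIM_zero_cancel, rule Lim_null_comparison)
    show "eventually (\<lambda>F. norm (sum (\<lambda>k. v (u k)) F - v \<theta>) \<le> C * (D * (infsum w lattice_pts - sum w F))) (finite_subsets_at_top lattice_pts)"
      by (rule eventually_finite_subsets_at_top_weakI) (rule est)
    have "(sum w \<longlongrightarrow> infsum w lattice_pts) (finite_subsets_at_top lattice_pts)"
      using has_sum_infsum[OF ws] by (simp add: has_sum_def)
    then have "((\<lambda>F. C * (D * (infsum w lattice_pts - sum w F))) \<longlongrightarrow> C * (D * (infsum w lattice_pts - infsum w lattice_pts))) (finite_subsets_at_top lattice_pts)"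
      by (intro tendsto_intros)
    then show "((\<lambda>F. C * (D * (infsum w lattice_pts - sum w F))) \<longlongrightarrow> 0) (finite_subsets_at_top lattice_pts)" by simp
  qed
  then show ?thesis unfolding vchi by (rule has_sum_cong[THEN iffD1, rotated]) (simp add: vu)
qed

end

subsection \<open>The extension operator\<close>

lemma sum_Basis_pair:
  fixes f :: "'a::euclidean_space \<times> real \<Rightarrow> 'b::comm_monoid_add"
  shows "(\<Sum>b\<in>Basis. f b) = (\<Sum>b\<in>Basis. f (b, 0)) + f (0, 1)"
proof -
  have "(\<Sum>b\<in>Basis. f b) = (\<Sum>b\<in>(\<lambda>u. (u, 0)) ` Basis. f b) + (\<Sum>b\<in>(\<lambda>v. (0, v)) ` Basis. f b)"
    unfolding Basis_prod_def by (rule sum.union_disjoint) (auto simp: Basis_real_def)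
  also have "(\<Sum>b\<in>(\<lambda>u. (u, 0)) ` Basis. f b) = (\<Sum>b\<in>Basis. f (b, 0))" by (subst sum.reindex) (auto simp: inj_on_def)
  also have "(\<Sum>b\<in>(\<lambda>v. (0, v)) ` Basis. f b) = f (0, 1)" by simp
  finally show ?thesis .
qed

text \<open>Acts on test functions; its transpose is the tensor product of a distribution with
  \<rho> in the last variable.\<close>

definition marginal :: "(real \<Rightarrow> complex) \<Rightarrow> ('a::euclidean_space \<times> real \<Rightarrow> complex) \<Rightarrow> 'a \<Rightarrow> complex" where
  "marginal \<rho> \<phi> \<xi> = (\<integral>\<tau>. \<phi> (\<xi>, \<tau>) * \<rho> \<tau> \<partial>lborel)"

text \<open>On the Fourier side this is the pull-back of \<open>g\<close> times the function \<open>\<rho>\<close> of the last frequency.\<close>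

definition extension :: "(real \<Rightarrow> complex) \<Rightarrow> 'a::euclidean_space functional \<Rightarrow> ('a \<times> real) functional" where
  "extension \<rho> g = on_schwartz (\<lambda>\<phi>. g (fourier (marginal \<rho> (inv_fourier \<phi>))))"

context
  fixes \<rho> :: "real \<Rightarrow> complex"
  assumes rho: "integrable lborel \<rho>"
begin

lemma marginal_integrable:
  fixes \<phi> :: "'a::euclidean_space \<times> real \<Rightarrow> complex"
  assumes "\<phi> \<in> schwartz"
  shows "integrable lborel (\<lambda>\<tau>. \<phi> (\<xi>, \<tau>) * \<rho> \<tau>)"
proof -
  obtain B where B: "sb 0 0 B \<phi>" using schwartz_sb[OF assms] by blast
  have [measurable]: "\<phi> \<in> borel_measurable borel" "\<rho> \<in> borel_measurable borel"
    using schwartz_borel[OF assms] borel_measurable_integrable[OF rho] by auto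
  have "integrable lborel (\<lambda>\<tau>. B * norm (\<rho> \<tau>))" using rho by simp
  then show ?thesis
  proof (rule Bochner_Integration.integrable_bound)
    show "AE \<tau> in lborel. norm (\<phi> (\<xi>, \<tau>) * \<rho> \<tau>) \<le> norm (B * norm (\<rho> \<tau>))"
    proof (rule AE_I2)
      fix \<tau>
      have "norm (\<phi> (\<xi>, \<tau>)) * norm (\<rho> \<tau>) \<le> B * norm (\<rho> \<tau>)" using sb_norm[OF B, of "(\<xi>, \<tau>)"] by (intro mult_right_mono) auto
      then show "norm (\<phi> (\<xi>, \<tau>) * \<rho> \<tau>) \<le> norm (B * norm (\<rho> \<tau>))" using sb_nonneg[OF B] by (simp add: norm_mult)
    qed
  qed measurable
qed

text \<open>The Taylor bound of \<phi> is uniform in \<tau>, so it can be integrated against the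
  integrable \<rho>. Increments have last component 0, and only the directions of the first factor
  enter.\<close>

lemma marginal_derivative:
  fixes \<phi> :: "'a::euclidean_space \<times> real \<Rightarrow> complex"
  assumes ph: "\<phi> \<in> schwartz"
  shows "marginal \<rho> \<phi> differentiable (at \<xi>)"
    and "b \<in> Basis \<Longrightarrow> pd b (marginal \<rho> \<phi>) = marginal \<rho> (pd (b, 0) \<phi>)"
proof -
  obtain B where B: "sb 2 0 B \<phi>" using schwartz_sb[OF ph] by blast
  let ?C = "(real DIM('a \<times> real))\<^sup>2 * B"
  have Sb: "pd (b, 0) \<phi> \<in> schwartz" if "b \<in> Basis" for b :: 'a
    by (rule schwartz_pd[OF ph]) (use that in \<open>simp add: Basis_prod_def\<close>)
  have *: "norm (marginal \<rho> \<phi> (\<xi> + h) - marginal \<rho> \<phi> \<xi> - (\<Sum>b\<in>Basis. (h \<bullet> b) *\<^sub>R marginal \<rho> (pd (b, 0) \<phi>) \<xi>)) \<le> (?C * (\<integral>\<tau>. norm (\<rho> \<tau>) \<partial>lborel)) * (norm h)\<^sup>2"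
    if h: "norm h \<le> 1" for h \<xi> :: 'a
  proof -
    let ?R = "\<lambda>\<tau>. \<phi> ((\<xi>, \<tau>) + (h, 0)) - \<phi> (\<xi>, \<tau>) - (\<Sum>c\<in>Basis. ((h, 0) \<bullet> c) *\<^sub>R pd c \<phi> (\<xi>, \<tau>))"
    have R: "norm (?R \<tau>) \<le> ?C * (norm h)\<^sup>2" for \<tau>
      using dbound_taylor[of "\<lambda>x. B / jbracket x ^ 0" \<phi> "(\<xi>, \<tau>)" B "(h, 0)"] B h by (simp add: sb_def norm_Pair)
    have Re: "?R \<tau> = \<phi> (\<xi> + h, \<tau>) - \<phi> (\<xi>, \<tau>) - (\<Sum>b\<in>Basis. (h \<bullet> b) *\<^sub>R pd (b, 0) \<phi> (\<xi>, \<tau>))" for \<tau>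
      by (subst sum_Basis_pair) simp
    have i: "integrable lborel (\<lambda>\<tau>. (h \<bullet> b) *\<^sub>R (pd (b, 0) \<phi> (\<xi>, \<tau>) * \<rho> \<tau>))" if "b \<in> Basis" for b
      by (intro integrable_scaleR_right marginal_integrable Sb that)
    have s: "(\<Sum>b\<in>Basis. (h \<bullet> b) *\<^sub>R marginal \<rho> (pd (b, 0) \<phi>) \<xi>) = (\<integral>\<tau>. (\<Sum>b\<in>Basis. (h \<bullet> b) *\<^sub>R (pd (b, 0) \<phi> (\<xi>, \<tau>) * \<rho> \<tau>)) \<partial>lborel)"
      unfolding marginal_def using i by (subst Bochner_Integration.integral_sum) auto
    have i2: "integrable lborel (\<lambda>\<tau>. \<Sum>b\<in>Basis. (h \<bullet> b) *\<^sub>R (pd (b, 0) \<phi> (\<xi>, \<tau>) * \<rho> \<tau>))"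
      using i by (intro Bochner_Integration.integrable_sum) auto
    note i1 = marginal_integrable[OF ph]
    have "marginal \<rho> \<phi> (\<xi> + h) - marginal \<rho> \<phi> \<xi> - (\<Sum>b\<in>Basis. (h \<bullet> b) *\<^sub>R marginal \<rho> (pd (b, 0) \<phi>) \<xi>)
      = (\<integral>\<tau>. \<phi> (\<xi> + h, \<tau>) * \<rho> \<tau> - \<phi> (\<xi>, \<tau>) * \<rho> \<tau> - (\<Sum>b\<in>Basis. (h \<bullet> b) *\<^sub>R (pd (b, 0) \<phi> (\<xi>, \<tau>) * \<rho> \<tau>)) \<partial>lborel)"
      unfolding s unfolding marginal_def Bochner_Integration.integral_diff[OF i1 i1, symmetric]
        Bochner_Integration.integral_diff[OF Bochner_Integration.integrable_diff[OF i1 i1] i2, symmetric] ..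
    also have "\<dots> = (\<integral>\<tau>. ?R \<tau> * \<rho> \<tau> \<partial>lborel)"
      unfolding Re by (intro Bochner_Integration.integral_cong refl) (simp add: left_diff_distrib sum_distrib_right)
    also have "norm \<dots> \<le> (\<integral>\<tau>. (?C * (norm h)\<^sup>2) * norm (\<rho> \<tau>) \<partial>lborel)"
    proof (rule Bochner_Integration.integral_norm_bound_integral)
      have "integrable lborel (\<lambda>\<tau>. \<phi> (\<xi> + h, \<tau>) * \<rho> \<tau> - \<phi> (\<xi>, \<tau>) * \<rho> \<tau> - (\<Sum>b\<in>Basis. (h \<bullet> b) *\<^sub>R (pd (b, 0) \<phi> (\<xi>, \<tau>) * \<rho> \<tau>)))"
        by (intro Bochner_Integration.integrable_diff i1 i2)
      then show "integrable lborel (\<lambda>\<tau>. ?R \<tau> * \<rho> \<tau>)"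
        unfolding Re by (simp add: left_diff_distrib sum_distrib_right)
      show "integrable lborel (\<lambda>\<tau>. (?C * (norm h)\<^sup>2) * norm (\<rho> \<tau>))" using rho by simp
      show "norm (?R \<tau> * \<rho> \<tau>) \<le> (?C * (norm h)\<^sup>2) * norm (\<rho> \<tau>)" for \<tau>
        unfolding norm_mult by (intro mult_right_mono R) simp
    qed
    also have "\<dots> = (?C * (\<integral>\<tau>. norm (\<rho> \<tau>) \<partial>lborel)) * (norm h)\<^sup>2" by simp
    finally show ?thesis .
  qed
  show "marginal \<rho> \<phi> differentiable (at \<xi>)" by (rule pd_quadratic(1)[OF *])
  show "pd b (marginal \<rho> \<phi>) = marginal \<rho> (pd (b, 0) \<phi>)" if "b \<in> Basis"
    by (rule ext) (rule pd_quadratic(2)[OF * that])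
qed

lemma marginal_sb:
  fixes \<phi> :: "'a::euclidean_space \<times> real \<Rightarrow> complex"
  shows "\<phi> \<in> schwartz \<Longrightarrow> sb k N B \<phi> \<Longrightarrow> sb k N ((\<integral>\<tau>. norm (\<rho> \<tau>) \<partial>lborel) * B) (marginal \<rho> \<phi>)"
proof (induction k arbitrary: \<phi>)
  have *: "norm (marginal \<rho> \<phi> \<xi>) \<le> (\<integral>\<tau>. norm (\<rho> \<tau>) \<partial>lborel) * B / jbracket \<xi> ^ N"
    if ph: "\<phi> \<in> schwartz" and B: "sb k N B \<phi>" for \<phi> :: "'a \<times> real \<Rightarrow> complex" and k \<xi>
  proof -
    have B0: "0 \<le> B" by (rule sb_nonneg[OF B])
    have "norm (marginal \<rho> \<phi> \<xi>) \<le> (\<integral>\<tau>. (B / jbracket \<xi> ^ N) * norm (\<rho> \<tau>) \<partial>lborel)"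
      unfolding marginal_def
    proof (rule Bochner_Integration.integral_norm_bound_integral[OF marginal_integrable[OF ph]])
      show "integrable lborel (\<lambda>\<tau>. (B / jbracket \<xi> ^ N) * norm (\<rho> \<tau>))" using rho by simp
      fix \<tau>
      have "norm (\<phi> (\<xi>, \<tau>)) \<le> B / jbracket (\<xi>, \<tau>) ^ N" by (rule sb_norm[OF B])
      also have "\<dots> \<le> B / jbracket \<xi> ^ N"
        using B0 jbracket_Pair_fst_le[of \<xi> \<tau>] by (intro divide_left_mono power_mono mult_pos_pos zero_less_power) auto
      finally show "norm (\<phi> (\<xi>, \<tau>) * \<rho> \<tau>) \<le> (B / jbracket \<xi> ^ N) * norm (\<rho> \<tau>)"
        unfolding norm_mult by (rule mult_right_mono) simp
    qed
    then show ?thesis by (simp add: mult.commute)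
  qed
  {
    case 0
    then show ?case using *[OF 0] by (simp add: sb_def)
  next
    case (Suc k)
    show ?case unfolding sb_def
    proof (rule dbound_SucI)
      show "norm (marginal \<rho> \<phi> \<xi>) \<le> (\<integral>\<tau>. norm (\<rho> \<tau>) \<partial>lborel) * B / jbracket \<xi> ^ N" for \<xi> by (rule *[OF Suc.prems])
      show "marginal \<rho> \<phi> differentiable (at \<xi>)" for \<xi> by (rule marginal_derivative(1)[OF Suc.prems(1)])
      show "dbound k (\<lambda>\<xi>. (\<integral>\<tau>. norm (\<rho> \<tau>) \<partial>lborel) * B / jbracket \<xi> ^ N) (pd b (marginal \<rho> \<phi>))" if b: "b \<in> Basis" for b
      proof -
        have b': "(b, 0) \<in> (Basis :: ('a \<times> real) set)" using b by (simp add: Basis_prod_def)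
        show ?thesis unfolding marginal_derivative(2)[OF Suc.prems(1) b]
          using Suc.IH[OF schwartz_pd[OF Suc.prems(1) b'] sb_pd[OF Suc.prems(2) b']] by (simp add: sb_def)
      qed
    qed
  }
qed

lemma scont_marginal: "scont (marginal \<rho> :: ('a::euclidean_space \<times> real \<Rightarrow> complex) \<Rightarrow> _)"
proof (rule scontI)
  fix k N
  show "\<exists>j M C. 0 \<le> C \<and> (\<forall>\<phi>\<in>schwartz. \<forall>B. sb j M B \<phi> \<longrightarrow> sb k N (C * B) (marginal \<rho> (\<phi> :: 'a \<times> real \<Rightarrow> complex)))"
    by (rule exI[of _ k], rule exI[of _ N], rule exI[of _ "\<integral>\<tau>. norm (\<rho> \<tau>) \<partial>lborel"]) (simp add: marginal_sb)
qed

lemma marginal_add: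
  fixes \<phi> \<psi> :: "'a::euclidean_space \<times> real \<Rightarrow> complex"
  assumes "\<phi> \<in> schwartz" "\<psi> \<in> schwartz"
  shows "marginal \<rho> (\<lambda>x. \<phi> x + \<psi> x) = (\<lambda>\<xi>. marginal \<rho> \<phi> \<xi> + marginal \<rho> \<psi> \<xi>)"
  unfolding marginal_def fun_eq_iff distrib_right
  by (auto intro!: Bochner_Integration.integral_add marginal_integrable assms)

lemma marginal_cmult: "marginal \<rho> (\<lambda>x. c * \<phi> x) = (\<lambda>\<xi>. c * marginal \<rho> \<phi> \<xi>)"
  unfolding marginal_def fun_eq_iff by (simp add: mult.assoc)

lemma extension_tempered:
  assumes "g \<in> tempered" shows "extension \<rho> g \<in> tempered"
  unfolding extension_def
proof (rule tempered_scont[OF assms])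
  show "scont (\<lambda>\<phi>. fourier (marginal \<rho> (inv_fourier \<phi>)))"
    by (intro scont_comp[OF scont_fourier] scont_comp[OF scont_marginal] scont_inv_fourier)
qed (auto simp: inv_fourier_add inv_fourier_cmult marginal_add marginal_cmult fourier_add fourier_cmult
    inv_fourier_schwartz scont_schwartz[OF scont_marginal])

text \<open>The inverse transform in the definition of \<open>extension\<close> cancels the
  transform, so the spectrum of the extension is the tensor product of the spectrum of g with
  \<rho>.\<close>

lemma dist_fourier_extension:
  assumes "\<phi> \<in> schwartz"
  shows "dist_fourier (extension \<rho> g) \<phi> = g (fourier (marginal \<rho> \<phi>))"
proof -
  have "inv_fourier (fourier \<phi>) = \<phi>" using fourier_inversion[OF assms] by blast
  then show ?thesis using assms fourier_schwartz[OF assms] by (simp add: dist_fourier_def extension_def on_schwartz_def)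
qed

end

section \<open>Norms of tensor products and of sequences\<close>

lemma fconst_Pair: "fconst TYPE('a::euclidean_space \<times> real) = fconst TYPE('a) * fconst TYPE(real)"
proof -
  have "- real DIM('a \<times> real) / 2 = - real DIM('a) / 2 + - real DIM(real) / 2" by (simp add: field_simps)
  then show ?thesis unfolding fconst_def by (simp only: powr_add)
qed

lemma wave_Pair: "wave (x, t) (\<xi>, \<tau>) = wave x \<xi> * wave t \<tau>"
  by (simp add: wave_def ring_distribs exp_add)

lemma Lp_norm_tensor:
  fixes a :: "'a::euclidean_space \<Rightarrow> complex" and w :: "real \<Rightarrow> complex"
  assumes p: "0 < p" and a: "continuous_on UNIV a" and w: "continuous_on UNIV w"
  shows "Lp_norm p (\<lambda>z. a (fst z) * w (snd z)) \<le> Lp_norm p a * Lp_norm p w"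
proof -
  have [measurable]: "a \<in> borel_measurable borel" "w \<in> borel_measurable borel"
    using a w by (auto intro: borel_measurable_continuous_onI)
  have fs: "fst \<in> borel_measurable (borel :: ('a \<times> real) measure)" "snd \<in> borel_measurable (borel :: ('a \<times> real) measure)"
    by (intro borel_measurable_continuous_onI continuous_intros)+
  have [measurable]: "(\<lambda>z::'a \<times> real. a (fst z)) \<in> borel_measurable borel" "(\<lambda>z::'a \<times> real. w (snd z)) \<in> borel_measurable borel"
    using fs by (auto intro!: measurable_compose[of _ borel borel])
  show ?thesis
  proof (cases "p = \<infinity>")
    case True
    have "Lp_norm \<infinity> (\<lambda>z. a (fst z) * w (snd z)) \<le> Lp_norm \<infinity> a * Lp_norm \<infinity> w"
    proof (rule Lp_norm_le_sup)
      show "(\<lambda>z::'a \<times> real. a (fst z) * w (snd z)) \<in> borel_measurable borel" by measurable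
      fix z :: "'a \<times> real"
      show "ennreal (norm (a (fst z) * w (snd z))) \<le> Lp_norm \<infinity> a * Lp_norm \<infinity> w"
        unfolding norm_mult ennreal_mult'[OF norm_ge_zero] Lp_norm_def
        using le_esssup_continuous[OF a] le_esssup_continuous[OF w] by (auto intro: mult_mono)
    qed
    then show ?thesis using True by simp
  next
    case False
    let ?p = "enn2real p"
    let ?A = "\<lambda>x. epowr (ennreal (norm (a x))) ?p" and ?W = "\<lambda>t. epowr (ennreal (norm (w t))) ?p"
    have "(\<integral>\<^sup>+z. epowr (ennreal (norm (a (fst z) * w (snd z)))) ?p \<partial>lborel) = (\<integral>\<^sup>+z. ?A (fst z) * ?W (snd z) \<partial>(lborel \<Otimes>\<^sub>M lborel))"
      unfolding lborel_prod norm_mult ennreal_mult'[OF norm_ge_zero] epowr_mult ..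
    also have "\<dots> = (\<integral>\<^sup>+x. \<integral>\<^sup>+t. ?A x * ?W t \<partial>lborel \<partial>lborel)"
      by (subst lborel.nn_integral_fst[symmetric]) auto
    also have "\<dots> = (\<integral>\<^sup>+x. ?A x \<partial>lborel) * (\<integral>\<^sup>+t. ?W t \<partial>lborel)"
      by (simp add: nn_integral_cmult nn_integral_multc)
    finally show ?thesis unfolding Lp_norm_eq[OF False] nlp_def by (simp add: epowr_mult)
  qed
qed

lemma Lp_norm_schwartz:
  fixes w :: "'a::euclidean_space \<Rightarrow> complex"
  assumes p: "0 < p" and w: "w \<in> schwartz"
  shows "Lp_norm p w < \<infinity>"
proof (cases "p = \<infinity>")
  case True
  obtain B where B: "sb 0 0 B w" using schwartz_sb[OF w] by blast
  have "Lp_norm \<infinity> w \<le> ennreal B"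
    using sb_norm[OF B] by (intro Lp_norm_le_sup schwartz_borel w ennreal_leI) auto
  then show ?thesis using True by (simp add: order_le_less_trans)
next
  case False
  let ?p = "enn2real p"
  have p0: "0 < ?p" by (rule enn2real_pos[OF p False])
  \<comment> \<open>Chosen with M p >= 2 DIM, so that the p-th power of the decaying bound is
    integrable.\<close>
  define M where "M = nat \<lceil>real (2 * DIM('a)) / ?p\<rceil>"
  have "real (2 * DIM('a)) / ?p \<le> real M" unfolding M_def by linarith
  then have M: "real (2 * DIM('a)) \<le> real M * ?p" using p0 by (simp add: field_simps)
  obtain B where B: "sb 0 M B w" using schwartz_sb[OF w] by blast
  have B0: "0 \<le> B" by (rule sb_nonneg[OF B])
  have pw: "epowr (ennreal (norm (w x))) ?p \<le> ennreal (B powr ?p) * ennreal (1 / jbracket x ^ (2 * DIM('a)))" for x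
  proof -
    have "norm (w x) powr ?p \<le> (B / jbracket x ^ M) powr ?p"
      using p0 by (intro powr_mono2 sb_norm[OF B]) auto
    also have "\<dots> = B powr ?p / jbracket x powr (real M * ?p)"
      using B0 by (simp add: powr_divide powr_powr flip: powr_realpow)
    also have "\<dots> \<le> B powr ?p / jbracket x powr real (2 * DIM('a))"
      by (intro divide_left_mono powr_mono M mult_pos_pos jbracket_ge_1) auto
    also have "\<dots> = B powr ?p * (1 / jbracket x ^ (2 * DIM('a)))"
      by (subst powr_realpow) auto
    finally show ?thesis unfolding epowr_ennreal[OF norm_ge_zero] by (subst ennreal_mult[symmetric]) (auto intro: ennreal_leI)
  qed
  have "(\<integral>\<^sup>+x. epowr (ennreal (norm (w x))) ?p \<partial>lborel) \<le> (\<integral>\<^sup>+(x::'a). ennreal (B powr ?p) * ennreal (1 / jbracket x ^ (2 * DIM('a))) \<partial>lborel)"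
    by (intro nn_integral_mono pw)
  also have "\<dots> = ennreal (B powr ?p) * ennreal (jint TYPE('a))"
    by (simp add: nn_integral_cmult nn_integral_jbracket)
  also have "\<dots> < \<infinity>" by (simp add: ennreal_mult_less_top)
  finally show ?thesis unfolding Lp_norm_eq[OF False] nlp_def by (simp add: epowr_eq_top flip: less_top)
qed

lemma Lp_norm_0: "0 < p \<Longrightarrow> Lp_norm p (\<lambda>x. 0) = 0"
  using Lp_norm_le_sup[of "\<lambda>x::'a. 0" 0]
  by (cases "p = \<infinity>") (auto simp: Lp_norm_eq nlp_def)

lemma lq_norm_cmult:
  assumes "0 < q" "countable A"
  shows "lq_norm q A (\<lambda>k. c * f k) = c * lq_norm q A f"
proof (cases "q = \<infinity>")
  case True
  then show ?thesis by (simp add: lq_norm_def SUP_mult_left_ennreal)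
next
  case False
  then show ?thesis using enn2real_pos[OF assms(1) False] by (simp add: lq_norm_eq[OF False assms(2)] nlp_cmult)
qed

lemma lq_norm_mono:
  assumes "0 < q" "countable A" "\<And>k. k \<in> A \<Longrightarrow> f k \<le> g k"
  shows "lq_norm q A f \<le> lq_norm q A g"
proof (cases "q = \<infinity>")
  case True
  then show ?thesis using assms(3) by (auto simp: lq_norm_def intro: SUP_mono)
next
  case False
  then show ?thesis using enn2real_pos[OF assms(1) False] assms(3) by (auto simp: lq_norm_eq[OF False assms(2)] intro!: nlp_mono)
qed

lemma has_sum_Times_finite:
  fixes a :: "'i \<Rightarrow> complex"
  assumes "(a has_sum S) K" "finite L"
  shows "((\<lambda>z. a (fst z) * m (snd z)) has_sum S * sum m L) (K \<times> L)"
  using assms(2)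
proof (induction L)
  case empty
  show ?case by simp
next
  case (insert l L)
  have "((\<lambda>k. a k * m l) has_sum S * m l) K" by (rule has_sum_cmult_left[OF assms(1)])
  then have "((\<lambda>z. a (fst z) * m (snd z)) has_sum S * m l) ((\<lambda>k. (k, l)) ` K)"
    by (subst has_sum_reindex) (auto simp: inj_on_def comp_def)
  then have "((\<lambda>z. a (fst z) * m (snd z)) has_sum S * m l + S * sum m L) ((\<lambda>k. (k, l)) ` K \<union> K \<times> L)"
    using insert by (intro has_sum_Un_disjoint) auto
  moreover have "(\<lambda>k. (k, l)) ` K \<union> K \<times> L = K \<times> insert l L" by auto
  ultimately show ?case using insert by (simp add: distrib_left)
qed

lemma tempered_functional_diff:
  fixes f g :: "'a::euclidean_space functional"
  assumes f: "f \<in> tempered" and g: "g \<in> tempered"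
  shows "(\<lambda>\<phi>. f \<phi> - g \<phi>) \<in> tempered"
proof -
  obtain C N where C: "0 \<le> C" "\<And>\<phi> B. \<phi> \<in> schwartz \<Longrightarrow> sb N N B \<phi> \<Longrightarrow> norm (f \<phi>) \<le> C * B"
    by (rule tempered_bound[OF f]) blast
  obtain D M where D: "0 \<le> D" "\<And>\<phi> B. \<phi> \<in> schwartz \<Longrightarrow> sb M M B \<phi> \<Longrightarrow> norm (g \<phi>) \<le> D * B"
    by (rule tempered_bound[OF g]) blast
  show ?thesis
  proof (rule temperedI)
    fix \<phi> :: "'a \<Rightarrow> complex" and B assume p: "\<phi> \<in> schwartz" and B: "sb (max N M) (max N M) B \<phi>"
    have "norm (f \<phi> - g \<phi>) \<le> norm (f \<phi>) + norm (g \<phi>)" by (rule norm_triangle_ineq4)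
    also have "\<dots> \<le> C * B + D * B"
      by (intro add_mono C(2) D(2) p sb_mono[OF B]) auto
    finally show "norm (f \<phi> - g \<phi>) \<le> (C + D) * B" by (simp add: distrib_right)
  qed (auto simp: tempered_outside[OF f] tempered_outside[OF g] tempered_add[OF f] tempered_add[OF g]
      tempered_cmult[OF f] tempered_cmult[OF g] algebra_simps)
qed

context decomposition
begin

section \<open>The profile in the last variable\<close>

lemma psic_real: "l \<in> \<int> \<Longrightarrow> psic l (\<tau>::real) = of_real (psi1 (\<tau> - l))"
  by (simp add: psi_real)

text \<open>Up to a constant this is the integral of \<open>psi1\<close>, which is nonnegative,
  continuous and nonzero at 0. It justifies the division in the definition of
  \<open>rho\<close>.\<close>

lemma inv_fourier_psic_0: "inv_fourier (psic (0::real)) 0 \<noteq> 0"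
proof
  have i: "integrable lborel (\<lambda>\<tau>. psi1 \<tau>)"
    using integrable_norm[OF schwartz_integrable[OF psi_schwartz[OF lattice_0, where 'a=real]]] by (simp add: psi_real psi1_nonneg)
  have c: "continuous_on UNIV psi1" by (rule smooth_continuous[OF smooth_psi1])
  have p0: "psi1 0 \<noteq> 0" using den_ge_1[of 0] eta2_1[of 0] by (simp add: psi1_def)
  assume "inv_fourier (psic (0::real)) 0 = 0"
  then have "(\<integral>\<tau>. psi1 \<tau> \<partial>lborel) = 0"
    by (simp add: inv_fourier_eq psic_real[OF Ints_0])
  then have "AE \<tau> in lborel. psi1 \<tau> = 0"
    using integral_nonneg_eq_0_iff_AE[OF i] psi1_nonneg by simp
  moreover have op: "open {\<tau>. psi1 \<tau> \<noteq> 0}" by (intro open_Collect_neq c continuous_intros)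
  then have "{\<tau>. psi1 \<tau> \<noteq> 0} \<in> sets lborel" by simp
  ultimately have "{\<tau>. psi1 \<tau> \<noteq> 0} \<in> null_sets lborel" by (subst (asm) AE_iff_null) auto
  then have "{\<tau>. psi1 \<tau> \<noteq> 0} = {}" by (rule open_null_set_empty[OF op])
  then show False using p0 by auto
qed

text \<open>Normalised so that the inverse Fourier transform of \<open>rho\<close>, the profile of the extension in the
  last variable, equals 1 on the hyperplane.\<close>

definition rho :: "real \<Rightarrow> complex" where
  "rho \<tau> = (1 / inv_fourier (psic (0::real)) 0) * psic (0::real) \<tau>"

text \<open>The part of the profile with last frequency l, the factor in the last variable of every
  piece of an extension.\<close>

definition piece :: "real \<Rightarrow> real \<Rightarrow> complex" where
  "piece l = inv_fourier (\<lambda>\<tau>. psic l \<tau> * rho \<tau>)"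

lemma rho_schwartz: "rho \<in> schwartz"
  unfolding rho_def[abs_def] by (intro schwartz_cmult psi_schwartz lattice_0)

lemma Ints_lattice_real: "l \<in> \<int> \<Longrightarrow> (l::real) \<in> lattice_pts"
  by (simp add: lattice_pts_def)

lemma psic_rho_schwartz: "l \<in> \<int> \<Longrightarrow> (\<lambda>\<tau>. psic l \<tau> * rho \<tau>) \<in> schwartz"
  by (intro schwartz_mult psi_schwartz rho_schwartz Ints_lattice_real)

lemma piece_schwartz: "l \<in> \<int> \<Longrightarrow> piece l \<in> schwartz"
  unfolding piece_def by (intro inv_fourier_schwartz psic_rho_schwartz)

text \<open>\<open>rho\<close> is nonzero only for |\<tau>| < 1 and \<open>psi \<eta> l\<close> only
  for |\<tau> - l| < 1; these sets are disjoint for |l| >= 2.\<close>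

lemma piece_eq_0:
  assumes "l \<in> \<int>" "l \<notin> {-1, 0, 1}" shows "piece l = (\<lambda>t. 0)"
proof -
  have l: "2 \<le> \<bar>l\<bar>"
  proof -
    obtain i where i: "l = of_int i" using assms(1) by (rule Ints_cases)
    then have "i \<noteq> -1" "i \<noteq> 0" "i \<noteq> 1" using assms(2) by auto
    then have "2 \<le> \<bar>i\<bar>" by linarith
    then show ?thesis unfolding i by linarith
  qed
  have "psic l \<tau> * rho \<tau> = 0" for \<tau>
  proof (cases "1 \<le> \<bar>\<tau>\<bar>")
    case True
    then show ?thesis by (simp add: rho_def psic_real[OF Ints_0] psi1_support)
  next
    case False
    then have "1 \<le> \<bar>\<tau> - l\<bar>" using l by linarith
    then show ?thesis by (simp add: psic_real[OF assms(1)] psi1_support)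
  qed
  then have "(\<lambda>\<tau>. psic l \<tau> * rho \<tau>) = (\<lambda>\<tau>. 0)" by blast
  then have "piece l = inv_fourier (\<lambda>\<tau>. 0)" by (simp only: piece_def)
  then show ?thesis by (simp add: inv_fourier_eq fun_eq_iff)
qed

text \<open>The cutoffs at -1, 0 and 1 sum to 1 wherever \<open>rho\<close> is nonzero, so the
  values at 0 sum to the inverse transform of \<open>rho\<close> at 0, which is 1 by
  normalisation.\<close>

lemma piece_sum: "(\<Sum>l\<in>{-1, 0, 1}. piece l 0) = 1"
proof -
  have 1: "(\<Sum>l\<in>{-1, 0, 1}. psic l \<tau> * rho \<tau>) = rho \<tau>" for \<tau>
  proof (cases "1 \<le> \<bar>\<tau>\<bar>")
    case True
    then show ?thesis by (simp add: rho_def psic_real[OF Ints_0] psi1_support)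
  next
    case False
    have "(\<Sum>i\<in>{-1, 0, 1}. psi1 (\<tau> - of_int i)) = 1"
    proof (rule psi1_partition)
      fix j :: int assume "\<bar>\<tau> - of_int j\<bar> < 1"
      then have "\<bar>of_int j\<bar> < (2::real)" using False by linarith
      then have "\<bar>j\<bar> < 2" by linarith
      then show "j \<in> {-1, 0, 1}" by auto
    qed simp
    then have "(\<Sum>l\<in>{-1, 0, 1::real}. psic l \<tau>) = 1"
      by (simp add: psic_real flip: of_real_add)
    then show ?thesis by (metis mult_1 sum_distrib_right)
  qed
  have "(\<Sum>l\<in>{-1, 0, 1}. piece l 0) = of_real (fconst TYPE(real)) * (\<Sum>l\<in>{-1, 0, 1}. \<integral>\<tau>. psic l \<tau> * rho \<tau> \<partial>lborel)"
    by (simp add: piece_def inv_fourier_eq distrib_left)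
  also have "(\<Sum>l\<in>{-1, 0, 1}. \<integral>\<tau>. psic l \<tau> * rho \<tau> \<partial>lborel) = (\<integral>\<tau>. (\<Sum>l\<in>{-1, 0, 1}. psic l \<tau> * rho \<tau>) \<partial>lborel)"
    by (rule Bochner_Integration.integral_sum[symmetric]) (auto intro!: schwartz_integrable psic_rho_schwartz)
  also have "\<dots> = (\<integral>\<tau>. rho \<tau> \<partial>lborel)" by (simp only: 1)
  also have "of_real (fconst TYPE(real)) * \<dots> = inv_fourier rho 0" by (simp add: inv_fourier_eq)
  also have "\<dots> = 1" unfolding rho_def[abs_def] inv_fourier_cmult using inv_fourier_psic_0 by simp
  finally show ?thesis .
qed

section \<open>The extension as a right inverse\<close>

abbreviation ext :: "'a::euclidean_space functional \<Rightarrow> ('a \<times> real) functional" where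
  "ext \<equiv> extension rho"

lemma rho_integrable: "integrable lborel rho"
  by (rule schwartz_integrable[OF rho_schwartz])

text \<open>Plane wave, cutoff and spectrum of the extension all factor, so integrating out the last
  frequency leaves the test function of \<open>box \<eta> k g\<close> times a scalar, which is
  \<open>piece l t\<close> up to normalisation.\<close>

lemma box_extension:
  fixes g :: "'a::euclidean_space functional"
  assumes g: "g \<in> tempered" and k: "k \<in> lattice_pts" and l: "l \<in> \<int>"
  shows "box \<eta> (k, l) (ext g) (x, t) = box \<eta> k g x * piece l t"
proof -
  have kl: "(k, l) \<in> lattice_pts" using k l by (simp add: lattice_Pair)
  have S: "(\<lambda>\<xi>. wave (x, t) \<xi> * psic (k, l) \<xi>) \<in> schwartz" by (intro schwartz_wave psi_schwartz kl)
  have S': "(\<lambda>\<xi>. wave x \<xi> * psic k \<xi>) \<in> schwartz" by (intro schwartz_wave psi_schwartz k)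
  let ?I = "\<integral>\<tau>. psic l \<tau> * rho \<tau> * wave t \<tau> \<partial>lborel"
  have "marginal rho (\<lambda>\<xi>. wave (x, t) \<xi> * psic (k, l) \<xi>) \<xi> = ?I * (wave x \<xi> * psic k \<xi>)" for \<xi>
  proof -
    have "marginal rho (\<lambda>\<xi>. wave (x, t) \<xi> * psic (k, l) \<xi>) \<xi> = (\<integral>\<tau>. (wave x \<xi> * psic k \<xi>) * (psic l \<tau> * rho \<tau> * wave t \<tau>) \<partial>lborel)"
      unfolding marginal_def wave_Pair psi_Pair[OF k l] by (simp add: mult_ac)
    also have "\<dots> = (wave x \<xi> * psic k \<xi>) * ?I" by (rule integral_mult_right_zero)
    finally show ?thesis by (simp add: mult.commute)
  qed
  then have m: "marginal rho (\<lambda>\<xi>. wave (x, t) \<xi> * psic (k, l) \<xi>) = (\<lambda>\<xi>. ?I * (wave x \<xi> * psic k \<xi>))" by blast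
  have "box \<eta> (k, l) (ext g) (x, t) = of_real (fconst TYPE('a \<times> real)) * g (fourier (\<lambda>\<xi>. ?I * (wave x \<xi> * psic k \<xi>)))"
    unfolding box_eq(1)[OF extension_tempered[OF rho_integrable g] kl] dist_fourier_extension[OF rho_integrable S] m ..
  also have "\<dots> = of_real (fconst TYPE('a)) * g (fourier (\<lambda>\<xi>. wave x \<xi> * psic k \<xi>)) * (of_real (fconst TYPE(real)) * ?I)"
    unfolding fconst_Pair fourier_cmult tempered_cmult[OF g fourier_schwartz[OF S']] by (simp add: mult_ac)
  also have "\<dots> = box \<eta> k g x * piece l t"
    unfolding box_eq(1)[OF g k] piece_def inv_fourier_eq using S' by (simp add: dist_fourier_def on_schwartz_def)
  finally show ?thesis .
qed

text \<open>At most three of the factors in the last variable are nonzero, so \<open>K\<close> is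
  finite. The inequality covers all tempered g, also those of infinite norm, so it can be applied to
  differences without first showing that they lie in the space.\<close>

lemma ext_bound:
  assumes p: "0 < p" and q: "0 < q"
  shows "\<exists>C>0. \<forall>g\<in>tempered. aniso_norm \<eta> s p q (min p (min q 1)) (ext g) \<le> ennreal C * modulation_norm \<eta> s p q (g :: 'a::euclidean_space functional)"
proof -
  define r where "r = enn2real (min p (min q 1))"
  have r: "0 < r" unfolding r_def by (rule min_exponent(2)[OF p q])
  define K where "K = nlp (count_space \<int>) r (\<lambda>l. Lp_norm p (piece l))"
  have "(\<integral>\<^sup>+l. epowr (Lp_norm p (piece l)) r \<partial>count_space \<int>) = (\<Sum>l\<in>{-1, 0, 1}. epowr (Lp_norm p (piece l)) r)"
    by (rule nn_integral_count_space') (auto simp: piece_eq_0 Lp_norm_0[OF p])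
  also have "\<dots> < \<infinity>"
    using Lp_norm_schwartz[OF p piece_schwartz] by (auto simp: epowr_eq_top simp flip: less_top)
  finally have K: "K < \<infinity>" unfolding K_def nlp_def by (auto simp: epowr_eq_top simp flip: less_top)
  have main: "aniso_norm \<eta> s p q (min p (min q 1)) (ext g) \<le> ennreal (enn2real K + 1) * modulation_norm \<eta> s p q g"
    if g: "g \<in> tempered" for g :: "'a functional"
  proof -
    have "aniso_norm \<eta> s p q (min p (min q 1)) (ext g) \<le> nlp (count_space \<int>) r (\<lambda>l. modulation_norm \<eta> s p q g * Lp_norm p (piece l))"
      unfolding aniso_norm_eq[OF p q] r_def[symmetric]
    proof (rule nlp_mono[OF r])
      fix l :: real assume "l \<in> space (count_space \<int>)"
      then have l: "l \<in> \<int>" by simp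
      have "lq_norm q lattice_pts (\<lambda>k. ennreal (jbracket k powr s) * Lp_norm p (box \<eta> (k, l) (ext g)))
        \<le> lq_norm q lattice_pts (\<lambda>k. Lp_norm p (piece l) * (ennreal (jbracket k powr s) * Lp_norm p (box \<eta> k g)))"
      proof (rule lq_norm_mono[OF q countable_lattice])
        fix k :: 'a assume k: "k \<in> lattice_pts"
        have "box \<eta> (k, l) (ext g) = (\<lambda>z. box \<eta> k g (fst z) * piece l (snd z))"
          using box_extension[OF g k l] by (auto simp: fun_eq_iff)
        then have "Lp_norm p (box \<eta> (k, l) (ext g)) \<le> Lp_norm p (box \<eta> k g) * Lp_norm p (piece l)"
          using Lp_norm_tensor[OF p smooth_continuous[OF box_eq(3)[OF g k]] smooth_continuous[OF schwartz_smooth[OF piece_schwartz[OF l]]]] by simp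
        then have "ennreal (jbracket k powr s) * Lp_norm p (box \<eta> (k, l) (ext g)) \<le> ennreal (jbracket k powr s) * (Lp_norm p (box \<eta> k g) * Lp_norm p (piece l))"
          by (rule mult_left_mono) simp
        then show "ennreal (jbracket k powr s) * Lp_norm p (box \<eta> (k, l) (ext g)) \<le> Lp_norm p (piece l) * (ennreal (jbracket k powr s) * Lp_norm p (box \<eta> k g))"
          by (simp add: mult_ac)
      qed
      also have "\<dots> = modulation_norm \<eta> s p q g * Lp_norm p (piece l)"
        unfolding lq_norm_cmult[OF q countable_lattice] modulation_norm_def by (rule mult.commute)
      finally show "lq_norm q lattice_pts (\<lambda>k. ennreal (jbracket k powr s) * Lp_norm p (box \<eta> (k, l) (ext g))) \<le> \<dots>" .
    qed
    also have "\<dots> = modulation_norm \<eta> s p q g * K"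
      unfolding K_def by (rule nlp_cmult[OF r]) simp
    also have "\<dots> \<le> modulation_norm \<eta> s p q g * ennreal (enn2real K + 1)"
      using K by (intro mult_left_mono) (auto simp: ennreal_plus)
    finally show ?thesis by (simp add: mult.commute)
  qed
  show ?thesis by (rule exI[of _ "enn2real K + 1"]) (intro conjI ballI main add_nonneg_pos, auto)
qed

text \<open>The trace terms factor into the terms of \<open>box_sum\<close> and the values
  \<open>piece l 0\<close>. The sum over l is finite and equals 1, and the sum over k restores
  g.\<close>

lemma has_trace_ext:
  fixes g :: "'a::euclidean_space functional"
  assumes g: "g \<in> tempered" shows "has_trace \<eta> (ext g) g"
  unfolding has_trace_def
proof (intro conjI ballI g)
  fix \<phi> :: "'a \<Rightarrow> complex" assume p: "\<phi> \<in> schwartz"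
  let ?a = "\<lambda>k. \<integral>x. box \<eta> k g x * \<phi> x \<partial>lborel"
  have "((\<lambda>z. ?a (fst z) * piece (snd z) 0) has_sum g \<phi> * (\<Sum>l\<in>{-1, 0, 1}. piece l 0)) (lattice_pts \<times> {-1, 0, 1})"
    by (rule has_sum_Times_finite[OF box_sum[OF g p]]) simp
  then have s: "((\<lambda>z. ?a (fst z) * piece (snd z) 0) has_sum g \<phi>) (lattice_pts \<times> {-1, 0, 1})"
    unfolding piece_sum by simp
  have t: "trace_term \<eta> (ext g) z \<phi> = ?a (fst z) * piece (snd z) 0" if zin: "z \<in> lattice_pts \<times> \<int>" for z
  proof -
    obtain k l where z: "z = (k, l)" "k \<in> lattice_pts" "l \<in> \<int>" using zin by blast
    have "trace_term \<eta> (ext g) z \<phi> = (\<integral>x. piece l 0 * (box \<eta> k g x * \<phi> x) \<partial>lborel)"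
      unfolding trace_term_def on_schwartz_def using p by (simp add: z box_extension[OF g] mult_ac)
    then show ?thesis by (simp add: z mult.commute)
  qed
  show "((\<lambda>z. trace_term \<eta> (ext g) z \<phi>) has_sum g \<phi>) lattice_pts"
    unfolding lattice_prod_eq
  proof (rule has_sum_cong_neutral[THEN iffD1, OF _ _ _ s])
    fix z :: "'a \<times> real" assume z: "z \<in> lattice_pts \<times> \<int> - lattice_pts \<times> {-1, 0, 1}"
    have "piece (snd z) = (\<lambda>t. 0)" by (rule piece_eq_0) (use z in auto)
    then show "trace_term \<eta> (ext g) z \<phi> = 0" using t[of z] z by simp
  qed (auto simp: t)
qed

lemma ext_add: "ext (\<lambda>\<phi>. f \<phi> + g \<phi>) = (\<lambda>\<phi>. ext f \<phi> + ext g \<phi>)"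
  by (simp add: extension_def on_schwartz_def fun_eq_iff)

lemma ext_diff: "ext (\<lambda>\<phi>. f \<phi> - g \<phi>) = (\<lambda>\<phi>. ext f \<phi> - ext g \<phi>)"
  by (simp add: extension_def on_schwartz_def fun_eq_iff)

lemma ext_cmult: "ext (\<lambda>\<phi>. c * f \<phi>) = (\<lambda>\<phi>. c * ext f \<phi>)"
  by (simp add: extension_def on_schwartz_def fun_eq_iff)

text \<open>The difference of the images is the image of the difference, so \<open>ext_bound\<close>
  acts as a Lipschitz estimate.\<close>

lemma ext_continuous:
  assumes p: "0 < p" and q: "0 < q"
  shows "continuous_on_space (modulation_space \<eta> s p q) (modulation_norm \<eta> s p q)
    (aniso_norm \<eta> s p q (min p (min q 1))) (ext :: 'a::euclidean_space functional \<Rightarrow> _)"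
proof -
  obtain C where C: "0 < C" "\<And>g::'a functional. g \<in> tempered \<Longrightarrow>
    aniso_norm \<eta> s p q (min p (min q 1)) (ext g) \<le> ennreal C * modulation_norm \<eta> s p q g"
    using ext_bound[OF p q, where 'a='a] by blast
  show ?thesis
    unfolding continuous_on_space_def
  proof (intro ballI allI impI)
    fix f :: "'a functional" and \<epsilon> :: ennreal
    assume f: "f \<in> modulation_space \<eta> s p q" and e: "0 < \<epsilon>"
    have C': "0 < ennreal C" using C(1) by simp
    show "\<exists>\<delta>>0. \<forall>g\<in>modulation_space \<eta> s p q. modulation_norm \<eta> s p q (\<lambda>\<phi>. g \<phi> - f \<phi>) < \<delta> \<longrightarrow>
      aniso_norm \<eta> s p q (min p (min q 1)) (\<lambda>\<phi>. ext g \<phi> - ext f \<phi>) < \<epsilon>"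
    proof (intro exI[of _ "\<epsilon> / ennreal C"] conjI ballI impI)
      show "0 < \<epsilon> / ennreal C" using e by (simp add: ennreal_zero_less_divide)
      fix g :: "'a functional" assume g: "g \<in> modulation_space \<eta> s p q" and lt: "modulation_norm \<eta> s p q (\<lambda>\<phi>. g \<phi> - f \<phi>) < \<epsilon> / ennreal C"
      have "(\<lambda>\<phi>. g \<phi> - f \<phi>) \<in> tempered"
        using f g by (intro tempered_functional_diff) (auto simp: modulation_space_def)
      then have "aniso_norm \<eta> s p q (min p (min q 1)) (\<lambda>\<phi>. ext g \<phi> - ext f \<phi>) \<le> ennreal C * modulation_norm \<eta> s p q (\<lambda>\<phi>. g \<phi> - f \<phi>)"
        using C(2) by (simp flip: ext_diff)
      also have "\<dots> < ennreal C * (\<epsilon> / ennreal C)"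
        using lt C' by (intro ennreal_mult_strict_left_mono) auto
      also have "\<dots> = \<epsilon>"
        using C(1) by (simp add: ennreal_times_divide mult_divide_eq_ennreal mult.commute)
      finally show "aniso_norm \<eta> s p q (min p (min q 1)) (\<lambda>\<phi>. ext g \<phi> - ext f \<phi>) < \<epsilon>" .
    qed
  qed
qed

end

theorem theorem1p2:
  fixes \<eta> :: "real \<Rightarrow> real" and p q :: ennreal and s :: real
  assumes "cutoff \<eta>" and "0 < p" and "0 < q"
  shows
    "(\<forall>f \<in> aniso_space \<eta> s p q (min p (min q 1)) :: ((real ^ 'm) \<times> real) functional set.
        has_trace \<eta> f (Tr \<eta> f) \<and> Tr \<eta> f \<in> modulation_space \<eta> s p q) \<and>
     (\<exists>C::real. C > 0 \<and>
        (\<forall>f \<in> aniso_space \<eta> s p q (min p (min q 1)) :: ((real ^ 'm) \<times> real) functional set.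
           modulation_norm \<eta> s p q (Tr \<eta> f) \<le> ennreal C * aniso_norm \<eta> s p q (min p (min q 1)) f)) \<and>
     (\<exists>E :: (real ^ 'm) functional \<Rightarrow> ((real ^ 'm) \<times> real) functional.
        E ` modulation_space \<eta> s p q \<subseteq> aniso_space \<eta> s p q (min p (min q 1)) \<and>
        linear_on_space (modulation_space \<eta> s p q) E \<and>
        continuous_on_space (modulation_space \<eta> s p q) (modulation_norm \<eta> s p q)
          (aniso_norm \<eta> s p q (min p (min q 1))) E \<and>
        (\<forall>g \<in> modulation_space \<eta> s p q. Tr \<eta> (E g) = g))"
proof -
  interpret decomposition \<eta> by unfold_locales (rule assms)
  note pq = assms(2,3)
  let ?A = "aniso_space \<eta> s p q (min p (min q 1)) :: ((real ^ 'm) \<times> real) functional set"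
  obtain C where C: "0 < C" "\<And>f (g :: (real ^ 'm) functional). f \<in> ?A \<Longrightarrow> has_trace \<eta> f g \<Longrightarrow>
    modulation_norm \<eta> s p q g \<le> ennreal C * aniso_norm \<eta> s p q (min p (min q 1)) f"
    using trace_bound[OF pq, where 'a="real ^ 'm"] by blast
  obtain D where D: "\<And>g :: (real ^ 'm) functional. g \<in> tempered \<Longrightarrow>
    aniso_norm \<eta> s p q (min p (min q 1)) (ext g) \<le> ennreal D * modulation_norm \<eta> s p q g"
    using ext_bound[OF pq, where 'a="real ^ 'm"] by blast
  \<comment> \<open>Existence together with uniqueness of the limit evaluates the description in
    \<open>Tr\<close>.\<close>
  have tr: "has_trace \<eta> f (Tr \<eta> f)" if "f \<in> ?A" for f
    using trace_exists[OF pq that] Tr_eqI by metis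
  have bd: "modulation_norm \<eta> s p q (Tr \<eta> f) \<le> ennreal C * aniso_norm \<eta> s p q (min p (min q 1)) f" if "f \<in> ?A" for f
    by (rule C(2)[OF that tr[OF that]])
  have "Tr \<eta> f \<in> modulation_space \<eta> s p q" if f: "f \<in> ?A" for f
  proof -
    have "ennreal C * aniso_norm \<eta> s p q (min p (min q 1)) f < \<infinity>"
      using f by (simp add: aniso_space_def ennreal_mult_less_top)
    then show ?thesis
      using bd[OF f] tr[OF f] by (auto simp: modulation_space_def has_trace_def intro: order_le_less_trans)
  qed
  moreover have "ext ` modulation_space \<eta> s p q \<subseteq> ?A"
  proof safe
    fix g :: "(real ^ 'm) functional" assume g: "g \<in> modulation_space \<eta> s p q"
    have "ennreal D * modulation_norm \<eta> s p q g < \<infinity>"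
      using g by (simp add: modulation_space_def ennreal_mult_less_top)
    then show "ext g \<in> ?A"
      using D[of g] g extension_tempered[OF rho_integrable]
      by (auto simp: modulation_space_def aniso_space_def intro: order_le_less_trans)
  qed
  moreover have "Tr \<eta> (ext g) = g" if "g \<in> modulation_space \<eta> s p q" for g :: "(real ^ 'm) functional"
    using that by (intro Tr_eqI has_trace_ext) (simp add: modulation_space_def)
  moreover have "linear_on_space (modulation_space \<eta> s p q) (ext :: (real ^ 'm) functional \<Rightarrow> _)"
    by (simp add: linear_on_space_def ext_add ext_cmult)
  ultimately show ?thesis
    using tr bd C(1) ext_continuous[OF pq] by (intro conjI exI[of _ C] exI[of _ ext]) auto
qed

end
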